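(* Let $\{u_n\}\subset H^1(\Omega)$ be a bounded sequence such that, for each $n$, the functional $\omega_n:=-\mathrm{div}(A(x,u_n)\nabla u_n)+\frac12D_sA(x,u_n)\nabla u_n\cdot\nabla u_n$, i.e. $\langle\omega_n,v\rangle=\int_\Omega A(x,u_n)\nabla u_n\cdot\nabla v+\frac12\int_\Omega(D_sA(x,u_n)\nabla u_n\cdot\nabla u_n)v$ for $v\in C^\infty(\overline\Omega)$, belongs to $(H^1(\Omega))'$, and $\{\omega_n\}$ converges strongly in $(H^1(\Omega))'$. Then $\{u_n\}$ admits a subsequence converging strongly in $H^1(\Omega)$ to some $u\in H^1(\Omega)$.
   Context: $N\ge2$, $\Omega\subset\mathbb{R}^N$ bounded Lipschitz domain. $A(x,s)=(a_{ij}(x,s))$ symmetric $N\times N$, $a_{ij}$ $C^1$-Carathéodory, $D_sA=(\partial_sa_{ij})$, and there are $C,\nu,R>0$ with: $|a_{ij}(x,s)|,|D_sa_{ij}(x,s)|\le C$; $A(x,s)\xi\cdot\xi\ge\nu|\xi|^2$; $|s|\ge R\Rightarrow sD_sA(x,s)\xi\cdot\xi\ge0$, for a.e. $x\in\Omega$, all $s\in\mathbb{R}$, $\xi\in\mathbb{R}^N$. *)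

theory Defs
  imports "HOL-Analysis.Analysis"
begin

text \<open>Bounded Lipschitz domain in R^N (N = CARD('n)): open, connected, bounded, and near each
  boundary point p, after choosing a unit direction e, the domain is the region strictly below
  the graph (over the hyperplane orthogonal to e) of a Lipschitz function.\<close>
definition lipschitz_domain :: "(real^'n) set \<Rightarrow> bool" where
  "lipschitz_domain \<Omega> \<longleftrightarrow> open \<Omega> \<and> connected \<Omega> \<and> \<Omega> \<noteq> {} \<and>
     (\<forall>p \<in> frontier \<Omega>. \<exists>r>0. \<exists>e::real^'n. \<exists>\<gamma>::real^'n \<Rightarrow> real. \<exists>L.
        norm e = 1 \<and> L-lipschitz_on {y. y \<bullet> e = 0} \<gamma> \<and>
        \<Omega> \<inter> ball p r = {x \<in> ball p r. (x - p) \<bullet> e < \<gamma> ((x - p) - ((x - p) \<bullet> e) *\<^sub>R e)})"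

definition partial :: "'n \<Rightarrow> (real^'n \<Rightarrow> real) \<Rightarrow> real^'n \<Rightarrow> real" where
  "partial i f x = deriv (\<lambda>t. f (x + t *\<^sub>R axis i 1)) 0"

definition grad :: "(real^'n \<Rightarrow> real) \<Rightarrow> real^'n \<Rightarrow> real^'n" where
  "grad f x = (\<chi> i. partial i f x)"

definition smooth :: "(real^'n \<Rightarrow> real) \<Rightarrow> bool" where
  "smooth f \<longleftrightarrow> (\<exists>D :: 'n list \<Rightarrow> real^'n \<Rightarrow> real. D [] = f \<and>
      (\<forall>\<alpha>. continuous_on UNIV (D \<alpha>)) \<and>
      (\<forall>\<alpha> i x. ((\<lambda>t. D \<alpha> (x + t *\<^sub>R axis i 1)) has_real_derivative D (i # \<alpha>) x) (at 0)))"

definition test_fun :: "(real^'n) set \<Rightarrow> (real^'n \<Rightarrow> real) \<Rightarrow> bool" where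
  "test_fun \<Omega> \<phi> \<longleftrightarrow> smooth \<phi> \<and> compact (closure {x. \<phi> x \<noteq> 0}) \<and> closure {x. \<phi> x \<noteq> 0} \<subseteq> \<Omega>"

definition L2 :: "(real^'n) set \<Rightarrow> (real^'n \<Rightarrow> real) \<Rightarrow> bool" where
  "L2 \<Omega> f \<longleftrightarrow> f \<in> borel_measurable (lebesgue_on \<Omega>) \<and> integrable (lebesgue_on \<Omega>) (\<lambda>x. (f x)\<^sup>2)"

definition is_weak_grad :: "(real^'n) set \<Rightarrow> (real^'n \<Rightarrow> real) \<Rightarrow> (real^'n \<Rightarrow> real^'n) \<Rightarrow> bool" where
  "is_weak_grad \<Omega> u g \<longleftrightarrow> L2 \<Omega> u \<and> (\<forall>i. L2 \<Omega> (\<lambda>x. g x $ i)) \<and>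
     (\<forall>\<phi> i. test_fun \<Omega> \<phi> \<longrightarrow>
        (LINT x|lebesgue_on \<Omega>. u x * partial i \<phi> x) = - (LINT x|lebesgue_on \<Omega>. g x $ i * \<phi> x))"

definition H1 :: "(real^'n) set \<Rightarrow> (real^'n \<Rightarrow> real) set" where
  "H1 \<Omega> = {u. \<exists>g. is_weak_grad \<Omega> u g}"

definition wgrad :: "(real^'n) set \<Rightarrow> (real^'n \<Rightarrow> real) \<Rightarrow> real^'n \<Rightarrow> real^'n" where
  "wgrad \<Omega> u = (SOME g. is_weak_grad \<Omega> u g)"

definition H1_norm :: "(real^'n) set \<Rightarrow> (real^'n \<Rightarrow> real) \<Rightarrow> real" where
  "H1_norm \<Omega> u = sqrt ((LINT x|lebesgue_on \<Omega>. (u x)\<^sup>2) + (LINT x|lebesgue_on \<Omega>. (norm (wgrad \<Omega> u x))\<^sup>2))"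

definition H1_dual :: "(real^'n) set \<Rightarrow> ((real^'n \<Rightarrow> real) \<Rightarrow> real) \<Rightarrow> bool" where
  "H1_dual \<Omega> L \<longleftrightarrow>
     (\<forall>v w a b. v \<in> H1 \<Omega> \<longrightarrow> w \<in> H1 \<Omega> \<longrightarrow> L (\<lambda>x. a * v x + b * w x) = a * L v + b * L w) \<and>
     (\<exists>K. \<forall>v \<in> H1 \<Omega>. \<bar>L v\<bar> \<le> K * H1_norm \<Omega> v)"

definition dual_tendsto :: "(real^'n) set \<Rightarrow> (nat \<Rightarrow> (real^'n \<Rightarrow> real) \<Rightarrow> real) \<Rightarrow> ((real^'n \<Rightarrow> real) \<Rightarrow> real) \<Rightarrow> bool" where
  "dual_tendsto \<Omega> Ls L \<longleftrightarrow> (\<forall>\<epsilon>>0. \<exists>M. \<forall>n\<ge>M. \<forall>v \<in> H1 \<Omega>. \<bar>Ls n v - L v\<bar> \<le> \<epsilon> * H1_norm \<Omega> v)"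

end

theory Submission
  imports Defs "HOL-Library.Diagonal_Subsequence" "HOL-Complex_Analysis.Great_Picard"
begin

text \<open>The weak limit \<open>w\<close> of a subsequence exists by Rellich's theorem, which, like the density of
  smooth functions, rests on one smoothing operator: near a boundary point a Lipschitz domain satisfies
  a cone condition, so averaging over inward shifts only uses values inside the domain.

  By the sign condition, testing with \<open>u\<^sub>n - T u\<^sub>n\<close>, \<open>T\<close> being the truncation at height \<open>\<kappa> \<ge> R\<close>, bounds the
  gradients on \<open>{\<bar>u\<^sub>n\<bar> \<ge> \<kappa>}\<close>, uniformly small for large \<open>\<kappa>\<close>. For fixed \<open>\<kappa>\<close>, the test function
  \<open>sinh(\<lambda> (T u\<^sub>n - T w)) / \<lambda>\<close> (Boccardo, Murat and Puel) converges weakly to \<open>0\<close>; for large \<open>\<lambda>\<close> its derivative absorbs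
  the quadratic term where \<open>\<bar>u\<^sub>n\<bar> < \<kappa>\<close>, while for \<open>\<bar>u\<^sub>n\<bar> \<ge> \<kappa>\<close> that term has a favourable sign. Hence
  \<open>\<nabla>T u\<^sub>n\<close> converges strongly to \<open>\<nabla>T w\<close>.\<close>

section \<open>Smooth functions\<close>

text \<open>The functionals are given by a formula on smooth functions only, and the quadratic term
  is merely integrable, so the formula extends to bounded test functions but not to all of
  \<open>H1\<close>. This shapes the smoothing operator: it is an average (nonnegative kernels of
  mass one, weighted by a partition of unity), so that the approximations of a bounded function obey
  the same bound and dominated convergence handles the quadratic term. It also explains the
  splitting of gradients at a height \<open>\<kappa>\<close>: the natural test function
  \<open>u n - w\<close> is unbounded, and weak convergence of gradients says nothing about the
  limit of a quadratic expression. Differences of truncations are bounded and hence admissible,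
  while the part above \<open>\<kappa>\<close> is controlled by an inequality only, coming from the
  sign condition. The cone condition is kept along whole segments, not just at their end points:
  this gives a smoothing error of order 1/m times the norm of the gradient, and it is the uniformity
  of this rate that produces compactness.\<close>

lemma smooth_coinduct:
  fixes f :: "real^'n \<Rightarrow> real"
  assumes "f \<in> S"
    and S: "\<And>g. g \<in> S \<Longrightarrow> continuous_on UNIV g \<and>
      (\<forall>i. \<exists>h\<in>S. \<forall>x. ((\<lambda>t. g (x + t *\<^sub>R axis i 1)) has_real_derivative h x) (at 0))"
  shows "smooth f"
proof -
  define d where "d i g = (SOME h. h \<in> S \<and> (\<forall>x. ((\<lambda>t. g (x + t *\<^sub>R axis i 1)) has_real_derivative h x) (at 0)))"
    for i :: 'n and g
  have d: "d i g \<in> S \<and> (\<forall>x. ((\<lambda>t. g (x + t *\<^sub>R axis i 1)) has_real_derivative d i g x) (at 0))"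
    if "g \<in> S" for i g
    using someI_ex[of "\<lambda>h. h \<in> S \<and> (\<forall>x. ((\<lambda>t. g (x + t *\<^sub>R axis i 1)) has_real_derivative h x) (at 0))"]
      S[OF that] unfolding d_def by blast
  \<comment> \<open>The head of the list is the derivative taken last, as \<open>smooth\<close>
    demands of \<open>D (i # \<alpha>)\<close>.\<close>
  define D where "D \<alpha> = foldr d \<alpha> f" for \<alpha>
  have DS: "D \<alpha> \<in> S" for \<alpha>
    by (induction \<alpha>) (use d \<open>f \<in> S\<close> in \<open>auto simp: D_def\<close>)
  have "D [] = f" by (simp add: D_def)
  moreover have "continuous_on UNIV (D \<alpha>)" for \<alpha> using S DS by blast
  moreover have "((\<lambda>t. D \<alpha> (x + t *\<^sub>R axis i 1)) has_real_derivative D (i # \<alpha>) x) (at 0)" for \<alpha> i x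
    using d[OF DS] by (simp add: D_def)
  ultimately show ?thesis unfolding smooth_def by blast
qed

lemma smooth_continuous: "smooth f \<Longrightarrow> continuous_on UNIV f"
  unfolding smooth_def by metis

lemma
  fixes f :: "real^'n \<Rightarrow> real"
  assumes "smooth f"
  shows smooth_deriv: "((\<lambda>t. f (x + t *\<^sub>R axis i 1)) has_real_derivative partial i f x) (at 0)"
    and smooth_partial: "smooth (partial i f)"
proof -
  obtain D :: "'n list \<Rightarrow> real^'n \<Rightarrow> real" where D: "D [] = f" "\<And>\<alpha>. continuous_on UNIV (D \<alpha>)"
    "\<And>\<alpha> i x. ((\<lambda>t. D \<alpha> (x + t *\<^sub>R axis i 1)) has_real_derivative D (i # \<alpha>) x) (at 0)"
    using assms unfolding smooth_def by metis
  have p: "partial i f = D [i]"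
    unfolding partial_def using D(1) D(3)[of "[]"] DERIV_imp_deriv by fastforce
  show "((\<lambda>t. f (x + t *\<^sub>R axis i 1)) has_real_derivative partial i f x) (at 0)"
    using D(3)[of "[]"] p D(1) by simp
  show "smooth (partial i f)"
    \<comment> \<open>The derivative taken first stands at the end of a list, so the derivatives of
      \<open>partial i f\<close> are those of \<open>f\<close> whose list ends in
      \<open>i\<close>.\<close>
    unfolding smooth_def p by (rule exI[of _ "\<lambda>\<alpha>. D (\<alpha> @ [i])"]) (use D in auto)
qed

lemma smooth_deriv_at:
  fixes f :: "real^'n \<Rightarrow> real"
  assumes "smooth f"
  shows "((\<lambda>s. f (x + s *\<^sub>R axis i 1)) has_real_derivative partial i f (x + t *\<^sub>R axis i 1)) (at t)"
proof -
  have "((\<lambda>s. f (x + (s + t) *\<^sub>R axis i 1)) has_real_derivative partial i f (x + t *\<^sub>R axis i 1)) (at 0)"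
    using smooth_deriv[OF assms, of "x + t *\<^sub>R axis i 1" i] by (simp add: algebra_simps)
  then show ?thesis
    using DERIV_shift[of "\<lambda>s. f (x + s *\<^sub>R axis i 1)" "partial i f (x + t *\<^sub>R axis i 1)" 0 t] by simp
qed

lemma partialI: "((\<lambda>t. f (x + t *\<^sub>R axis i 1)) has_real_derivative d) (at 0) \<Longrightarrow> partial i f x = d"
  unfolding partial_def by (rule DERIV_imp_deriv)

text \<open>This set is closed under partial derivatives, so one coinduction gives sums, products
  and reciprocals without Leibniz formulas of higher order. Reciprocals are formed of smooth
  functions only: the derivative of 1/f is the product of -f' and two copies of 1/f, which stays in
  the set because f' enters through \<open>base\<close>.\<close>

inductive_set smooth_alg :: "(real^'n \<Rightarrow> real) set" where
  base: "smooth f \<Longrightarrow> f \<in> smooth_alg"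
| add: "f \<in> smooth_alg \<Longrightarrow> g \<in> smooth_alg \<Longrightarrow> (\<lambda>x. f x + g x) \<in> smooth_alg"
| mult: "f \<in> smooth_alg \<Longrightarrow> g \<in> smooth_alg \<Longrightarrow> (\<lambda>x. f x * g x) \<in> smooth_alg"
| inv: "smooth f \<Longrightarrow> (\<forall>x. f x \<noteq> 0) \<Longrightarrow> (\<lambda>x. inverse (f x)) \<in> smooth_alg"

lemma smooth_const: "smooth (\<lambda>x::real^'n. c)"
  by (rule smooth_coinduct[of _ "range (\<lambda>c x. c)"]) (auto intro!: exI[of _ "0"])

lemma smooth_alg_smooth:
  fixes f :: "real^'n \<Rightarrow> real"
  assumes "f \<in> smooth_alg"
  shows "smooth f"
proof (rule smooth_coinduct[OF assms])
  fix g :: "real^'n \<Rightarrow> real"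
  assume "g \<in> smooth_alg"
  then show "continuous_on UNIV g \<and>
      (\<forall>i. \<exists>h\<in>smooth_alg. \<forall>x. ((\<lambda>t. g (x + t *\<^sub>R axis i 1)) has_real_derivative h x) (at 0))"
  proof induction
    case (base f)
    then show ?case using smooth_continuous smooth_deriv smooth_partial smooth_alg.base by blast
  next
    case (add f g)
    show ?case
    proof (intro conjI allI)
      show "continuous_on UNIV (\<lambda>x. f x + g x)" using add by (intro continuous_intros) auto
      fix i
      obtain h k where h: "h \<in> smooth_alg" "\<And>x. ((\<lambda>t. f (x + t *\<^sub>R axis i 1)) has_real_derivative h x) (at 0)"
        and k: "k \<in> smooth_alg" "\<And>x. ((\<lambda>t. g (x + t *\<^sub>R axis i 1)) has_real_derivative k x) (at 0)"
        using add.IH by blast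
      show "\<exists>h\<in>smooth_alg. \<forall>x. ((\<lambda>t. f (x + t *\<^sub>R axis i 1) + g (x + t *\<^sub>R axis i 1)) has_real_derivative h x) (at 0)"
        by (rule bexI[of _ "\<lambda>x. h x + k x"]) (use h k in \<open>auto intro!: derivative_intros smooth_alg.add\<close>)
    qed
  next
    case (mult f g)
    show ?case
    proof (intro conjI allI)
      show "continuous_on UNIV (\<lambda>x. f x * g x)" using mult by (intro continuous_intros) auto
      fix i
      obtain h k where h: "h \<in> smooth_alg" "\<And>x. ((\<lambda>t. f (x + t *\<^sub>R axis i 1)) has_real_derivative h x) (at 0)"
        and k: "k \<in> smooth_alg" "\<And>x. ((\<lambda>t. g (x + t *\<^sub>R axis i 1)) has_real_derivative k x) (at 0)"
        using mult.IH by blast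
      show "\<exists>h\<in>smooth_alg. \<forall>x. ((\<lambda>t. f (x + t *\<^sub>R axis i 1) * g (x + t *\<^sub>R axis i 1)) has_real_derivative h x) (at 0)"
      proof (rule bexI[of _ "\<lambda>x. h x * g x + k x * f x"], intro allI)
        fix x show "((\<lambda>t. f (x + t *\<^sub>R axis i 1) * g (x + t *\<^sub>R axis i 1)) has_real_derivative h x * g x + k x * f x) (at 0)"
          using DERIV_mult[OF h(2)[of x] k(2)[of x]] by (simp add: algebra_simps)
      qed (use h k mult in \<open>auto intro!: smooth_alg.add smooth_alg.mult\<close>)
    qed
  next
    case (inv f)
    show ?case
    proof (intro conjI allI)
      show "continuous_on UNIV (\<lambda>x. inverse (f x))"
        using inv smooth_continuous[of f] by (intro continuous_intros) auto
      fix i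
      show "\<exists>h\<in>smooth_alg. \<forall>x. ((\<lambda>t. inverse (f (x + t *\<^sub>R axis i 1))) has_real_derivative h x) (at 0)"
      proof (rule bexI[of _ "\<lambda>x. - 1 * partial i f x * (inverse (f x) * inverse (f x))"], intro allI)
        fix x show "((\<lambda>t. inverse (f (x + t *\<^sub>R axis i 1))) has_real_derivative
            - 1 * partial i f x * (inverse (f x) * inverse (f x))) (at 0)"
          using DERIV_inverse_fun[OF smooth_deriv[of f x i]] inv by (simp add: algebra_simps)
      next
        have *: "(\<lambda>x. - 1 * partial i f x) \<in> smooth_alg"
          using inv(1) by (intro smooth_alg.mult smooth_alg.base smooth_const smooth_partial)
        have "(\<lambda>x. inverse (f x)) \<in> smooth_alg" using inv by (intro smooth_alg.inv)
        from smooth_alg.mult[OF * smooth_alg.mult[OF this this]]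
        show "(\<lambda>x. - 1 * partial i f x * (inverse (f x) * inverse (f x))) \<in> smooth_alg" .
      qed
    qed
  qed
qed

lemma smooth_add: "smooth f \<Longrightarrow> smooth g \<Longrightarrow> smooth (\<lambda>x. f x + g x)"
  by (rule smooth_alg_smooth) (intro smooth_alg.add smooth_alg.base)

lemma smooth_mult: "smooth f \<Longrightarrow> smooth g \<Longrightarrow> smooth (\<lambda>x. f x * g x)"
  by (rule smooth_alg_smooth) (intro smooth_alg.mult smooth_alg.base)

lemma smooth_inverse: "smooth f \<Longrightarrow> (\<And>x. f x \<noteq> 0) \<Longrightarrow> smooth (\<lambda>x. inverse (f x))"
  by (rule smooth_alg_smooth) (auto intro: smooth_alg.inv)

lemma smooth_diff: "smooth f \<Longrightarrow> smooth g \<Longrightarrow> smooth (\<lambda>x. f x - g x)"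
  using smooth_add[of f "\<lambda>x. -1 * g x"] smooth_mult[OF smooth_const, of g "-1"] by simp

lemma smooth_sum: "(\<And>i. i \<in> I \<Longrightarrow> smooth (f i)) \<Longrightarrow> smooth (\<lambda>x. \<Sum>i\<in>I. f i x)"
  by (induction I rule: infinite_finite_induct) (auto intro: smooth_add smooth_const)

lemma smooth_prod: "(\<And>i. i \<in> I \<Longrightarrow> smooth (f i)) \<Longrightarrow> smooth (\<lambda>x. \<Prod>i\<in>I. f i x)"
  by (induction I rule: infinite_finite_induct) (auto intro: smooth_mult smooth_const)

lemma
  fixes f :: "real^'n \<Rightarrow> real"
  assumes "smooth f"
  shows smooth_affine: "smooth (\<lambda>x. f (a + c *\<^sub>R x))"
    and partial_affine: "partial i (\<lambda>x. f (a + c *\<^sub>R x)) x = c * partial i f (a + c *\<^sub>R x)"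
proof -
  have der: "((\<lambda>t. g (a + c *\<^sub>R (x + t *\<^sub>R axis i 1))) has_real_derivative c * partial i g (a + c *\<^sub>R x)) (at 0)"
    if "smooth g" for g x i
  proof -
    have "((\<lambda>t. g ((a + c *\<^sub>R x) + (c * t) *\<^sub>R axis i 1)) has_real_derivative partial i g (a + c *\<^sub>R x) * c) (at 0)"
      by (rule DERIV_chain2[where g = "\<lambda>t. c * t" and f = "\<lambda>s. g ((a + c *\<^sub>R x) + s *\<^sub>R axis i 1)"])
        (use smooth_deriv[OF that] in \<open>auto intro!: derivative_eq_intros\<close>)
    then show ?thesis by (simp add: algebra_simps)
  qed
  \<comment> \<open>Each differentiation produces another factor \<open>c\<close>; the free multiple
    \<open>m\<close> absorbs it and makes the set closed.\<close>
  let ?S = "{(\<lambda>x. m * g (a + c *\<^sub>R x)) | m g. smooth g}"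
  show "smooth (\<lambda>x. f (a + c *\<^sub>R x))"
  proof (rule smooth_coinduct[of _ ?S])
    show "(\<lambda>x. f (a + c *\<^sub>R x)) \<in> ?S" using assms by (auto intro!: exI[of _ 1] exI[of _ f])
    fix h assume "h \<in> ?S"
    then obtain m g where h: "h = (\<lambda>x. m * g (a + c *\<^sub>R x))" and g: "smooth g" by auto
    have "continuous_on UNIV h" unfolding h
      by (intro continuous_intros continuous_on_compose2[OF smooth_continuous[OF g]]) auto
    moreover have "\<exists>k\<in>?S. \<forall>x. ((\<lambda>t. h (x + t *\<^sub>R axis i 1)) has_real_derivative k x) (at 0)" for i
    proof (rule bexI[of _ "\<lambda>x. (m * c) * partial i g (a + c *\<^sub>R x)"])
      show "\<forall>x. ((\<lambda>t. h (x + t *\<^sub>R axis i 1)) has_real_derivative m * c * partial i g (a + c *\<^sub>R x)) (at 0)"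
        unfolding h using der[OF g] by (auto intro!: derivative_eq_intros)
    qed (use smooth_partial[OF g] in blast)
    ultimately show "continuous_on UNIV h \<and> (\<forall>i. \<exists>k\<in>?S. \<forall>x. ((\<lambda>t. h (x + t *\<^sub>R axis i 1)) has_real_derivative k x) (at 0))"
      by blast
  qed
  show "partial i (\<lambda>x. f (a + c *\<^sub>R x)) x = c * partial i f (a + c *\<^sub>R x)"
    by (rule partialI[OF der[OF assms]])
qed

text \<open>The functions \<open>P(1/t) exp(-1/t)\<close>, extended by \<open>0\<close> to \<open>t \<le> 0\<close>, with \<open>P\<close> a polynomial,
  are closed under differentiation; this gives all derivatives of \<open>exp(-1/t)\<close> at once.\<close>

definition flat :: "real poly \<Rightarrow> real \<Rightarrow> real" where
  "flat p t = (if t > 0 then poly p (1/t) * exp (- (1/t)) else 0)"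

lemma poly_exp_tendsto_0: "((\<lambda>x::real. poly p x * exp (- x)) \<longlongrightarrow> 0) at_top"
proof -
  have "((\<lambda>x::real. \<Sum>i\<le>degree p. coeff p i * (x ^ i * exp (- x))) \<longlongrightarrow> (\<Sum>i\<le>degree p. coeff p i * 0)) at_top"
  proof (intro tendsto_sum tendsto_mult tendsto_const)
    fix i show "((\<lambda>x::real. x ^ i * exp (- x)) \<longlongrightarrow> 0) at_top"
      using tendsto_power_div_exp_0[of i] by (simp add: exp_minus divide_inverse)
  qed
  then show ?thesis by (simp add: poly_altdef sum_distrib_right mult.assoc)
qed

lemma flat_tendsto_0: "(flat p \<longlongrightarrow> 0) (at 0)"
proof -
  have "(flat p \<longlongrightarrow> 0) (at_right 0)"
  proof (rule Lim_transform_eventually)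
    show "((\<lambda>t. poly p (inverse t) * exp (- (inverse t))) \<longlongrightarrow> 0) (at_right 0)"
      by (rule filterlim_compose[OF poly_exp_tendsto_0 filterlim_inverse_at_top_right])
    show "\<forall>\<^sub>F t in at_right 0. poly p (inverse t) * exp (- (inverse t)) = flat p t"
      unfolding eventually_at_filter by (auto simp: flat_def divide_inverse)
  qed
  moreover have "(flat p \<longlongrightarrow> 0) (at_left 0)"
    by (rule Lim_transform_eventually[OF tendsto_const]) (auto simp: flat_def eventually_at_filter)
  ultimately show ?thesis by (simp add: filterlim_split_at)
qed

text \<open>With s = 1/t, differentiating P(s) exp(-s) with respect to t brings out the factor -s^2
  and turns P into X^2 (P - P'); \<open>[:0,0,1:]\<close> is X^2.\<close>

lemma flat_deriv: "(flat p has_real_derivative flat ([:0,0,1:] * (p - pderiv p)) t) (at t)"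
proof -
  consider "t > 0" | "t < 0" | "t = 0" by linarith
  then show ?thesis
  proof cases
    case 1
    have i: "((\<lambda>t. 1/t) has_real_derivative - (1/t^2)) (at t)"
      using 1 by (auto intro!: derivative_eq_intros simp: power2_eq_square)
    have "((\<lambda>t. poly p (1/t) * exp (- (1/t))) has_real_derivative
        (poly (pderiv p) (1/t) * - (1/t^2)) * exp (- (1/t)) + (exp (- (1/t)) * - (- (1/t^2))) * poly p (1/t)) (at t)"
      by (intro DERIV_mult DERIV_chain2[OF poly_DERIV i] DERIV_chain2[OF DERIV_exp] DERIV_minus i)
    moreover have "(poly (pderiv p) (1/t) * - (1/t^2)) * exp (- (1/t)) + (exp (- (1/t)) * - (- (1/t^2))) * poly p (1/t)
        = flat ([:0,0,1:] * (p - pderiv p)) t"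
    proof -
      have "poly ([:0,0,1:] * (p - pderiv p)) (1/t) = (1/t^2) * (poly p (1/t) - poly (pderiv p) (1/t))"
        by (simp only: poly_mult poly_diff poly_pCons poly_0) (simp add: power2_eq_square)
      moreover have "a * - r * E + (E * - (- r)) * b = r * (b - a) * E" for a b r E :: real
        by (simp add: algebra_simps)
      ultimately show ?thesis unfolding flat_def using 1 by (simp only: if_True)
    qed
    ultimately have "((\<lambda>t. poly p (1/t) * exp (- (1/t))) has_real_derivative flat ([:0,0,1:] * (p - pderiv p)) t) (at t)"
      by simp
    moreover have "\<forall>\<^sub>F s in nhds t. poly p (1/s) * exp (- (1/s)) = flat p s"
      using eventually_nhds_in_open[of "{0<..}" t] 1 by (auto elim!: eventually_mono simp: flat_def)
    ultimately show ?thesis by (simp only: DERIV_cong_ev[OF refl _ refl])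
  next
    case 2
    have "((\<lambda>t. 0) has_real_derivative flat ([:0,0,1:] * (p - pderiv p)) t) (at t)"
      using 2 by (simp add: flat_def)
    moreover have "\<forall>\<^sub>F s in nhds t. 0 = flat p s"
      using eventually_nhds_in_open[of "{..<0}" t] 2 by (auto elim!: eventually_mono simp: flat_def)
    ultimately show ?thesis by (simp only: DERIV_cong_ev[OF refl _ refl])
  next
    case 3
    \<comment> \<open>At 0, dividing by \<open>h\<close> multiplies the polynomial by X, so the
      difference quotient is again a flat function and tends to 0.\<close>
    have eq: "(flat p (0 + h) - flat p 0) / h = flat ([:0,1:] * p) h" for h
      by (simp add: flat_def)
    have "flat ([:0,0,1:] * (p - pderiv p)) 0 = 0" by (simp add: flat_def)
    then show ?thesis using flat_tendsto_0[of "[:0,1:] * p"] 3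
      by (simp only: DERIV_def eq)
  qed
qed

lemma smooth_flat_coord: "smooth (\<lambda>x::real^'n. flat p (a + c * x $ i))"
proof (rule smooth_coinduct[of _ "{\<lambda>x. flat p (a + c * x $ i) | p. True}"])
  let ?S = "{\<lambda>x::real^'n. flat p (a + c * x $ i) | p. True}"
  fix g assume "g \<in> ?S"
  then obtain p where g: "g = (\<lambda>x. flat p (a + c * x $ i))" by auto
  have "continuous_on UNIV (flat p)"
    using flat_deriv by (meson DERIV_isCont continuous_at_imp_continuous_on)
  then have "continuous_on UNIV g" unfolding g
    by (rule continuous_on_compose2) (auto intro!: continuous_intros)
  moreover have "\<exists>h\<in>?S. \<forall>x. ((\<lambda>t. g (x + t *\<^sub>R axis j 1)) has_real_derivative h x) (at 0)" for j
  proof -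
    let ?d = "if j = i then c else 0"
    let ?q = "smult ?d ([:0,0,1:] * (p - pderiv p))"
    have "((\<lambda>t. g (x + t *\<^sub>R axis j 1)) has_real_derivative flat ?q (a + c * x $ i)) (at 0)" for x
    proof -
      have "((\<lambda>t. flat p (a + c * x $ i + t * ?d)) has_real_derivative
          flat ([:0,0,1:] * (p - pderiv p)) (a + c * x $ i + 0 * ?d) * ?d) (at 0)"
        by (rule DERIV_chain2[OF flat_deriv]) (auto intro!: derivative_eq_intros)
      moreover have "flat ([:0,0,1:] * (p - pderiv p)) (a + c * x $ i + 0 * ?d) * ?d = flat ?q (a + c * x $ i)"
        by (simp add: flat_def)
      moreover have "g (x + t *\<^sub>R axis j 1) = flat p (a + c * x $ i + t * ?d)" for t
        by (simp add: g axis_def algebra_simps)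
      ultimately show ?thesis by simp
    qed
    then show ?thesis by (intro bexI[of _ "\<lambda>x. flat ?q (a + c * x $ i)"]) auto
  qed
  ultimately show "continuous_on UNIV g \<and> (\<forall>j. \<exists>h\<in>?S. \<forall>x. ((\<lambda>t. g (x + t *\<^sub>R axis j 1)) has_real_derivative h x) (at 0))"
    by blast
qed auto

lemma flat_1: "flat 1 t > 0 \<longleftrightarrow> t > 0" "flat 1 t = 0 \<longleftrightarrow> t \<le> 0" "flat 1 t \<ge> 0"
  by (auto simp: flat_def)

text \<open>Cubes instead of balls, because a product of one-variable functions then suffices. The
  set of nonzeros is known exactly; its openness later shows that the integral is positive, so that
  the bump can be normalised.\<close>

lemma ex_smooth_bump:
  fixes p :: "real^'n"
  assumes "s > 0"
  obtains \<eta> where "smooth \<eta>" "\<And>x. \<eta> x \<ge> 0" "\<And>x. \<eta> x \<noteq> 0 \<longleftrightarrow> (\<forall>i. \<bar>x $ i - p $ i\<bar> < s)"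
proof
  let ?f = "\<lambda>i x. flat 1 (s - p $ i + 1 * x $ i) * flat 1 (s + p $ i + (-1) * x $ i)"
  let ?e = "\<lambda>x. \<Prod>i\<in>UNIV. ?f i x"
  show "smooth ?e" by (intro smooth_prod smooth_mult smooth_flat_coord)
  show "?e x \<ge> 0" for x by (intro prod_nonneg ballI mult_nonneg_nonneg flat_1)
  show "?e x \<noteq> 0 \<longleftrightarrow> (\<forall>i. \<bar>x $ i - p $ i\<bar> < s)" for x
    by (auto simp: prod_zero_iff flat_1 abs_less_iff not_le algebra_simps)
qed

lemma ex_smooth_plateau:
  fixes p :: "real^'n"
  assumes "s > 0"
  obtains \<beta> where "smooth \<beta>" "\<And>x. 0 \<le> \<beta> x" "\<And>x. \<beta> x \<le> 1"
    "\<And>x. (\<forall>i. \<bar>x $ i - p $ i\<bar> \<le> s) \<Longrightarrow> \<beta> x = 1"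
    "\<And>x i. \<bar>x $ i - p $ i\<bar> \<ge> 2 * s \<Longrightarrow> \<beta> x = 0"
proof
  \<comment> \<open>The usual smooth step in the affine variable y = a + c x_i, a quotient of the
    form f(y) / (f(y) + f(1 - y)): it is 0 for y \<le> 0 and 1 for y \<ge> 1. The denominator is
    positive since y and 1 - y cannot both be nonpositive.\<close>
  define st where "st a c i = (\<lambda>x::real^'n. flat 1 (a + c * x $ i) *
    inverse (flat 1 (a + c * x $ i) + flat 1 (1 - a + (-c) * x $ i)))" for a c i
  have pos: "flat 1 (a + c * x $ i) + flat 1 (1 - a + (-c) * x $ i) > 0" for a c i and x :: "real^'n"
    using flat_1[of "a + c * x $ i"] flat_1[of "1 - a + (-c) * x $ i"] by (cases "a + c * x $ i > 0") (auto intro: add_pos_nonneg add_nonneg_pos)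
  have sm: "smooth (st a c i)" for a c i
    unfolding st_def using pos[of a c _ i]
    by (intro smooth_mult smooth_inverse smooth_add smooth_flat_coord) (metis less_irrefl)
  have st01: "0 \<le> st a c i x" "st a c i x \<le> 1" for a c i x
    unfolding st_def divide_inverse[symmetric] using pos[of a c x i] flat_1(3)
    by (auto simp: divide_le_eq)
  have st1: "st a c i x = 1" if "a + c * x $ i \<ge> 1" for a c i x
    using that pos[of a c x i] flat_1(2)[of "1 - a + (-c) * x $ i"] unfolding st_def by simp
  have st0: "st a c i x = 0" if "a + c * x $ i \<le> 0" for a c i x
    using that flat_1(2)[of "a + c * x $ i"] unfolding st_def by simp
  \<comment> \<open>The first factor uses y = 2 + (x_i - p_i)/s, which reaches 0 at x_i - p_i = -2s
    and 1 at x_i - p_i = -s; the second factor is its mirror image.\<close>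
  let ?b = "\<lambda>x. \<Prod>i\<in>UNIV. st (2 - p $ i / s) (1/s) i x * st (2 + p $ i / s) (-1/s) i x"
  show "smooth ?b" by (intro smooth_prod smooth_mult sm)
  show "0 \<le> ?b x" for x using st01 by (intro prod_nonneg ballI mult_nonneg_nonneg)
  show "?b x \<le> 1" for x using st01 by (intro prod_le_1) (auto intro: mult_le_one)
  show "?b x = 1" if x: "\<forall>i. \<bar>x $ i - p $ i\<bar> \<le> s" for x
  proof (intro prod.neutral ballI)
    fix i
    have "\<bar>x $ i - p $ i\<bar> \<le> s" using x by blast
    then have "(x $ i - p $ i) / s \<le> 1" "- 1 \<le> (x $ i - p $ i) / s"
      using assms by (auto simp: le_divide_eq divide_le_eq)
    then have "st (2 - p $ i / s) (1/s) i x = 1" "st (2 + p $ i / s) (-1/s) i x = 1"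
      by (auto intro!: st1 simp: diff_divide_distrib)
    then show "st (2 - p $ i / s) (1/s) i x * st (2 + p $ i / s) (-1/s) i x = 1" by simp
  qed
  show "?b x = 0" if x: "\<bar>x $ i - p $ i\<bar> \<ge> 2 * s" for x i
  proof (rule prod_zero)
    show "\<exists>i\<in>UNIV. st (2 - p $ i / s) (1/s) i x * st (2 + p $ i / s) (-1/s) i x = 0"
    proof (rule bexI[of _ i])
      consider "x $ i - p $ i \<ge> 2 * s" | "x $ i - p $ i \<le> - 2 * s" using x by linarith
      then show "st (2 - p $ i / s) (1/s) i x * st (2 + p $ i / s) (-1/s) i x = 0"
      proof cases
        case 1
        then have "(x $ i - p $ i) / s \<ge> 2" using assms by (simp add: le_divide_eq)
        then have "st (2 + p $ i / s) (-1/s) i x = 0" by (intro st0) (simp add: diff_divide_distrib)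
        then show ?thesis by simp
      next
        case 2
        then have "(x $ i - p $ i) / s \<le> -2" using assms by (simp add: divide_le_eq)
        then have "st (2 - p $ i / s) (1/s) i x = 0" by (intro st0) (simp add: diff_divide_distrib)
        then show ?thesis by simp
      qed
    qed auto
  qed auto
qed

text \<open>\<open>smooth\<close> speaks of coordinate lines only. Continuity of the partial
  derivatives upgrades this to total differentiability, which the estimates along segments in
  arbitrary directions rely on.\<close>

lemma smooth_has_derivative:
  fixes f :: "real^'n \<Rightarrow> real"
  assumes f: "smooth f"
  shows "(f has_derivative (\<lambda>h. grad f x \<bullet> h)) (at x)"
  unfolding has_derivative_at_alt
proof (intro conjI allI impI)
  show "bounded_linear (\<lambda>h. grad f x \<bullet> h)" by (rule bounded_linear_inner_right)
  fix e :: real assume "e > 0"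
  define e' where "e' = e / real CARD('n)"
  have e': "e' > 0" unfolding e'_def using \<open>e > 0\<close> by simp
  have "\<exists>d>0. \<forall>y. dist y x < d \<longrightarrow> dist (partial i f y) (partial i f x) < e'" for i
    using smooth_continuous[OF smooth_partial[OF f, of i]] e'
    by (auto simp: continuous_on_iff)
  then obtain d where d: "\<And>i. d i > 0" "\<And>i y. dist y x < d i \<Longrightarrow> dist (partial i f y) (partial i f x) < e'"
    by metis
  define \<delta> where "\<delta> = Min (range d)"
  have \<delta>: "\<delta> > 0" "\<And>i. \<delta> \<le> d i" unfolding \<delta>_def using d(1) by (auto simp: Min_gr_iff)
  show "\<exists>\<delta>>0. \<forall>y. norm (y - x) < \<delta> \<longrightarrow> norm (f y - f x - grad f x \<bullet> (y - x)) \<le> e * norm (y - x)"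
  proof (intro exI[of _ \<delta>] conjI allI impI \<delta>)
    fix y assume y: "norm (y - x) < \<delta>"
    define h where "h = y - x"
    \<comment> \<open>The increment is switched on one coordinate at a time. Every intermediate
      point is componentwise dominated by \<open>h\<close>, hence stays within the radius on which
      the partial derivatives are \<open>e'\<close>-close.\<close>
    define hh where "hh I = (\<chi> i. if i \<in> I then h $ i else 0)" for I
    have main: "\<bar>f (x + hh I) - f x - (\<Sum>i\<in>I. partial i f x * h $ i)\<bar> \<le> (\<Sum>i\<in>I. e' * \<bar>h $ i\<bar>)" for I
    proof -
      have "finite I" by simp
      then show ?thesis
      proof induction
        case empty
        have "hh {} = 0" by (simp add: hh_def vec_eq_iff)
        then show ?case by simp
      next
        case (insert j I)
        have hj: "hh (insert j I) = hh I + (h $ j) *\<^sub>R axis j 1"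
          using insert(2) by (auto simp: hh_def vec_eq_iff axis_def)
        have "\<bar>f ((x + hh I) + (h $ j) *\<^sub>R axis j 1) - f (x + hh I) - partial j f x * h $ j\<bar> \<le> e' * \<bar>h $ j\<bar>"
        proof -
          have "norm ((\<lambda>t. f ((x + hh I) + t *\<^sub>R axis j 1) - partial j f x * t) (h $ j)
               - (\<lambda>t. f ((x + hh I) + t *\<^sub>R axis j 1) - partial j f x * t) 0) \<le> e' * norm (h $ j - 0)"
          proof (rule field_differentiable_bound[where S = "closed_segment 0 (h $ j)" and
                f' = "\<lambda>t. partial j f ((x + hh I) + t *\<^sub>R axis j 1) - partial j f x"])
            fix t assume t: "t \<in> closed_segment 0 (h $ j)"
            show "((\<lambda>t. f (x + hh I + t *\<^sub>R axis j 1) - partial j f x * t) has_field_derivative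
                partial j f (x + hh I + t *\<^sub>R axis j 1) - partial j f x) (at t within closed_segment 0 (h $ j))"
              by (rule has_field_derivative_at_within) (auto intro!: derivative_eq_intros smooth_deriv_at[OF f])
            have tb: "\<bar>t\<bar> \<le> \<bar>h $ j\<bar>" using t by (auto simp: closed_segment_eq_real_ivl split: if_splits)
            have "norm (hh I + t *\<^sub>R axis j 1) \<le> norm h"
            proof (rule norm_le_componentwise_cart)
              fix i show "norm ((hh I + t *\<^sub>R axis j 1) $ i) \<le> norm (h $ i)"
                using tb insert(2) by (auto simp: hh_def axis_def)
            qed
            then have "dist (x + hh I + t *\<^sub>R axis j 1) x < d j"
              using y \<delta>(2)[of j] by (simp add: dist_norm h_def add.assoc)
            from d(2)[OF this] show "norm (partial j f (x + hh I + t *\<^sub>R axis j 1) - partial j f x) \<le> e'"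
              by (simp add: dist_norm)
          qed auto
          then show ?thesis by simp
        qed
        then show ?case using insert by (simp add: hj add.assoc)
      qed
    qed
    have "hh UNIV = h" by (simp add: hh_def vec_eq_iff)
    then have "\<bar>f y - f x - grad f x \<bullet> h\<bar> \<le> (\<Sum>i\<in>UNIV. e' * \<bar>h $ i\<bar>)"
      using main[of UNIV] by (simp add: h_def inner_vec_def grad_def)
    also have "\<dots> \<le> (\<Sum>i::'n\<in>UNIV. e' * norm h)"
      using e' by (intro sum_mono mult_left_mono component_le_norm_cart) auto
    also have "\<dots> = e * norm h" by (simp add: e'_def)
    finally show "norm (f y - f x - grad f x \<bullet> (y - x)) \<le> e * norm (y - x)" by (simp add: h_def)
  qed
qed

section \<open>Square integrable functions\<close>

definition sqint :: "'a measure \<Rightarrow> ('a \<Rightarrow> 'b::euclidean_space) \<Rightarrow> bool" where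
  "sqint M f \<longleftrightarrow> f \<in> borel_measurable M \<and> integrable M (\<lambda>x. (norm (f x))\<^sup>2)"

text \<open>The L2 norm is kept squared, so that convergence and semicontinuity are statements about
  integrals. The price is a factor 2 in each triangle inequality, which accounts for most of the
  fractions of epsilon below.\<close>

definition sqn :: "'a measure \<Rightarrow> ('a \<Rightarrow> 'b::euclidean_space) \<Rightarrow> real" where
  "sqn M f = (LINT x|M. (norm (f x))\<^sup>2)"

lemma sqn_nonneg [simp]: "sqn M f \<ge> 0"
  by (simp add: sqn_def)

lemma sqint_measurable [measurable_dest]: "sqint M f \<Longrightarrow> f \<in> borel_measurable M"
  by (simp add: sqint_def)

lemma sqint_bound:
  fixes f :: "'a \<Rightarrow> 'b::euclidean_space" and g :: "'a \<Rightarrow> 'c::euclidean_space"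
  assumes g: "sqint M g" and f: "f \<in> borel_measurable M" and le: "AE x in M. norm (f x) \<le> K * norm (g x)"
  shows "sqint M f" and "sqn M f \<le> K\<^sup>2 * sqn M g"
proof -
  have le2: "AE x in M. (norm (f x))\<^sup>2 \<le> K\<^sup>2 * (norm (g x))\<^sup>2"
    using le by eventually_elim (simp add: power_mono flip: power_mult_distrib)
  have gi: "integrable M (\<lambda>x. K\<^sup>2 * (norm (g x))\<^sup>2)" using g by (simp add: sqint_def)
  show "sqint M f" unfolding sqint_def
    using f Bochner_Integration.integrable_bound[OF gi, of "\<lambda>x. (norm (f x))\<^sup>2"] le2 by auto
  then show "sqn M f \<le> K\<^sup>2 * sqn M g"
    unfolding sqn_def integral_mult_right_zero[symmetric]
    by (intro integral_mono_AE gi le2) (auto simp: sqint_def)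
qed

lemma sqint_add:
  fixes f g :: "'a \<Rightarrow> 'b::euclidean_space"
  assumes f: "sqint M f" and g: "sqint M g"
  shows "sqint M (\<lambda>x. f x + g x)" and "sqn M (\<lambda>x. f x + g x) \<le> 2 * sqn M f + 2 * sqn M g"
proof -
  have le: "(norm (f x + g x))\<^sup>2 \<le> 2 * (norm (f x))\<^sup>2 + 2 * (norm (g x))\<^sup>2" for x
  proof -
    have "(norm (f x + g x))\<^sup>2 \<le> (norm (f x) + norm (g x))\<^sup>2"
      by (intro power_mono norm_triangle_ineq) simp
    also have "\<dots> \<le> 2 * (norm (f x))\<^sup>2 + 2 * (norm (g x))\<^sup>2"
      using sum_squares_bound[of "norm (f x)" "norm (g x)"] by (simp add: power2_sum)
    finally show ?thesis .
  qed
  have i: "integrable M (\<lambda>x. 2 * (norm (f x))\<^sup>2 + 2 * (norm (g x))\<^sup>2)"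
    using f g by (auto simp: sqint_def)
  show "sqint M (\<lambda>x. f x + g x)" unfolding sqint_def
    using f g by (auto intro!: Bochner_Integration.integrable_bound[OF i] simp: le sqint_def)
  then have "sqn M (\<lambda>x. f x + g x) \<le> (LINT x|M. 2 * (norm (f x))\<^sup>2 + 2 * (norm (g x))\<^sup>2)"
    unfolding sqn_def by (intro integral_mono i le) (auto simp: sqint_def)
  then show "sqn M (\<lambda>x. f x + g x) \<le> 2 * sqn M f + 2 * sqn M g"
    using f g by (simp add: sqn_def sqint_def)
qed

lemma sqint_scaleR:
  fixes f :: "'a \<Rightarrow> 'b::euclidean_space"
  assumes "sqint M f"
  shows "sqint M (\<lambda>x. c *\<^sub>R f x)" and "sqn M (\<lambda>x. c *\<^sub>R f x) = c\<^sup>2 * sqn M f"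
  using assms by (auto simp: sqint_def sqn_def power_mult_distrib)

lemma sqint_uminus:
  fixes f :: "'a \<Rightarrow> 'b::euclidean_space"
  assumes "sqint M f"
  shows "sqint M (\<lambda>x. - f x)" and "sqn M (\<lambda>x. - f x) = sqn M f"
  using assms by (auto simp: sqint_def sqn_def)

lemma sqint_diff:
  fixes f g :: "'a \<Rightarrow> 'b::euclidean_space"
  assumes "sqint M f" "sqint M g"
  shows "sqint M (\<lambda>x. f x - g x)" and "sqn M (\<lambda>x. f x - g x) \<le> 2 * sqn M f + 2 * sqn M g"
  using sqint_add[OF assms(1) sqint_uminus(1)[OF assms(2)]] sqint_uminus(2)[OF assms(2)] by auto

lemma sqint_zero [simp]: "sqint M (\<lambda>x. 0)" "sqn M (\<lambda>x. 0) = 0"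
  by (auto simp: sqint_def sqn_def)

lemma sqint_sum:
  fixes f :: "'i \<Rightarrow> 'a \<Rightarrow> 'b::euclidean_space"
  shows "(\<And>i. i \<in> I \<Longrightarrow> sqint M (f i)) \<Longrightarrow> sqint M (\<lambda>x. \<Sum>i\<in>I. f i x)"
  by (induction I rule: infinite_finite_induct) (auto intro: sqint_add)

lemma sqint_inner:
  fixes f g :: "'a \<Rightarrow> 'b::euclidean_space"
  assumes f: "sqint M f" and g: "sqint M g"
  shows "integrable M (\<lambda>x. f x \<bullet> g x)"
proof (rule Bochner_Integration.integrable_bound)
  show "integrable M (\<lambda>x. (norm (f x))\<^sup>2 + (norm (g x))\<^sup>2)" using f g by (auto simp: sqint_def)
  show "AE x in M. norm (f x \<bullet> g x) \<le> norm ((norm (f x))\<^sup>2 + (norm (g x))\<^sup>2)"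
  proof (intro AE_I2)
    fix x
    have "\<bar>f x \<bullet> g x\<bar> \<le> norm (f x) * norm (g x)" by (rule Cauchy_Schwarz_ineq2)
    also have "\<dots> \<le> (norm (f x))\<^sup>2 + (norm (g x))\<^sup>2"
      using sum_squares_bound[of "norm (f x)" "norm (g x)"]
        mult_nonneg_nonneg[OF norm_ge_zero[of "f x"] norm_ge_zero[of "g x"]] by linarith
    finally show "norm (f x \<bullet> g x) \<le> norm ((norm (f x))\<^sup>2 + (norm (g x))\<^sup>2)" by simp
  qed
qed (use f g in \<open>auto simp: sqint_def\<close>)

lemma sqint_mult: "sqint M f \<Longrightarrow> sqint M g \<Longrightarrow> integrable M (\<lambda>x. f x * g x :: real)"
  using sqint_inner[of M f g] by simp

lemma sqint_norm: "sqint M f \<Longrightarrow> sqint M (\<lambda>x. norm (f x))"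
  by (auto simp: sqint_def)

text \<open>A nonnegative quadratic polynomial in \<open>t\<close> has nonpositive discriminant;
  evaluate at the minimum t = -c/b. It serves twice: for the Cauchy-Schwarz inequality, and for the
  variational inequality at an almost minimiser in \<open>approx_riesz\<close>.\<close>

lemma discriminant_le:
  fixes a b c :: real
  assumes "\<And>t. a + 2 * t * c + t\<^sup>2 * b \<ge> 0" and "b \<ge> 0"
  shows "c\<^sup>2 \<le> a * b"
proof (cases "b = 0")
  case True
  have "c = 0"
  proof (rule ccontr)
    assume "c \<noteq> 0"
    then show False using assms(1)[of "- (a + 1) / (2 * c)"] True by (simp add: field_simps)
  qed
  then show ?thesis using True by simp
next
  case False
  then have b: "b > 0" using assms(2) by simp
  have "0 \<le> a + 2 * (- c / b) * c + (- c / b)\<^sup>2 * b" by (rule assms(1))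
  also have "\<dots> = a - c\<^sup>2 / b" using b by (simp add: power2_eq_square field_simps)
  finally show ?thesis using b by (simp add: divide_le_eq)
qed

lemma sqint_Cauchy_Schwarz:
  fixes f g :: "'a \<Rightarrow> 'b::euclidean_space"
  assumes f: "sqint M f" and g: "sqint M g"
  shows "\<bar>LINT x|M. f x \<bullet> g x\<bar> \<le> sqrt (sqn M f * sqn M g)"
proof -
  have "sqn M f + 2 * t * (LINT x|M. f x \<bullet> g x) + t\<^sup>2 * sqn M g \<ge> 0" for t
  proof -
    have eq: "(norm (f x + t *\<^sub>R g x))\<^sup>2 = (norm (f x))\<^sup>2 + 2 * t * (f x \<bullet> g x) + t\<^sup>2 * (norm (g x))\<^sup>2" for x
      unfolding power2_norm_eq_inner power2_eq_square[of t]
      by (simp add: inner_add_left inner_add_right inner_commute[of "g x" "f x"] algebra_simps)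
    have "0 \<le> (LINT x|M. (norm (f x + t *\<^sub>R g x))\<^sup>2)" by simp
    also have "\<dots> = sqn M f + 2 * t * (LINT x|M. f x \<bullet> g x) + t\<^sup>2 * sqn M g"
      using f g sqint_inner[OF f g] unfolding eq sqn_def sqint_def by simp
    finally show ?thesis .
  qed
  from discriminant_le[OF this] have "(LINT x|M. f x \<bullet> g x)\<^sup>2 \<le> sqn M f * sqn M g" by simp
  then show ?thesis by (simp add: real_le_rsqrt)
qed

lemma inner_tendsto_0:
  fixes f g :: "nat \<Rightarrow> 'a \<Rightarrow> 'b::euclidean_space"
  assumes f: "\<And>k. sqint M (f k)" and g: "\<And>k. sqint M (g k)"
    and lim: "(\<lambda>k. sqn M (f k)) \<longlonglongrightarrow> 0" and B: "\<And>k. sqn M (g k) \<le> B"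
  shows "(\<lambda>k. LINT x|M. f k x \<bullet> g k x) \<longlonglongrightarrow> 0"
proof (rule Lim_null_comparison)
  show "\<forall>\<^sub>F k in sequentially. norm (LINT x|M. f k x \<bullet> g k x) \<le> sqrt (sqn M (f k) * B)"
  proof (intro always_eventually allI)
    fix k
    have "norm (LINT x|M. f k x \<bullet> g k x) \<le> sqrt (sqn M (f k) * sqn M (g k))"
      using sqint_Cauchy_Schwarz[OF f g] by simp
    also have "\<dots> \<le> sqrt (sqn M (f k) * B)" using B by (intro real_sqrt_le_mono mult_left_mono) auto
    finally show "norm (LINT x|M. f k x \<bullet> g k x) \<le> sqrt (sqn M (f k) * B)" .
  qed
  show "(\<lambda>k. sqrt (sqn M (f k) * B)) \<longlonglongrightarrow> 0"
    using tendsto_real_sqrt[OF tendsto_mult_left_zero[OF lim, of B]] by simp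
qed

lemma sqn_tendsto_0_add:
  fixes f g :: "nat \<Rightarrow> 'a \<Rightarrow> 'b::euclidean_space"
  assumes "\<And>k. sqint M (f k)" "\<And>k. sqint M (g k)"
    and "(\<lambda>k. sqn M (f k)) \<longlonglongrightarrow> 0" "(\<lambda>k. sqn M (g k)) \<longlonglongrightarrow> 0"
  shows "(\<lambda>k. sqn M (\<lambda>x. f k x + g k x)) \<longlonglongrightarrow> 0"
proof (rule Lim_null_comparison)
  show "\<forall>\<^sub>F k in sequentially. norm (sqn M (\<lambda>x. f k x + g k x)) \<le> 2 * sqn M (f k) + 2 * sqn M (g k)"
    using sqint_add(2)[OF assms(1,2)] by simp
  show "(\<lambda>k. 2 * sqn M (f k) + 2 * sqn M (g k)) \<longlonglongrightarrow> 0"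
    using tendsto_add[OF tendsto_mult_left[OF assms(3), of 2] tendsto_mult_left[OF assms(4), of 2]] by simp
qed

lemma sqn_tendsto_0_bound:
  fixes f :: "nat \<Rightarrow> 'a \<Rightarrow> 'b::euclidean_space" and g :: "nat \<Rightarrow> 'a \<Rightarrow> 'c::euclidean_space"
  assumes "\<And>k. sqint M (g k)" "\<And>k. f k \<in> borel_measurable M" "\<And>k. AE x in M. norm (f k x) \<le> K * norm (g k x)"
    and "(\<lambda>k. sqn M (g k)) \<longlonglongrightarrow> 0"
  shows "(\<lambda>k. sqn M (f k)) \<longlonglongrightarrow> 0"
proof (rule Lim_null_comparison)
  show "\<forall>\<^sub>F k in sequentially. norm (sqn M (f k)) \<le> K\<^sup>2 * sqn M (g k)"
    using sqint_bound(2)[OF assms(1,2,3)] by simp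
  show "(\<lambda>k. K\<^sup>2 * sqn M (g k)) \<longlonglongrightarrow> 0"
    using tendsto_mult_left[OF assms(4), of "K\<^sup>2"] by simp
qed

lemma sqn_dominated:
  fixes f :: "nat \<Rightarrow> 'a \<Rightarrow> 'b::euclidean_space" and q :: "'a \<Rightarrow> 'c::euclidean_space"
  assumes q: "sqint M q" and f: "\<And>k. f k \<in> borel_measurable M"
    and le: "\<And>k. AE x in M. norm (f k x) \<le> K * norm (q x)"
    and lim: "AE x in M. (\<lambda>k. f k x) \<longlonglongrightarrow> 0"
  shows "(\<lambda>k. sqn M (f k)) \<longlonglongrightarrow> 0"
proof -
  have "(\<lambda>k. LINT x|M. (norm (f k x))\<^sup>2) \<longlonglongrightarrow> (LINT x|M. 0)"
  proof (rule integral_dominated_convergence[where w = "\<lambda>x. K\<^sup>2 * (norm (q x))\<^sup>2"])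
    show "integrable M (\<lambda>x. K\<^sup>2 * (norm (q x))\<^sup>2)" using q by (simp add: sqint_def)
    show "AE x in M. (\<lambda>k. (norm (f k x))\<^sup>2) \<longlonglongrightarrow> 0"
      using lim by eventually_elim (use tendsto_norm_zero in \<open>fastforce intro: tendsto_eq_intros\<close>)
    show "AE x in M. norm ((norm (f k x))\<^sup>2) \<le> K\<^sup>2 * (norm (q x))\<^sup>2" for k
      using le[of k] by eventually_elim (simp add: power_mono flip: power_mult_distrib)
  qed (use f in auto)
  then show ?thesis by (simp add: sqn_def)
qed

lemma sqn_tendsto_0_AE_subseq:
  fixes f :: "nat \<Rightarrow> 'a \<Rightarrow> 'b::euclidean_space"
  assumes f: "\<And>k. sqint M (f k)" and lim: "(\<lambda>k. sqn M (f k)) \<longlonglongrightarrow> 0"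
  obtains r where "strict_mono r" "AE x in M. (\<lambda>k. f (r k) x) \<longlonglongrightarrow> 0"
proof -
  have "\<exists>r::nat\<Rightarrow>nat. strict_mono r \<and> (AE x in M. (\<lambda>k. (norm (f (r k) x))\<^sup>2) \<longlonglongrightarrow> 0)"
    by (rule tendsto_L1_AE_subseq) (use f lim in \<open>auto simp: sqint_def sqn_def\<close>)
  then obtain r where r: "strict_mono r" "AE x in M. (\<lambda>k. (norm (f (r k) x))\<^sup>2) \<longlonglongrightarrow> 0" by auto
  have "AE x in M. (\<lambda>k. f (r k) x) \<longlonglongrightarrow> 0"
    using r(2)
  proof eventually_elim
    case (elim x)
    then have "(\<lambda>k. sqrt ((norm (f (r k) x))\<^sup>2)) \<longlonglongrightarrow> sqrt 0" by (rule tendsto_real_sqrt)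
    then show ?case by (simp add: tendsto_norm_zero_iff)
  qed
  with r(1) that show thesis by blast
qed

text \<open>Riesz-Fischer: a fast subsequence converges almost everywhere because its increments are
  summable at almost every point, and Fatou's lemma turns the pointwise limit into an L2
  limit.\<close>

lemma sqint_complete:
  fixes f :: "nat \<Rightarrow> 'a \<Rightarrow> real"
  assumes f: "\<And>n. sqint M (f n)"
    and Cauchy: "\<And>e. e > 0 \<Longrightarrow> \<exists>N. \<forall>m\<ge>N. \<forall>n\<ge>N. sqn M (\<lambda>x. f m x - f n x) \<le> e"
  obtains g where "sqint M g" "(\<lambda>n. sqn M (\<lambda>x. f n x - g x)) \<longlonglongrightarrow> 0"
proof -
  have "\<exists>N. \<forall>m\<ge>N. \<forall>n\<ge>N. sqn M (\<lambda>x. f m x - f n x) \<le> (1/4)^k" for k by (rule Cauchy) simp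
  then obtain N where N: "\<And>k m n. m \<ge> N k \<Longrightarrow> n \<ge> N k \<Longrightarrow> sqn M (\<lambda>x. f m x - f n x) \<le> (1/4)^k" by metis
  \<comment> \<open>The sum keeps \<open>r k\<close> above \<open>N k\<close>; the extra summand
    \<open>k\<close> makes \<open>r\<close> strictly increasing.\<close>
  define r where "r k = (\<Sum>i\<le>k. N i) + k" for k
  have rN: "N k \<le> r k" for k by (auto simp: r_def intro: trans_le_add1 member_le_sum)
  have r: "strict_mono r" by (auto simp: strict_mono_Suc_iff r_def)
  define d where "d k x = f (r (Suc k)) x - f (r k) x" for k x
  have d: "sqint M (d k)" for k unfolding d_def by (intro sqint_diff f)
  have dle: "sqn M (d k) \<le> (1/4)^k" for k
    unfolding d_def using rN[of k] r by (intro N) (auto simp: strict_mono_Suc_iff intro: less_imp_le order_trans)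
  have [measurable]: "f n \<in> borel_measurable M" "d n \<in> borel_measurable M" for n using f d by (auto simp: sqint_def)
  \<comment> \<open>The weight 2^k still leaves the summable bound 2^k 4^{-k} = 2^{-k}. It pays off
    pointwise: a finite sum of 2^k d^2 controls the sum of |d|, since |d| exceeds 2^{-k} only if |d|
    \<le> 2^k d^2.\<close>
  have "(\<integral>\<^sup>+x. (\<Sum>k. ennreal (2^k * (d k x)\<^sup>2)) \<partial>M) = (\<Sum>k. \<integral>\<^sup>+x. ennreal (2^k * (d k x)\<^sup>2) \<partial>M)"
    by (rule nn_integral_suminf) measurable
  also have "\<dots> \<le> (\<Sum>k. ennreal ((1/2)^k))"
  proof (intro suminf_le)
    fix k
    have "(\<integral>\<^sup>+x. ennreal (2^k * (d k x)\<^sup>2) \<partial>M) = ennreal (LINT x|M. 2^k * (d k x)\<^sup>2)"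
      using d[of k] by (intro nn_integral_eq_integral) (auto simp: sqint_def)
    also have "\<dots> = ennreal (2^k * sqn M (d k))" by (simp add: sqn_def)
    also have "\<dots> \<le> ennreal (2^k * (1/4)^k)" using dle by (intro ennreal_leI mult_left_mono) auto
    also have "2^k * (1/4)^k = (1/2::real)^k" by (simp flip: power_mult_distrib)
    finally show "(\<integral>\<^sup>+x. ennreal (2^k * (d k x)\<^sup>2) \<partial>M) \<le> ennreal ((1/2)^k)" .
  qed auto
  also have "\<dots> < \<infinity>" by (subst suminf_ennreal2) auto
  finally have "AE x in M. (\<Sum>k. ennreal (2^k * (d k x)\<^sup>2)) \<noteq> \<infinity>"
    by (intro nn_integral_PInf_AE) auto
  then have conv: "AE x in M. convergent (\<lambda>k. f (r k) x)"
  proof eventually_elim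
    case (elim x)
    then have "summable (\<lambda>k. 2^k * (d k x)\<^sup>2)" by (intro summable_suminf_not_top) auto
    then have "summable (\<lambda>k. 2^k * (d k x)\<^sup>2 + (1/2)^k)" by (intro summable_add) auto
    then have "summable (\<lambda>k. d k x)"
    proof (rule summable_comparison_test[rotated], intro exI allI impI)
      fix k :: nat
      show "norm (d k x) \<le> 2^k * (d k x)\<^sup>2 + (1/2)^k"
      proof (cases "\<bar>d k x\<bar> \<le> (1/2)^k")
        case True then show ?thesis by (smt (verit) real_norm_def mult_nonneg_nonneg zero_le_power zero_le_power2)
      next
        case False
        then have "1 \<le> 2^k * \<bar>d k x\<bar>" by (simp add: power_one_over divide_le_eq field_simps)
        then have "\<bar>d k x\<bar> * 1 \<le> \<bar>d k x\<bar> * (2^k * \<bar>d k x\<bar>)" by (intro mult_left_mono) auto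
        also have "\<dots> = 2^k * (d k x)\<^sup>2" by (simp add: power2_eq_square abs_mult_self_eq flip: abs_mult)
        finally show ?thesis by (simp add: add_increasing2)
      qed
    qed
    then have "convergent (\<lambda>n. \<Sum>k<n. d k x)" by (simp add: summable_iff_convergent)
    then have "convergent (\<lambda>n. f (r n) x - f (r 0) x)"
      unfolding d_def by (simp add: sum_lessThan_telescope[of "\<lambda>k. f (r k) x"])
    then have "convergent (\<lambda>n. (f (r n) x - f (r 0) x) + f (r 0) x)" by (intro convergent_add convergent_const)
    then show ?case by simp
  qed
  define g where "g x = lim (\<lambda>k. f (r k) x)" for x
  have g [measurable]: "g \<in> borel_measurable M" unfolding g_def by measurable
  have lim: "AE x in M. (\<lambda>k. f (r k) x) \<longlonglongrightarrow> g x"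
    using conv by eventually_elim (simp add: g_def convergent_LIMSEQ_iff)
  \<comment> \<open>Fatou with \<open>n\<close> fixed and the other index running along the
    subsequence.\<close>
  have main: "integrable M (\<lambda>x. (f n x - g x)\<^sup>2) \<and> sqn M (\<lambda>x. f n x - g x) \<le> e"
    if n: "n \<ge> K" and e: "e > 0" and K: "\<And>m n. m \<ge> K \<Longrightarrow> n \<ge> K \<Longrightarrow> sqn M (\<lambda>x. f m x - f n x) \<le> e" for n e K
  proof -
    have "(\<integral>\<^sup>+x. ennreal ((f n x - g x)\<^sup>2) \<partial>M) \<le> (\<integral>\<^sup>+x. liminf (\<lambda>k. ennreal ((f n x - f (r k) x)\<^sup>2)) \<partial>M)"
    proof (rule nn_integral_mono_AE)
      show "AE x in M. ennreal ((f n x - g x)\<^sup>2) \<le> liminf (\<lambda>k. ennreal ((f n x - f (r k) x)\<^sup>2))"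
        using lim
      proof eventually_elim
        case (elim x)
        have "(\<lambda>k. ennreal ((f n x - f (r k) x)\<^sup>2)) \<longlonglongrightarrow> ennreal ((f n x - g x)\<^sup>2)"
          by (intro tendsto_intros elim)
        from lim_imp_Liminf[OF trivial_limit_sequentially this] show ?case by simp
      qed
    qed
    also have "\<dots> \<le> liminf (\<lambda>k. \<integral>\<^sup>+x. ennreal ((f n x - f (r k) x)\<^sup>2) \<partial>M)"
      by (rule nn_integral_liminf) measurable
    also have "\<dots> \<le> ennreal e"
    proof (rule Liminf_le)
      show "\<forall>\<^sub>F k in sequentially. (\<integral>\<^sup>+x. ennreal ((f n x - f (r k) x)\<^sup>2) \<partial>M) \<le> ennreal e"
        using eventually_ge_at_top[of K]
      proof eventually_elim
        case (elim k)
        have "(\<integral>\<^sup>+x. ennreal ((f n x - f (r k) x)\<^sup>2) \<partial>M) = ennreal (sqn M (\<lambda>x. f n x - f (r k) x))"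
          using sqint_diff(1)[OF f f, of n "r k"] unfolding sqn_def
          by (subst nn_integral_eq_integral) (auto simp: sqint_def)
        also have "\<dots> \<le> ennreal e"
          using elim n seq_suble[OF r, of k] by (intro ennreal_leI K) auto
        finally show ?case .
      qed
    qed simp
    finally have le: "(\<integral>\<^sup>+x. ennreal ((f n x - g x)\<^sup>2) \<partial>M) \<le> ennreal e" .
    then have i: "integrable M (\<lambda>x. (f n x - g x)\<^sup>2)"
      by (intro integrableI_bounded) (auto simp: less_top[symmetric] top_unique)
    moreover have "sqn M (\<lambda>x. f n x - g x) \<le> e"
      using le e unfolding sqn_def by (subst (asm) nn_integral_eq_integral) (use i in auto)
    ultimately show ?thesis by simp
  qed
  have lim: "(\<lambda>n. sqn M (\<lambda>x. f n x - g x)) \<longlonglongrightarrow> 0"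
  proof (rule LIMSEQ_I)
    fix e :: real assume "e > 0"
    then obtain K where K: "\<And>m n. m \<ge> K \<Longrightarrow> n \<ge> K \<Longrightarrow> sqn M (\<lambda>x. f m x - f n x) \<le> e/2"
      using Cauchy[of "e/2"] by auto
    then show "\<exists>K. \<forall>n\<ge>K. norm (sqn M (\<lambda>x. f n x - g x) - 0) < e"
      using main[of K _ "e/2"] \<open>e > 0\<close> by (intro exI[of _ K]) fastforce
  qed
  obtain K where "\<And>m n. m \<ge> K \<Longrightarrow> n \<ge> K \<Longrightarrow> sqn M (\<lambda>x. f m x - f n x) \<le> 1"
    using Cauchy[of 1] by auto
  then have "sqint M (\<lambda>x. f K x - g x)" using main[of K K 1] by (auto simp: sqint_def)
  from sqint_diff(1)[OF f[of K] this] have "sqint M g" by simp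
  then show thesis using lim that by blast
qed

lemma sqint_vec_iff: "sqint M g \<longleftrightarrow> (\<forall>i. sqint M (\<lambda>x. g x $ i))" for g :: "'a \<Rightarrow> real^'n"
proof
  assume g: "sqint M g"
  have "(\<lambda>x. g x $ i) \<in> borel_measurable M" for i
    using borel_measurable_inner[of g M "\<lambda>x. axis i 1"] g by (simp add: sqint_def inner_axis)
  then show "\<forall>i. sqint M (\<lambda>x. g x $ i)"
    by (auto intro!: sqint_bound(1)[OF g, where K = 1] simp: component_le_norm_cart)
next
  assume g: "\<forall>i. sqint M (\<lambda>x. g x $ i)"
  have eq: "(\<lambda>x. \<Sum>i\<in>UNIV. (g x $ i) *\<^sub>R (axis i 1 :: real^'n)) = g"
    by (simp add: fun_eq_iff basis_expansion flip: scalar_mult_eq_scaleR)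
  have "sqint M (\<lambda>x. \<Sum>i\<in>UNIV. (g x $ i) *\<^sub>R (axis i 1 :: real^'n))"
  proof (rule sqint_sum)
    fix i
    show "sqint M (\<lambda>x. (g x $ i) *\<^sub>R (axis i 1 :: real^'n))"
      by (rule sqint_bound(1)[where K = 1 and g = "\<lambda>x. g x $ i"])
        (use g in \<open>auto simp: sqint_def intro!: borel_measurable_scaleR\<close>)
  qed
  then show "sqint M g" unfolding eq .
qed

lemma sqn_vec: "sqint M g \<Longrightarrow> sqn M g = (\<Sum>i\<in>UNIV. sqn M (\<lambda>x. g x $ i))" for g :: "'a \<Rightarrow> real^'n"
  unfolding sqint_vec_iff unfolding sqn_def sqint_def
  by (subst Bochner_Integration.integral_sum[symmetric]) (auto simp: norm_vec_def L2_set_def sum_nonneg)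

section \<open>Translations and mollification\<close>

lemma AE_lebesgue_on_iff:
  "S \<in> sets lebesgue \<Longrightarrow> (AE x in lebesgue_on S. P x) \<longleftrightarrow> (AE x in lebesgue. x \<in> S \<longrightarrow> P x)"
  by (subst AE_restrict_space_iff) auto

lemma borel_measurable_lebesgue_on_AE:
  fixes f g :: "'a::euclidean_space \<Rightarrow> 'b::euclidean_space"
  assumes "f \<in> borel_measurable (lebesgue_on S)" "S \<in> sets lebesgue" "AE x in lebesgue_on S. f x = g x"
  shows "g \<in> borel_measurable (lebesgue_on S)"
proof -
  have "AE x in lebesgue. (if x \<in> S then f x else 0) = (if x \<in> S then g x else 0)"
    using assms(3) unfolding AE_lebesgue_on_iff[OF assms(2)] by eventually_elim auto
  from borel_measurable_AE[OF _ this] assms show ?thesis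
    unfolding borel_measurable_if[OF assms(2)] by blast
qed

text \<open>Tonelli and translation invariance are applied over \<open>lborel\<close>, for Borel
  functions on the whole space. The representative vanishes outside \<open>S\<close>, so integrals
  over \<open>S\<close> become integrals over the space.\<close>

lemma ex_borel_representative:
  fixes u :: "'a::euclidean_space \<Rightarrow> real"
  assumes u: "u \<in> borel_measurable (lebesgue_on S)" and S: "S \<in> sets borel"
  obtains U where "U \<in> borel_measurable borel" "\<And>x. x \<notin> S \<Longrightarrow> U x = 0" "AE x in lebesgue_on S. u x = U x"
proof -
  have SL: "S \<in> sets lebesgue" using S by auto
  obtain V where V: "V \<in> borel_measurable lborel" "AE x in lborel. (if x \<in> S then u x else 0) = V x"
    using completion_ex_borel_measurable_real[OF borel_measurable_if_I[OF u SL]] by auto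
  have "AE x in lebesgue_on S. u x = indicator S x * V x"
    unfolding AE_lebesgue_on_iff[OF SL] using AE_completion[OF V(2)] by eventually_elim (auto split: if_splits)
  moreover have "(\<lambda>x. indicator S x * V x) \<in> borel_measurable borel" using V(1) S by auto
  ultimately show thesis by (intro that[of "\<lambda>x. indicator S x * V x"]) auto
qed

lemma
  fixes q :: "'a::euclidean_space \<Rightarrow> 'b::euclidean_space"
  assumes q: "q \<in> borel_measurable borel" and S: "S \<in> sets borel" and 0: "\<And>x. x \<notin> S \<Longrightarrow> q x = 0"
  shows integral_lebesgue_on_lborel: "integral\<^sup>L (lebesgue_on S) q = integral\<^sup>L lborel q"
    and integrable_lebesgue_on_lborel: "integrable (lebesgue_on S) q \<longleftrightarrow> integrable lborel q"
proof -
  have SL: "S \<inter> space lebesgue \<in> sets lebesgue" using S by auto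
  have eq: "(\<lambda>x. indicator S x *\<^sub>R q x) = q" using 0 by (auto simp: fun_eq_iff indicator_def)
  show "integral\<^sup>L (lebesgue_on S) q = integral\<^sup>L lborel q"
    unfolding integral_restrict_space[OF SL] eq by (rule integral_completion) (use q in simp)
  show "integrable (lebesgue_on S) q \<longleftrightarrow> integrable lborel q"
    unfolding integrable_restrict_space[OF SL] eq by (rule integrable_completion) (use q in simp)
qed

lemma borel_measurable_lebesgue_onI:
  "q \<in> borel_measurable borel \<Longrightarrow> q \<in> borel_measurable (lebesgue_on S)"
  by (intro measurable_restrict_space1 measurable_completion) simp

lemma continuous_borel_measurable_lebesgue_on:
  "continuous_on UNIV f \<Longrightarrow> f \<in> borel_measurable (lebesgue_on S)"
  by (intro borel_measurable_lebesgue_onI borel_measurable_continuous_onI)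

lemma
  fixes q :: "'a::euclidean_space \<Rightarrow> 'b::euclidean_space"
  assumes q: "q \<in> borel_measurable borel" and S: "S \<in> sets borel" and 0: "\<And>x. x \<notin> S \<Longrightarrow> q x = 0"
  shows sqint_lebesgue_on_lborel: "sqint (lebesgue_on S) q \<longleftrightarrow> sqint lborel q"
    and sqn_lebesgue_on_lborel: "sqn (lebesgue_on S) q = sqn lborel q"
  using integral_lebesgue_on_lborel[of "\<lambda>x. (norm (q x))\<^sup>2" S]
    integrable_lebesgue_on_lborel[of "\<lambda>x. (norm (q x))\<^sup>2" S] borel_measurable_lebesgue_onI[OF q, of S] q S 0
  by (auto simp: sqint_def sqn_def)

section \<open>Invariance of Lebesgue measure under translation and reflection\<close>

lemma lborel_distr_minus:
  fixes y :: "'a::euclidean_space"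
  shows "distr lborel borel (\<lambda>x. x - y) = lborel"
  using lborel_distr_plus[of "- y"] by (simp add: fun_eq_iff cong: distr_cong)

lemma lborel_distr_reflect:
  fixes x :: "'a::euclidean_space"
  shows "distr lborel borel (\<lambda>z. x - z) = lborel"
  by (subst (2) lborel_affine[of "-1" x]) (auto simp: density_1)

lemma nn_integral_lborel_minus:
  fixes f :: "'a::euclidean_space \<Rightarrow> ennreal"
  shows "f \<in> borel_measurable borel \<Longrightarrow> (\<integral>\<^sup>+x. f (x - y) \<partial>lborel) = (\<integral>\<^sup>+x. f x \<partial>lborel)"
  by (subst (2) lborel_distr_minus[of y, symmetric], subst nn_integral_distr) auto

lemma
  fixes f :: "'a::euclidean_space \<Rightarrow> 'b::euclidean_space"
  assumes "f \<in> borel_measurable borel"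
  shows integral_lborel_minus: "(LINT x|lborel. f (x - y)) = (LINT x|lborel. f x)"
    and integrable_lborel_minus: "integrable lborel (\<lambda>x. f (x - y)) \<longleftrightarrow> integrable lborel f"
  using assms integral_distr[of "\<lambda>x. x - y" lborel borel f] integrable_distr_eq[of "\<lambda>x. x - y" lborel borel f]
  by (auto simp: lborel_distr_minus)

lemma
  fixes f :: "'a::euclidean_space \<Rightarrow> 'b::euclidean_space"
  assumes "f \<in> borel_measurable borel"
  shows integral_lborel_reflect: "(LINT z|lborel. f (x - z)) = (LINT z|lborel. f z)"
    and integrable_lborel_reflect: "integrable lborel (\<lambda>z. f (x - z)) \<longleftrightarrow> integrable lborel f"
  using assms integral_distr[of "\<lambda>z. x - z" lborel borel f] integrable_distr_eq[of "\<lambda>z. x - z" lborel borel f]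
  by (auto simp: lborel_distr_reflect)

lemma
  fixes f :: "'a::euclidean_space \<Rightarrow> 'b::euclidean_space"
  assumes "f \<in> borel_measurable borel"
  shows sqint_lborel_minus: "sqint lborel (\<lambda>x. f (x - y)) \<longleftrightarrow> sqint lborel f"
    and sqn_lborel_minus: "sqn lborel (\<lambda>x. f (x - y)) = sqn lborel f"
  using assms integral_lborel_minus[of "\<lambda>x. (norm (f x))\<^sup>2" y] integrable_lborel_minus[of "\<lambda>x. (norm (f x))\<^sup>2" y]
  by (auto simp: sqint_def sqn_def)

section \<open>Continuous functions of compact support\<close>

lemma continuous_compact_support:
  fixes h :: "'a::euclidean_space \<Rightarrow> real"
  assumes h: "continuous_on UNIV h" and 0: "\<And>x. norm x > r \<Longrightarrow> h x = 0"
  obtains B where "\<And>x. \<bar>h x\<bar> \<le> B" "B \<ge> 0"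
proof -
  have "bounded (h ` cball 0 r)"
    by (intro compact_imp_bounded compact_continuous_image continuous_on_subset[OF h]) auto
  then obtain B where "\<forall>y\<in>h ` cball 0 r. norm y \<le> B" unfolding bounded_iff by blast
  then have B: "\<And>x. x \<in> cball 0 r \<Longrightarrow> \<bar>h x\<bar> \<le> B" by simp
  show thesis
  proof (rule that[of "max B 0"])
    show "\<bar>h x\<bar> \<le> max B 0" for x using B[of x] 0[of x] by (cases "norm x \<le> r") auto
  qed auto
qed

lemma integrable_continuous_compact_support:
  fixes h :: "'a::euclidean_space \<Rightarrow> real"
  assumes h: "continuous_on UNIV h" and 0: "\<And>x. norm x > r \<Longrightarrow> h x = 0"
  shows "integrable lborel h"
proof -
  have "integrable lborel (\<lambda>x. indicator (cball 0 r) x *\<^sub>R h x)"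
    by (intro borel_integrable_compact continuous_on_subset[OF h]) auto
  moreover have "(\<lambda>x. indicator (cball 0 r) x *\<^sub>R h x) = h"
    using 0 by (force simp: fun_eq_iff indicator_def)
  ultimately show ?thesis by simp
qed

lemma sqint_continuous_compact_support:
  fixes h :: "'a::euclidean_space \<Rightarrow> real"
  assumes h: "continuous_on UNIV h" and 0: "\<And>x. norm x > r \<Longrightarrow> h x = 0"
  shows "sqint lborel h"
  using integrable_continuous_compact_support[of "\<lambda>x. (h x)\<^sup>2" r] assms
  by (auto simp: sqint_def intro!: continuous_intros borel_measurable_continuous_onI)

text \<open>Translation invariance makes the integral of every difference quotient vanish, and
  dominated convergence passes to the derivative. This is the only source of integration by parts in
  the development.\<close>

lemma integral_directional_derivative_eq_0:
  fixes h d :: "'a::euclidean_space \<Rightarrow> real"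
  assumes h: "continuous_on UNIV h" and d: "continuous_on UNIV d"
    and der: "\<And>x t. ((\<lambda>s. h (x + s *\<^sub>R e)) has_real_derivative d (x + t *\<^sub>R e)) (at t)"
    and 0: "\<And>x. norm x > r \<Longrightarrow> h x = 0" and e: "norm e = 1"
  shows "(LINT x|lborel. d x) = 0"
proof -
  \<comment> \<open>Outside the ball \<open>h\<close> is zero on a neighbourhood, so the derivative
    vanishes there too and is bounded as a continuous function of compact support.\<close>
  have d0: "d x = 0" if "norm x > r" for x
  proof -
    have "open {s. norm (x + s *\<^sub>R e) > r}"
      by (intro open_Collect_less continuous_intros)
    then have "\<forall>\<^sub>F s in nhds 0. norm (x + s *\<^sub>R e) > r"
      using that eventually_nhds_in_open[of "{s. norm (x + s *\<^sub>R e) > r}" 0] by simp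
    then have "\<forall>\<^sub>F s in nhds 0. h (x + s *\<^sub>R e) = 0" by eventually_elim (rule 0)
    then have "((\<lambda>s. h (x + s *\<^sub>R e)) has_real_derivative 0) (at 0)"
      by (subst DERIV_cong_ev[OF refl _ refl, of _ "\<lambda>_. 0"]) auto
    then show ?thesis using der[of x 0] DERIV_unique by fastforce
  qed
  obtain B where B: "\<And>x. \<bar>d x\<bar> \<le> B" "B \<ge> 0" using continuous_compact_support[OF d d0] by blast
  define q where "q m x = (h (x + inverse (real (Suc m)) *\<^sub>R e) - h x) / inverse (real (Suc m))" for m x
  have hi: "integrable lborel h" by (rule integrable_continuous_compact_support[OF h 0])
  have hb [measurable]: "h \<in> borel_measurable borel" by (rule borel_measurable_continuous_onI[OF h])
  have "(LINT x|lborel. q m x) = 0" for m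
    using integral_lborel_minus[of h "- (inverse (real (Suc m)) *\<^sub>R e)"]
      integrable_lborel_minus[of h "- (inverse (real (Suc m)) *\<^sub>R e)"] hi
    by (simp add: q_def)
  moreover have "(\<lambda>m. LINT x|lborel. q m x) \<longlonglongrightarrow> (LINT x|lborel. d x)"
  \<comment> \<open>The steps are at most 1, so all difference quotients live in the ball of radius
    \<open>r + 1\<close>; there the mean value inequality bounds them by \<open>B\<close>.\<close>
  proof (rule integral_dominated_convergence[where w = "\<lambda>x. B * indicator (cball 0 (r + 1)) x"])
    show "d \<in> borel_measurable lborel" using d by (simp add: borel_measurable_continuous_onI)
    show "q m \<in> borel_measurable lborel" for m unfolding q_def by measurable
    show "integrable lborel (\<lambda>x. B * indicator (cball 0 (r + 1)) x)"
      by (intro integrable_mult_right integrable_real_indicator) (use emeasure_lborel_cball_finite in auto)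
    show "AE x in lborel. (\<lambda>m. q m x) \<longlonglongrightarrow> d x"
    proof (intro AE_I2)
      fix x
      have "((\<lambda>s. (h (x + s *\<^sub>R e) - h x) / s) \<longlongrightarrow> d x) (at 0)"
        using der[of x 0] by (simp add: DERIV_def)
      moreover have "filterlim (\<lambda>m. inverse (real (Suc m))) (at 0) sequentially"
        using LIMSEQ_inverse_real_of_nat by (intro filterlim_atI) auto
      ultimately show "(\<lambda>m. q m x) \<longlonglongrightarrow> d x"
        unfolding q_def by (rule filterlim_compose)
    qed
    show "AE x in lborel. norm (q m x) \<le> B * indicator (cball 0 (r + 1)) x" for m
    proof (intro AE_I2)
      fix x
      obtain \<sigma> where s: "0 < \<sigma>" "\<sigma> \<le> 1" and q: "q m x = (h (x + \<sigma> *\<^sub>R e) - h x) / \<sigma>"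
        by (rule that[of "inverse (real (Suc m))"]) (auto simp: divide_simps q_def)
      show "norm (q m x) \<le> B * indicator (cball 0 (r + 1)) x"
      proof (cases "norm x \<le> r + 1")
        case True
        have "norm (h (x + \<sigma> *\<^sub>R e) - h (x + 0 *\<^sub>R e)) \<le> B * norm (\<sigma> - 0)"
          by (rule field_differentiable_bound[where S = UNIV and f' = "\<lambda>t. d (x + t *\<^sub>R e)"])
            (use der B in \<open>auto\<close>)
        then have "norm (q m x) \<le> B" using s by (simp add: q divide_le_eq)
        then show ?thesis using True by simp
      next
        case False
        have "norm x \<le> norm (x + \<sigma> *\<^sub>R e) + norm (\<sigma> *\<^sub>R e)" using norm_triangle_ineq4[of "x + \<sigma> *\<^sub>R e" "\<sigma> *\<^sub>R e"] by simp
        then have "norm (x + \<sigma> *\<^sub>R e) > r" using False e s by simp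
        then show ?thesis using False 0[of x] 0[of "x + \<sigma> *\<^sub>R e"] by (simp add: q)
      qed
    qed
  qed
  ultimately show ?thesis by (simp add: LIMSEQ_const_iff)
qed

section \<open>Truncation and continuity of translations in L2\<close>

definition trunc :: "real \<Rightarrow> real \<Rightarrow> real" where
  "trunc k s = max (- k) (min k s)"

lemma trunc_bounds: "k \<ge> 0 \<Longrightarrow> \<bar>trunc k s\<bar> \<le> k" "k \<ge> 0 \<Longrightarrow> \<bar>trunc k s\<bar> \<le> \<bar>s\<bar>"
    "k \<ge> 0 \<Longrightarrow> trunc k 0 = 0" "\<bar>s\<bar> \<le> k \<Longrightarrow> trunc k s = s" "\<bar>trunc k s - trunc k t\<bar> \<le> \<bar>s - t\<bar>"
  by (auto simp: trunc_def)

lemma trunc_measurable [measurable]: "trunc k \<in> borel_measurable borel"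
  unfolding trunc_def by measurable

lemma continuous_on_trunc [continuous_intros]: "continuous_on S f \<Longrightarrow> continuous_on S (\<lambda>x. trunc k (f x))"
  unfolding trunc_def by (intro continuous_intros)

lemma trunc_tendsto: "(\<lambda>m. trunc (real m) s) \<longlonglongrightarrow> s"
proof (rule tendsto_eventually)
  obtain N where "\<bar>s\<bar> \<le> real N" using real_arch_simple by blast
  then show "\<forall>\<^sub>F m in sequentially. trunc (real m) s = s"
    by (intro eventually_sequentiallyI[of N] trunc_bounds) simp
qed

text \<open>Almost everywhere approximation by continuous functions becomes L2 approximation once a
  dominating function exists. Truncating at height \<open>m\<close> and multiplying by a cut-off
  provides one: a multiple of the indicator of a ball.\<close>

lemma L2_continuous_approx:
  fixes U :: "'a::euclidean_space \<Rightarrow> real"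
  assumes U: "sqint lborel U" and 0: "\<And>x. norm x > r \<Longrightarrow> U x = 0" and "\<epsilon> > 0"
  obtains h where "continuous_on UNIV h" "\<And>x. norm x > r + 1 \<Longrightarrow> h x = 0" "sqn lborel (\<lambda>x. U x - h x) < \<epsilon>"
proof -
  have [measurable]: "U \<in> borel_measurable borel" using U by (simp add: sqint_def)
  have "(\<lambda>m. sqn lborel (\<lambda>x. U x - trunc (real m) (U x))) \<longlonglongrightarrow> 0"
  proof (rule sqn_dominated[OF U, where K = 2])
    show "AE x in lborel. norm (U x - trunc (real k) (U x)) \<le> 2 * norm (U x)" for k
      by (auto simp: trunc_def)
    show "AE x in lborel. (\<lambda>m. U x - trunc (real m) (U x)) \<longlonglongrightarrow> 0"
    proof (intro AE_I2)
      fix x show "(\<lambda>m. U x - trunc (real m) (U x)) \<longlonglongrightarrow> 0"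
        using tendsto_diff[OF tendsto_const[of "U x"] trunc_tendsto[of "U x"]] by simp
    qed
  qed auto
  \<comment> \<open>Two errors of size \<open>\<epsilon>/4\<close>, each doubled by the squared
    triangle inequality, add up to \<open>\<epsilon>\<close>.\<close>
  from order_tendstoD(2)[OF this, of "\<epsilon>/4"] obtain m where m: "sqn lborel (\<lambda>x. U x - trunc (real m) (U x)) < \<epsilon>/4"
    using \<open>\<epsilon> > 0\<close> by (auto simp: eventually_sequentially)
  let ?T = "\<lambda>x. trunc (real m) (U x)"
  have T: "sqint lborel ?T" by (rule sqint_bound(1)[OF U, where K = 1]) (auto simp: trunc_def)
  have "U measurable_on UNIV"
    by (intro lebesgue_measurable_imp_measurable_on measurable_completion) auto
  then obtain N g where g: "negligible N" "\<And>n. continuous_on UNIV (g n)" "\<And>x. x \<notin> N \<Longrightarrow> (\<lambda>n. g n x) \<longlonglongrightarrow> U x"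
    by (auto simp: measurable_on_def)
  \<comment> \<open>Equal to 1 on the ball of radius \<open>r\<close>, outside which
    \<open>U\<close> vanishes anyway, and equal to 0 beyond \<open>r + 1\<close>.\<close>
  define cof where "cof x = max 0 (min 1 (r + 1 - norm x))" for x :: 'a
  define h where "h n x = cof x * trunc (real m) (g n x)" for n x
  have cof_cont: "continuous_on UNIV cof" unfolding cof_def by (intro continuous_intros)
  have h: "continuous_on UNIV (h n)" for n unfolding h_def by (intro continuous_intros cof_cont g)
  have h0: "h n x = 0" if "norm x > r + 1" for n x using that by (simp add: h_def cof_def)
  have [measurable]: "h n \<in> borel_measurable borel" for n by (rule borel_measurable_continuous_onI[OF h])
  have "(\<lambda>n. sqn lborel (\<lambda>x. ?T x - h n x)) \<longlonglongrightarrow> 0"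
  proof (rule sqn_dominated[where K = "2 * real m" and q = "\<lambda>x. indicator (cball 0 (r+1)) x :: real"])
    have "integrable lborel (indicator (cball 0 (r + 1)) :: 'a \<Rightarrow> real)"
      by (intro integrable_real_indicator) (use emeasure_lborel_cball_finite in auto)
    moreover have "(\<lambda>x. (norm (indicator (cball 0 (r + 1)) x :: real))\<^sup>2) = (indicator (cball 0 (r + 1)) :: 'a \<Rightarrow> real)"
      by (auto simp: fun_eq_iff indicator_def)
    ultimately show "sqint lborel (\<lambda>x::'a. indicator (cball 0 (r+1)) x :: real)"
      unfolding sqint_def by simp
    show "AE x in lborel. norm (?T x - h n x) \<le> 2 * real m * norm (indicator (cball 0 (r + 1)) x :: real)" for n
    proof (intro AE_I2)
      fix x
      show "norm (?T x - h n x) \<le> 2 * real m * norm (indicator (cball 0 (r + 1)) x :: real)"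
      proof (cases "norm x \<le> r + 1")
        case True
        have "\<bar>h n x\<bar> \<le> 1 * real m" unfolding h_def abs_mult
          by (intro mult_mono trunc_bounds) (auto simp: cof_def)
        then show ?thesis using True trunc_bounds(1)[of "real m" "U x"] by auto
      next
        case False
        then show ?thesis using 0[of x] h0[of x n] by (simp add: trunc_bounds)
      qed
    qed
    have "N \<in> null_sets lebesgue" using g(1) by (simp add: negligible_iff_null_sets)
    then have "AE x in lebesgue. x \<notin> N" by (rule AE_not_in)
    then have "AE x in lborel. x \<notin> N" by (simp add: AE_completion_iff)
    then show "AE x in lborel. (\<lambda>n. ?T x - h n x) \<longlonglongrightarrow> 0"
    proof eventually_elim
      case (elim x)
      have "(\<lambda>n. trunc (real m) (g n x)) \<longlonglongrightarrow> ?T x"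
        unfolding trunc_def by (intro tendsto_intros g(3) elim)
      then have "(\<lambda>n. ?T x - h n x) \<longlonglongrightarrow> ?T x - cof x * ?T x"
        unfolding h_def by (intro tendsto_intros)
      moreover have "?T x - cof x * ?T x = 0"
        using 0[of x] by (cases "norm x \<le> r") (auto simp: cof_def trunc_bounds)
      ultimately show ?case by simp
    qed
  qed measurable
  from order_tendstoD(2)[OF this, of "\<epsilon>/4"] obtain n where n: "sqn lborel (\<lambda>x. ?T x - h n x) < \<epsilon>/4"
    using \<open>\<epsilon> > 0\<close> by (auto simp: eventually_sequentially)
  have "sqn lborel (\<lambda>x. (U x - ?T x) + (?T x - h n x)) \<le> 2 * sqn lborel (\<lambda>x. U x - ?T x) + 2 * sqn lborel (\<lambda>x. ?T x - h n x)"
    by (intro sqint_add sqint_diff U T sqint_continuous_compact_support[OF h h0])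
  then have "sqn lborel (\<lambda>x. U x - h n x) < \<epsilon>" using m n by simp
  with h h0 that show thesis by blast
qed

lemma L2_translation_continuous:
  fixes U :: "'a::euclidean_space \<Rightarrow> real"
  assumes U: "sqint lborel U" and 0: "\<And>x. norm x > r \<Longrightarrow> U x = 0" and "\<epsilon> > 0"
  obtains \<delta> where "\<delta> > 0" "\<And>y. norm y \<le> \<delta> \<Longrightarrow> sqn lborel (\<lambda>x. U (x - y) - U x) \<le> \<epsilon>"
proof -
  \<comment> \<open>Three differences are added in two steps, with total weight 2 + 4 + 4 = 10, so
    twelfths leave some room.\<close>
  obtain h where h: "continuous_on UNIV h" "\<And>x. norm x > r + 1 \<Longrightarrow> h x = 0" "sqn lborel (\<lambda>x. U x - h x) < \<epsilon>/12"
    by (rule L2_continuous_approx[of U r "\<epsilon>/12"]) (use U 0 \<open>\<epsilon> > 0\<close> in auto)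
  have [measurable]: "U \<in> borel_measurable borel" "h \<in> borel_measurable borel"
    using U h(1) by (auto simp: sqint_def intro: borel_measurable_continuous_onI)
  have hs: "sqint lborel h" by (rule sqint_continuous_compact_support[OF h(1,2)])
  define V where "V = measure lborel (cball (0::'a) (r + 2))"
  define \<eta> where "\<eta> = sqrt (\<epsilon> / (12 * (V + 1)))"
  have V: "V \<ge> 0" by (simp add: V_def)
  have \<eta>: "\<eta> > 0" "\<eta>\<^sup>2 * V \<le> \<epsilon>/12"
    using \<open>\<epsilon> > 0\<close> V by (auto simp: \<eta>_def divide_simps mult_left_mono)
  \<comment> \<open>For |x| \<le> r + 2 and |y| \<le> 1 both x and x - y lie in this ball; for
    larger x both values of \<open>h\<close> are 0.\<close>
  have "uniformly_continuous_on (cball 0 (r + 3)) h"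
    by (intro compact_uniformly_continuous continuous_on_subset[OF h(1)]) auto
  then obtain \<delta> where \<delta>: "\<delta> > 0" "\<And>x y. x \<in> cball 0 (r+3) \<Longrightarrow> y \<in> cball 0 (r+3) \<Longrightarrow> dist y x < \<delta> \<Longrightarrow> dist (h y) (h x) < \<eta>"
    unfolding uniformly_continuous_on_def using \<eta>(1) by metis
  show thesis
  proof (rule that[of "min (\<delta>/2) 1"])
    show "min (\<delta>/2) 1 > 0" using \<delta> by simp
    fix y :: 'a assume y: "norm y \<le> min (\<delta>/2) 1"
    have hy: "sqint lborel (\<lambda>x. h (x - y))" "sqint lborel (\<lambda>x. U (x - y))"
      using hs U by (simp_all add: sqint_lborel_minus)
    have "sqn lborel (\<lambda>x. h (x - y) - h x) \<le> (LINT x|lborel. \<eta>\<^sup>2 * indicator (cball (0::'a) (r + 2)) x)"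
      unfolding sqn_def
    proof (rule integral_mono)
      show "integrable lborel (\<lambda>x. (norm (h (x - y) - h x))\<^sup>2)"
        using sqint_diff(1)[OF hy(1) hs] by (simp add: sqint_def)
      show "integrable lborel (\<lambda>x. \<eta>\<^sup>2 * indicator (cball (0::'a) (r + 2)) x)"
        by (intro integrable_mult_right integrable_real_indicator) (use emeasure_lborel_cball_finite in auto)
      fix x :: 'a
      have ny: "norm (x - y) \<ge> norm x - 1" "norm (x - y) \<le> norm x + 1"
        using norm_triangle_ineq2[of x y] norm_triangle_ineq4[of x y] y by auto
      show "(norm (h (x - y) - h x))\<^sup>2 \<le> \<eta>\<^sup>2 * indicator (cball 0 (r + 2)) x"
      proof (cases "norm x \<le> r + 2")
        case True
        have "dist (h (x - y)) (h x) < \<eta>" using True ny y \<delta>(1) by (intro \<delta>(2)) (auto simp: dist_norm norm_minus_commute)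
        then have "(norm (h (x - y) - h x))\<^sup>2 \<le> \<eta>\<^sup>2"
          by (intro power_mono) (auto simp: dist_norm)
        then show ?thesis using True by simp
      next
        case False then show ?thesis using h(2)[of x] h(2)[of "x - y"] ny by auto
      qed
    qed
    also have "\<dots> = \<eta>\<^sup>2 * V" by (simp add: V_def)
    finally have hd: "sqn lborel (\<lambda>x. h (x - y) - h x) \<le> \<epsilon>/12" using \<eta>(2) by linarith
    have "sqn lborel (\<lambda>x. U (x - y) - h (x - y)) = sqn lborel (\<lambda>x. U x - h x)"
      using sqn_lborel_minus[of "\<lambda>x. U x - h x" y] by simp
    moreover have "sqn lborel (\<lambda>x. (U (x - y) - h (x - y)) + ((h (x - y) - h x) - (U x - h x)))
        \<le> 2 * sqn lborel (\<lambda>x. U (x - y) - h (x - y)) + 2 * sqn lborel (\<lambda>x. (h (x - y) - h x) - (U x - h x))"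
      by (intro sqint_add sqint_diff hy hs U)
    moreover have "sqn lborel (\<lambda>x. (h (x - y) - h x) - (U x - h x)) \<le> 2 * sqn lborel (\<lambda>x. h (x - y) - h x) + 2 * sqn lborel (\<lambda>x. U x - h x)"
      by (intro sqint_diff hy hs U)
    moreover have "(\<lambda>x. (U (x - y) - h (x - y)) + ((h (x - y) - h x) - (U x - h x))) = (\<lambda>x. U (x - y) - U x)"
      by auto
    ultimately show "sqn lborel (\<lambda>x. U (x - y) - U x) \<le> \<epsilon>"
      using h(3) hd \<open>\<epsilon> > 0\<close> by (simp only:)
  qed
qed

text \<open>The kernel is a probability density, so the square of an average is at most the average
  of squares; exchanging the integrals reduces the claim to single shifts in the support of
  \<open>k\<close>. The set \<open>B\<close> is there because shifts will be controlled only at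
  points that they keep inside the domain.\<close>

lemma convolution_L2_estimate:
  fixes U k :: "'a::euclidean_space \<Rightarrow> real"
  assumes k: "continuous_on UNIV k" "\<And>x. k x \<ge> 0" "\<And>x. norm x > r \<Longrightarrow> k x = 0" "(LINT y|lborel. k y) = 1"
    and U: "integrable lborel U" and B: "B \<in> sets borel"
    and est: "\<And>y. k y \<noteq> 0 \<Longrightarrow> (\<integral>\<^sup>+x. indicator B x * ennreal ((U (x - y) - U x)\<^sup>2) \<partial>lborel) \<le> ennreal \<epsilon>"
  shows "(\<integral>\<^sup>+x. indicator B x * ennreal (((LINT z|lborel. k (x - z) * U z) - U x)\<^sup>2) \<partial>lborel) \<le> ennreal \<epsilon>"
proof -
  have [measurable]: "U \<in> borel_measurable borel" "k \<in> borel_measurable borel" "B \<in> sets borel"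
    using U k(1) B by (auto intro: borel_measurable_continuous_onI)
  obtain K where K: "\<And>x. \<bar>k x\<bar> \<le> K" using continuous_compact_support[OF k(1,3)] by blast
  have ki: "integrable lborel k" by (rule integrable_continuous_compact_support[OF k(1,3)])
  have pt: "ennreal (((LINT z|lborel. k (x - z) * U z) - U x)\<^sup>2) \<le> (\<integral>\<^sup>+y. ennreal (k y) * ennreal ((U (x - y) - U x)\<^sup>2) \<partial>lborel)" for x
  \<comment> \<open>If the right-hand side is infinite there is nothing to show; if it is finite, it
    supplies the integrability for Cauchy-Schwarz.\<close>
  proof (cases "(\<integral>\<^sup>+y. ennreal (k y) * ennreal ((U (x - y) - U x)\<^sup>2) \<partial>lborel) = \<infinity>")
    case False
    have Ui: "integrable lborel (\<lambda>y. U (x - y))" using U by (simp add: integrable_lborel_reflect)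
    have kU: "integrable lborel (\<lambda>y. k y * U (x - y))"
    proof (rule Bochner_Integration.integrable_bound)
      show "integrable lborel (\<lambda>y. K * U (x - y))" using Ui by simp
      show "AE y in lborel. norm (k y * U (x - y)) \<le> norm (K * U (x - y))"
        using K by (auto simp: abs_mult intro!: mult_right_mono intro: order_trans[OF K abs_ge_self])
    qed measurable
    have "(LINT z|lborel. k (x - z) * U z) = (LINT y|lborel. k y * U (x - y))"
      using integral_lborel_reflect[of "\<lambda>y. k y * U (x - y)" x] by simp
    \<comment> \<open>Splitting \<open>k\<close> as the square of \<open>sqrt k\<close> turns
      Cauchy-Schwarz into Jensen's inequality for the measure with density \<open>k\<close>.\<close>
    then have e1: "(LINT z|lborel. k (x - z) * U z) - U x = (LINT y|lborel. sqrt (k y) \<bullet> (sqrt (k y) * (U (x - y) - U x)))"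
      using kU ki k(2,4) by (simp add: right_diff_distrib flip: mult.assoc)
    have qi: "integrable lborel (\<lambda>y. k y * (U (x - y) - U x)\<^sup>2)"
    proof (intro integrableI_bounded)
      show "(\<integral>\<^sup>+y. ennreal (norm (k y * (U (x - y) - U x)\<^sup>2)) \<partial>lborel) < \<infinity>"
        using False k(2) by (simp add: ennreal_mult less_top)
    qed measurable
    have s1: "sqint lborel (\<lambda>y. sqrt (k y))" using ki k(2) by (auto simp: sqint_def)
    have s2: "sqint lborel (\<lambda>y. sqrt (k y) * (U (x - y) - U x))"
      using qi k(2) by (auto simp: sqint_def power_mult_distrib abs_mult)
    have "\<bar>(LINT z|lborel. k (x - z) * U z) - U x\<bar> \<le> sqrt (1 * (LINT y|lborel. k y * (U (x - y) - U x)\<^sup>2))"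
      unfolding e1 using sqint_Cauchy_Schwarz[OF s1 s2] k(2,4) by (simp add: sqn_def power_mult_distrib abs_mult)
    then have "((LINT z|lborel. k (x - z) * U z) - U x)\<^sup>2 \<le> (LINT y|lborel. k y * (U (x - y) - U x)\<^sup>2)"
      using k(2) by (metis (no_types, lifting) mult_1 real_sqrt_le_iff real_sqrt_abs)
    then have "ennreal (((LINT z|lborel. k (x - z) * U z) - U x)\<^sup>2) \<le> ennreal (LINT y|lborel. k y * (U (x - y) - U x)\<^sup>2)"
      by (rule ennreal_leI)
    also have "\<dots> = (\<integral>\<^sup>+y. ennreal (k y * (U (x - y) - U x)\<^sup>2) \<partial>lborel)"
      using qi k(2) by (intro nn_integral_eq_integral[symmetric]) auto
    finally show ?thesis using k(2) by (simp add: ennreal_mult)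
  qed simp
  have "(\<integral>\<^sup>+x. indicator B x * ennreal (((LINT z|lborel. k (x - z) * U z) - U x)\<^sup>2) \<partial>lborel)
      \<le> (\<integral>\<^sup>+x. (\<integral>\<^sup>+y. indicator B x * (ennreal (k y) * ennreal ((U (x - y) - U x)\<^sup>2)) \<partial>lborel) \<partial>lborel)"
    using pt by (intro nn_integral_mono) (auto simp: nn_integral_cmult intro!: mult_left_mono)
  also have "\<dots> = (\<integral>\<^sup>+y. (\<integral>\<^sup>+x. indicator B x * (ennreal (k y) * ennreal ((U (x - y) - U x)\<^sup>2)) \<partial>lborel) \<partial>lborel)"
    by (rule lborel_pair.Fubini') measurable
  also have "\<dots> = (\<integral>\<^sup>+y. ennreal (k y) * (\<integral>\<^sup>+x. indicator B x * ennreal ((U (x - y) - U x)\<^sup>2) \<partial>lborel) \<partial>lborel)"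
    by (subst nn_integral_cmult[symmetric]) (auto intro!: nn_integral_cong simp: ac_simps)
  also have "\<dots> \<le> (\<integral>\<^sup>+y. ennreal (k y) * ennreal \<epsilon> \<partial>lborel)"
  proof (rule nn_integral_mono)
    fix y
    show "ennreal (k y) * (\<integral>\<^sup>+x. indicator B x * ennreal ((U (x - y) - U x)\<^sup>2) \<partial>lborel) \<le> ennreal (k y) * ennreal \<epsilon>"
      by (cases "k y = 0") (auto intro!: mult_left_mono est)
  qed
  also have "\<dots> = ennreal \<epsilon>"
    using nn_integral_eq_integral[OF ki] k(2,4) by (simp add: nn_integral_multc)
  finally show ?thesis .
qed

section \<open>The cone property and partitions of unity\<close>

text \<open>Below a Lipschitz graph, moving down in direction \<open>e\<close> stays below, and so
  does every direction close enough to \<open>-e\<close>. Such displacements \<open>-y\<close> fill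
  a whole ball of vectors \<open>y\<close> of arbitrarily small size, which leaves room for the
  support of a kernel. At interior points all small displacements qualify.\<close>

lemma lipschitz_domain_cone:
  fixes \<Omega> :: "(real^'n) set"
  assumes dom: "lipschitz_domain \<Omega>" and p: "p \<in> closure \<Omega>"
  obtains \<rho> where "\<rho> > 0" "\<And>\<delta>. \<delta> > 0 \<Longrightarrow> \<exists>y0 s. s > 0 \<and> (\<forall>y\<in>cball y0 s. norm y \<le> \<delta> \<and>
    (\<forall>x\<in>\<Omega> \<inter> ball p \<rho>. \<forall>t\<in>{0..1}. x - t *\<^sub>R y \<in> \<Omega>))"
proof (cases "p \<in> \<Omega>")
  case True
  have "open \<Omega>" using dom by (simp add: lipschitz_domain_def)
  then obtain r where r: "r > 0" "ball p r \<subseteq> \<Omega>" using True open_contains_ball by blast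
  show thesis
  proof (rule that[of "r/2"])
    fix \<delta> :: real assume "\<delta> > 0"
    show "\<exists>y0 s. s > 0 \<and> (\<forall>y\<in>cball y0 s. norm y \<le> \<delta> \<and>
      (\<forall>x\<in>\<Omega> \<inter> ball p (r/2). \<forall>t\<in>{0..1}. x - t *\<^sub>R y \<in> \<Omega>))"
    proof (rule exI[of _ 0], rule exI[of _ "min \<delta> (r/2)"], intro conjI ballI)
      fix y x :: "real^'n" and t :: real
      assume y: "y \<in> cball 0 (min \<delta> (r/2))" and x: "x \<in> \<Omega> \<inter> ball p (r/2)" and t: "t \<in> {0..1}"
      have "norm (t *\<^sub>R y) \<le> 1 * norm y" unfolding norm_scaleR using t by (intro mult_right_mono) auto
      then have "norm ((x - p) - t *\<^sub>R y) \<le> norm (x - p) + r/2"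
        using norm_triangle_ineq4[of "x - p" "t *\<^sub>R y"] y by auto
      moreover have "norm (x - p) < r/2" using x by (simp add: dist_norm norm_minus_commute)
      ultimately have "norm (x - t *\<^sub>R y - p) < r" by (simp add: algebra_simps)
      then show "x - t *\<^sub>R y \<in> \<Omega>" using r(2) by (auto simp: dist_norm norm_minus_commute)
    qed (use r \<open>\<delta> > 0\<close> in auto)
  qed (use r in auto)
next
  case False
  have "open \<Omega>" using dom by (simp add: lipschitz_domain_def)
  then have "p \<in> frontier \<Omega>" using p False by (simp add: frontier_def interior_open)
  then obtain r e \<gamma> L where r: "r > 0" and e: "norm e = 1" and lip: "L-lipschitz_on {y. y \<bullet> e = 0} \<gamma>"
    and eq: "\<Omega> \<inter> ball p r = {x \<in> ball p r. (x - p) \<bullet> e < \<gamma> ((x - p) - ((x - p) \<bullet> e) *\<^sub>R e)}"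
    using dom unfolding lipschitz_domain_def by blast
  have L: "L \<ge> 0" using lip by (rule lipschitz_on_nonneg)
  have ee: "e \<bullet> e = 1" using e by (simp add: norm_eq_1)
  \<comment> \<open>The opening of the cone: a perturbation of size \<tau> c of the shift \<tau> e
    may cost \<tau> c in height, and L \<tau> c through the variation of the graph. The choice makes
    the total exactly \<tau>; strictness survives because \<open>x\<close> is strictly below the
    graph.\<close>
  define c where "c = 1 / (1 + L)"
  have c: "0 < c" "c \<le> 1" "c + L * c = 1" using L by (auto simp: c_def field_simps)
  define Pr where "Pr z = z - (z \<bullet> e) *\<^sub>R e" for z
  have Pr0: "Pr z \<bullet> e = 0" for z by (simp add: Pr_def inner_diff_left ee)
  have Prn: "norm (Pr z) \<le> norm z" for z
  proof -
    have "(norm (Pr z))\<^sup>2 = (norm z)\<^sup>2 - (z \<bullet> e)\<^sup>2"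
      unfolding power2_norm_eq_inner Pr_def
      by (simp add: inner_diff_left inner_diff_right ee inner_commute[of e z]) (simp add: power2_eq_square)
    then have "(norm (Pr z))\<^sup>2 \<le> (norm z)\<^sup>2" using zero_le_power2[of "z \<bullet> e"] by linarith
    then show ?thesis by (rule power2_le_imp_le) (rule norm_ge_zero)
  qed
  show thesis
  proof (rule that[of "r/2"])
    fix \<delta> :: real assume "\<delta> > 0"
    \<comment> \<open>Shifts have length at most 2 \<tau> \<le> r/2, so points of the half ball stay
      in the ball where the graph description is valid.\<close>
    define \<tau> where "\<tau> = min (\<delta>/2) (r/4)"
    have \<tau>: "\<tau> > 0" "2 * \<tau> \<le> \<delta>" "2 * \<tau> \<le> r/2" using \<open>\<delta> > 0\<close> r by (auto simp: \<tau>_def)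
    have *: "norm y \<le> 2 * \<tau> \<and> (\<forall>x\<in>\<Omega> \<inter> ball p (r/2). \<forall>t\<in>{0..1}. x - t *\<^sub>R y \<in> \<Omega>)"
      if y: "y \<in> cball (\<tau> *\<^sub>R e) (\<tau> * c)" for y
    proof -
      define v where "v = y - \<tau> *\<^sub>R e"
      have v: "norm v \<le> \<tau> * c" using y by (simp add: v_def dist_norm norm_minus_commute)
      have "\<tau> * c \<le> \<tau> * 1" using \<tau> c by (intro mult_left_mono) auto
      moreover have "norm y \<le> norm v + norm (\<tau> *\<^sub>R e)" using norm_triangle_ineq[of v "\<tau> *\<^sub>R e"] by (simp add: v_def)
      moreover have "norm (\<tau> *\<^sub>R e) = \<tau>" using e \<tau> by simp
      ultimately have ny: "norm y \<le> 2 * \<tau>" using v by linarith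
      have "x - t *\<^sub>R y \<in> \<Omega>" if x: "x \<in> \<Omega> \<inter> ball p (r/2)" and t: "t \<in> {0..1}" for x t
      proof -
        have "norm (t *\<^sub>R y) \<le> 1 * norm y" unfolding norm_scaleR using t by (intro mult_right_mono) auto
        then have "norm ((x - p) - t *\<^sub>R y) \<le> norm (x - p) + r/2"
          using norm_triangle_ineq4[of "x - p" "t *\<^sub>R y"] ny \<tau> by auto
        moreover have xp: "norm (x - p) < r/2" using x by (simp add: dist_norm norm_minus_commute)
        ultimately have "norm ((x - p) - t *\<^sub>R y) < r" "norm (x - p) < r" using r by linarith+
        moreover have "(x - p) - t *\<^sub>R y = (x - t *\<^sub>R y) - p" by simp
        ultimately have "norm ((x - t *\<^sub>R y) - p) < r" "norm (x - p) < r" by simp_all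
        then have b: "x - t *\<^sub>R y \<in> ball p r" "x \<in> ball p r"
          unfolding mem_ball dist_norm norm_minus_commute[of p] .
        have "x \<in> {x \<in> ball p r. (x - p) \<bullet> e < \<gamma> ((x - p) - ((x - p) \<bullet> e) *\<^sub>R e)}"
          using x b(2) unfolding eq[symmetric] by blast
        then have xe: "(x - p) \<bullet> e < \<gamma> (Pr (x - p))" unfolding Pr_def by blast
        have "y = v + \<tau> *\<^sub>R e" by (simp add: v_def)
        then have e1: "(x - t *\<^sub>R y - p) \<bullet> e = (x - p) \<bullet> e - t * \<tau> - t * (v \<bullet> e)"
          and e2: "Pr (x - t *\<^sub>R y - p) = Pr (x - p) - t *\<^sub>R Pr v"
          by (simp_all add: Pr_def inner_diff_left inner_add_left ee algebra_simps)
        have "\<bar>v \<bullet> e\<bar> \<le> \<tau> * c" using Cauchy_Schwarz_ineq2[of v e] v e by simp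
        then have "t * (v \<bullet> e) \<ge> - (t * (\<tau> * c))"
          using t mult_left_mono[of "- (v \<bullet> e)" "\<tau> * c" t] by (simp add: abs_le_iff)
        moreover have "\<gamma> (Pr (x - p)) - \<gamma> (Pr (x - t *\<^sub>R y - p)) \<le> L * (t * (\<tau> * c))"
        proof -
          have "dist (\<gamma> (Pr (x - p))) (\<gamma> (Pr (x - t *\<^sub>R y - p))) \<le> L * dist (Pr (x - p)) (Pr (x - t *\<^sub>R y - p))"
            by (rule lipschitz_onD[OF lip]) (use Pr0 in auto)
          also have "dist (Pr (x - p)) (Pr (x - t *\<^sub>R y - p)) = t * norm (Pr v)"
            using t by (simp add: e2 dist_norm)
          also have "L * (t * norm (Pr v)) \<le> L * (t * (\<tau> * c))"
            using L t Prn[of v] v by (intro mult_left_mono) auto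
          finally show ?thesis by (simp add: dist_real_def)
        qed
        moreover have "t * \<tau> = t * (\<tau> * c) + L * (t * (\<tau> * c))"
        proof -
          have "t * (\<tau> * c) + L * (t * (\<tau> * c)) = t * \<tau> * (c + L * c)" by (simp add: algebra_simps)
          then show ?thesis using c(3) by simp
        qed
        ultimately have "(x - t *\<^sub>R y - p) \<bullet> e < \<gamma> (Pr (x - t *\<^sub>R y - p))"
          using xe e1 by linarith
        then have "x - t *\<^sub>R y \<in> {x \<in> ball p r. (x - p) \<bullet> e < \<gamma> ((x - p) - ((x - p) \<bullet> e) *\<^sub>R e)}"
          using b(1) unfolding Pr_def by blast
        then show ?thesis unfolding eq[symmetric] by blast
      qed
      with ny show ?thesis by blast
    qed
    show "\<exists>y0 s. s > 0 \<and> (\<forall>y\<in>cball y0 s. norm y \<le> \<delta> \<and>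
      (\<forall>x\<in>\<Omega> \<inter> ball p (r/2). \<forall>t\<in>{0..1}. x - t *\<^sub>R y \<in> \<Omega>))"
      using * \<tau> c by (intro exI[of _ "\<tau> *\<^sub>R e"] exI[of _ "\<tau> * c"]) fastforce
  qed (use r in auto)
qed

lemma ex_mollifier:
  fixes y0 :: "real^'n"
  assumes "s > 0"
  obtains k where "smooth k" "\<And>y. k y \<ge> 0" "\<And>y. k y \<noteq> 0 \<Longrightarrow> y \<in> cball y0 s" "(LINT y|lborel. k y) = 1"
proof -
  \<comment> \<open>The Euclidean norm is bounded by the sum of the coordinates, so a cube of half
    side \<open>s / N\<close> lies in the ball of radius \<open>s\<close>.\<close>
  define a where "a = s / real CARD('n)"
  have a: "a > 0" using assms by (simp add: a_def)
  obtain \<eta> where \<eta>: "smooth \<eta>" "\<And>x. \<eta> x \<ge> 0" "\<And>x. \<eta> x \<noteq> 0 \<longleftrightarrow> (\<forall>i. \<bar>x $ i - y0 $ i\<bar> < a)"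
    using ex_smooth_bump[OF a] by blast
  have supp: "y \<in> cball y0 s" if "\<eta> y \<noteq> 0" for y
  proof -
    have "norm (y - y0) \<le> (\<Sum>i\<in>UNIV. \<bar>(y - y0) $ i\<bar>)" by (rule norm_le_l1_cart)
    also have "\<dots> \<le> (\<Sum>i::'n\<in>UNIV. a)" using that \<eta>(3) by (intro sum_mono) (auto simp: less_imp_le)
    finally show ?thesis by (simp add: a_def dist_norm norm_minus_commute)
  qed
  have c: "continuous_on UNIV \<eta>" by (rule smooth_continuous[OF \<eta>(1)])
  have "\<eta> x = 0" if "norm x > norm y0 + s" for x
  proof (rule ccontr)
    assume "\<eta> x \<noteq> 0"
    then have "norm (x - y0) \<le> s" using supp by (auto simp: dist_norm norm_minus_commute)
    then show False using that norm_triangle_sub[of x y0] by linarith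
  qed
  then have i: "integrable lborel \<eta>" using integrable_continuous_compact_support[OF c] by blast
  \<comment> \<open>A vanishing integral would make the nonempty open set of nonzeros
    negligible.\<close>
  have "(LINT y|lborel. \<eta> y) \<noteq> 0"
  proof
    assume "(LINT y|lborel. \<eta> y) = 0"
    then have "AE y in lborel. \<eta> y = 0" using i \<eta>(2) integral_nonneg_eq_0_iff_AE by blast
    then have "AE y in lebesgue. y \<notin> {y. \<eta> y \<noteq> 0}" by (simp add: AE_completion_iff)
    moreover have op: "open {y. \<eta> y \<noteq> 0}" using c by (intro open_Collect_neq) auto
    ultimately have "negligible {y. \<eta> y \<noteq> 0}"
      by (subst (asm) AE_iff_null_sets[symmetric]) (auto simp: negligible_iff_null_sets)
    moreover have "\<eta> y0 \<noteq> 0" using \<eta>(3) a by simp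
    ultimately show False using op open_not_negligible by blast
  qed
  then have pos: "(LINT y|lborel. \<eta> y) > 0" using \<eta>(2) Bochner_Integration.integral_nonneg[of lborel \<eta>] by fastforce
  show thesis
  proof (rule that[of "\<lambda>y. inverse (LINT y|lborel. \<eta> y) * \<eta> y"])
    show "smooth (\<lambda>y. inverse (LINT y|lborel. \<eta> y) * \<eta> y)" by (intro smooth_mult smooth_const \<eta>)
  qed (use pos \<eta> supp in auto)
qed

text \<open>Multiplying each new plateau by the product of the earlier factors 1 - \<beta> makes the
  sum telescope to 1 - \<Prod>(1 - \<beta>), which equals 1 wherever some plateau equals 1. No
  division occurs, so smoothness is immediate.\<close>

lemma ex_partition_of_unity:
  fixes \<beta> :: "'a \<Rightarrow> real^'n \<Rightarrow> real"
  assumes "finite P" and "\<And>p. p \<in> P \<Longrightarrow> smooth (\<beta> p)" "\<And>p x. p \<in> P \<Longrightarrow> 0 \<le> \<beta> p x" "\<And>p x. p \<in> P \<Longrightarrow> \<beta> p x \<le> 1"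
  shows "\<exists>\<psi>. (\<forall>p\<in>P. smooth (\<psi> p) \<and> (\<forall>x. 0 \<le> \<psi> p x \<and> \<psi> p x \<le> 1 \<and> (\<beta> p x = 0 \<longrightarrow> \<psi> p x = 0))) \<and>
    (\<forall>x. (\<Sum>p\<in>P. \<psi> p x) = 1 - (\<Prod>p\<in>P. 1 - \<beta> p x))"
  using assms
proof (induction P)
  case empty
  then show ?case by auto
next
  case (insert q P)
  then obtain \<psi> where \<psi>: "\<And>p. p \<in> P \<Longrightarrow> smooth (\<psi> p)"
    "\<And>p x. p \<in> P \<Longrightarrow> 0 \<le> \<psi> p x \<and> \<psi> p x \<le> 1 \<and> (\<beta> p x = 0 \<longrightarrow> \<psi> p x = 0)"
    "\<And>x. (\<Sum>p\<in>P. \<psi> p x) = 1 - (\<Prod>p\<in>P. 1 - \<beta> p x)"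
    by (metis insertCI)
  let ?q = "\<lambda>x. \<beta> q x * (\<Prod>p\<in>P. 1 - \<beta> p x)"
  have sm: "smooth ?q"
    using insert.prems by (intro smooth_mult smooth_prod smooth_diff smooth_const) auto
  have pr: "0 \<le> (\<Prod>p\<in>P. 1 - \<beta> p x)" "(\<Prod>p\<in>P. 1 - \<beta> p x) \<le> 1" for x
    using insert.prems by (auto intro!: prod_nonneg prod_le_1)
  show ?case
  proof (intro exI[of _ "\<psi>(q := ?q)"] conjI ballI allI)
    fix p assume "p \<in> insert q P"
    show "smooth ((\<psi>(q := ?q)) p)" using sm \<psi>(1) \<open>p \<in> insert q P\<close> by auto
    fix x
    show "0 \<le> (\<psi>(q := ?q)) p x" "(\<psi>(q := ?q)) p x \<le> 1" "\<beta> p x = 0 \<longrightarrow> (\<psi>(q := ?q)) p x = 0"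
      using \<psi>(2)[of p x] insert.prems(2,3)[of q x] pr[of x] \<open>p \<in> insert q P\<close> by (auto intro: mult_le_one)
  next
    fix x
    have "(\<Sum>p\<in>insert q P. (\<psi>(q := ?q)) p x) = ?q x + (\<Sum>p\<in>P. (\<psi>(q := ?q)) p x)"
      using insert(1,2) by simp
    also have "(\<Sum>p\<in>P. (\<psi>(q := ?q)) p x) = (\<Sum>p\<in>P. \<psi> p x)"
      using insert(2) by (intro sum.cong) auto
    finally show "(\<Sum>p\<in>insert q P. (\<psi>(q := ?q)) p x) = 1 - (\<Prod>p\<in>insert q P. 1 - \<beta> p x)"
      using insert(1,2) by (simp add: \<psi>(3) algebra_simps)
  qed
qed

text \<open>\<open>k_cone\<close> is stated on the closure of the support, so that the reflected and
  translated kernel has compact support in \<Omega> and is a test function. It is stated for all t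
  in [0,1] because the value t = 1 serves differentiation of convolutions, while whole segments
  serve the estimate of translates by gradients.\<close>

locale smoothing =
  fixes \<Omega> P :: "(real^'n) set" and \<psi> :: "real^'n \<Rightarrow> real^'n \<Rightarrow> real" and k :: "nat \<Rightarrow> real^'n \<Rightarrow> real^'n \<Rightarrow> real"
  assumes open_dom: "open \<Omega>" and bounded_dom: "bounded \<Omega>" and fin: "finite P"
    and psi_smooth: "\<And>p. p \<in> P \<Longrightarrow> smooth (\<psi> p)"
    and psi_01: "\<And>p x. p \<in> P \<Longrightarrow> 0 \<le> \<psi> p x \<and> \<psi> p x \<le> 1"
    and psi_sum: "\<And>x. x \<in> \<Omega> \<Longrightarrow> (\<Sum>p\<in>P. \<psi> p x) = 1"
    and k_smooth: "\<And>m p. p \<in> P \<Longrightarrow> smooth (k m p)"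
    and k_nonneg: "\<And>m p x. p \<in> P \<Longrightarrow> 0 \<le> k m p x"
    and k_int: "\<And>m p. p \<in> P \<Longrightarrow> (LINT x|lborel. k m p x) = 1"
    and k_supp: "\<And>m p y. p \<in> P \<Longrightarrow> y \<in> closure {y. k m p y \<noteq> 0} \<Longrightarrow> norm y \<le> inverse (real (Suc m))"
    and k_cone: "\<And>m p y x t. p \<in> P \<Longrightarrow> y \<in> closure {y. k m p y \<noteq> 0} \<Longrightarrow> x \<in> \<Omega> \<Longrightarrow> \<psi> p x \<noteq> 0 \<Longrightarrow>
      0 \<le> t \<Longrightarrow> t \<le> 1 \<Longrightarrow> x - t *\<^sub>R y \<in> \<Omega>"

lemma ex_smoothing:
  fixes \<Omega> :: "(real^'n) set"
  assumes dom: "lipschitz_domain \<Omega>" and bdd: "bounded \<Omega>"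
  obtains P \<psi> k where "smoothing \<Omega> P \<psi> k"
proof -
  have "\<exists>\<rho>>0. \<forall>\<delta>>0. \<exists>y0 s. s > 0 \<and> (\<forall>y\<in>cball y0 s. norm y \<le> \<delta> \<and>
    (\<forall>x\<in>\<Omega> \<inter> ball p \<rho>. \<forall>t\<in>{0..1}. x - t *\<^sub>R y \<in> \<Omega>))" if "p \<in> closure \<Omega>" for p
    using lipschitz_domain_cone[OF dom that] by metis
  then obtain \<rho> where \<rho>: "\<And>p. p \<in> closure \<Omega> \<Longrightarrow> \<rho> p > 0"
    "\<And>p \<delta>. p \<in> closure \<Omega> \<Longrightarrow> \<delta> > 0 \<Longrightarrow> \<exists>y0 s. s > 0 \<and> (\<forall>y\<in>cball y0 s. norm y \<le> \<delta> \<and>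
    (\<forall>x\<in>\<Omega> \<inter> ball p (\<rho> p). \<forall>t\<in>{0..1}. x - t *\<^sub>R y \<in> \<Omega>))"
    by metis
  \<comment> \<open>The plateau at \<open>p\<close> lives in a cube of half side 2 \<sigma>, whose
    points are at distance at most 2 \<sigma> N = \<rho>/2 from \<open>p\<close>, inside the ball
    where the cone condition holds.\<close>
  define \<sigma> where "\<sigma> p = \<rho> p / (4 * real CARD('n))" for p
  have \<sigma>: "\<sigma> p > 0" if "p \<in> closure \<Omega>" for p using \<rho>(1)[OF that] by (simp add: \<sigma>_def)
  have "\<exists>\<beta>. smooth \<beta> \<and> (\<forall>x. 0 \<le> \<beta> x \<and> \<beta> x \<le> 1) \<and> (\<forall>x. (\<forall>i. \<bar>x $ i - p $ i\<bar> \<le> \<sigma> p) \<longrightarrow> \<beta> x = 1)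
      \<and> (\<forall>x i. \<bar>x $ i - p $ i\<bar> \<ge> 2 * \<sigma> p \<longrightarrow> \<beta> x = 0)" if "p \<in> closure \<Omega>" for p
    by (rule ex_smooth_plateau[OF \<sigma>[OF that], of p]) blast
  then have "\<exists>\<beta>. \<forall>p\<in>closure \<Omega>. smooth (\<beta> p) \<and> (\<forall>x. 0 \<le> \<beta> p x \<and> \<beta> p x \<le> 1) \<and>
      (\<forall>x. (\<forall>i. \<bar>x $ i - p $ i\<bar> \<le> \<sigma> p) \<longrightarrow> \<beta> p x = 1) \<and>
      (\<forall>x i. \<bar>x $ i - p $ i\<bar> \<ge> 2 * \<sigma> p \<longrightarrow> \<beta> p x = 0)"
    by (intro bchoice ballI)
  then obtain \<beta> where \<beta>: "\<And>p. p \<in> closure \<Omega> \<Longrightarrow> smooth (\<beta> p)"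
    "\<And>p x. p \<in> closure \<Omega> \<Longrightarrow> 0 \<le> \<beta> p x" "\<And>p x. p \<in> closure \<Omega> \<Longrightarrow> \<beta> p x \<le> 1"
    "\<And>p x. p \<in> closure \<Omega> \<Longrightarrow> (\<forall>i. \<bar>x $ i - p $ i\<bar> \<le> \<sigma> p) \<Longrightarrow> \<beta> p x = 1"
    "\<And>p x i. p \<in> closure \<Omega> \<Longrightarrow> \<bar>x $ i - p $ i\<bar> \<ge> 2 * \<sigma> p \<Longrightarrow> \<beta> p x = 0"
    by blast
  have "compact (closure \<Omega>)" using bdd by simp
  moreover have "closure \<Omega> \<subseteq> (\<Union>p\<in>closure \<Omega>. ball p (\<sigma> p))" using \<sigma> by force
  ultimately obtain P where P: "P \<subseteq> closure \<Omega>" "finite P" "closure \<Omega> \<subseteq> (\<Union>p\<in>P. ball p (\<sigma> p))"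
    using compactE_image[of "closure \<Omega>" "closure \<Omega>" "\<lambda>p. ball p (\<sigma> p)"] by (metis open_ball)
  obtain \<psi> where \<psi>: "\<And>p. p \<in> P \<Longrightarrow> smooth (\<psi> p)"
    "\<And>p x. p \<in> P \<Longrightarrow> 0 \<le> \<psi> p x \<and> \<psi> p x \<le> 1 \<and> (\<beta> p x = 0 \<longrightarrow> \<psi> p x = 0)"
    "\<And>x. (\<Sum>p\<in>P. \<psi> p x) = 1 - (\<Prod>p\<in>P. 1 - \<beta> p x)"
    using ex_partition_of_unity[OF P(2), of \<beta>] \<beta>(1,2,3) P(1) by (smt (verit) subset_iff)
  have supp: "x \<in> ball p (\<rho> p)" if p: "p \<in> P" and "\<psi> p x \<noteq> 0" for p x
  proof -
    have "\<beta> p x \<noteq> 0" using that \<psi>(2) by blast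
    then have "\<bar>(x - p) $ i\<bar> \<le> 2 * \<sigma> p" for i
      using \<beta>(5)[of p x i] p P(1) by (cases "2 * \<sigma> p \<le> \<bar>(x - p) $ i\<bar>") auto
    then have "(\<Sum>i\<in>UNIV. \<bar>(x - p) $ i\<bar>) \<le> (\<Sum>i::'n\<in>UNIV. 2 * \<sigma> p)" by (intro sum_mono)
    also have "\<dots> = \<rho> p / 2" by (simp add: \<sigma>_def)
    also have "\<dots> < \<rho> p" using \<rho>(1)[of p] p P(1) by auto
    finally show ?thesis using norm_le_l1_cart[of "x - p"] by (simp add: dist_norm norm_minus_commute)
  qed
  define Q where "Q m p k \<longleftrightarrow> smooth k \<and> (\<forall>x. 0 \<le> k x) \<and> (LINT x|lborel. k x) = 1 \<and>
      (\<forall>y\<in>closure {y. k y \<noteq> 0}. norm y \<le> inverse (real (Suc m)) \<and>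
        (\<forall>x\<in>\<Omega> \<inter> ball p (\<rho> p). \<forall>t\<in>{0..1}. x - t *\<^sub>R y \<in> \<Omega>))" for m p and k :: "real^'n \<Rightarrow> real"
  have exQ: "\<exists>k. Q m p k" if p: "p \<in> P" for p m
  proof -
    have "inverse (real (Suc m)) > 0" by simp
    then obtain y0 s where s: "s > 0" "\<And>y. y \<in> cball y0 s \<Longrightarrow> norm y \<le> inverse (real (Suc m)) \<and>
        (\<forall>x\<in>\<Omega> \<inter> ball p (\<rho> p). \<forall>t\<in>{0..1}. x - t *\<^sub>R y \<in> \<Omega>)"
      using \<rho>(2)[of p "inverse (real (Suc m))"] p P(1) by blast
    obtain k where k: "smooth k" "\<And>y. k y \<ge> 0" "\<And>y. k y \<noteq> 0 \<Longrightarrow> y \<in> cball y0 s" "(LINT y|lborel. k y) = 1"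
      using ex_mollifier[OF s(1)] by blast
    have "closure {y. k y \<noteq> 0} \<subseteq> cball y0 s" by (rule closure_minimal) (use k(3) in auto)
    then show ?thesis unfolding Q_def using k s(2) by (intro exI[of _ k]) blast
  qed
  define k where "k m p = (SOME k. Q m p k)" for m p
  have "Q m p (k m p)" if "p \<in> P" for m p unfolding k_def by (rule someI_ex[OF exQ[OF that]])
  then have k: "\<And>m p. p \<in> P \<Longrightarrow> smooth (k m p)" "\<And>m p x. p \<in> P \<Longrightarrow> 0 \<le> k m p x"
    "\<And>m p. p \<in> P \<Longrightarrow> (LINT x|lborel. k m p x) = 1"
    "\<And>m p y. p \<in> P \<Longrightarrow> y \<in> closure {y. k m p y \<noteq> 0} \<Longrightarrow> norm y \<le> inverse (real (Suc m)) \<and>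
        (\<forall>x\<in>\<Omega> \<inter> ball p (\<rho> p). \<forall>t\<in>{0..1}. x - t *\<^sub>R y \<in> \<Omega>)"
    unfolding Q_def by blast+
  have "smoothing \<Omega> P \<psi> k"
  proof
    show "open \<Omega>" using dom by (simp add: lipschitz_domain_def)
    fix x assume "x \<in> \<Omega>"
    then obtain p where p: "p \<in> P" "x \<in> ball p (\<sigma> p)" using P(3) closure_subset by blast
    have "\<beta> p x = 1"
    proof (rule \<beta>(4), use p P in blast, intro allI)
      fix i
      have "\<bar>(x - p) $ i\<bar> \<le> norm (x - p)" by (rule component_le_norm_cart)
      then show "\<bar>x $ i - p $ i\<bar> \<le> \<sigma> p" using p(2) by (simp add: dist_norm norm_minus_commute)
    qed
    then have "(\<Prod>p\<in>P. 1 - \<beta> p x) = 0" using p P(2) by (intro prod_zero) auto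
    then show "(\<Sum>p\<in>P. \<psi> p x) = 1" by (simp add: \<psi>(3))
  qed (use bdd P(2) \<psi>(1,2) k supp in auto)
  then show thesis by (rule that)
qed

section \<open>Convolution over the domain\<close>

lemma L2_iff_sqint: "L2 \<Omega> f \<longleftrightarrow> sqint (lebesgue_on \<Omega>) f"
  by (simp add: L2_def sqint_def)

lemma weak_gradD:
  assumes "is_weak_grad \<Omega> u g"
  shows "sqint (lebesgue_on \<Omega>) u" "sqint (lebesgue_on \<Omega>) g" "sqint (lebesgue_on \<Omega>) (\<lambda>x. g x $ i)"
    "test_fun \<Omega> \<phi> \<Longrightarrow> (LINT x|lebesgue_on \<Omega>. u x * partial i \<phi> x) = - (LINT x|lebesgue_on \<Omega>. g x $ i * \<phi> x)"
  using assms by (auto simp: is_weak_grad_def L2_iff_sqint sqint_vec_iff)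

lemma finite_measure_lebesgue_on_bounded:
  assumes "open \<Omega>" "bounded \<Omega>"
  shows "finite_measure (lebesgue_on \<Omega>)"
proof
  have "emeasure lebesgue \<Omega> < \<infinity>"
    using emeasure_bounded_finite[OF assms(2)] assms(1) by simp
  then show "emeasure (lebesgue_on \<Omega>) (space (lebesgue_on \<Omega>)) \<noteq> \<infinity>"
    using assms(1) by (subst emeasure_restrict_space) (auto simp: space_restrict_space)
qed

lemma AE_lebesgue_onI: "(\<And>x. x \<in> \<Omega> \<Longrightarrow> P x) \<Longrightarrow> AE x in lebesgue_on \<Omega>. P x"
  by (rule AE_I2) (simp add: space_restrict_space)

context
  fixes \<Omega> :: "(real^'n) set"
  assumes op: "open \<Omega>" and bdd: "bounded \<Omega>"
begin

interpretation finite_measure "lebesgue_on \<Omega>"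
  by (rule finite_measure_lebesgue_on_bounded[OF op bdd])

lemma sqint_const: "sqint (lebesgue_on \<Omega>) (\<lambda>x. c)"
  by (simp add: sqint_def)

lemma sqint_integrable: "sqint (lebesgue_on \<Omega>) u \<Longrightarrow> integrable (lebesgue_on \<Omega>) u" for u :: "real^'n \<Rightarrow> real"
  using sqint_mult[OF sqint_const[of 1]] by simp

lemma continuous_bounded_dom:
  assumes "continuous_on UNIV f"
  obtains B where "B \<ge> 0" "\<And>x. x \<in> \<Omega> \<Longrightarrow> norm (f x :: 'b::real_normed_vector) \<le> B"
proof -
  have "bounded (f ` closure \<Omega>)"
    using bdd by (intro compact_imp_bounded compact_continuous_image continuous_on_subset[OF assms]) auto
  then obtain B where "\<forall>y\<in>f ` closure \<Omega>. norm y \<le> B" unfolding bounded_iff by blast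
  then have B: "\<And>x. x \<in> \<Omega> \<Longrightarrow> norm (f x) \<le> B" using closure_subset by blast
  show thesis by (rule that[of "max B 0"]) (use B in \<open>auto intro: max.coboundedI1\<close>)
qed

lemma sqint_continuous: "continuous_on UNIV f \<Longrightarrow> sqint (lebesgue_on \<Omega>) f" for f :: "real^'n \<Rightarrow> real"
proof -
  assume f: "continuous_on UNIV f"
  obtain B where "\<And>x. x \<in> \<Omega> \<Longrightarrow> norm (f x) \<le> B" using continuous_bounded_dom[OF f] by blast
  then show ?thesis
    by (intro sqint_bound(1)[OF sqint_const[of "1::real"], of _ B] continuous_borel_measurable_lebesgue_on[OF f] AE_lebesgue_onI) auto
qed

lemma sqint_continuous_mult:
  fixes f g :: "real^'n \<Rightarrow> real"
  assumes f: "continuous_on UNIV f" and g: "sqint (lebesgue_on \<Omega>) g"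
  shows "sqint (lebesgue_on \<Omega>) (\<lambda>x. f x * g x)"
proof -
  obtain B where B: "B \<ge> 0" "\<And>x. x \<in> \<Omega> \<Longrightarrow> norm (f x) \<le> B" using continuous_bounded_dom[OF f] by blast
  have [measurable]: "f \<in> borel_measurable (lebesgue_on \<Omega>)" "g \<in> borel_measurable (lebesgue_on \<Omega>)"
    using continuous_borel_measurable_lebesgue_on[OF f] g by (auto simp: sqint_def)
  show ?thesis
    by (rule sqint_bound(1)[OF g, of _ B]) (use B in \<open>auto intro!: AE_lebesgue_onI mult_right_mono simp: abs_mult\<close>)
qed

text \<open>The convolution of \<open>k\<close> with the extension of \<open>u\<close> by zero.
  Integrating over \<Omega> makes the values of \<open>u\<close> outside \<Omega>
  irrelevant.\<close>

definition moll :: "(real^'n \<Rightarrow> real) \<Rightarrow> (real^'n \<Rightarrow> real) \<Rightarrow> real^'n \<Rightarrow> real" where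
  "moll k u x = (LINT z|lebesgue_on \<Omega>. k (x - z) * u z)"

lemma bound_translates:
  fixes f :: "real^'n \<Rightarrow> real"
  assumes f: "continuous_on UNIV f"
  obtains B where "B \<ge> 0" "\<And>x z. norm x \<le> r \<Longrightarrow> z \<in> \<Omega> \<Longrightarrow> \<bar>f (x - z)\<bar> \<le> B"
proof -
  obtain b where b: "\<And>z. z \<in> \<Omega> \<Longrightarrow> norm z \<le> b" using bdd by (auto simp: bounded_iff)
  have "bounded (f ` cball 0 (r + b))"
    by (intro compact_imp_bounded compact_continuous_image continuous_on_subset[OF f]) auto
  then obtain B where B: "\<forall>y\<in>f ` cball 0 (r + b). norm y \<le> B" unfolding bounded_iff by blast
  have "\<bar>f (x - z)\<bar> \<le> max B 0" if "norm x \<le> r" "z \<in> \<Omega>" for x z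
  proof -
    have "norm (x - z) \<le> r + b" using norm_triangle_ineq4[of x z] that b[of z] by linarith
    then show ?thesis using B by (auto intro: max.coboundedI1)
  qed
  then show thesis by (intro that[of "max B 0"]) auto
qed

lemma measurable_translate:
  "continuous_on UNIV f \<Longrightarrow> (\<lambda>z. f (x - z)) \<in> borel_measurable (lebesgue_on \<Omega>)" for f :: "real^'n \<Rightarrow> real"
  by (rule continuous_borel_measurable_lebesgue_on, rule continuous_on_compose2[of UNIV f]) (auto intro!: continuous_intros)

lemma moll_integrable:
  fixes k u :: "real^'n \<Rightarrow> real"
  assumes k: "continuous_on UNIV k" and u: "integrable (lebesgue_on \<Omega>) u"
  shows "integrable (lebesgue_on \<Omega>) (\<lambda>z. k (x - z) * u z)"
proof -
  obtain B where B: "B \<ge> 0" "\<And>z. z \<in> \<Omega> \<Longrightarrow> \<bar>k (x - z)\<bar> \<le> B" using bound_translates[OF k, of "norm x"] by (metis order_refl)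
  show ?thesis
  proof (rule Bochner_Integration.integrable_bound)
    show "integrable (lebesgue_on \<Omega>) (\<lambda>z. B * u z)" using u by simp
    show "(\<lambda>z. k (x - z) * u z) \<in> borel_measurable (lebesgue_on \<Omega>)"
      using measurable_translate[OF k] u by simp
    show "AE z in lebesgue_on \<Omega>. norm (k (x - z) * u z) \<le> norm (B * u z)"
      using B by (intro AE_lebesgue_onI) (simp add: abs_mult mult_right_mono)
  qed
qed

lemma moll_continuous:
  assumes k: "continuous_on UNIV k" and u: "integrable (lebesgue_on \<Omega>) u"
  shows "continuous_on UNIV (moll k u)"
  unfolding continuous_on_sequentially
proof (intro allI ballI impI)
  fix X :: "nat \<Rightarrow> real^'n" and x assume "(\<forall>n. X n \<in> UNIV) \<and> X \<longlonglongrightarrow> x"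
  then have X: "X \<longlonglongrightarrow> x" by simp
  then obtain r where r: "\<And>n. norm (X n) \<le> r" by (meson Bseq_def convergentI convergent_imp_Bseq)
  obtain B where B: "B \<ge> 0" "\<And>x z. norm x \<le> r \<Longrightarrow> z \<in> \<Omega> \<Longrightarrow> \<bar>k (x - z)\<bar> \<le> B" using bound_translates[OF k, of r] by blast
  have kc: "isCont k y" for y using k by (simp add: continuous_on_eq_continuous_at)
  show "(moll k u \<circ> X) \<longlonglongrightarrow> moll k u x" unfolding moll_def comp_def
  proof (rule integral_dominated_convergence[where w = "\<lambda>z. B * \<bar>u z\<bar>"])
    show "integrable (lebesgue_on \<Omega>) (\<lambda>z. B * \<bar>u z\<bar>)" using u by simp
    show "AE z in lebesgue_on \<Omega>. (\<lambda>i. k (X i - z) * u z) \<longlonglongrightarrow> k (x - z) * u z"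
      by (intro AE_I2 tendsto_intros isCont_tendsto_compose[OF kc] X)
    show "AE z in lebesgue_on \<Omega>. norm (k (X i - z) * u z) \<le> B * \<bar>u z\<bar>" for i
      using B(2)[OF r] by (intro AE_lebesgue_onI) (simp add: abs_mult mult_right_mono)
  qed (use measurable_translate[OF k] u in simp_all)
qed

lemma moll_deriv:
  assumes k: "smooth k" and u: "integrable (lebesgue_on \<Omega>) u"
  shows "((\<lambda>t. moll k u (x + t *\<^sub>R axis i 1)) has_real_derivative moll (partial i k) u x) (at 0)"
  unfolding DERIV_def tendsto_at_iff_sequentially
proof (intro allI impI)
  fix X :: "nat \<Rightarrow> real" assume X0: "\<forall>n. X n \<in> UNIV - {0}" and X: "X \<longlonglongrightarrow> 0"
  obtain b where b: "\<And>n. \<bar>X n\<bar> \<le> b" using X by (metis Bseq_def convergentI convergent_imp_Bseq real_norm_def)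
  have kc: "continuous_on UNIV k" "continuous_on UNIV (partial i k)"
    using smooth_continuous smooth_partial k by auto
  obtain B where B: "B \<ge> 0" "\<And>y z. norm y \<le> norm x + b \<Longrightarrow> z \<in> \<Omega> \<Longrightarrow> \<bar>partial i k (y - z)\<bar> \<le> B"
    using bound_translates[OF kc(2), of "norm x + b"] by blast
  let ?q = "\<lambda>n z. (k (x + X n *\<^sub>R axis i 1 - z) - k (x - z)) / X n * u z"
  have "(\<lambda>n. LINT z|lebesgue_on \<Omega>. ?q n z) \<longlonglongrightarrow> moll (partial i k) u x"
    unfolding moll_def
  proof (rule integral_dominated_convergence[where w = "\<lambda>z. B * \<bar>u z\<bar>"])
    show "integrable (lebesgue_on \<Omega>) (\<lambda>z. B * \<bar>u z\<bar>)" using u by simp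
    show "(\<lambda>z. partial i k (x - z) * u z) \<in> borel_measurable (lebesgue_on \<Omega>)"
      using measurable_translate[OF kc(2)] u by simp
    show "?q n \<in> borel_measurable (lebesgue_on \<Omega>)" for n
      using measurable_translate[OF kc(1)] u
      by (intro borel_measurable_times borel_measurable_divide borel_measurable_diff borel_measurable_const) auto
    show "AE z in lebesgue_on \<Omega>. (\<lambda>n. ?q n z) \<longlonglongrightarrow> partial i k (x - z) * u z"
    proof (intro AE_I2 tendsto_mult tendsto_const)
      fix z
      have "((\<lambda>h. (k (x - z + h *\<^sub>R axis i 1) - k (x - z)) / h) \<longlongrightarrow> partial i k (x - z)) (at 0)"
        using smooth_deriv[OF k, of "x - z" i] by (simp add: DERIV_def)
      moreover have "filterlim X (at 0) sequentially"
        using X X0 by (intro filterlim_atI) auto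
      ultimately have "(\<lambda>n. (k (x - z + X n *\<^sub>R axis i 1) - k (x - z)) / X n) \<longlonglongrightarrow> partial i k (x - z)"
        by (rule filterlim_compose)
      then show "(\<lambda>n. (k (x + X n *\<^sub>R axis i 1 - z) - k (x - z)) / X n) \<longlonglongrightarrow> partial i k (x - z)"
        by (simp add: algebra_simps)
    qed
    show "AE z in lebesgue_on \<Omega>. norm (?q n z) \<le> B * \<bar>u z\<bar>" for n
    proof (intro AE_lebesgue_onI)
      fix z assume z: "z \<in> \<Omega>"
      have "norm (k ((x - z) + X n *\<^sub>R axis i 1) - k ((x - z) + 0 *\<^sub>R axis i 1)) \<le> B * norm (X n - 0)"
      proof (rule field_differentiable_bound[where S = "closed_segment 0 (X n)" and
            f' = "\<lambda>t. partial i k ((x - z) + t *\<^sub>R axis i 1)" and f = "\<lambda>t. k ((x - z) + t *\<^sub>R axis i 1)"])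
        fix t assume t: "t \<in> closed_segment 0 (X n)"
        show "((\<lambda>t. k (x - z + t *\<^sub>R axis i 1)) has_field_derivative partial i k (x - z + t *\<^sub>R axis i 1))
           (at t within closed_segment 0 (X n))"
          by (rule has_field_derivative_at_within[OF smooth_deriv_at[OF k]])
        have "\<bar>t\<bar> \<le> \<bar>X n\<bar>" using t by (auto simp: closed_segment_eq_real_ivl split: if_splits)
        then have "norm (x + t *\<^sub>R axis i 1) \<le> norm x + b"
          using norm_triangle_ineq[of x "t *\<^sub>R axis i 1"] b[of n] by simp
        from B(2)[OF this z] show "norm (partial i k (x - z + t *\<^sub>R axis i 1)) \<le> B"
          by (simp add: algebra_simps)
      qed auto
      then have "\<bar>k (x + X n *\<^sub>R axis i 1 - z) - k (x - z)\<bar> / \<bar>X n\<bar> \<le> B"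
        using X0 by (simp add: divide_le_eq algebra_simps)
      then show "norm (?q n z) \<le> B * \<bar>u z\<bar>" by (simp only: real_norm_def abs_mult abs_divide mult_right_mono abs_ge_zero)
    qed
  qed
  moreover have "(LINT z|lebesgue_on \<Omega>. ?q n z) = (moll k u (x + X n *\<^sub>R axis i 1) - moll k u x) / X n" for n
  proof -
    have "?q n z = (k (x + X n *\<^sub>R axis i 1 - z) * u z - k (x - z) * u z) / X n" for z
      by (simp add: left_diff_distrib)
    then show ?thesis unfolding moll_def
      using moll_integrable[OF kc(1) u] by (simp only: integral_divide_zero Bochner_Integration.integral_diff)
  qed
  ultimately show "((\<lambda>h. (moll k u (x + (0 + h) *\<^sub>R axis i 1) - moll k u (x + 0 *\<^sub>R axis i 1)) / h) \<circ> X) \<longlonglongrightarrow> moll (partial i k) u x"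
    by (simp only: comp_def add_0_left scaleR_zero_left add_0_right)
qed

lemma moll_smooth:
  assumes "smooth k" "integrable (lebesgue_on \<Omega>) u"
  shows "smooth (moll k u)"
proof (rule smooth_coinduct[of _ "{moll k u | k. smooth k}"])
  show "moll k u \<in> {moll k u | k. smooth k}" using assms(1) by blast
  fix g assume "g \<in> {moll k u | k. smooth k}"
  then obtain k where g: "g = moll k u" "smooth k" by blast
  show "continuous_on UNIV g \<and> (\<forall>i. \<exists>h\<in>{moll k u | k. smooth k}. \<forall>x. ((\<lambda>t. g (x + t *\<^sub>R axis i 1)) has_real_derivative h x) (at 0))"
  proof (intro conjI allI)
    show "continuous_on UNIV g" using g moll_continuous[OF smooth_continuous assms(2)] by blast
    fix i show "\<exists>h\<in>{moll k u | k. smooth k}. \<forall>x. ((\<lambda>t. g (x + t *\<^sub>R axis i 1)) has_real_derivative h x) (at 0)"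
      using g moll_deriv[OF g(2) assms(2)] smooth_partial[OF g(2)] by blast
  qed
qed

lemma partial_moll: "smooth k \<Longrightarrow> integrable (lebesgue_on \<Omega>) u \<Longrightarrow> partial i (moll k u) x = moll (partial i k) u x"
  by (rule partialI[OF moll_deriv])

lemma moll_cong_AE:
  assumes k: "continuous_on UNIV k" and u: "u \<in> borel_measurable (lebesgue_on \<Omega>)"
    and ae: "AE x in lebesgue_on \<Omega>. u x = v x"
  shows "moll k u x = moll k v x"
  unfolding moll_def
proof (rule integral_cong_AE)
  have "v \<in> borel_measurable (lebesgue_on \<Omega>)" using borel_measurable_lebesgue_on_AE[OF u _ ae] op by auto
  then show "(\<lambda>z. k (x - z) * v z) \<in> borel_measurable (lebesgue_on \<Omega>)"
      "(\<lambda>z. k (x - z) * u z) \<in> borel_measurable (lebesgue_on \<Omega>)" using measurable_translate[OF k] u by auto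
  show "AE z in lebesgue_on \<Omega>. k (x - z) * u z = k (x - z) * v z" using ae by eventually_elim simp
qed

lemma moll_lborel:
  assumes k: "continuous_on UNIV k" and U: "U \<in> borel_measurable borel" "\<And>x. x \<notin> \<Omega> \<Longrightarrow> U x = 0"
  shows "moll k U x = (LINT z|lborel. k (x - z) * U z)"
  unfolding moll_def
proof (rule integral_lebesgue_on_lborel)
  have "(\<lambda>z. k (x - z)) \<in> borel_measurable borel"
    by (intro borel_measurable_continuous_onI continuous_on_compose2[OF k]) (auto intro!: continuous_intros)
  then show "(\<lambda>z. k (x - z) * U z) \<in> borel_measurable borel" using U(1) by simp
qed (use op U(2) in auto)

text \<open>An average of values bounded by \<open>K\<close>, where the part of the kernel falling
  outside \<Omega> only loses mass.\<close>

lemma moll_bound: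
  assumes k: "continuous_on UNIV k" "\<And>x. k x \<ge> 0" "integrable lborel k" "(LINT x|lborel. k x) = 1"
    and u: "integrable (lebesgue_on \<Omega>) u" "AE x in lebesgue_on \<Omega>. \<bar>u x\<bar> \<le> K" and K: "K \<ge> 0"
  shows "\<bar>moll k u x\<bar> \<le> K"
proof -
  have kb: "k \<in> borel_measurable borel" using k(1) by (rule borel_measurable_continuous_onI)
  have ki: "integrable lborel (\<lambda>z. k (x - z))" using integrable_lborel_reflect[OF kb] k(3) by simp
  have "\<bar>moll k u x\<bar> \<le> (LINT z|lebesgue_on \<Omega>. norm (k (x - z) * u z))"
    unfolding moll_def using integral_norm_bound[of "lebesgue_on \<Omega>" "\<lambda>z. k (x - z) * u z"] by simp
  also have "\<dots> \<le> (LINT z|lebesgue_on \<Omega>. k (x - z) * K)"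
  proof (rule integral_mono_AE)
    show "integrable (lebesgue_on \<Omega>) (\<lambda>z. norm (k (x - z) * u z))" using moll_integrable[OF k(1) u(1)] by simp
    show "integrable (lebesgue_on \<Omega>) (\<lambda>z. k (x - z) * K)" by (rule moll_integrable[OF k(1)]) simp
    show "AE z in lebesgue_on \<Omega>. norm (k (x - z) * u z) \<le> k (x - z) * K"
      using u(2) by eventually_elim (use k(2) in \<open>auto simp: abs_mult intro!: mult_left_mono\<close>)
  qed
  also have "\<dots> = (LINT z|lebesgue_on \<Omega>. indicator \<Omega> z * (k (x - z) * K))"
    by (intro Bochner_Integration.integral_cong) (auto simp: space_restrict_space)
  also have "\<dots> = (LINT z|lborel. indicator \<Omega> z * (k (x - z) * K))"
    by (intro integral_lebesgue_on_lborel) (use kb op in auto)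
  also have "\<dots> \<le> (LINT z|lborel. k (x - z) * K)"
  proof (rule integral_mono)
    show "integrable lborel (\<lambda>z. indicator \<Omega> z * (k (x - z) * K))"
      using ki op integrable_real_mult_indicator[of \<Omega> lborel "\<lambda>z. k (x - z) * K"] by (simp add: mult.commute)
    show "indicator \<Omega> z * (k (x - z) * K) \<le> k (x - z) * K" for z using K k(2) by (auto simp: indicator_def)
  qed (use ki in simp)
  also have "\<dots> = K" using integral_lborel_reflect[OF kb, of x] k(4) by simp
  finally show ?thesis .
qed

end

section \<open>Approximation by smooth functions up to the boundary\<close>

lemma sqn_tendsto_0_sum:
  fixes f :: "'i \<Rightarrow> nat \<Rightarrow> 'a \<Rightarrow> 'b::euclidean_space"
  assumes "finite I" "\<And>i m. i \<in> I \<Longrightarrow> sqint M (f i m)" "\<And>i. i \<in> I \<Longrightarrow> (\<lambda>m. sqn M (f i m)) \<longlonglongrightarrow> 0"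
  shows "(\<lambda>m. sqn M (\<lambda>x. \<Sum>i\<in>I. f i m x)) \<longlonglongrightarrow> 0"
  using assms
proof (induction I)
  case (insert j I)
  have "(\<lambda>m. sqn M (\<lambda>x. f j m x + (\<Sum>i\<in>I. f i m x))) \<longlonglongrightarrow> 0"
    by (rule sqn_tendsto_0_add) (use insert in \<open>auto intro!: sqint_sum\<close>)
  then show ?case using insert(1,2) by simp
qed simp

lemma sqn_sum_le:
  fixes f :: "'i \<Rightarrow> 'a \<Rightarrow> real"
  assumes "\<And>i. i \<in> I \<Longrightarrow> sqint M (f i)"
  shows "sqn M (\<lambda>x. \<Sum>i\<in>I. f i x) \<le> real (card I) * (\<Sum>i\<in>I. sqn M (f i))"
proof -
  have "sqn M (\<lambda>x. \<Sum>i\<in>I. f i x) \<le> (LINT x|M. real (card I) * (\<Sum>i\<in>I. (norm (f i x))\<^sup>2))"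
    unfolding sqn_def
  proof (rule integral_mono)
    show "integrable M (\<lambda>x. (norm (\<Sum>i\<in>I. f i x))\<^sup>2)" using sqint_sum[of I M f] assms by (simp add: sqint_def)
    show "integrable M (\<lambda>x. real (card I) * (\<Sum>i\<in>I. (norm (f i x))\<^sup>2))"
      using assms by (auto simp: sqint_def)
    fix x
    show "(norm (\<Sum>i\<in>I. f i x))\<^sup>2 \<le> real (card I) * (\<Sum>i\<in>I. (norm (f i x))\<^sup>2)"
      using sum_squared_le_sum_of_squares[of "\<lambda>i. f i x" I] by (simp add: mult.commute)
  qed
  also have "\<dots> = real (card I) * (\<Sum>i\<in>I. sqn M (f i))"
    using assms by (simp add: sqn_def sqint_def)
  finally show ?thesis .
qed

lemma smooth_grad_continuous: "smooth v \<Longrightarrow> continuous_on UNIV (grad v)" for v :: "real^'n \<Rightarrow> real"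
  unfolding grad_def by (intro continuous_on_vec_lambda smooth_continuous smooth_partial)

text \<open>Fundamental theorem of calculus along the segment from x to x - y, then Cauchy-Schwarz
  on the unit interval. The right-hand side is an extended integral, ready for Tonelli.\<close>

lemma smooth_line_estimate:
  fixes v :: "real^'n \<Rightarrow> real"
  assumes v: "smooth v"
  shows "ennreal ((v (x - y) - v x)\<^sup>2) \<le> (\<integral>\<^sup>+t. indicator {0..1} t * ennreal ((norm y)\<^sup>2 * (norm (grad v (x - t *\<^sub>R y)))\<^sup>2) \<partial>lborel)"
proof -
  let ?G = "\<lambda>t. grad v (x - t *\<^sub>R y) \<bullet> y"
  have cG: "continuous_on UNIV (\<lambda>t. grad v (x - t *\<^sub>R y))"
    by (rule continuous_on_compose2[OF smooth_grad_continuous[OF v]]) (auto intro!: continuous_intros)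
  have der: "((\<lambda>t. v (x - t *\<^sub>R y)) has_vector_derivative - ?G t) (at t within {0..1})" for t
  proof -
    have "((\<lambda>t. x - t *\<^sub>R y) has_vector_derivative - y) (at t)"
      by (auto intro!: derivative_eq_intros)
    from vector_derivative_diff_chain_within[OF has_vector_derivative_at_within[OF this] has_derivative_at_withinI[OF smooth_has_derivative[OF v]]]
    have "(v \<circ> (\<lambda>t. x - t *\<^sub>R y) has_vector_derivative grad v (x - t *\<^sub>R y) \<bullet> (- y)) (at t within {0..1})" by blast
    then show ?thesis by (simp add: comp_def)
  qed
  have cont: "continuous_on {0..1} (\<lambda>t. - ?G t)"
    by (intro continuous_intros continuous_on_subset[OF cG]) auto
  have "(LINT t|lborel. indicator {0..1} t *\<^sub>R (- ?G t)) = v (x - 1 *\<^sub>R y) - v (x - 0 *\<^sub>R y)"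
    by (rule integral_FTC_atLeastAtMost) (use der cont in auto)
  moreover have "indicator {0..1} t *\<^sub>R (- ?G t) = indicator {0..1} t \<bullet> (indicator {0..1} t * (- ?G t))" for t :: real
    by (simp add: indicator_def)
  ultimately have e: "v (x - y) - v x = (LINT t|lborel. indicator {0..1} t \<bullet> (indicator {0..1} t * (- ?G t)))"
    by (simp only: scaleR_one scaleR_zero_left diff_zero)
  have sq1: "(\<lambda>t. (norm (indicator {0..1::real} t :: real))\<^sup>2) = indicator {0..1}"
    by (auto simp: fun_eq_iff indicator_def)
  have s1: "sqint lborel (indicator {0..1::real} :: real \<Rightarrow> real)"
    unfolding sqint_def sq1 by simp
  have s2: "sqint lborel (\<lambda>t. indicator {0..1} t * (- ?G t))"
  proof -
    have "integrable lborel (\<lambda>t. indicator {0..1} t *\<^sub>R (?G t)\<^sup>2)"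
      by (intro borel_integrable_compact continuous_intros continuous_on_subset[OF cG]) auto
    moreover have "(\<lambda>t. - ?G t) \<in> borel_measurable borel"
      by (intro borel_measurable_continuous_onI continuous_intros cG)
    moreover have "(norm (indicator {0..1} t * (- ?G t)))\<^sup>2 = indicator {0..1} t *\<^sub>R (?G t)\<^sup>2" for t
      by (auto simp: indicator_def)
    ultimately show ?thesis unfolding sqint_def by simp
  qed
  have "\<bar>v (x - y) - v x\<bar> \<le> sqrt (sqn lborel (indicator {0..1::real} :: real \<Rightarrow> real) * sqn lborel (\<lambda>t. indicator {0..1} t * (- ?G t)))"
    unfolding e by (rule sqint_Cauchy_Schwarz[OF s1 s2])
  also have "sqn lborel (indicator {0..1::real} :: real \<Rightarrow> real) = 1"
    unfolding sqn_def sq1 by simp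
  finally have "(v (x - y) - v x)\<^sup>2 \<le> sqn lborel (\<lambda>t. indicator {0..1} t * (- ?G t))"
    by (intro sqrt_ge_absD) (simp only: mult_1)
  then have "ennreal ((v (x - y) - v x)\<^sup>2) \<le> ennreal (sqn lborel (\<lambda>t. indicator {0..1} t * (- ?G t)))"
    by (rule ennreal_leI)
  also have "\<dots> = (\<integral>\<^sup>+t. ennreal ((norm (indicator {0..1} t * (- ?G t)))\<^sup>2) \<partial>lborel)"
    using s2 unfolding sqn_def by (intro nn_integral_eq_integral[symmetric]) (auto simp: sqint_def)
  also have "\<dots> \<le> (\<integral>\<^sup>+t. indicator {0..1} t * ennreal ((norm y)\<^sup>2 * (norm (grad v (x - t *\<^sub>R y)))\<^sup>2) \<partial>lborel)"
  proof (rule nn_integral_mono)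
    fix t
    have "\<bar>?G t\<bar>\<^sup>2 \<le> (norm (grad v (x - t *\<^sub>R y)) * norm y)\<^sup>2"
      by (intro power_mono Cauchy_Schwarz_ineq2) auto
    then show "ennreal ((norm (indicator {0..1} t * (- ?G t)))\<^sup>2) \<le> indicator {0..1} t * ennreal ((norm y)\<^sup>2 * (norm (grad v (x - t *\<^sub>R y)))\<^sup>2)"
      by (auto simp: indicator_def power_mult_distrib mult.commute intro!: ennreal_leI)
  qed
  finally show ?thesis .
qed

text \<open>After exchanging the integrals, each fixed t contributes the gradient on the translate
  of \<open>B\<close> by t y, which lies in \<Omega>. Thus only the gradient inside the domain is
  paid for.\<close>

lemma smooth_shift_estimate:
  fixes v :: "real^'n \<Rightarrow> real"
  assumes v: "smooth v" and B: "B \<in> sets borel" and \<Omega>: "\<Omega> \<in> sets borel"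
    and seg: "\<And>x t. x \<in> B \<Longrightarrow> 0 \<le> t \<Longrightarrow> t \<le> 1 \<Longrightarrow> x - t *\<^sub>R y \<in> \<Omega>"
  shows "(\<integral>\<^sup>+x. indicator B x * ennreal ((v (x - y) - v x)\<^sup>2) \<partial>lborel)
    \<le> ennreal ((norm y)\<^sup>2) * (\<integral>\<^sup>+x. indicator \<Omega> x * ennreal ((norm (grad v x))\<^sup>2) \<partial>lborel)"
proof -
  have [measurable]: "grad v \<in> borel_measurable borel" "B \<in> sets borel" "\<Omega> \<in> sets borel"
    using smooth_grad_continuous[OF v] B \<Omega> by (auto intro: borel_measurable_continuous_onI)
  have "(\<integral>\<^sup>+x. indicator B x * ennreal ((v (x - y) - v x)\<^sup>2) \<partial>lborel)
     \<le> (\<integral>\<^sup>+x. (\<integral>\<^sup>+t. indicator B x * (indicator {0..1} t * ennreal ((norm y)\<^sup>2 * (norm (grad v (x - t *\<^sub>R y)))\<^sup>2)) \<partial>lborel) \<partial>lborel)"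
    using smooth_line_estimate[OF v] by (intro nn_integral_mono) (auto simp: nn_integral_cmult intro!: mult_left_mono)
  also have "\<dots> = (\<integral>\<^sup>+t. (\<integral>\<^sup>+x. indicator B x * (indicator {0..1} t * ennreal ((norm y)\<^sup>2 * (norm (grad v (x - t *\<^sub>R y)))\<^sup>2)) \<partial>lborel) \<partial>lborel)"
    by (rule lborel_pair.Fubini') measurable
  also have "\<dots> \<le> (\<integral>\<^sup>+t. indicator {0..1::real} t * (ennreal ((norm y)\<^sup>2) * (\<integral>\<^sup>+x. indicator \<Omega> x * ennreal ((norm (grad v x))\<^sup>2) \<partial>lborel)) \<partial>lborel)"
  proof (rule nn_integral_mono)
    fix t :: real
    show "(\<integral>\<^sup>+x. indicator B x * (indicator {0..1} t * ennreal ((norm y)\<^sup>2 * (norm (grad v (x - t *\<^sub>R y)))\<^sup>2)) \<partial>lborel)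
      \<le> indicator {0..1} t * (ennreal ((norm y)\<^sup>2) * (\<integral>\<^sup>+x. indicator \<Omega> x * ennreal ((norm (grad v x))\<^sup>2) \<partial>lborel))"
    proof (cases "t \<in> {0..1}")
      case True
      have "(\<integral>\<^sup>+x. indicator B x * (indicator {0..1} t * ennreal ((norm y)\<^sup>2 * (norm (grad v (x - t *\<^sub>R y)))\<^sup>2)) \<partial>lborel)
        \<le> (\<integral>\<^sup>+x. ennreal ((norm y)\<^sup>2) * (indicator \<Omega> (x - t *\<^sub>R y) * ennreal ((norm (grad v (x - t *\<^sub>R y)))\<^sup>2)) \<partial>lborel)"
        using True seg by (intro nn_integral_mono) (auto simp: indicator_def ennreal_mult)
      also have "\<dots> = ennreal ((norm y)\<^sup>2) * (\<integral>\<^sup>+x. indicator \<Omega> (x - t *\<^sub>R y) * ennreal ((norm (grad v (x - t *\<^sub>R y)))\<^sup>2) \<partial>lborel)"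
        by (rule nn_integral_cmult) measurable
      also have "(\<integral>\<^sup>+x. indicator \<Omega> (x - t *\<^sub>R y) * ennreal ((norm (grad v (x - t *\<^sub>R y)))\<^sup>2) \<partial>lborel)
         = (\<integral>\<^sup>+x. indicator \<Omega> x * ennreal ((norm (grad v x))\<^sup>2) \<partial>lborel)"
        by (rule nn_integral_lborel_minus[of "\<lambda>x. indicator \<Omega> x * ennreal ((norm (grad v x))\<^sup>2)"]) measurable
      finally show ?thesis using True by simp
    qed simp
  qed
  also have "\<dots> = ennreal ((norm y)\<^sup>2) * (\<integral>\<^sup>+x. indicator \<Omega> x * ennreal ((norm (grad v x))\<^sup>2) \<partial>lborel)"
    by (subst nn_integral_multc) auto
  finally show ?thesis .
qed

section \<open>The smoothing operator and its convergence\<close>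

context smoothing
begin

text \<open>The weights stand outside the convolution. Hence the kernel at \<open>p\<close> matters
  only at points where \<open>\<psi> p\<close> is nonzero, and there the cone condition keeps all
  arguments in \<Omega>. Differentiating the weights creates extra terms; they vanish in the limit
  because the derivatives of the weights sum to 0.\<close>

definition S :: "nat \<Rightarrow> (real^'n \<Rightarrow> real) \<Rightarrow> real^'n \<Rightarrow> real" where
  "S m u x = (\<Sum>p\<in>P. \<psi> p x * moll \<Omega> (k m p) u x)"

lemma dom_borel: "\<Omega> \<in> sets borel" "\<Omega> \<in> sets lebesgue"
  using open_dom by auto

lemma k_cont: "p \<in> P \<Longrightarrow> continuous_on UNIV (k m p)"
  by (rule smooth_continuous[OF k_smooth])

lemma k_supp': "p \<in> P \<Longrightarrow> k m p y \<noteq> 0 \<Longrightarrow> y \<in> closure {y. k m p y \<noteq> 0}"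
  by (rule subsetD[OF closure_subset]) simp

lemma k_0: "p \<in> P \<Longrightarrow> norm y > 1 \<Longrightarrow> k m p y = 0"
proof (rule ccontr)
  assume "p \<in> P" "norm y > 1" "k m p y \<noteq> 0"
  then have "norm y \<le> inverse (real (Suc m))" using k_supp k_supp' by blast
  also have "\<dots> \<le> 1" by (simp add: divide_simps)
  finally show False using \<open>norm y > 1\<close> by simp
qed

lemma k_integrable: "p \<in> P \<Longrightarrow> integrable lborel (k m p)"
  using integrable_continuous_compact_support[OF k_cont k_0] by blast

lemma S_smooth: "integrable (lebesgue_on \<Omega>) u \<Longrightarrow> smooth (S m u)"
  unfolding S_def[abs_def] by (intro smooth_sum smooth_mult psi_smooth moll_smooth[OF open_dom bounded_dom] k_smooth)

text \<open>A convex combination of averages cannot exceed \<open>K\<close>. This preservation of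
  bounds makes smooth functions usable as approximations of bounded test functions against an
  integrand that is only integrable.\<close>

lemma S_bound:
  assumes "integrable (lebesgue_on \<Omega>) u" "AE x in lebesgue_on \<Omega>. \<bar>u x\<bar> \<le> K" "K \<ge> 0" and x: "x \<in> \<Omega>"
  shows "\<bar>S m u x\<bar> \<le> K"
proof -
  have "\<bar>S m u x\<bar> \<le> (\<Sum>p\<in>P. \<bar>\<psi> p x * moll \<Omega> (k m p) u x\<bar>)" unfolding S_def by (rule sum_abs)
  also have "\<dots> \<le> (\<Sum>p\<in>P. \<psi> p x * K)"
  proof (rule sum_mono)
    fix p assume p: "p \<in> P"
    have "\<bar>moll \<Omega> (k m p) u x\<bar> \<le> K"
      by (rule moll_bound[OF open_dom bounded_dom k_cont k_nonneg k_integrable k_int]) (use p assms in auto)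
    then show "\<bar>\<psi> p x * moll \<Omega> (k m p) u x\<bar> \<le> \<psi> p x * K"
      using psi_01[OF p, of x] by (simp add: abs_mult mult_left_mono)
  qed
  also have "\<dots> = K" using psi_sum[OF x] by (simp flip: sum_distrib_right)
  finally show ?thesis .
qed

lemma S_diff: "x \<in> \<Omega> \<Longrightarrow> S m u x - u x = (\<Sum>p\<in>P. \<psi> p x * (moll \<Omega> (k m p) u x - u x))"
  using psi_sum[of x] by (simp add: S_def right_diff_distrib sum_subtractf flip: sum_distrib_right)

text \<open>The common bridge from translates to convolutions. The weight \<open>w\<close> is
  \<open>\<psi> p\<close> or one of its partial derivatives; both vanish where
  \<open>\<psi> p\<close> does, so only admissible points contribute. The hypothesis
  \<open>est\<close> is filled by continuity of translations for convergence and by the gradient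
  bound for the rate.\<close>

lemma local_estimate:
  assumes p: "p \<in> P" and u: "sqint (lebesgue_on \<Omega>) u"
    and U: "U \<in> borel_measurable borel" "\<And>x. x \<notin> \<Omega> \<Longrightarrow> U x = 0" "AE x in lebesgue_on \<Omega>. u x = U x"
    and w: "continuous_on UNIV w" "\<And>x. x \<in> \<Omega> \<Longrightarrow> \<bar>w x\<bar> \<le> W" "\<And>x. \<psi> p x = 0 \<Longrightarrow> w x = 0"
    and est: "\<And>y. k m p y \<noteq> 0 \<Longrightarrow> (\<integral>\<^sup>+x. indicator (\<Omega> \<inter> {x. \<psi> p x \<noteq> 0}) x * ennreal ((U (x - y) - U x)\<^sup>2) \<partial>lborel) \<le> ennreal \<epsilon>"
    and "\<epsilon> \<ge> 0"
  shows "sqint (lebesgue_on \<Omega>) (\<lambda>x. w x * (moll \<Omega> (k m p) u x - u x))"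
    and "sqn (lebesgue_on \<Omega>) (\<lambda>x. w x * (moll \<Omega> (k m p) u x - u x)) \<le> W\<^sup>2 * \<epsilon>"
proof -
  define B where "B = \<Omega> \<inter> {x. \<psi> p x \<noteq> 0}"
  have B: "B \<in> sets borel"
    unfolding B_def using open_dom smooth_continuous[OF psi_smooth[OF p]]
    by (intro borel_open open_Int open_Collect_neq) auto
  have um: "u \<in> borel_measurable (lebesgue_on \<Omega>)" using u by (simp add: sqint_def)
  have ui: "integrable (lebesgue_on \<Omega>) u" using sqint_integrable[OF open_dom bounded_dom u] .
  have "integrable (lebesgue_on \<Omega>) U"
    using integrable_cong_AE_imp[OF ui borel_measurable_lebesgue_onI[OF U(1)]] U(3) by (auto elim: eventually_mono)
  then have Ui: "integrable lborel U" using integrable_lebesgue_on_lborel[OF U(1) dom_borel(1) U(2)] by blast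
  define c where "c x = (LINT z|lborel. k m p (x - z) * U z)" for x
  have c: "moll \<Omega> (k m p) u x = c x" for x
    using moll_cong_AE[OF open_dom bounded_dom k_cont[OF p] um U(3)]
      moll_lborel[OF open_dom bounded_dom k_cont[OF p] U(1,2)] by (simp add: c_def)
  have "continuous_on UNIV (moll \<Omega> (k m p) u)" by (rule moll_continuous[OF open_dom bounded_dom k_cont[OF p] ui])
  then have [measurable]: "c \<in> borel_measurable borel" unfolding c[abs_def] by (simp add: borel_measurable_continuous_onI)
  have [measurable]: "U \<in> borel_measurable borel" "B \<in> sets borel" by fact+
  let ?q = "\<lambda>x. indicator B x * (c x - U x)"
  have "(\<integral>\<^sup>+x. indicator B x * ennreal ((c x - U x)\<^sup>2) \<partial>lborel) \<le> ennreal \<epsilon>"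
    unfolding c_def
    by (rule convolution_L2_estimate[OF k_cont k_nonneg k_0 k_int Ui B])
      (use p est in \<open>auto simp: B_def\<close>)
  moreover have "(\<integral>\<^sup>+x. indicator B x * ennreal ((c x - U x)\<^sup>2) \<partial>lborel) = (\<integral>\<^sup>+x. ennreal ((norm (?q x))\<^sup>2) \<partial>lborel)"
    by (intro nn_integral_cong) (auto simp: indicator_def)
  ultimately have le: "(\<integral>\<^sup>+x. ennreal ((norm (?q x))\<^sup>2) \<partial>lborel) \<le> ennreal \<epsilon>" by simp
  have "(\<integral>\<^sup>+x. ennreal (norm ((norm (?q x))\<^sup>2)) \<partial>lborel) < \<infinity>"
    using le by (auto simp: less_top[symmetric] top_unique)
  then have i: "integrable lborel (\<lambda>x. (norm (?q x))\<^sup>2)"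
    by (intro integrableI_bounded) measurable
  then have q: "sqint lborel ?q" unfolding sqint_def by simp
  have "sqn lborel ?q \<le> \<epsilon>"
    using le \<open>\<epsilon> \<ge> 0\<close> unfolding sqn_def by (subst (asm) nn_integral_eq_integral[OF i]) auto
  moreover have qb: "?q \<in> borel_measurable borel" "\<And>x. x \<notin> \<Omega> \<Longrightarrow> ?q x = 0" by (measurable, auto simp: B_def)
  ultimately have q': "sqint (lebesgue_on \<Omega>) ?q" "sqn (lebesgue_on \<Omega>) ?q \<le> \<epsilon>"
    using q sqint_lebesgue_on_lborel[OF qb(1) dom_borel(1) qb(2)] sqn_lebesgue_on_lborel[OF qb(1) dom_borel(1) qb(2)] by auto
  have m: "(\<lambda>x. w x * (moll \<Omega> (k m p) u x - u x)) \<in> borel_measurable (lebesgue_on \<Omega>)"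
    unfolding c using um continuous_borel_measurable_lebesgue_on[OF w(1), of \<Omega>] borel_measurable_lebesgue_onI[of c \<Omega>]
    by auto
  have ae: "AE x in lebesgue_on \<Omega>. norm (w x * (moll \<Omega> (k m p) u x - u x)) \<le> W * norm (?q x)"
    using U(3) AE_space
  proof eventually_elim
    case (elim x)
    then have x: "x \<in> \<Omega>" by (simp add: space_restrict_space)
    show ?case
    proof (cases "\<psi> p x = 0")
      case True then show ?thesis using w(2)[OF x] w(3) by simp
    next
      case False
      then have "?q x = c x - u x" using x elim by (simp add: B_def)
      then show ?thesis unfolding c using w(2)[OF x] by (simp add: abs_mult mult_right_mono)
    qed
  qed
  show "sqint (lebesgue_on \<Omega>) (\<lambda>x. w x * (moll \<Omega> (k m p) u x - u x))"
    by (rule sqint_bound(1)[OF q'(1) m ae])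
  have "sqn (lebesgue_on \<Omega>) (\<lambda>x. w x * (moll \<Omega> (k m p) u x - u x)) \<le> W\<^sup>2 * sqn (lebesgue_on \<Omega>) ?q"
    by (rule sqint_bound(2)[OF q'(1) m ae])
  also have "\<dots> \<le> W\<^sup>2 * \<epsilon>" using q'(2) by (intro mult_left_mono) auto
  finally show "sqn (lebesgue_on \<Omega>) (\<lambda>x. w x * (moll \<Omega> (k m p) u x - u x)) \<le> W\<^sup>2 * \<epsilon>" .
qed

lemma moll_sqint:
  assumes p: "p \<in> P" and u: "sqint (lebesgue_on \<Omega>) u" and w: "continuous_on UNIV w"
  shows "sqint (lebesgue_on \<Omega>) (\<lambda>x. w x * (moll \<Omega> (k m p) u x - u x))"
  by (intro sqint_continuous_mult[OF open_dom bounded_dom w] sqint_diff u sqint_continuous[OF open_dom bounded_dom]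
      moll_continuous[OF open_dom bounded_dom k_cont[OF p] sqint_integrable[OF open_dom bounded_dom u]])

lemma local_convergence:
  assumes p: "p \<in> P" and u: "sqint (lebesgue_on \<Omega>) u"
    and w: "continuous_on UNIV w" "\<And>x. \<psi> p x = 0 \<Longrightarrow> w x = 0"
  shows "(\<lambda>m. sqn (lebesgue_on \<Omega>) (\<lambda>x. w x * (moll \<Omega> (k m p) u x - u x))) \<longlonglongrightarrow> 0"
proof (rule LIMSEQ_I)
  fix e :: real assume "e > 0"
  obtain W where W: "W \<ge> 0" "\<And>x. x \<in> \<Omega> \<Longrightarrow> norm (w x) \<le> W" using continuous_bounded_dom[OF open_dom bounded_dom w(1)] by blast
  have um: "u \<in> borel_measurable (lebesgue_on \<Omega>)" using u by (simp add: sqint_def)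
  obtain U where U: "U \<in> borel_measurable borel" "\<And>x. x \<notin> \<Omega> \<Longrightarrow> U x = 0" "AE x in lebesgue_on \<Omega>. u x = U x"
    using ex_borel_representative[OF um dom_borel(1)] by blast
  have "sqint (lebesgue_on \<Omega>) U"
    by (rule sqint_bound(1)[OF u borel_measurable_lebesgue_onI[OF U(1)], of 1]) (use U(3) in \<open>auto elim: eventually_mono\<close>)
  then have Us: "sqint lborel U" using sqint_lebesgue_on_lborel[OF U(1) dom_borel(1) U(2)] by blast
  obtain r where r: "\<And>x. x \<in> \<Omega> \<Longrightarrow> norm x \<le> r" using bounded_dom by (auto simp: bounded_iff)
  have U0: "U x = 0" if "norm x > r" for x using U(2)[of x] r[of x] that by fastforce
  \<comment> \<open>The summand 1 covers W = 0, and the factor 2 makes the final inequality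
    strict.\<close>
  define \<epsilon> where "\<epsilon> = e / (2 * (W\<^sup>2 + 1))"
  have \<epsilon>: "\<epsilon> > 0" "W\<^sup>2 * \<epsilon> < e"
  proof -
    have "W\<^sup>2 + 1 > 0" by (rule add_nonneg_pos) auto
    then show "\<epsilon> > 0" "W\<^sup>2 * \<epsilon> < e" using \<open>e > 0\<close> by (auto simp: \<epsilon>_def divide_simps algebra_simps add_pos_nonneg)
  qed
  obtain \<delta> where \<delta>: "\<delta> > 0" "\<And>y. norm y \<le> \<delta> \<Longrightarrow> sqn lborel (\<lambda>x. U (x - y) - U x) \<le> \<epsilon>"
    using L2_translation_continuous[OF Us U0 \<epsilon>(1)] by blast
  obtain N where N: "inverse (real (Suc N)) < \<delta>" using reals_Archimedean[OF \<delta>(1)] by blast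
  have "norm (sqn (lebesgue_on \<Omega>) (\<lambda>x. w x * (moll \<Omega> (k m p) u x - u x)) - 0) < e" if m: "m \<ge> N" for m
  proof -
    have "sqn (lebesgue_on \<Omega>) (\<lambda>x. w x * (moll \<Omega> (k m p) u x - u x)) \<le> W\<^sup>2 * \<epsilon>"
    proof (rule local_estimate(2)[OF p u U w(1) _ w(2)])
      fix y assume y: "k m p y \<noteq> 0"
      have "norm y \<le> inverse (real (Suc m))" using k_supp k_supp' p y by blast
      also have "\<dots> \<le> inverse (real (Suc N))" using m by (simp add: le_imp_inverse_le)
      finally have sy: "sqn lborel (\<lambda>x. U (x - y) - U x) \<le> \<epsilon>" using N by (intro \<delta>(2)) simp
      have sq: "sqint lborel (\<lambda>x. U (x - y) - U x)"
        by (intro sqint_diff Us) (use Us sqint_lborel_minus[OF U(1)] in blast)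
      have "(\<integral>\<^sup>+x. indicator (\<Omega> \<inter> {x. \<psi> p x \<noteq> 0}) x * ennreal ((U (x - y) - U x)\<^sup>2) \<partial>lborel) \<le> (\<integral>\<^sup>+x. ennreal ((norm (U (x - y) - U x))\<^sup>2) \<partial>lborel)"
        by (intro nn_integral_mono) (auto simp: indicator_def)
      also have "\<dots> = ennreal (sqn lborel (\<lambda>x. U (x - y) - U x))"
        using sq unfolding sqn_def by (intro nn_integral_eq_integral) (auto simp: sqint_def)
      also have "\<dots> \<le> ennreal \<epsilon>" by (rule ennreal_leI[OF sy])
      finally show "(\<integral>\<^sup>+x. indicator (\<Omega> \<inter> {x. \<psi> p x \<noteq> 0}) x * ennreal ((U (x - y) - U x)\<^sup>2) \<partial>lborel) \<le> ennreal \<epsilon>" .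
    qed (use W \<epsilon> in auto)
    then show ?thesis using \<epsilon>(2) by simp
  qed
  then show "\<exists>N. \<forall>m\<ge>N. norm (sqn (lebesgue_on \<Omega>) (\<lambda>x. w x * (moll \<Omega> (k m p) u x - u x)) - 0) < e" by blast
qed

lemma sqn_cong_dom:
  fixes f g :: "real^'n \<Rightarrow> 'b::euclidean_space"
  assumes "\<And>x. x \<in> \<Omega> \<Longrightarrow> f x = g x"
  shows "sqn (lebesgue_on \<Omega>) f = sqn (lebesgue_on \<Omega>) g"
  unfolding sqn_def by (rule Bochner_Integration.integral_cong) (use assms in \<open>auto simp: space_restrict_space\<close>)

lemma S_tendsto:
  assumes u: "sqint (lebesgue_on \<Omega>) u"
  shows "(\<lambda>m. sqn (lebesgue_on \<Omega>) (\<lambda>x. S m u x - u x)) \<longlonglongrightarrow> 0"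
proof -
  have "sqn (lebesgue_on \<Omega>) (\<lambda>x. S m u x - u x) = sqn (lebesgue_on \<Omega>) (\<lambda>x. \<Sum>p\<in>P. \<psi> p x * (moll \<Omega> (k m p) u x - u x))" for m
    by (rule sqn_cong_dom[OF S_diff])
  moreover have "(\<lambda>m. sqn (lebesgue_on \<Omega>) (\<lambda>x. \<Sum>p\<in>P. \<psi> p x * (moll \<Omega> (k m p) u x - u x))) \<longlonglongrightarrow> 0"
    by (intro sqn_tendsto_0_sum fin moll_sqint local_convergence u smooth_continuous psi_smooth)
  ultimately show ?thesis by simp
qed

text \<open>A zero of a nonnegative function is a minimum.\<close>

lemma partial_psi_0: "p \<in> P \<Longrightarrow> \<psi> p x = 0 \<Longrightarrow> partial i (\<psi> p) x = 0"
  by (rule DERIV_local_min[OF smooth_deriv[OF psi_smooth], of p 1]) (use psi_01 in auto)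

lemma sum_partial_psi:
  assumes x: "x \<in> \<Omega>"
  shows "(\<Sum>p\<in>P. partial i (\<psi> p) x) = 0"
proof -
  have d: "((\<lambda>t. \<Sum>p\<in>P. \<psi> p (x + t *\<^sub>R axis i 1)) has_real_derivative (\<Sum>p\<in>P. partial i (\<psi> p) x)) (at 0)"
    by (intro DERIV_sum smooth_deriv psi_smooth)
  have "open ((\<lambda>t. x + t *\<^sub>R axis i 1) -` \<Omega>)"
    by (intro open_vimage open_dom continuous_intros)
  then have "\<forall>\<^sub>F t in nhds 0. t \<in> (\<lambda>t. x + t *\<^sub>R axis i 1) -` \<Omega>"
    using x by (intro eventually_nhds_in_open) auto
  then have "\<forall>\<^sub>F t in nhds 0. (\<Sum>p\<in>P. \<psi> p (x + t *\<^sub>R axis i 1)) = 1"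
    by eventually_elim (simp add: psi_sum)
  then have "((\<lambda>t. \<Sum>p\<in>P. \<psi> p (x + t *\<^sub>R axis i 1)) has_real_derivative 0) (at 0)"
    by (subst DERIV_cong_ev[OF refl _ refl, of _ "\<lambda>_. 1"]) auto
  then show ?thesis using d DERIV_unique by blast
qed

text \<open>With x fixed, z \<mapsto> k(x - z) is a test function in \<Omega>, since x minus the
  support of the kernel lies in \<Omega>. The weak gradient may therefore be tested with it; the
  sign from the reflection cancels the sign of integration by parts.\<close>

lemma moll_weak_partial:
  assumes u: "is_weak_grad \<Omega> u g" and p: "p \<in> P" and x: "x \<in> \<Omega>" "\<psi> p x \<noteq> 0"
  shows "partial i (moll \<Omega> (k m p) u) x = moll \<Omega> (k m p) (\<lambda>z. g z $ i) x"
proof -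
  define \<phi> where "\<phi> z = k m p (x + (-1) *\<^sub>R z)" for z
  have sm: "smooth \<phi>" unfolding \<phi>_def by (rule smooth_affine[OF k_smooth[OF p]])
  have par: "partial i \<phi> z = - partial i (k m p) (x - z)" for z
    unfolding \<phi>_def by (subst partial_affine[OF k_smooth[OF p]]) simp
  let ?K = "(\<lambda>y. x - y) ` closure {y. k m p y \<noteq> 0}"
  have "bounded (closure {y. k m p y \<noteq> 0})"
    unfolding bounded_iff using k_supp[OF p] by blast
  then have "compact (closure {y. k m p y \<noteq> 0})" by (simp add: compact_eq_bounded_closed)
  then have K: "compact ?K" by (intro compact_continuous_image continuous_intros)
  have "{z. \<phi> z \<noteq> 0} \<subseteq> ?K"
  proof
    fix z assume "z \<in> {z. \<phi> z \<noteq> 0}"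
    then have "x - z \<in> closure {y. k m p y \<noteq> 0}" using k_supp'[OF p] by (simp add: \<phi>_def)
    then show "z \<in> ?K" by (rule rev_image_eqI) simp
  qed
  then have cl: "closure {z. \<phi> z \<noteq> 0} \<subseteq> ?K" using K by (intro closure_minimal compact_imp_closed)
  have "?K \<subseteq> \<Omega>" using k_cone[OF p _ x, where t = 1 and m = m] by auto
  with cl have "test_fun \<Omega> \<phi>" unfolding test_fun_def using sm K
    by (meson closed_closure closed_subset compact_Int_closed compact_closure bounded_subset compact_imp_bounded closure_subset subset_trans)
  then have "(LINT z|lebesgue_on \<Omega>. u z * partial i \<phi> z) = - (LINT z|lebesgue_on \<Omega>. g z $ i * \<phi> z)"
    by (rule weak_gradD(4)[OF u])
  then have "(LINT z|lebesgue_on \<Omega>. partial i (k m p) (x - z) * u z) = (LINT z|lebesgue_on \<Omega>. k m p (x - z) * g z $ i)"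
    by (simp add: par \<phi>_def mult.commute)
  then show ?thesis
    using partial_moll[OF open_dom bounded_dom k_smooth[OF p] sqint_integrable[OF open_dom bounded_dom weak_gradD(1)[OF u]]]
    by (simp add: moll_def[OF open_dom bounded_dom])
qed

text \<open>The weights sum to 1 and their derivatives to 0, so \<open>g\<close> and
  \<open>u\<close> can be subtracted inside the sums. Both sums then consist of convolution errors,
  the first for \<open>u\<close> and the second for its gradient.\<close>

lemma S_partial_diff:
  assumes u: "is_weak_grad \<Omega> u g" and x: "x \<in> \<Omega>"
  shows "partial i (S m u) x - g x $ i = (\<Sum>p\<in>P. partial i (\<psi> p) x * (moll \<Omega> (k m p) u x - u x))
     + (\<Sum>p\<in>P. \<psi> p x * (moll \<Omega> (k m p) (\<lambda>z. g z $ i) x - g x $ i))"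
proof -
  have ui: "integrable (lebesgue_on \<Omega>) u" using sqint_integrable[OF open_dom bounded_dom weak_gradD(1)[OF u]] .
  have "((\<lambda>t. S m u (x + t *\<^sub>R axis i 1)) has_real_derivative
      (\<Sum>p\<in>P. partial i (\<psi> p) x * moll \<Omega> (k m p) u x + partial i (moll \<Omega> (k m p) u) x * \<psi> p x)) (at 0)"
    unfolding S_def
  proof (rule DERIV_sum)
    fix p assume p: "p \<in> P"
    show "((\<lambda>t. \<psi> p (x + t *\<^sub>R axis i 1) * moll \<Omega> (k m p) u (x + t *\<^sub>R axis i 1)) has_real_derivative
      partial i (\<psi> p) x * moll \<Omega> (k m p) u x + partial i (moll \<Omega> (k m p) u) x * \<psi> p x) (at 0)"
      using DERIV_mult[OF smooth_deriv[OF psi_smooth[OF p], of x i] smooth_deriv[OF moll_smooth[OF open_dom bounded_dom k_smooth[OF p] ui], where x = x and i = i]]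
      by simp
  qed
  then have "partial i (S m u) x = (\<Sum>p\<in>P. partial i (\<psi> p) x * moll \<Omega> (k m p) u x + partial i (moll \<Omega> (k m p) u) x * \<psi> p x)"
    by (rule partialI)
  also have "\<dots> = (\<Sum>p\<in>P. partial i (\<psi> p) x * moll \<Omega> (k m p) u x + \<psi> p x * moll \<Omega> (k m p) (\<lambda>z. g z $ i) x)"
  proof (rule sum.cong[OF refl])
    fix p assume p: "p \<in> P"
    show "partial i (\<psi> p) x * moll \<Omega> (k m p) u x + partial i (moll \<Omega> (k m p) u) x * \<psi> p x =
        partial i (\<psi> p) x * moll \<Omega> (k m p) u x + \<psi> p x * moll \<Omega> (k m p) (\<lambda>z. g z $ i) x"
      using moll_weak_partial[OF u p x] by (cases "\<psi> p x = 0") auto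
  qed
  finally show ?thesis
    using psi_sum[OF x] sum_partial_psi[OF x, of i]
    by (simp add: right_diff_distrib sum_subtractf sum.distrib flip: sum_distrib_right)
qed

lemma S_partial_tendsto:
  assumes u: "is_weak_grad \<Omega> u g"
  shows "(\<lambda>m. sqn (lebesgue_on \<Omega>) (\<lambda>x. partial i (S m u) x - g x $ i)) \<longlonglongrightarrow> 0"
proof -
  have "sqn (lebesgue_on \<Omega>) (\<lambda>x. partial i (S m u) x - g x $ i) =
    sqn (lebesgue_on \<Omega>) (\<lambda>x. (\<Sum>p\<in>P. partial i (\<psi> p) x * (moll \<Omega> (k m p) u x - u x))
     + (\<Sum>p\<in>P. \<psi> p x * (moll \<Omega> (k m p) (\<lambda>z. g z $ i) x - g x $ i)))" for m
    by (rule sqn_cong_dom[OF S_partial_diff[OF u]])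
  moreover have "(\<lambda>m. sqn (lebesgue_on \<Omega>) (\<lambda>x. (\<Sum>p\<in>P. partial i (\<psi> p) x * (moll \<Omega> (k m p) u x - u x))
     + (\<Sum>p\<in>P. \<psi> p x * (moll \<Omega> (k m p) (\<lambda>z. g z $ i) x - g x $ i)))) \<longlonglongrightarrow> 0"
    by (intro sqn_tendsto_0_add sqint_sum sqn_tendsto_0_sum fin moll_sqint local_convergence weak_gradD(1,3)[OF u]
        smooth_continuous psi_smooth smooth_partial partial_psi_0)
  ultimately show ?thesis by simp
qed

lemma S_grad_tendsto:
  assumes u: "is_weak_grad \<Omega> u g"
  shows "(\<lambda>m. sqn (lebesgue_on \<Omega>) (\<lambda>x. grad (S m u) x - g x)) \<longlonglongrightarrow> 0"
proof -
  have sm: "smooth (S m u)" for m by (rule S_smooth[OF sqint_integrable[OF open_dom bounded_dom weak_gradD(1)[OF u]]])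
  have sq: "sqint (lebesgue_on \<Omega>) (\<lambda>x. grad (S m u) x - g x)" for m
    unfolding sqint_vec_iff
    using sqint_diff(1)[OF sqint_continuous[OF open_dom bounded_dom smooth_continuous[OF smooth_partial[OF sm]]] weak_gradD(3)[OF u]]
    by (simp add: grad_def)
  have "(\<lambda>m. \<Sum>i\<in>UNIV. sqn (lebesgue_on \<Omega>) (\<lambda>x. partial i (S m u) x - g x $ i)) \<longlonglongrightarrow> (\<Sum>i::'n\<in>UNIV. 0)"
    by (intro tendsto_sum S_partial_tendsto u)
  moreover have "sqn (lebesgue_on \<Omega>) (\<lambda>x. grad (S m u) x - g x) = (\<Sum>i\<in>UNIV. sqn (lebesgue_on \<Omega>) (\<lambda>x. partial i (S m u) x - g x $ i))" for m
    unfolding sqn_vec[OF sq] by (simp add: grad_def)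
  ultimately show ?thesis by simp
qed

end

section \<open>Calculus of weak gradients\<close>

lemma test_fun_smooth: "test_fun \<Omega> \<phi> \<Longrightarrow> smooth \<phi>"
  by (simp add: test_fun_def)

lemma test_fun_outside:
  fixes \<phi> :: "real^'n \<Rightarrow> real"
  assumes "test_fun \<Omega> \<phi>" "x \<notin> \<Omega>"
  shows "\<phi> x = 0" "partial i \<phi> x = 0"
proof -
  let ?C = "closure {x. \<phi> x \<noteq> 0}"
  have x: "x \<notin> ?C" using assms by (auto simp: test_fun_def)
  have 0: "\<phi> y = 0" if "y \<notin> ?C" for y
  proof (rule ccontr)
    assume "\<phi> y \<noteq> 0"
    then have "y \<in> ?C" by (intro subsetD[OF closure_subset]) simp
    with that show False by contradiction
  qed
  show "\<phi> x = 0" using 0 x by blast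
  have "open ((\<lambda>t::real. x + t *\<^sub>R axis i 1) -` (- ?C))"
    by (intro open_vimage continuous_intros) auto
  then have "\<forall>\<^sub>F t::real in nhds 0. t \<in> (\<lambda>t. x + t *\<^sub>R axis i 1) -` (- ?C)"
    using x by (intro eventually_nhds_in_open) auto
  then have "\<forall>\<^sub>F t::real in nhds 0. \<phi> (x + t *\<^sub>R axis i 1) = 0"
    by eventually_elim (rule 0, simp)
  then have "((\<lambda>t. \<phi> (x + t *\<^sub>R axis i 1)) has_real_derivative 0) (at 0)"
    by (subst DERIV_cong_ev[OF refl _ refl, of _ "\<lambda>_. 0"]) auto
  then show "partial i \<phi> x = 0" by (rule partialI)
qed

lemma deriv_bounded_Lipschitz:
  fixes f f' :: "real \<Rightarrow> real"
  assumes "\<And>s. (f has_real_derivative f' s) (at s)" "\<And>s. s \<in> J \<Longrightarrow> \<bar>f' s\<bar> \<le> K" "convex J" "a \<in> J" "b \<in> J"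
  shows "\<bar>f a - f b\<bar> \<le> K * \<bar>a - b\<bar>"
  using field_differentiable_bound[of J f f' K a b] assms by (auto simp: has_field_derivative_at_within)

lemma is_weak_grad_iff:
  "is_weak_grad \<Omega> u g \<longleftrightarrow> sqint (lebesgue_on \<Omega>) u \<and> sqint (lebesgue_on \<Omega>) g \<and>
    (\<forall>\<phi> i. test_fun \<Omega> \<phi> \<longrightarrow>
        (LINT x|lebesgue_on \<Omega>. u x * partial i \<phi> x) = - (LINT x|lebesgue_on \<Omega>. g x $ i * \<phi> x))"
  by (auto simp: is_weak_grad_def L2_iff_sqint sqint_vec_iff)

lemma sqint_nth: "sqint M g \<Longrightarrow> sqint M (\<lambda>x. g x $ i)" for g :: "'a \<Rightarrow> real^'n"
  by (simp add: sqint_vec_iff)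

context smoothing
begin

abbreviation "M \<equiv> lebesgue_on \<Omega>"

lemma sqint_test: "test_fun \<Omega> \<phi> \<Longrightarrow> sqint M \<phi>" "test_fun \<Omega> \<phi> \<Longrightarrow> sqint M (partial i \<phi>)"
  by (auto intro!: sqint_continuous[OF open_dom bounded_dom] smooth_continuous smooth_partial dest: test_fun_smooth)

lemma integral_mult_tendsto:
  fixes a b :: "(real^'n) \<Rightarrow> real"
  assumes "\<And>m. sqint M (f m)" "sqint M a" "(\<lambda>m. sqn M (\<lambda>x. f m x - a x)) \<longlonglongrightarrow> 0" "sqint M b"
  shows "(\<lambda>m. LINT x|M. f m x * b x) \<longlonglongrightarrow> (LINT x|M. a x * b x)"
proof -
  have "(\<lambda>m. LINT x|M. (f m x - a x) \<bullet> b x) \<longlonglongrightarrow> 0"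
    by (rule inner_tendsto_0) (use assms in \<open>auto intro: sqint_diff\<close>)
  then have "(\<lambda>m. (LINT x|M. f m x * b x) - (LINT x|M. a x * b x)) \<longlonglongrightarrow> 0"
    using assms by (simp add: left_diff_distrib sqint_mult)
  then show ?thesis by (rule LIM_zero_cancel)
qed

lemma sqn_nth_le: "sqint M g \<Longrightarrow> sqn M (\<lambda>x. g x $ i) \<le> sqn M g" for g :: "real^'n \<Rightarrow> real^'n"
  unfolding sqn_vec by (rule member_le_sum) auto

text \<open>For a fixed test function both sides of the defining identity are continuous in L2.
  Every weak gradient of a nonsmooth expression below is obtained through this closedness.\<close>

lemma weak_grad_closed:
  assumes w: "\<And>m. is_weak_grad \<Omega> (f m) (h m)" and u: "sqint M u" and g: "sqint M g"
    and lim: "(\<lambda>m. sqn M (\<lambda>x. f m x - u x)) \<longlonglongrightarrow> 0" "(\<lambda>m. sqn M (\<lambda>x. h m x - g x)) \<longlonglongrightarrow> 0"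
  shows "is_weak_grad \<Omega> u g"
  unfolding is_weak_grad_iff
proof (intro conjI allI impI u g)
  fix \<phi> i assume \<phi>: "test_fun \<Omega> \<phi>"
  have "(\<lambda>m. sqn M (\<lambda>x. h m x $ i - g x $ i)) \<longlonglongrightarrow> 0"
  proof (rule Lim_null_comparison[OF _ lim(2)], intro always_eventually allI)
    fix m show "norm (sqn M (\<lambda>x. h m x $ i - g x $ i)) \<le> sqn M (\<lambda>x. h m x - g x)"
      using sqn_nth_le[OF sqint_diff(1)[OF weak_gradD(2)[OF w[of m]] g], of i] by simp
  qed
  then have "(\<lambda>m. LINT x|M. h m x $ i * \<phi> x) \<longlonglongrightarrow> (LINT x|M. g x $ i * \<phi> x)"
    by (intro integral_mult_tendsto weak_gradD(3)[OF w] sqint_nth g sqint_test \<phi>)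
  moreover have "(\<lambda>m. LINT x|M. f m x * partial i \<phi> x) \<longlonglongrightarrow> (LINT x|M. u x * partial i \<phi> x)"
    by (intro integral_mult_tendsto weak_gradD(1)[OF w] u lim sqint_test \<phi>)
  moreover have "(LINT x|M. f m x * partial i \<phi> x) = - (LINT x|M. h m x $ i * \<phi> x)" for m
    by (rule weak_gradD(4)[OF w \<phi>])
  ultimately show "(LINT x|M. u x * partial i \<phi> x) = - (LINT x|M. g x $ i * \<phi> x)"
    by (simp only:) (rule LIMSEQ_unique[OF _ tendsto_minus])
qed

lemma weak_grad_lincomb:
  assumes u: "is_weak_grad \<Omega> u g" and v: "is_weak_grad \<Omega> v h"
  shows "is_weak_grad \<Omega> (\<lambda>x. a * u x + b * v x) (\<lambda>x. a *\<^sub>R g x + b *\<^sub>R h x)"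
  unfolding is_weak_grad_iff
proof (intro conjI allI impI)
  show "sqint M (\<lambda>x. a * u x + b * v x)"
    using sqint_add(1)[OF sqint_scaleR(1)[OF weak_gradD(1)[OF u], of a] sqint_scaleR(1)[OF weak_gradD(1)[OF v], of b]] by simp
  show "sqint M (\<lambda>x. a *\<^sub>R g x + b *\<^sub>R h x)"
    by (intro sqint_add sqint_scaleR weak_gradD(2)[OF u] weak_gradD(2)[OF v])
  fix \<phi> i assume \<phi>: "test_fun \<Omega> \<phi>"
  have i: "integrable M (\<lambda>x. u x * partial i \<phi> x)" "integrable M (\<lambda>x. v x * partial i \<phi> x)"
    "integrable M (\<lambda>x. g x $ i * \<phi> x)" "integrable M (\<lambda>x. h x $ i * \<phi> x)"
    by (intro sqint_mult sqint_test \<phi> weak_gradD[OF u] weak_gradD[OF v])+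
  have "(LINT x|M. (a * u x + b * v x) * partial i \<phi> x) = a * (LINT x|M. u x * partial i \<phi> x) + b * (LINT x|M. v x * partial i \<phi> x)"
    using i by (simp add: distrib_right mult.assoc)
  also have "\<dots> = - (LINT x|M. (a *\<^sub>R g x + b *\<^sub>R h x) $ i * \<phi> x)"
    using i unfolding weak_gradD(4)[OF u \<phi>] weak_gradD(4)[OF v \<phi>] by (simp add: distrib_right mult.assoc)
  finally show "(LINT x|M. (a * u x + b * v x) * partial i \<phi> x) = - (LINT x|M. (a *\<^sub>R g x + b *\<^sub>R h x) $ i * \<phi> x)" .
qed

lemma weak_grad_diff:
  assumes "is_weak_grad \<Omega> u g" "is_weak_grad \<Omega> v h"
  shows "is_weak_grad \<Omega> (\<lambda>x. u x - v x) (\<lambda>x. g x - h x)"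
  using weak_grad_lincomb[OF assms, of 1 "-1"] by simp

text \<open>The product f(v) \<phi> vanishes outside \<Omega>, so its derivative in a coordinate
  direction integrates to 0 over the space; the product rule splits this into the two sides.\<close>

lemma weak_grad_smooth_comp:
  fixes f f' :: "real \<Rightarrow> real"
  assumes v: "smooth v" and f: "\<And>s. (f has_real_derivative f' s) (at s)" and f': "continuous_on UNIV f'"
  shows "is_weak_grad \<Omega> (\<lambda>x. f (v x)) (\<lambda>x. f' (v x) *\<^sub>R grad v x)"
  unfolding is_weak_grad_iff
proof (intro conjI allI impI)
  have cf: "continuous_on UNIV f" using f by (meson DERIV_isCont continuous_at_imp_continuous_on)
  have cv: "continuous_on UNIV v" by (rule smooth_continuous[OF v])
  have cfv: "continuous_on UNIV (\<lambda>x. f (v x))" "continuous_on UNIV (\<lambda>x. f' (v x))"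
    by (rule continuous_on_compose2[OF cf cv], simp) (rule continuous_on_compose2[OF f' cv], simp)
  have cp: "continuous_on UNIV (partial i v)" for i by (rule smooth_continuous[OF smooth_partial[OF v]])
  show "sqint M (\<lambda>x. f (v x))" by (rule sqint_continuous[OF open_dom bounded_dom cfv(1)])
  show "sqint M (\<lambda>x. f' (v x) *\<^sub>R grad v x)"
    unfolding sqint_vec_iff using sqint_continuous[OF open_dom bounded_dom continuous_on_mult[OF cfv(2) cp]]
    by (simp add: grad_def)
  fix \<phi> i assume \<phi>: "test_fun \<Omega> \<phi>"
  have s\<phi>: "smooth \<phi>" by (rule test_fun_smooth[OF \<phi>])
  have c\<phi>: "continuous_on UNIV \<phi>" "continuous_on UNIV (partial i \<phi>)"
    by (intro smooth_continuous smooth_partial s\<phi>)+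
  let ?h = "\<lambda>x. f (v x) * \<phi> x" and ?d = "\<lambda>x. f (v x) * partial i \<phi> x + (f' (v x) *\<^sub>R grad v x) $ i * \<phi> x"
  have cd: "continuous_on UNIV ?d"
    unfolding grad_def vector_scaleR_component vec_lambda_beta real_scaleR_def
    by (intro continuous_on_add continuous_on_mult cfv cp c\<phi>)
  obtain r where r: "\<And>x. x \<in> \<Omega> \<Longrightarrow> norm x \<le> r" using bounded_dom by (auto simp: bounded_iff)
  have "(LINT x|lborel. ?d x) = 0"
  proof (rule integral_directional_derivative_eq_0[where h = ?h and r = r])
    show "continuous_on UNIV ?h" by (intro continuous_on_mult cfv c\<phi>)
    show "continuous_on UNIV ?d" by (rule cd)
    show "((\<lambda>s. ?h (x + s *\<^sub>R axis i 1)) has_real_derivative ?d (x + t *\<^sub>R axis i 1)) (at t)" for x t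
    proof -
      have "((\<lambda>s. f (v (x + s *\<^sub>R axis i 1))) has_real_derivative f' (v (x + t *\<^sub>R axis i 1)) * partial i v (x + t *\<^sub>R axis i 1)) (at t)"
        by (rule DERIV_chain2[OF f smooth_deriv_at[OF v]])
      from DERIV_mult[OF this smooth_deriv_at[OF s\<phi>]] show ?thesis
        by (simp add: grad_def algebra_simps)
    qed
    show "?h x = 0" if "norm x > r" for x
      using test_fun_outside(1)[OF \<phi>, of x] r[of x] that by fastforce
  qed simp
  moreover have "(LINT x|M. ?d x) = (LINT x|lborel. ?d x)"
    by (rule integral_lebesgue_on_lborel[OF borel_measurable_continuous_onI[OF cd] dom_borel(1)])
      (simp add: test_fun_outside[OF \<phi>])
  moreover have "(LINT x|M. ?d x) = (LINT x|M. f (v x) * partial i \<phi> x) + (LINT x|M. (f' (v x) *\<^sub>R grad v x) $ i * \<phi> x)"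
    by (intro Bochner_Integration.integral_add sqint_mult sqint_test \<phi> \<open>sqint M (\<lambda>x. f (v x))\<close> sqint_nth \<open>sqint M (\<lambda>x. f' (v x) *\<^sub>R grad v x)\<close>)
  ultimately show "(LINT x|M. f (v x) * partial i \<phi> x) = - (LINT x|M. (f' (v x) *\<^sub>R grad v x) $ i * \<phi> x)"
    by linarith
qed

lemma weak_grad_smooth: "smooth v \<Longrightarrow> is_weak_grad \<Omega> v (grad v)"
  using weak_grad_smooth_comp[of v "\<lambda>s. s" "\<lambda>_. 1"] by simp

lemma weak_grad_integrable: "is_weak_grad \<Omega> u g \<Longrightarrow> integrable M u"
  by (rule sqint_integrable[OF open_dom bounded_dom weak_gradD(1)])

text \<open>Passing to a subsequence adds convergence almost everywhere. The last property bounds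
  all members by any essential bound of \<open>u\<close>; together the two permit dominated
  convergence, both in the chain rule and in the formula for the functionals.\<close>

lemma ex_smooth_sequence:
  assumes u: "is_weak_grad \<Omega> u g"
  obtains v where "\<And>m::nat. smooth (v m)" "(\<lambda>m. sqn M (\<lambda>x. v m x - u x)) \<longlonglongrightarrow> 0"
    "(\<lambda>m. sqn M (\<lambda>x. grad (v m) x - g x)) \<longlonglongrightarrow> 0" "AE x in M. (\<lambda>m. v m x) \<longlonglongrightarrow> u x"
    "\<And>K m x. K \<ge> 0 \<Longrightarrow> (AE x in M. \<bar>u x\<bar> \<le> K) \<Longrightarrow> x \<in> \<Omega> \<Longrightarrow> \<bar>v m x\<bar> \<le> K"
proof -
  have sm: "smooth (S m u)" for m by (rule S_smooth[OF weak_grad_integrable[OF u]])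
  have sq: "sqint M (\<lambda>x. S m u x - u x)" for m
    by (intro sqint_diff weak_gradD(1)[OF u] sqint_continuous[OF open_dom bounded_dom] smooth_continuous sm)
  obtain r where r: "strict_mono r" "AE x in M. (\<lambda>m. S (r m) u x - u x) \<longlonglongrightarrow> 0"
    using sqn_tendsto_0_AE_subseq[OF sq S_tendsto[OF weak_gradD(1)[OF u]]] by blast
  show thesis
  proof (rule that[of "\<lambda>m. S (r m) u"])
    show "(\<lambda>m. sqn M (\<lambda>x. S (r m) u x - u x)) \<longlonglongrightarrow> 0"
      using LIMSEQ_subseq_LIMSEQ[OF S_tendsto[OF weak_gradD(1)[OF u]] r(1)] by (simp add: comp_def)
    show "(\<lambda>m. sqn M (\<lambda>x. grad (S (r m) u) x - g x)) \<longlonglongrightarrow> 0"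
      using LIMSEQ_subseq_LIMSEQ[OF S_grad_tendsto[OF u] r(1)] by (simp add: comp_def)
    show "AE x in M. (\<lambda>m. S (r m) u x) \<longlonglongrightarrow> u x" using r(2) by eventually_elim (rule LIM_zero_cancel)
  qed (use sm S_bound[OF weak_grad_integrable[OF u]] in auto)
qed

text \<open>The derivative is bounded only on \<open>J\<close>, which allows functions such as sinh
  on a bounded range. A symmetric interval is inherited by the smooth approximations of
  \<open>u\<close> through their bound, so both \<open>u\<close> and its approximations stay in
  \<open>J\<close>.\<close>

lemma weak_grad_chain:
  fixes f f' :: "real \<Rightarrow> real"
  assumes u: "is_weak_grad \<Omega> u g" and f: "\<And>s. (f has_real_derivative f' s) (at s)"
    and f': "continuous_on UNIV f'" "\<And>s. s \<in> J \<Longrightarrow> \<bar>f' s\<bar> \<le> K"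
    and J: "J = UNIV \<or> (\<exists>c\<ge>0. J = {-c..c})" "AE x in M. u x \<in> J"
  shows "is_weak_grad \<Omega> (\<lambda>x. f (u x)) (\<lambda>x. f' (u x) *\<^sub>R g x)"
proof -
  obtain v where v: "\<And>m::nat. smooth (v m)" "(\<lambda>m. sqn M (\<lambda>x. v m x - u x)) \<longlonglongrightarrow> 0"
    "(\<lambda>m. sqn M (\<lambda>x. grad (v m) x - g x)) \<longlonglongrightarrow> 0" "AE x in M. (\<lambda>m. v m x) \<longlonglongrightarrow> u x"
    "\<And>K m x. K \<ge> 0 \<Longrightarrow> (AE x in M. \<bar>u x\<bar> \<le> K) \<Longrightarrow> x \<in> \<Omega> \<Longrightarrow> \<bar>v m x\<bar> \<le> K"
    using ex_smooth_sequence[OF u] by blast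
  have vJ: "v m x \<in> J" if "x \<in> \<Omega>" for m x
    using J(1)
  proof
    assume "\<exists>c\<ge>0. J = {-c..c}"
    then obtain c where c: "c \<ge> 0" "J = {-c..c}" by blast
    have "AE x in M. \<bar>u x\<bar> \<le> c" using J(2) by eventually_elim (auto simp: c(2))
    then show ?thesis using v(5)[OF c(1) _ that, of m] by (auto simp: c(2) abs_le_iff)
  qed simp
  have J': "convex J" "0 \<in> J" using J(1) by auto
  have aeJ: "AE x in M. u x \<in> J \<and> (\<forall>m. v m x \<in> J)"
    using J(2) AE_space by eventually_elim (use vJ in \<open>auto simp: space_restrict_space\<close>)
  have f'v: "AE x in M. \<bar>f' (v m x)\<bar> \<le> K" for m
    using aeJ by eventually_elim (use f'(2) in blast)
  have cf: "continuous_on UNIV f" using f by (meson DERIV_isCont continuous_at_imp_continuous_on)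
  have [measurable]: "f \<in> borel_measurable borel" "f' \<in> borel_measurable borel"
    using cf f' by (auto intro: borel_measurable_continuous_onI)
  have us: "sqint M u" and gs: "sqint M g" by (rule weak_gradD[OF u])+
  have vs: "sqint M (v m)" and gvs: "sqint M (grad (v m))" for m
    by (rule weak_gradD[OF weak_grad_smooth[OF v(1)]])+
  have [measurable]: "u \<in> borel_measurable M" "g \<in> borel_measurable M"
      "v m \<in> borel_measurable M" "grad (v m) \<in> borel_measurable M" for m
    using us gs vs gvs by (auto simp: sqint_def)
  have lip: "\<bar>f a - f b\<bar> \<le> K * \<bar>a - b\<bar>" if "a \<in> J" "b \<in> J" for a b
    by (rule deriv_bounded_Lipschitz[OF f f'(2) J'(1) that])
  have fu: "sqint M (\<lambda>x. f (u x))"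
  proof -
    have "sqint M (\<lambda>x. f (u x) - f 0)"
      by (rule sqint_bound(1)[OF us, of _ K]) (measurable, use aeJ lip[OF _ J'(2)] in \<open>auto elim!: eventually_mono\<close>)
    from sqint_add(1)[OF this sqint_const[OF open_dom bounded_dom, of "f 0"]] show ?thesis by simp
  qed
  have fg: "sqint M (\<lambda>x. f' (u x) *\<^sub>R g x)"
    by (rule sqint_bound(1)[OF gs, of _ K]) (measurable, use aeJ f'(2) in \<open>auto elim!: eventually_mono intro!: mult_right_mono\<close>)
  show ?thesis
  proof (rule weak_grad_closed[OF weak_grad_smooth_comp[OF v(1) f f'(1)] fu fg])
    show "(\<lambda>m. sqn M (\<lambda>x. f (v m x) - f (u x))) \<longlonglongrightarrow> 0"
    proof (rule sqn_tendsto_0_bound[OF _ _ _ v(2), where K = K])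
      show "sqint M (\<lambda>x. v m x - u x)" for m by (rule sqint_diff(1)[OF vs us])
      show "(\<lambda>x. f (v m x) - f (u x)) \<in> borel_measurable M" for m by measurable
      show "AE x in M. norm (f (v m x) - f (u x)) \<le> K * norm (v m x - u x)" for m
        using aeJ by eventually_elim (use lip in simp)
    qed
    \<comment> \<open>The gradient error is f'(v)(\<nabla>v - g) + (f'(v) - f'(u)) g: bounded times
      convergent in L2, and dominated by 2K|g| with limit 0 almost everywhere.\<close>
    have l1: "(\<lambda>m. sqn M (\<lambda>x. f' (v m x) *\<^sub>R (grad (v m) x - g x))) \<longlonglongrightarrow> 0"
    proof (rule sqn_tendsto_0_bound[OF _ _ _ v(3), where K = K])
      show "sqint M (\<lambda>x. grad (v m) x - g x)" for m by (rule sqint_diff(1)[OF gvs gs])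
      show "(\<lambda>x. f' (v m x) *\<^sub>R (grad (v m) x - g x)) \<in> borel_measurable M" for m by measurable
      show "AE x in M. norm (f' (v m x) *\<^sub>R (grad (v m) x - g x)) \<le> K * norm (grad (v m) x - g x)" for m
        using aeJ by eventually_elim (use f'(2) in \<open>auto intro!: mult_right_mono\<close>)
    qed
    have l2: "(\<lambda>m. sqn M (\<lambda>x. (f' (v m x) - f' (u x)) *\<^sub>R g x)) \<longlonglongrightarrow> 0"
    proof (rule sqn_dominated[OF gs, where K = "2 * K"])
      show "AE x in M. norm ((f' (v m x) - f' (u x)) *\<^sub>R g x) \<le> 2 * K * norm (g x)" for m
        using aeJ
      proof eventually_elim
        case (elim x)
        then have "\<bar>f' (v m x)\<bar> \<le> K" "\<bar>f' (u x)\<bar> \<le> K" using f'(2) by blast+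
        then have "\<bar>f' (v m x) - f' (u x)\<bar> \<le> 2 * K" by linarith
        then show "norm ((f' (v m x) - f' (u x)) *\<^sub>R g x) \<le> 2 * K * norm (g x)"
          unfolding norm_scaleR by (intro mult_right_mono) auto
      qed
      show "AE x in M. (\<lambda>m. (f' (v m x) - f' (u x)) *\<^sub>R g x) \<longlonglongrightarrow> 0"
        using v(4)
      proof eventually_elim
        case (elim x)
        have "isCont f' (u x)" using f'(1) by (simp add: continuous_on_eq_continuous_at)
        then have "(\<lambda>m. f' (v m x)) \<longlonglongrightarrow> f' (u x)" using elim by (rule isCont_tendsto_compose)
        from tendsto_scaleR[OF LIM_zero[OF this] tendsto_const[of "g x"]] show ?case by simp
      qed
    qed measurable
    have "(\<lambda>m. sqn M (\<lambda>x. f' (v m x) *\<^sub>R (grad (v m) x - g x) + (f' (v m x) - f' (u x)) *\<^sub>R g x)) \<longlonglongrightarrow> 0"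
    proof (rule sqn_tendsto_0_add[OF _ _ l1 l2])
      show "sqint M (\<lambda>x. f' (v m x) *\<^sub>R (grad (v m) x - g x))" for m
        by (rule sqint_bound(1)[OF sqint_diff(1)[OF gvs[of m] gs], where K = K]) (measurable, use f'v[of m] in \<open>auto elim!: eventually_mono intro!: mult_right_mono\<close>)
      have "sqint M (\<lambda>x. f' (v m x) *\<^sub>R g x)" for m
        by (rule sqint_bound(1)[OF gs, of _ K]) (measurable, use f'v[of m] in \<open>auto elim!: eventually_mono intro!: mult_right_mono\<close>)
      from sqint_diff(1)[OF this fg] show "sqint M (\<lambda>x. (f' (v m x) - f' (u x)) *\<^sub>R g x)" for m
        by (simp add: scaleR_left_diff_distrib)
    qed
    then show "(\<lambda>m. sqn M (\<lambda>x. f' (v m x) *\<^sub>R grad (v m) x - f' (u x) *\<^sub>R g x)) \<longlonglongrightarrow> 0"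
      by (simp add: scaleR_diff_right scaleR_left_diff_distrib)
  qed
qed

text \<open>For functions that are not continuously differentiable. \<open>F'\<close> is only the
  pointwise limit of the derivatives and may fail to be the derivative of \<open>F\<close> at single
  points; the result on zero levels lives on this discrepancy.\<close>

lemma weak_grad_chain_limit:
  fixes f f' :: "nat \<Rightarrow> real \<Rightarrow> real" and F F' :: "real \<Rightarrow> real"
  assumes u: "is_weak_grad \<Omega> u g" and f: "\<And>m s. (f m has_real_derivative f' m s) (at s)"
    and f': "\<And>m. continuous_on UNIV (f' m)" "\<And>m s. \<bar>f' m s\<bar> \<le> 1"
    and F: "\<And>m s. \<bar>f m s - F s\<bar> \<le> c m" "c \<longlonglongrightarrow> 0" and F': "\<And>s. (\<lambda>m. f' m s) \<longlonglongrightarrow> F' s"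
  shows "is_weak_grad \<Omega> (\<lambda>x. F (u x)) (\<lambda>x. F' (u x) *\<^sub>R g x)"
proof -
  have w: "is_weak_grad \<Omega> (\<lambda>x. f m (u x)) (\<lambda>x. f' m (u x) *\<^sub>R g x)" for m
    by (rule weak_grad_chain[OF u f f', of UNIV]) auto
  have us: "sqint M u" and gs: "sqint M g" by (rule weak_gradD[OF u])+
  have fm: "f m \<in> borel_measurable borel" "f' m \<in> borel_measurable borel" for m
    using f f' by (auto intro!: borel_measurable_continuous_onI) (meson DERIV_isCont continuous_at_imp_continuous_on)
  have lim: "(\<lambda>m. f m s) \<longlonglongrightarrow> F s" for s
  proof (rule LIM_zero_cancel, rule Lim_null_comparison[OF _ F(2)])
    show "\<forall>\<^sub>F m in sequentially. norm (f m s - F s) \<le> c m" using F(1) by simp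
  qed
  have [measurable]: "F \<in> borel_measurable borel" "F' \<in> borel_measurable borel"
    by (rule borel_measurable_LIMSEQ_real[OF lim fm(1)]) (rule borel_measurable_LIMSEQ_real[OF F' fm(2)])
  have [measurable]: "u \<in> borel_measurable M" "g \<in> borel_measurable M" "f m \<in> borel_measurable borel" "f' m \<in> borel_measurable borel" for m
    using us gs fm by (auto simp: sqint_def)
  have F'b: "\<bar>F' s\<bar> \<le> 1" for s
    using LIMSEQ_le_const2[OF tendsto_rabs[OF F'[of s]], of 1] f'(2) by blast
  have d: "sqint M (\<lambda>x. f m (u x) - F (u x))" for m
    by (rule sqint_bound(1)[OF sqint_const[OF open_dom bounded_dom, of "1::real"], of _ "c m"]) (use F(1) in auto)
  show ?thesis
  proof (rule weak_grad_closed[OF w])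
    from sqint_diff(1)[OF weak_gradD(1)[OF w] d, of 0 0] show "sqint M (\<lambda>x. F (u x))" by simp
    show "sqint M (\<lambda>x. F' (u x) *\<^sub>R g x)"
      by (rule sqint_bound(1)[OF gs, of _ 1]) (use F'b in \<open>auto intro!: mult_left_le_one_le\<close>)
    have "sqn M (\<lambda>x. f m (u x) - F (u x)) \<le> (c m)\<^sup>2 * sqn M (\<lambda>x. 1::real)" for m
      by (rule sqint_bound(2)[OF sqint_const[OF open_dom bounded_dom]]) (use F(1) in auto)
    moreover have "(\<lambda>m. (c m)\<^sup>2 * sqn M (\<lambda>x. 1::real)) \<longlonglongrightarrow> 0"
      using tendsto_mult_right[OF tendsto_power[OF F(2), of 2], of "sqn M (\<lambda>x. 1::real)"] by simp
    ultimately show "(\<lambda>m. sqn M (\<lambda>x. f m (u x) - F (u x))) \<longlonglongrightarrow> 0"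
      by (intro Lim_null_comparison[OF _ \<open>(\<lambda>m. (c m)\<^sup>2 * sqn M (\<lambda>x. 1::real)) \<longlonglongrightarrow> 0\<close>]) auto
    show "(\<lambda>m. sqn M (\<lambda>x. f' m (u x) *\<^sub>R g x - F' (u x) *\<^sub>R g x)) \<longlonglongrightarrow> 0"
    proof (rule sqn_dominated[OF gs, where K = 2])
      show "AE x in M. norm (f' m (u x) *\<^sub>R g x - F' (u x) *\<^sub>R g x) \<le> 2 * norm (g x)" for m
      proof (intro AE_I2)
        fix x
        have "\<bar>f' m (u x) - F' (u x)\<bar> \<le> 2" using f'(2)[of m "u x"] F'b[of "u x"] by linarith
        then show "norm (f' m (u x) *\<^sub>R g x - F' (u x) *\<^sub>R g x) \<le> 2 * norm (g x)"
          unfolding scaleR_left_diff_distrib[symmetric] norm_scaleR by (intro mult_right_mono) auto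
      qed
      show "AE x in M. (\<lambda>m. f' m (u x) *\<^sub>R g x - F' (u x) *\<^sub>R g x) \<longlonglongrightarrow> 0"
        by (intro AE_I2 LIM_zero tendsto_scaleR F' tendsto_const)
    qed measurable
  qed
qed

end

section \<open>Approximate Riesz representation and density of test functions\<close>

lemma sqn_eq_0_AE: "sqint M f \<Longrightarrow> sqn M f = 0 \<Longrightarrow> AE x in M. f x = 0"
  using integral_nonneg_eq_0_iff_AE[of M "\<lambda>x. (norm (f x))\<^sup>2"] by (auto simp: sqint_def sqn_def)

lemma sqn_tendsto:
  fixes f :: "nat \<Rightarrow> 'a \<Rightarrow> 'b::euclidean_space"
  assumes f: "\<And>m. sqint M (f m)" and g: "sqint M g" and lim: "(\<lambda>m. sqn M (\<lambda>x. f m x - g x)) \<longlonglongrightarrow> 0"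
  shows "(\<lambda>m. sqn M (f m)) \<longlonglongrightarrow> sqn M g"
proof -
  have d: "sqint M (\<lambda>x. f m x - g x)" for m by (rule sqint_diff(1)[OF f g])
  have eq: "sqn M (f m) = sqn M (\<lambda>x. f m x - g x) + 2 * (LINT x|M. (f m x - g x) \<bullet> g x) + sqn M g" for m
  proof -
    have "(norm (f m x))\<^sup>2 = (norm (f m x - g x))\<^sup>2 + 2 * ((f m x - g x) \<bullet> g x) + (norm (g x))\<^sup>2" for x
      unfolding power2_norm_eq_inner by (simp add: inner_diff_left inner_diff_right inner_commute)
    then show ?thesis using d[of m] g sqint_inner[OF d[of m] g] by (simp add: sqn_def sqint_def)
  qed
  have "(\<lambda>m. LINT x|M. (f m x - g x) \<bullet> g x) \<longlonglongrightarrow> 0"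
    by (rule inner_tendsto_0[OF d g lim order_refl])
  then have "(\<lambda>m. sqn M (\<lambda>x. f m x - g x) + 2 * (LINT x|M. (f m x - g x) \<bullet> g x) + sqn M g) \<longlonglongrightarrow> 0 + 2 * 0 + sqn M g"
    by (intro tendsto_intros lim)
  then show ?thesis by (simp add: eq[symmetric])
qed

text \<open>Minimise B(v,v)/2 - L(v). An exact minimiser would represent \<open>L\<close>; a near
  minimiser \<open>h\<close> does so up to a small multiple of the norm, because varying it in
  direction \<open>v\<close> gives a quadratic polynomial in \<open>t\<close> that is nonnegative up
  to the tolerance.\<close>

lemma approx_riesz:
  fixes V :: "('a \<Rightarrow> real) set" and B :: "('a \<Rightarrow> real) \<Rightarrow> ('a \<Rightarrow> real) \<Rightarrow> real"
  assumes V: "V \<noteq> {}" "\<And>u v a b. u \<in> V \<Longrightarrow> v \<in> V \<Longrightarrow> (\<lambda>x. a * u x + b * v x) \<in> V"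
    and Bsym: "\<And>u v. B u v = B v u"
    and Blin: "\<And>u v w a b. u \<in> V \<Longrightarrow> v \<in> V \<Longrightarrow> w \<in> V \<Longrightarrow> B (\<lambda>x. a * u x + b * v x) w = a * B u w + b * B v w"
    and Bpos: "\<And>u. u \<in> V \<Longrightarrow> B u u \<ge> 0"
    and Llin: "\<And>u v a b. u \<in> V \<Longrightarrow> v \<in> V \<Longrightarrow> L (\<lambda>x. a * u x + b * v x) = a * L u + b * L v"
    and Lb: "\<And>v. v \<in> V \<Longrightarrow> \<bar>L v\<bar> \<le> K * sqrt (B v v)" and e: "e > 0"
  obtains h where "h \<in> V" "\<And>v. v \<in> V \<Longrightarrow> \<bar>L v - B h v\<bar> \<le> e * sqrt (B v v)"
proof -
  define J where "J v = B v v / 2 - L v" for v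
  have bb: "bdd_below (J ` V)"
  proof (rule bdd_belowI2)
    fix v assume v: "v \<in> V"
    let ?t = "sqrt (B v v)"
    have "?t\<^sup>2 = B v v" using Bpos[OF v] by simp
    moreover have "0 \<le> (?t - K)\<^sup>2" by simp
    ultimately have "K * ?t \<le> B v v / 2 + K\<^sup>2 / 2" by (simp add: power2_diff algebra_simps)
    then show "- (K\<^sup>2 / 2) \<le> J v" using Lb[OF v] unfolding J_def by linarith
  qed
  \<comment> \<open>The tolerance is doubled when the inequality is cleared of its factor 1/2, so
    the constant term becomes e^2 and the discriminant gives (B(h,v) - L(v))^2 \<le> e^2
    B(v,v).\<close>
  have "Inf (J ` V) < Inf (J ` V) + e\<^sup>2 / 2" using e by simp
  then obtain h where h: "h \<in> V" "J h < Inf (J ` V) + e\<^sup>2 / 2"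
    using cInf_lessD[of "J ` V"] V(1) by blast
  show thesis
  proof (rule that[OF h(1)])
    fix v assume v: "v \<in> V"
    have "e\<^sup>2 + 2 * t * (B h v - L v) + t\<^sup>2 * B v v \<ge> 0" for t
    proof -
      let ?w = "\<lambda>x. 1 * h x + t * v x"
      have w: "?w \<in> V" by (intro V h v)
      have "B ?w ?w = B h ?w + t * B v ?w" using Blin[OF h(1) v w, of 1 t] by simp
      also have "B h ?w = B h h + t * B h v" using Blin[OF h(1) v h(1), of 1 t] Bsym[of h ?w] Bsym[of v h] by simp
      also have "B v ?w = B h v + t * B v v" using Blin[OF h(1) v v, of 1 t] Bsym[of v ?w] Bsym[of v h] by simp
      finally have Bw: "B ?w ?w = B h h + 2 * t * B h v + t\<^sup>2 * B v v" by (simp add: power2_eq_square algebra_simps)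
      have "L ?w = L h + t * L v" using Llin[OF h(1) v, of 1 t] by simp
      moreover have "Inf (J ` V) \<le> J ?w" using w by (intro cInf_lower bb) auto
      ultimately show ?thesis using h(2) Bw unfolding J_def by (simp add: algebra_simps)
    qed
    from discriminant_le[OF this Bpos[OF v]] have "(B h v - L v)\<^sup>2 \<le> (e * sqrt (B v v))\<^sup>2"
      using Bpos[OF v] by (simp add: power_mult_distrib)
    then have "\<bar>B h v - L v\<bar> \<le> \<bar>e * sqrt (B v v)\<bar>" by (simp only: abs_le_square_iff)
    then show "\<bar>L v - B h v\<bar> \<le> e * sqrt (B v v)" using e Bpos[OF v] by (simp add: abs_minus_commute)
  qed
qed

lemma test_fun_lincomb:
  fixes \<phi> \<psi> :: "real^'n \<Rightarrow> real"
  assumes \<phi>: "test_fun \<Omega> \<phi>" and \<psi>: "test_fun \<Omega> \<psi>"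
  shows "test_fun \<Omega> (\<lambda>x. a * \<phi> x + b * \<psi> x)"
    and "partial i (\<lambda>x. a * \<phi> x + b * \<psi> x) x = a * partial i \<phi> x + b * partial i \<psi> x"
proof -
  have s: "smooth \<phi>" "smooth \<psi>" by (rule test_fun_smooth, fact)+
  let ?f = "\<lambda>x. a * \<phi> x + b * \<psi> x"
  let ?C = "closure {x. \<phi> x \<noteq> 0} \<union> closure {x. \<psi> x \<noteq> 0}"
  have C: "compact ?C" "?C \<subseteq> \<Omega>" using \<phi> \<psi> by (auto simp: test_fun_def)
  have "{x. ?f x \<noteq> 0} \<subseteq> {x. \<phi> x \<noteq> 0} \<union> {x. \<psi> x \<noteq> 0}" by auto
  then have cl: "closure {x. ?f x \<noteq> 0} \<subseteq> ?C" unfolding closure_Un[symmetric] by (rule closure_mono)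
  have "compact (?C \<inter> closure {x. ?f x \<noteq> 0})" by (intro compact_Int_closed C closed_closure)
  moreover have "?C \<inter> closure {x. ?f x \<noteq> 0} = closure {x. ?f x \<noteq> 0}" using cl by blast
  ultimately show "test_fun \<Omega> ?f" unfolding test_fun_def
    using cl C s by (auto intro!: smooth_add smooth_mult smooth_const)
  show "partial i ?f x = a * partial i \<phi> x + b * partial i \<psi> x"
    by (rule partialI) (intro DERIV_add DERIV_cmult smooth_deriv s)
qed

context smoothing
begin

lemma compl_nonempty: "- \<Omega> \<noteq> {}"
proof
  assume "- \<Omega> = {}"
  then have "\<Omega> = UNIV" by blast
  then show False using bounded_dom not_bounded_UNIV by metis
qed

lemma S_test_fun:
  assumes v: "integrable M v" and K: "compact K" "\<And>x. x \<notin> K \<Longrightarrow> v x = 0"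
    and sub: "\<And>x y. x \<in> K \<Longrightarrow> norm y \<le> \<delta> \<Longrightarrow> x + y \<in> \<Omega>" and m: "inverse (real (Suc m)) \<le> \<delta>"
  shows "test_fun \<Omega> (S m v)"
proof -
  let ?T = "{x + y | x y. x \<in> K \<and> y \<in> cball 0 \<delta>}"
  have T: "compact ?T" by (rule compact_sums[OF K(1) compact_cball])
  have TO: "?T \<subseteq> \<Omega>" using sub by auto
  have "{x. S m v x \<noteq> 0} \<subseteq> ?T"
  proof (rule ccontr)
    assume "\<not> {x. S m v x \<noteq> 0} \<subseteq> ?T"
    then obtain x where x: "S m v x \<noteq> 0" "x \<notin> ?T" by blast
    have "k m p (x - z) * v z = 0" if p: "p \<in> P" for p z
    proof (rule ccontr)
      assume "k m p (x - z) * v z \<noteq> 0"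
      then have z: "z \<in> K" "k m p (x - z) \<noteq> 0" using K(2) by auto
      have "norm (x - z) \<le> \<delta>" using k_supp[OF p k_supp'[OF p z(2)]] m by linarith
      then have "z + (x - z) \<in> ?T" using z(1) by (intro CollectI exI[of _ z] exI[of _ "x - z"]) auto
      then show False using x(2) by simp
    qed
    then have "(LINT z|M. k m p (x - z) * v z) = 0" if "p \<in> P" for p
      using that by (intro integral_eq_zero_AE AE_I2)
    then have "S m v x = 0" unfolding S_def moll_def[OF open_dom bounded_dom] by simp
    with x(1) show False by simp
  qed
  then have cl: "closure {x. S m v x \<noteq> 0} \<subseteq> ?T" using T by (intro closure_minimal compact_imp_closed)
  have "compact (?T \<inter> closure {x. S m v x \<noteq> 0})" by (intro compact_Int_closed T closed_closure)
  moreover have "?T \<inter> closure {x. S m v x \<noteq> 0} = closure {x. S m v x \<noteq> 0}" using cl by blast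
  ultimately show ?thesis unfolding test_fun_def using S_smooth[OF v] cl TO by auto
qed

text \<open>Cut \<open>q\<close> down to a compact set in \<Omega>, then smooth with a radius below
  the distance to the boundary, so that the support stays compact in \<Omega>.\<close>

lemma test_fun_dense:
  assumes q: "sqint M q" and e: "e > 0"
  shows "\<exists>\<phi>. test_fun \<Omega> \<phi> \<and> sqn M (\<lambda>x. \<phi> x - q x) < e"
proof -
  define K where "K j = {x. inverse (real (Suc j)) \<le> infdist x (- \<Omega>)}" for j
  have KO: "K j \<subseteq> \<Omega>" for j
  proof
    fix x assume x: "x \<in> K j"
    show "x \<in> \<Omega>"
    proof (rule ccontr)
      assume "x \<notin> \<Omega>"
      then have "infdist x (- \<Omega>) = 0" by (intro infdist_zero) auto
      moreover have "inverse (real (Suc j)) > 0" by simp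
      ultimately show False using x unfolding K_def by (auto simp del: of_nat_Suc)
    qed
  qed
  have Kcl: "closed (K j)" for j unfolding K_def by (intro closed_Collect_le continuous_intros)
  have Kc: "compact (K j)" for j using Kcl bounded_subset[OF bounded_dom KO] by (simp add: compact_eq_bounded_closed)
  have [measurable]: "K j \<in> sets borel" for j using Kcl by simp
  have qm: "q \<in> borel_measurable M" using q by (simp add: sqint_def)
  have im: "(\<lambda>x. indicator (K j) x :: real) \<in> borel_measurable M" for j
    by (rule borel_measurable_lebesgue_onI) measurable
  define qj where "qj j x = indicator (K j) x * q x" for j x
  have qjm: "qj j \<in> borel_measurable M" for j unfolding qj_def using qm im by auto
  have qjs: "sqint M (qj j)" for j
    by (rule sqint_bound(1)[OF q qjm, of _ 1]) (auto simp: qj_def indicator_def)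
  have "(\<lambda>j. sqn M (\<lambda>x. qj j x - q x)) \<longlonglongrightarrow> 0"
  proof (rule sqn_dominated[OF q, where K = 1])
    show "(\<lambda>x. qj j x - q x) \<in> borel_measurable M" for j using qjm qm by auto
    show "AE x in M. norm (qj j x - q x) \<le> 1 * norm (q x)" for j by (auto simp: qj_def indicator_def)
    show "AE x in M. (\<lambda>j. qj j x - q x) \<longlonglongrightarrow> 0"
    proof (rule AE_lebesgue_onI)
      fix x assume x: "x \<in> \<Omega>"
      have "infdist x (- \<Omega>) > 0"
        using x open_dom compl_nonempty infdist_pos_not_in_closed[of "- \<Omega>" x] by (auto simp: closed_def)
      then obtain J where J: "inverse (real (Suc J)) < infdist x (- \<Omega>)" using reals_Archimedean by blast
      show "(\<lambda>j. qj j x - q x) \<longlonglongrightarrow> 0"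
      proof (rule tendsto_eventually, rule eventually_sequentiallyI[of J])
        fix j assume "j \<ge> J"
        then have "inverse (real (Suc j)) \<le> inverse (real (Suc J))" by (simp add: le_imp_inverse_le)
        then have "x \<in> K j" using J unfolding K_def by (simp only: mem_Collect_eq)
        then show "qj j x - q x = 0" by (simp add: qj_def)
      qed
    qed
  qed
  from order_tendstoD(2)[OF this, of "e/4"] obtain j where j: "sqn M (\<lambda>x. qj j x - q x) < e/4"
    using e by (auto simp: eventually_sequentially)
  have qji: "integrable M (qj j)" by (rule sqint_integrable[OF open_dom bounded_dom qjs])
  from order_tendstoD(2)[OF S_tendsto[OF qjs[of j]], of "e/4"] obtain m0
    where m0: "\<And>m. m \<ge> m0 \<Longrightarrow> sqn M (\<lambda>x. S m (qj j) x - qj j x) < e/4"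
    using e by (auto simp: eventually_sequentially)
  \<comment> \<open>The second entry makes the smoothing radius at most half of the distance 1/(j+1)
    that separates \<open>K j\<close> from the complement; half, because the contradiction with that
    distance has to be strict.\<close>
  define m where "m = max m0 (2 * Suc j)"
  define \<delta> where "\<delta> = inverse (real (Suc j)) / 2"
  have "real (2 * Suc j) \<le> real (Suc m)" by (simp add: m_def)
  then have "inverse (real (Suc m)) \<le> inverse (real (2 * Suc j))" by (intro le_imp_inverse_le) auto
  also have "\<dots> = \<delta>" unfolding \<delta>_def of_nat_mult by (simp only: inverse_mult_distrib) simp
  finally have m\<delta>: "inverse (real (Suc m)) \<le> \<delta>" .
  have "test_fun \<Omega> (S m (qj j))"
  proof (rule S_test_fun[OF qji Kc[of j] _ _ m\<delta>])
    show "qj j x = 0" if "x \<notin> K j" for x using that by (simp add: qj_def)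
    fix x y :: "real^'n" assume x: "x \<in> K j" and y: "norm y \<le> \<delta>"
    show "x + y \<in> \<Omega>"
    proof (rule ccontr)
      assume "x + y \<notin> \<Omega>"
      then have "infdist x (- \<Omega>) \<le> dist x (x + y)" by (intro infdist_le) auto
      also have "\<dots> \<le> \<delta>" using y by (simp add: dist_norm)
      finally have "inverse (real (Suc j)) \<le> \<delta>" using x by (simp add: K_def)
      moreover have "inverse (real (Suc j)) > 0" by simp
      ultimately show False unfolding \<delta>_def by linarith
    qed
  qed
  moreover have "sqn M (\<lambda>x. (S m (qj j) x - qj j x) + (qj j x - q x)) \<le> 2 * sqn M (\<lambda>x. S m (qj j) x - qj j x) + 2 * sqn M (\<lambda>x. qj j x - q x)"
    by (intro sqint_add sqint_diff qjs q sqint_test calculation)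
  then have "sqn M (\<lambda>x. S m (qj j) x - q x) < e" using j m0[of m] by (simp add: m_def)
  ultimately show ?thesis by blast
qed

lemma test_fun_dense_seq:
  assumes q: "sqint M q"
  obtains \<phi> where "\<And>m::nat. test_fun \<Omega> (\<phi> m)" "(\<lambda>m. sqn M (\<lambda>x. \<phi> m x - q x)) \<longlonglongrightarrow> 0"
proof -
  have "\<exists>\<phi>. test_fun \<Omega> \<phi> \<and> sqn M (\<lambda>x. \<phi> x - q x) < inverse (real (Suc m))" for m
    by (rule test_fun_dense[OF q]) simp
  then obtain \<phi> where \<phi>: "\<And>m. test_fun \<Omega> (\<phi> m)" "\<And>m. sqn M (\<lambda>x. \<phi> m x - q x) < inverse (real (Suc m))" by metis
  have "(\<lambda>m. sqn M (\<lambda>x. \<phi> m x - q x)) \<longlonglongrightarrow> 0"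
  proof (rule Lim_null_comparison[OF _ LIMSEQ_inverse_real_of_nat], intro always_eventually allI)
    fix m show "norm (sqn M (\<lambda>x. \<phi> m x - q x)) \<le> inverse (real (Suc m))"
      using \<phi>(2)[of m] by (simp del: of_nat_Suc)
  qed
  with \<phi>(1) show thesis by (rule that)
qed

text \<open>The difference of two weak gradients is orthogonal to all test functions; approximating
  the difference itself by test functions shows that its norm is 0.\<close>

lemma weak_grad_unique:
  assumes g: "is_weak_grad \<Omega> u g" and h: "is_weak_grad \<Omega> u h"
  shows "AE x in M. g x = h x"
proof -
  have "AE x in M. g x $ i - h x $ i = 0" for i
  proof (rule sqn_eq_0_AE)
    show d: "sqint M (\<lambda>x. g x $ i - h x $ i)" by (rule sqint_diff(1)[OF weak_gradD(3)[OF g] weak_gradD(3)[OF h]])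
    obtain \<phi> where \<phi>: "\<And>m::nat. test_fun \<Omega> (\<phi> m)" "(\<lambda>m. sqn M (\<lambda>x. \<phi> m x - (g x $ i - h x $ i))) \<longlonglongrightarrow> 0"
      using test_fun_dense_seq[OF d] by blast
    have "(\<lambda>m. LINT x|M. \<phi> m x * (g x $ i - h x $ i)) \<longlonglongrightarrow> (LINT x|M. (g x $ i - h x $ i) * (g x $ i - h x $ i))"
      by (intro integral_mult_tendsto sqint_test \<phi> d)
    moreover have "(LINT x|M. \<phi> m x * (g x $ i - h x $ i)) = 0" for m
      using weak_gradD(4)[OF g \<phi>(1)[of m], of i] weak_gradD(4)[OF h \<phi>(1)[of m], of i]
        sqint_mult[OF sqint_test(1)[OF \<phi>(1)[of m]] weak_gradD(3)[OF g, of i]]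
        sqint_mult[OF sqint_test(1)[OF \<phi>(1)[of m]] weak_gradD(3)[OF h, of i]]
      by (simp add: right_diff_distrib mult.commute)
    ultimately have "(LINT x|M. (g x $ i - h x $ i) * (g x $ i - h x $ i)) = 0" by (simp add: LIMSEQ_const_iff)
    then show "sqn M (\<lambda>x. g x $ i - h x $ i) = 0" by (simp add: sqn_def power2_eq_square)
  qed
  then have "AE x in M. \<forall>i. g x $ i - h x $ i = 0" by (simp add: AE_all_countable)
  then show ?thesis by eventually_elim (simp add: vec_eq_iff)
qed

lemma weak_grad_cong_AE:
  assumes u: "is_weak_grad \<Omega> u g" and ae: "AE x in M. g x = h x"
  shows "is_weak_grad \<Omega> u h"
proof -
  have hm: "h \<in> borel_measurable M"
    using borel_measurable_lebesgue_on_AE[OF _ dom_borel(2) ae] weak_gradD(2)[OF u] by (simp add: sqint_def)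
  have hs: "sqint M h"
    by (rule sqint_bound(1)[OF weak_gradD(2)[OF u] hm, of 1]) (use ae in \<open>auto elim: eventually_mono\<close>)
  show ?thesis unfolding is_weak_grad_iff
  proof (intro conjI allI impI hs weak_gradD(1)[OF u])
    fix \<phi> i assume \<phi>: "test_fun \<Omega> \<phi>"
    have "(LINT x|M. g x $ i * \<phi> x) = (LINT x|M. h x $ i * \<phi> x)"
    proof (rule integral_cong_AE)
      show "(\<lambda>x. g x $ i * \<phi> x) \<in> borel_measurable M" "(\<lambda>x. h x $ i * \<phi> x) \<in> borel_measurable M"
        using sqint_mult[OF weak_gradD(3)[OF u] sqint_test(1)[OF \<phi>]] sqint_mult[OF sqint_nth[OF hs] sqint_test(1)[OF \<phi>]] by blast+
      show "AE x in M. g x $ i * \<phi> x = h x $ i * \<phi> x" using ae by eventually_elim simp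
    qed
    then show "(LINT x|M. u x * partial i \<phi> x) = - (LINT x|M. h x $ i * \<phi> x)"
      using weak_gradD(4)[OF u \<phi>] by simp
  qed
qed

section \<open>Absolute value, level sets and truncation\<close>

lemma weak_grad_const: "is_weak_grad \<Omega> (\<lambda>x. c) (\<lambda>x. 0)"
proof -
  have "grad (\<lambda>x::real^'n. c) = (\<lambda>x. 0)"
    by (auto simp: grad_def fun_eq_iff vec_eq_iff intro!: partialI)
  then show ?thesis using weak_grad_smooth[OF smooth_const, of c] by simp
qed

lemma weak_grad_shift: "is_weak_grad \<Omega> u g \<Longrightarrow> is_weak_grad \<Omega> (\<lambda>x. u x - c) g"
  using weak_grad_diff[OF _ weak_grad_const] by fastforce

text \<open>The smooth functions sqrt(s^2 + \<epsilon>^2) differ from |s| by at most \<epsilon>, and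
  their derivatives tend to \<open>sgn\<close>, with the value 0 at s = 0.\<close>

lemma weak_grad_abs:
  assumes u: "is_weak_grad \<Omega> u g"
  shows "is_weak_grad \<Omega> (\<lambda>x. \<bar>u x\<bar>) (\<lambda>x. sgn (u x) *\<^sub>R g x)"
proof -
  define \<epsilon> where "\<epsilon> m = inverse (real (Suc m))" for m
  have \<epsilon>: "\<epsilon> m > 0" "\<epsilon> \<longlonglongrightarrow> 0" for m unfolding \<epsilon>_def using LIMSEQ_inverse_real_of_nat by auto
  have pos: "s\<^sup>2 + (\<epsilon> m)\<^sup>2 > 0" for s m using \<epsilon>(1)[of m] by (intro add_nonneg_pos) auto
  have le: "\<bar>s\<bar> \<le> sqrt (s\<^sup>2 + (\<epsilon> m)\<^sup>2)" "sqrt (s\<^sup>2 + (\<epsilon> m)\<^sup>2) \<le> \<bar>s\<bar> + \<epsilon> m" for s m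
  proof -
    show "\<bar>s\<bar> \<le> sqrt (s\<^sup>2 + (\<epsilon> m)\<^sup>2)" by (rule real_le_rsqrt) simp
    show "sqrt (s\<^sup>2 + (\<epsilon> m)\<^sup>2) \<le> \<bar>s\<bar> + \<epsilon> m"
      using sqrt_sum_squares_le_sum_abs[of s "\<epsilon> m"] \<epsilon>(1)[of m] by simp
  qed
  show ?thesis
  proof (rule weak_grad_chain_limit[OF u, where f = "\<lambda>m s. sqrt (s\<^sup>2 + (\<epsilon> m)\<^sup>2)"
        and f' = "\<lambda>m s. s / sqrt (s\<^sup>2 + (\<epsilon> m)\<^sup>2)" and c = \<epsilon>])
    show "((\<lambda>s. sqrt (s\<^sup>2 + (\<epsilon> m)\<^sup>2)) has_real_derivative s / sqrt (s\<^sup>2 + (\<epsilon> m)\<^sup>2)) (at s)" for m s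
      using pos[of s m] by (auto intro!: derivative_eq_intros simp: divide_simps)
    show "continuous_on UNIV (\<lambda>s. s / sqrt (s\<^sup>2 + (\<epsilon> m)\<^sup>2))" for m
      using pos[of _ m] by (intro continuous_intros) (metis less_irrefl real_sqrt_eq_zero_cancel_iff)
    show "\<bar>s / sqrt (s\<^sup>2 + (\<epsilon> m)\<^sup>2)\<bar> \<le> 1" for m s
      using le(1)[of s m] pos[of s m] by (simp add: divide_le_eq)
    show "\<bar>sqrt (s\<^sup>2 + (\<epsilon> m)\<^sup>2) - \<bar>s\<bar>\<bar> \<le> \<epsilon> m" for m s using le[of s m] by linarith
    show "\<epsilon> \<longlonglongrightarrow> 0" by (rule \<epsilon>(2))
    show "(\<lambda>m. s / sqrt (s\<^sup>2 + (\<epsilon> m)\<^sup>2)) \<longlonglongrightarrow> sgn s" for s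
    proof (cases "s = 0")
      case False
      have "(\<lambda>m. s / sqrt (s\<^sup>2 + (\<epsilon> m)\<^sup>2)) \<longlonglongrightarrow> s / sqrt (s\<^sup>2 + 0\<^sup>2)"
        by (intro tendsto_intros \<epsilon>(2)) (use False in auto)
      then show ?thesis by (simp add: real_sgn_eq)
    qed simp
  qed
qed

text \<open>\<epsilon> arctan(s/\<epsilon>) tends to 0 uniformly, while its derivatives tend to the
  indicator of s = 0. So the zero function has the gradient \<open>g\<close> restricted to the zero
  level as a weak gradient, and uniqueness forces it to vanish.\<close>

lemma weak_grad_zero_level:
  assumes u: "is_weak_grad \<Omega> u g"
  shows "AE x in M. u x = 0 \<longrightarrow> g x = 0"
proof -
  define \<epsilon> where "\<epsilon> m = inverse (real (Suc m))" for m
  have \<epsilon>: "\<epsilon> m > 0" "\<epsilon> \<longlonglongrightarrow> 0" for m unfolding \<epsilon>_def using LIMSEQ_inverse_real_of_nat by auto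
  have "is_weak_grad \<Omega> (\<lambda>x. (\<lambda>s. 0) (u x)) (\<lambda>x. (\<lambda>s. if s = 0 then 1 else 0) (u x) *\<^sub>R g x)"
  proof (rule weak_grad_chain_limit[OF u, where f = "\<lambda>m s. \<epsilon> m * arctan (s / \<epsilon> m)"
        and f' = "\<lambda>m s. 1 / (1 + (s / \<epsilon> m)\<^sup>2)" and c = "\<lambda>m. 2 * \<epsilon> m" and F = "\<lambda>s. 0" and F' = "\<lambda>s. if s = 0 then 1 else 0"])
    have pos: "1 + (s / \<epsilon> m)\<^sup>2 > 0" for s m by (intro add_pos_nonneg) auto
    show "((\<lambda>s. \<epsilon> m * arctan (s / \<epsilon> m)) has_real_derivative 1 / (1 + (s / \<epsilon> m)\<^sup>2)) (at s)" for m s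
      using \<epsilon>(1)[of m] by (auto intro!: derivative_eq_intros simp: divide_inverse)
    show "continuous_on UNIV (\<lambda>s. 1 / (1 + (s / \<epsilon> m)\<^sup>2))" for m
      using pos[of _ m] \<epsilon>(1)[of m] by (intro continuous_intros) (auto simp: less_imp_neq[symmetric])
    show "\<bar>1 / (1 + (s / \<epsilon> m)\<^sup>2)\<bar> \<le> 1" for m s using pos[of s m] by (simp add: divide_le_eq)
    show "\<bar>\<epsilon> m * arctan (s / \<epsilon> m) - 0\<bar> \<le> 2 * \<epsilon> m" for m s
    proof -
      have "\<bar>arctan (s / \<epsilon> m)\<bar> \<le> 2" using arctan_bounded[of "s / \<epsilon> m"] pi_less_4 by linarith
      then show ?thesis using \<epsilon>(1)[of m] by (simp add: abs_mult)
    qed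
    show "(\<lambda>m. 2 * \<epsilon> m) \<longlonglongrightarrow> 0" using tendsto_mult_left[OF \<epsilon>(2), of 2] by simp
    show "(\<lambda>m. 1 / (1 + (s / \<epsilon> m)\<^sup>2)) \<longlonglongrightarrow> (if s = 0 then 1 else 0)" for s
    proof (cases "s = 0")
      case False
      have "(\<lambda>m. (\<epsilon> m)\<^sup>2 / ((\<epsilon> m)\<^sup>2 + s\<^sup>2)) \<longlonglongrightarrow> 0\<^sup>2 / (0\<^sup>2 + s\<^sup>2)"
        by (intro tendsto_intros \<epsilon>(2)) (use False in auto)
      moreover have "1 / (1 + (s / \<epsilon> m)\<^sup>2) = (\<epsilon> m)\<^sup>2 / ((\<epsilon> m)\<^sup>2 + s\<^sup>2)" for m
        using \<epsilon>(1)[of m] by (simp add: field_simps)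
      ultimately show ?thesis using False by simp
    qed simp
  qed
  from weak_grad_unique[OF this weak_grad_const] show ?thesis
    by eventually_elim (auto split: if_splits)
qed

lemma weak_grad_level: "is_weak_grad \<Omega> u g \<Longrightarrow> AE x in M. u x = c \<longrightarrow> g x = 0"
  using weak_grad_zero_level[OF weak_grad_shift, of u g c] by simp

lemma weak_grad_trunc:
  assumes u: "is_weak_grad \<Omega> u g" and \<kappa>: "\<kappa> > 0"
  shows "is_weak_grad \<Omega> (\<lambda>x. trunc \<kappa> (u x)) (\<lambda>x. if \<bar>u x\<bar> < \<kappa> then g x else 0)"
proof -
  \<comment> \<open>The truncation is half of |s + \<kappa>| - |s - \<kappa>|. The formula gives a
    gradient g/2 on the levels \<plusminus>\<kappa>; it is zero there because \<open>g\<close>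
    vanishes on level sets.\<close>
  have "is_weak_grad \<Omega> (\<lambda>x. 1/2 * \<bar>u x - (-\<kappa>)\<bar> + (-1/2) * \<bar>u x - \<kappa>\<bar>)
      (\<lambda>x. (1/2) *\<^sub>R sgn (u x - (-\<kappa>)) *\<^sub>R g x + (-1/2) *\<^sub>R sgn (u x - \<kappa>) *\<^sub>R g x)"
    by (intro weak_grad_lincomb weak_grad_abs weak_grad_shift u)
  moreover have "1/2 * \<bar>s - (-\<kappa>)\<bar> + (-1/2) * \<bar>s - \<kappa>\<bar> = trunc \<kappa> s" for s
    using \<kappa> by (auto simp: trunc_def abs_if max_def min_def field_simps)
  ultimately have w: "is_weak_grad \<Omega> (\<lambda>x. trunc \<kappa> (u x))
      (\<lambda>x. (1/2) *\<^sub>R sgn (u x - (-\<kappa>)) *\<^sub>R g x + (-1/2) *\<^sub>R sgn (u x - \<kappa>) *\<^sub>R g x)" by simp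
  show ?thesis
  proof (rule weak_grad_cong_AE[OF w])
    show "AE x in M. (1/2) *\<^sub>R sgn (u x - (-\<kappa>)) *\<^sub>R g x + (-1/2) *\<^sub>R sgn (u x - \<kappa>) *\<^sub>R g x = (if \<bar>u x\<bar> < \<kappa> then g x else 0)"
      using weak_grad_level[OF u, of \<kappa>] weak_grad_level[OF u, of "- \<kappa>"]
    proof eventually_elim
      case (elim x)
      have half: "(1/2) *\<^sub>R v + (1/2) *\<^sub>R v = v" for v :: "real^'n"
        by (simp flip: scaleR_left_distrib)
      consider "u x = \<kappa>" | "u x = - \<kappa>" | "\<bar>u x\<bar> < \<kappa>" | "u x > \<kappa>" | "u x < - \<kappa>" by linarith
      then show ?case using elim \<kappa> half by cases (auto simp: sgn_if abs_if)
    qed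
  qed
qed

text \<open>Against a test function the gradient is moved off \<open>z n\<close>, which tends to 0;
  density of test functions and the bound on the gradients extend this to every square integrable
  \<open>q\<close>.\<close>

lemma weak_convergence:
  assumes w: "\<And>n::nat. is_weak_grad \<Omega> (z n) (h n)" and lim: "(\<lambda>n. sqn M (z n)) \<longlonglongrightarrow> 0"
    and B: "\<And>n. sqn M (h n) \<le> B" and q: "sqint M q"
  shows "(\<lambda>n. LINT x|M. h n x \<bullet> q x) \<longlonglongrightarrow> 0"
proof -
  have comp: "(\<lambda>n. LINT x|M. h n x $ i * q x $ i) \<longlonglongrightarrow> 0" for i
  proof (rule LIMSEQ_I)
    fix e :: real assume e: "e > 0"
    have B0: "B \<ge> 0" using order_trans[OF sqn_nonneg B] .
    \<comment> \<open>Chosen so that Cauchy-Schwarz bounds the error of replacing the component of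
      \<open>q\<close> by a test function by e/2; the summand 1 covers B = 0.\<close>
    define d where "d = (e/2)\<^sup>2 / (B + 1)"
    have d: "d > 0" "sqrt (B * d) \<le> e/2"
    proof -
      show "d > 0" using e B0 by (simp add: d_def)
      have "B * d \<le> (e/2)\<^sup>2" using B0 e by (simp add: d_def divide_simps mult_right_mono)
      then show "sqrt (B * d) \<le> e/2" using e by (intro real_le_lsqrt) auto
    qed
    obtain \<phi> where \<phi>: "test_fun \<Omega> \<phi>" "sqn M (\<lambda>x. \<phi> x - q x $ i) < d"
      using test_fun_dense[OF sqint_nth[OF q] d(1)] by blast
    have "(\<lambda>n. LINT x|M. z n x \<bullet> partial i \<phi> x) \<longlonglongrightarrow> 0"
      by (rule inner_tendsto_0[OF weak_gradD(1)[OF w] sqint_test(2)[OF \<phi>(1)] lim order_refl])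
    then obtain N where N: "\<And>n. n \<ge> N \<Longrightarrow> \<bar>LINT x|M. z n x * partial i \<phi> x\<bar> < e/2"
      using LIMSEQ_D[of _ 0 "e/2"] e by fastforce
    show "\<exists>N. \<forall>n\<ge>N. norm ((LINT x|M. h n x $ i * q x $ i) - 0) < e"
    proof (intro exI[of _ N] allI impI)
      fix n assume n: "n \<ge> N"
      have h: "sqint M (\<lambda>x. h n x $ i)" by (rule weak_gradD(3)[OF w])
      have dq: "sqint M (\<lambda>x. \<phi> x - q x $ i)" by (intro sqint_diff sqint_test \<phi> sqint_nth q)
      have "(LINT x|M. h n x $ i * q x $ i) = (LINT x|M. h n x $ i * \<phi> x) - (LINT x|M. h n x $ i \<bullet> (\<phi> x - q x $ i))"
        using sqint_mult[OF h sqint_test(1)[OF \<phi>(1)]] sqint_mult[OF h sqint_nth[OF q, of i]] by (simp add: right_diff_distrib)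
      moreover have "\<bar>LINT x|M. h n x $ i * \<phi> x\<bar> < e/2" using N[OF n] weak_gradD(4)[OF w \<phi>(1)] by simp
      moreover have "\<bar>LINT x|M. h n x $ i \<bullet> (\<phi> x - q x $ i)\<bar> \<le> e/2"
      proof -
        have "\<bar>LINT x|M. h n x $ i \<bullet> (\<phi> x - q x $ i)\<bar> \<le> sqrt (sqn M (\<lambda>x. h n x $ i) * sqn M (\<lambda>x. \<phi> x - q x $ i))"
          by (rule sqint_Cauchy_Schwarz[OF h dq])
        also have "\<dots> \<le> sqrt (B * d)"
          using \<phi>(2) B0 order_trans[OF sqn_nth_le[OF weak_gradD(2)[OF w]] B]
          by (intro real_sqrt_le_mono mult_mono) auto
        finally show ?thesis using d(2) by linarith
      qed
      ultimately show "norm ((LINT x|M. h n x $ i * q x $ i) - 0) < e" by simp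
    qed
  qed
  have "(LINT x|M. h n x \<bullet> q x) = (\<Sum>i\<in>UNIV. LINT x|M. h n x $ i * q x $ i)" for n
    unfolding inner_vec_def inner_real_def
    by (intro Bochner_Integration.integral_sum sqint_mult weak_gradD(3)[OF w] sqint_nth q)
  then show ?thesis using tendsto_sum[of UNIV, OF comp] by simp
qed

lemma weak_strong_convergence:
  assumes w: "\<And>n::nat. is_weak_grad \<Omega> (z n) (h n)" and lim: "(\<lambda>n. sqn M (z n)) \<longlonglongrightarrow> 0"
    and B: "\<And>n. sqn M (h n) \<le> B" and q: "sqint M q" and qn: "\<And>n. sqint M (qn n)"
    and ql: "(\<lambda>n. sqn M (\<lambda>x. qn n x - q x)) \<longlonglongrightarrow> 0"
  shows "(\<lambda>n. LINT x|M. h n x \<bullet> qn n x) \<longlonglongrightarrow> 0"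
proof -
  have h: "sqint M (h n)" for n by (rule weak_gradD(2)[OF w])
  have "(\<lambda>n. LINT x|M. (qn n x - q x) \<bullet> h n x) \<longlonglongrightarrow> 0"
    by (rule inner_tendsto_0[OF _ h ql B]) (intro sqint_diff q qn)
  moreover have "(LINT x|M. (qn n x - q x) \<bullet> h n x) = (LINT x|M. h n x \<bullet> qn n x) - (LINT x|M. h n x \<bullet> q x)" for n
    unfolding inner_commute[of _ "h n _"] inner_diff_right
    by (intro Bochner_Integration.integral_diff sqint_inner h qn q)
  ultimately show ?thesis using tendsto_add[OF _ weak_convergence[OF w lim B q]] by fastforce
qed

end

section \<open>Compactness\<close>

lemma Cauchy_subsequence_diagonal:
  fixes d :: "nat \<Rightarrow> nat \<Rightarrow> real" and c :: "nat \<Rightarrow> real"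
  assumes c: "c \<longlonglongrightarrow> 0"
    and sub: "\<And>m s. strict_mono (s :: nat \<Rightarrow> nat) \<Longrightarrow> \<exists>r. strict_mono (r :: nat \<Rightarrow> nat) \<and> (\<forall>i j. d (s (r i)) (s (r j)) \<le> c m)"
  obtains r :: "nat \<Rightarrow> nat" where "strict_mono r" "\<And>e. e > 0 \<Longrightarrow> \<exists>N. \<forall>i\<ge>N. \<forall>j\<ge>N. d (r i) (r j) \<le> e"
proof -
  interpret subseqs "\<lambda>m s. \<forall>i j. d (s i) (s j) \<le> c m"
    by unfold_locales (use sub in \<open>auto simp: comp_def\<close>)
  show thesis
  proof (rule that[OF subseq_diagseq])
    fix e :: real assume "e > 0"
    then obtain m where m: "c m < e" using order_tendstoD(2)[OF c] by (auto simp: eventually_sequentially)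
    \<comment> \<open>From index \<open>Suc m\<close> on, the diagonal sequence runs inside the m-th
      extraction, and the property is inherited by subsequences.\<close>
    have h: "\<forall>i j. d ((diagseq \<circ> (+) (Suc m)) i) ((diagseq \<circ> (+) (Suc m)) j) \<le> c m"
      by (rule diagseq_holds) auto
    show "\<exists>N. \<forall>i\<ge>N. \<forall>j\<ge>N. d (diagseq i) (diagseq j) \<le> e"
    proof (intro exI[of _ "Suc m"] allI impI)
      fix i j assume "i \<ge> Suc m" "j \<ge> Suc m"
      then have "Suc m + (i - Suc m) = i" "Suc m + (j - Suc m) = j" by auto
      then have "d (diagseq i) (diagseq j) \<le> c m"
        using h[rule_format, of "i - Suc m" "j - Suc m"] by (simp only: comp_apply)
      then show "d (diagseq i) (diagseq j) \<le> e" using m by simp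
    qed
  qed
qed

context smoothing
begin

text \<open>Known for smooth functions, and carried over to \<open>u\<close> by Fatou along the
  smooth sequence. Convergence is needed at x and at x - y for almost every x, hence the second
  almost everywhere statement, obtained by translation; the cone condition puts x - y in
  \<Omega>.\<close>

lemma translation_H1:
  assumes u: "is_weak_grad \<Omega> u g"
    and U: "U \<in> borel_measurable borel" "\<And>x. x \<notin> \<Omega> \<Longrightarrow> U x = 0" "AE x in M. u x = U x"
    and p: "p \<in> P" and y: "y \<in> closure {y. k m p y \<noteq> 0}"
  shows "(\<integral>\<^sup>+x. indicator (\<Omega> \<inter> {x. \<psi> p x \<noteq> 0}) x * ennreal ((U (x - y) - U x)\<^sup>2) \<partial>lborel)
    \<le> ennreal ((norm y)\<^sup>2 * sqn M g)"
proof -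
  define B where "B = \<Omega> \<inter> {x. \<psi> p x \<noteq> 0}"
  have B: "B \<in> sets borel"
    unfolding B_def using open_dom smooth_continuous[OF psi_smooth[OF p]]
    by (intro borel_open open_Int open_Collect_neq) auto
  have seg: "x - t *\<^sub>R y \<in> \<Omega>" if "x \<in> B" "0 \<le> t" "t \<le> 1" for x t
    using k_cone[OF p y _ _ that(2,3)] that(1) by (auto simp: B_def)
  obtain v where v: "\<And>m::nat. smooth (v m)" "(\<lambda>m. sqn M (\<lambda>x. v m x - u x)) \<longlonglongrightarrow> 0"
    "(\<lambda>m. sqn M (\<lambda>x. grad (v m) x - g x)) \<longlonglongrightarrow> 0" "AE x in M. (\<lambda>m. v m x) \<longlonglongrightarrow> u x"
    "\<And>K m x. K \<ge> 0 \<Longrightarrow> (AE x in M. \<bar>u x\<bar> \<le> K) \<Longrightarrow> x \<in> \<Omega> \<Longrightarrow> \<bar>v m x\<bar> \<le> K"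
    using ex_smooth_sequence[OF u] by blast
  have gv: "sqint M (grad (v m))" for m by (rule weak_gradD(2)[OF weak_grad_smooth[OF v(1)]])
  have [measurable]: "v j \<in> borel_measurable borel" "grad (v j) \<in> borel_measurable borel" for j
    using smooth_continuous[OF v(1)] smooth_grad_continuous[OF v(1)] by (auto intro: borel_measurable_continuous_onI)
  have [measurable]: "B \<in> sets borel" "\<Omega> \<in> sets borel" using B dom_borel by auto
  have "AE x in M. (\<lambda>j. v j x) \<longlonglongrightarrow> U x" using U(3) v(4) by eventually_elim simp
  then have ae: "AE x in lborel. x \<in> \<Omega> \<longrightarrow> (\<lambda>j. v j x) \<longlonglongrightarrow> U x"
    unfolding AE_lebesgue_on_iff[OF dom_borel(2)] AE_completion_iff .
  have ae': "AE x in lborel. x - y \<in> \<Omega> \<longrightarrow> (\<lambda>j. v j (x - y)) \<longlonglongrightarrow> U (x - y)"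
  proof -
    have "AE x in distr lborel borel (\<lambda>x. x - y). x \<in> \<Omega> \<longrightarrow> (\<lambda>j. v j x) \<longlonglongrightarrow> U x"
      unfolding lborel_distr_minus by (rule ae)
    from AE_distrD[OF _ this] show ?thesis by simp
  qed
  have gle: "(\<integral>\<^sup>+x. indicator \<Omega> x * ennreal ((norm (grad (v j) x))\<^sup>2) \<partial>lborel) = ennreal (sqn M (grad (v j)))" for j
  proof -
    let ?q = "\<lambda>x. indicator \<Omega> x *\<^sub>R grad (v j) x"
    have q: "?q \<in> borel_measurable borel" "\<And>x. x \<notin> \<Omega> \<Longrightarrow> ?q x = 0" by auto
    have "sqint M ?q" by (rule sqint_bound(1)[OF gv[of j] borel_measurable_lebesgue_onI[OF q(1)], of 1]) (auto simp: indicator_def)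
    then have "sqint lborel ?q" using sqint_lebesgue_on_lborel[OF q(1) dom_borel(1) q(2)] by blast
    then have "(\<integral>\<^sup>+x. ennreal ((norm (?q x))\<^sup>2) \<partial>lborel) = ennreal (sqn lborel ?q)"
      unfolding sqn_def by (intro nn_integral_eq_integral) (auto simp: sqint_def)
    also have "sqn lborel ?q = sqn M ?q" using sqn_lebesgue_on_lborel[OF q(1) dom_borel(1) q(2)] by simp
    also have "\<dots> = sqn M (grad (v j))" by (rule sqn_cong_dom) simp
    also have "(\<integral>\<^sup>+x. ennreal ((norm (?q x))\<^sup>2) \<partial>lborel) = (\<integral>\<^sup>+x. indicator \<Omega> x * ennreal ((norm (grad (v j) x))\<^sup>2) \<partial>lborel)"
      by (intro nn_integral_cong) (auto simp: indicator_def)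
    finally show ?thesis .
  qed
  have "(\<integral>\<^sup>+x. indicator B x * ennreal ((U (x - y) - U x)\<^sup>2) \<partial>lborel)
     \<le> (\<integral>\<^sup>+x. liminf (\<lambda>j. indicator B x * ennreal ((v j (x - y) - v j x)\<^sup>2)) \<partial>lborel)"
  proof (rule nn_integral_mono_AE)
    show "AE x in lborel. indicator B x * ennreal ((U (x - y) - U x)\<^sup>2) \<le> liminf (\<lambda>j. indicator B x * ennreal ((v j (x - y) - v j x)\<^sup>2))"
      using ae ae'
    proof eventually_elim
      case (elim x)
      show ?case
      proof (cases "x \<in> B")
        case True
        then have "x \<in> \<Omega>" "x - y \<in> \<Omega>" using seg[OF True, of 1] by (auto simp: B_def)
        then have "(\<lambda>j. ennreal ((v j (x - y) - v j x)\<^sup>2)) \<longlonglongrightarrow> ennreal ((U (x - y) - U x)\<^sup>2)"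
          using elim by (intro tendsto_intros) auto
        from lim_imp_Liminf[OF trivial_limit_sequentially this] show ?thesis using True by simp
      qed simp
    qed
  qed
  also have "\<dots> \<le> liminf (\<lambda>j. \<integral>\<^sup>+x. indicator B x * ennreal ((v j (x - y) - v j x)\<^sup>2) \<partial>lborel)"
    by (rule nn_integral_liminf) measurable
  also have "\<dots> \<le> liminf (\<lambda>j. ennreal ((norm y)\<^sup>2 * sqn M (grad (v j))))"
  proof (intro Liminf_mono always_eventually allI)
    fix j
    show "(\<integral>\<^sup>+x. indicator B x * ennreal ((v j (x - y) - v j x)\<^sup>2) \<partial>lborel) \<le> ennreal ((norm y)\<^sup>2 * sqn M (grad (v j)))"
      using smooth_shift_estimate[OF v(1)[of j] B dom_borel(1), of y] seg unfolding gle by (simp add: ennreal_mult)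
  qed
  also have "\<dots> = ennreal ((norm y)\<^sup>2 * sqn M g)"
    by (intro lim_imp_Liminf tendsto_intros sqn_tendsto[OF gv weak_gradD(2)[OF u] v(3)]) simp
  finally show ?thesis by (simp add: B_def)
qed

text \<open>The error depends on \<open>u\<close> only through the norm of its gradient. This
  uniformity is what \<open>S_tendsto\<close> lacks and what compactness requires.\<close>

lemma S_rate:
  assumes u: "is_weak_grad \<Omega> u g"
  shows "sqn M (\<lambda>x. S m u x - u x) \<le> (real (card P))\<^sup>2 * ((inverse (real (Suc m)))\<^sup>2 * sqn M g)"
proof -
  have us: "sqint M u" by (rule weak_gradD(1)[OF u])
  have um: "u \<in> borel_measurable M" using us by (simp add: sqint_def)
  obtain U where U: "U \<in> borel_measurable borel" "\<And>x. x \<notin> \<Omega> \<Longrightarrow> U x = 0" "AE x in M. u x = U x"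
    using ex_borel_representative[OF um dom_borel(1)] by blast
  define \<epsilon> where "\<epsilon> = (inverse (real (Suc m)))\<^sup>2 * sqn M g"
  have sq: "sqint M (\<lambda>x. \<psi> p x * (moll \<Omega> (k m p) u x - u x))" if "p \<in> P" for p
    by (intro moll_sqint that us smooth_continuous psi_smooth)
  have le: "sqn M (\<lambda>x. \<psi> p x * (moll \<Omega> (k m p) u x - u x)) \<le> 1\<^sup>2 * \<epsilon>" if p: "p \<in> P" for p
  proof (rule local_estimate(2)[OF p us U smooth_continuous[OF psi_smooth[OF p]]])
    fix y assume "k m p y \<noteq> 0"
    then have y: "y \<in> closure {y. k m p y \<noteq> 0}" by (rule k_supp'[OF p])
    have "(norm y)\<^sup>2 * sqn M g \<le> \<epsilon>"
      unfolding \<epsilon>_def using k_supp[OF p y] by (intro mult_right_mono power_mono) auto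
    from order_trans[OF translation_H1[OF u U p y] ennreal_leI[OF this]]
    show "(\<integral>\<^sup>+x. indicator (\<Omega> \<inter> {x. \<psi> p x \<noteq> 0}) x * ennreal ((U (x - y) - U x)\<^sup>2) \<partial>lborel) \<le> ennreal \<epsilon>" .
  qed (use psi_01[OF p] in \<open>auto simp: \<epsilon>_def\<close>)
  have "sqn M (\<lambda>x. S m u x - u x) = sqn M (\<lambda>x. \<Sum>p\<in>P. \<psi> p x * (moll \<Omega> (k m p) u x - u x))"
    by (rule sqn_cong_dom[OF S_diff])
  also have "\<dots> \<le> real (card P) * (\<Sum>p\<in>P. sqn M (\<lambda>x. \<psi> p x * (moll \<Omega> (k m p) u x - u x)))"
    by (rule sqn_sum_le[OF sq])
  also have "\<dots> \<le> real (card P) * (\<Sum>p\<in>P. \<epsilon>)"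
    using le by (intro mult_left_mono sum_mono) auto
  finally show ?thesis by (simp add: \<epsilon>_def power2_eq_square mult.assoc)
qed

section \<open>Compactness of the smoothing operators and of bounded sequences\<close>

definition ker :: "nat \<Rightarrow> real^'n \<Rightarrow> real^'n \<Rightarrow> real" where
  "ker m x z = (\<Sum>p\<in>P. \<psi> p x * k m p (x - z))"

lemma S_ker:
  assumes "integrable M u"
  shows "S m u x = (LINT z|M. ker m x z * u z)" "integrable M (\<lambda>z. ker m x z * u z)"
proof -
  have i: "integrable M (\<lambda>z. \<psi> p x * (k m p (x - z) * u z))" if "p \<in> P" for p
    using moll_integrable[OF open_dom bounded_dom k_cont[OF that] assms, of m x] by simp
  have eq: "ker m x z * u z = (\<Sum>p\<in>P. \<psi> p x * (k m p (x - z) * u z))" for z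
    by (simp add: ker_def sum_distrib_right mult.assoc)
  show "integrable M (\<lambda>z. ker m x z * u z)" unfolding eq using i by simp
  show "S m u x = (LINT z|M. ker m x z * u z)"
    unfolding eq S_def moll_def[OF open_dom bounded_dom] using i by simp
qed

text \<open>For fixed \<open>m\<close> the operator is an integral operator whose kernel is
  uniformly continuous on the compact product of closures, so it sends sets bounded in L1 to bounded
  equicontinuous families.\<close>

lemma S_equicontinuous:
  obtains D where "\<And>u x. integrable M u \<Longrightarrow> x \<in> closure \<Omega> \<Longrightarrow> \<bar>S m u x\<bar> \<le> D * (LINT z|M. \<bar>u z\<bar>)"
    "\<And>e. e > 0 \<Longrightarrow> \<exists>d>0. \<forall>u x x'. integrable M u \<longrightarrow> x \<in> closure \<Omega> \<longrightarrow> x' \<in> closure \<Omega> \<longrightarrow> norm (x - x') < d \<longrightarrow>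
      \<bar>S m u x - S m u x'\<bar> \<le> e * (LINT z|M. \<bar>u z\<bar>)"
proof -
  have comp: "compact (closure \<Omega> \<times> closure \<Omega>)" using bounded_dom by (intro compact_Times) auto
  have "continuous_on UNIV (\<lambda>(x, z). ker m x z)"
    unfolding ker_def split_beta
    by (intro continuous_on_sum continuous_on_mult)
      (auto intro!: continuous_intros continuous_on_compose2[OF smooth_continuous[OF psi_smooth]] continuous_on_compose2[OF k_cont])
  then have cont: "continuous_on (closure \<Omega> \<times> closure \<Omega>) (\<lambda>(x, z). ker m x z)" by (rule continuous_on_subset) simp
  have "bounded ((\<lambda>(x, z). ker m x z) ` (closure \<Omega> \<times> closure \<Omega>))"
    by (intro compact_imp_bounded compact_continuous_image cont comp)
  then obtain D where D: "\<forall>y\<in>(\<lambda>(x, z). ker m x z) ` (closure \<Omega> \<times> closure \<Omega>). norm y \<le> D" unfolding bounded_iff by blast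
  have unif: "uniformly_continuous_on (closure \<Omega> \<times> closure \<Omega>) (\<lambda>(x, z). ker m x z)"
    by (rule compact_uniformly_continuous[OF cont comp])
  show thesis
  proof (rule that[of D])
    fix u :: "real^'n \<Rightarrow> real" and x assume u: "integrable M u" and x: "x \<in> closure \<Omega>"
    have "\<bar>S m u x\<bar> \<le> (LINT z|M. norm (ker m x z * u z))"
      unfolding S_ker[OF u] using integral_norm_bound[of M "\<lambda>z. ker m x z * u z"] by simp
    also have "\<dots> \<le> (LINT z|M. D * \<bar>u z\<bar>)"
    proof (rule integral_mono_AE)
      show "AE z in M. norm (ker m x z * u z) \<le> D * \<bar>u z\<bar>"
      proof (rule AE_lebesgue_onI)
        fix z assume "z \<in> \<Omega>"
        then have "norm (ker m x z) \<le> D" using D x closure_subset[of \<Omega>] by (auto simp: image_iff)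
        then show "norm (ker m x z * u z) \<le> D * \<bar>u z\<bar>" by (simp add: abs_mult mult_right_mono)
      qed
    qed (use S_ker(2)[OF u] u in auto)
    finally show "\<bar>S m u x\<bar> \<le> D * (LINT z|M. \<bar>u z\<bar>)" by simp
  next
    fix e :: real assume "e > 0"
    then obtain d where d: "d > 0" "\<And>a b. a \<in> closure \<Omega> \<times> closure \<Omega> \<Longrightarrow> b \<in> closure \<Omega> \<times> closure \<Omega> \<Longrightarrow> dist b a < d \<Longrightarrow>
        dist ((\<lambda>(x, z). ker m x z) b) ((\<lambda>(x, z). ker m x z) a) < e"
      using unif unfolding uniformly_continuous_on_def by metis
    show "\<exists>d>0. \<forall>u x x'. integrable M u \<longrightarrow> x \<in> closure \<Omega> \<longrightarrow> x' \<in> closure \<Omega> \<longrightarrow> norm (x - x') < d \<longrightarrow>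
      \<bar>S m u x - S m u x'\<bar> \<le> e * (LINT z|M. \<bar>u z\<bar>)"
    proof (intro exI[of _ d] conjI allI impI d(1))
      fix u :: "real^'n \<Rightarrow> real" and x x' assume u: "integrable M u" and x: "x \<in> closure \<Omega>" and x': "x' \<in> closure \<Omega>" and xx: "norm (x - x') < d"
      have "S m u x - S m u x' = (LINT z|M. (ker m x z - ker m x' z) * u z)"
        unfolding S_ker(1)[OF u] using S_ker(2)[OF u] by (simp add: left_diff_distrib)
      then have "\<bar>S m u x - S m u x'\<bar> \<le> (LINT z|M. norm ((ker m x z - ker m x' z) * u z))"
        using integral_norm_bound[of M "\<lambda>z. (ker m x z - ker m x' z) * u z"] by simp
      also have "\<dots> \<le> (LINT z|M. e * \<bar>u z\<bar>)"
      proof (rule integral_mono_AE)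
        show "integrable M (\<lambda>z. norm ((ker m x z - ker m x' z) * u z))"
          using S_ker(2)[OF u, of m x] S_ker(2)[OF u, of m x'] by (intro integrable_norm) (simp add: left_diff_distrib)
        show "AE z in M. norm ((ker m x z - ker m x' z) * u z) \<le> e * \<bar>u z\<bar>"
        proof (rule AE_lebesgue_onI)
          fix z assume "z \<in> \<Omega>"
          then have z: "z \<in> closure \<Omega>" using closure_subset by blast
          have "dist (x, z) (x', z) < d" using xx by (simp add: dist_Pair_Pair dist_norm)
          then have "dist (ker m x z) (ker m x' z) < e" using d(2)[of "(x', z)" "(x, z)"] x x' z by simp
          then have "\<bar>ker m x z - ker m x' z\<bar> \<le> e" by (simp add: dist_real_def)
          then show "norm ((ker m x z - ker m x' z) * u z) \<le> e * \<bar>u z\<bar>" by (simp add: abs_mult mult_right_mono)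
        qed
      qed (use u in auto)
      finally show "\<bar>S m u x - S m u x'\<bar> \<le> e * (LINT z|M. \<bar>u z\<bar>)" by simp
    qed
  qed
qed

lemma S_compact:
  assumes u: "\<And>n::nat. sqint M (u n)" and B: "\<And>n. sqn M (u n) \<le> B" and e: "e > 0"
  obtains r :: "nat \<Rightarrow> nat" where "strict_mono r" "\<And>i j. sqn M (\<lambda>x. S m (u (r i)) x - S m (u (r j)) x) \<le> e"
proof -
  have ui: "integrable M (u n)" for n by (rule sqint_integrable[OF open_dom bounded_dom u])
  define C1 where "C1 = sqrt (B * sqn M (\<lambda>x. 1::real))"
  have C1: "(LINT z|M. \<bar>u n z\<bar>) \<le> C1" for n
  proof -
    have "(LINT z|M. \<bar>u n z\<bar>) \<le> \<bar>LINT z|M. norm (u n z) \<bullet> 1\<bar>" by simp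
    also have "\<dots> \<le> sqrt (sqn M (\<lambda>x. norm (u n x)) * sqn M (\<lambda>x. 1::real))"
      by (rule sqint_Cauchy_Schwarz[OF sqint_norm[OF u] sqint_const[OF open_dom bounded_dom]])
    also have "sqn M (\<lambda>x. norm (u n x)) = sqn M (u n)" by (simp add: sqn_def)
    also have "sqrt (sqn M (u n) * sqn M (\<lambda>x. 1::real)) \<le> C1"
      unfolding C1_def by (intro real_sqrt_le_mono mult_right_mono B) simp
    finally show ?thesis .
  qed
  have C10: "C1 \<ge> 0" using order_trans[OF sqn_nonneg B[of 0]] by (simp add: C1_def)
  obtain D where D: "\<And>u x. integrable M u \<Longrightarrow> x \<in> closure \<Omega> \<Longrightarrow> \<bar>S m u x\<bar> \<le> D * (LINT z|M. \<bar>u z\<bar>)"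
    "\<And>e. e > 0 \<Longrightarrow> \<exists>d>0. \<forall>u x x'. integrable M u \<longrightarrow> x \<in> closure \<Omega> \<longrightarrow> x' \<in> closure \<Omega> \<longrightarrow> norm (x - x') < d \<longrightarrow>
      \<bar>S m u x - S m u x'\<bar> \<le> e * (LINT z|M. \<bar>u z\<bar>)"
    using S_equicontinuous[of m] by metis
  obtain g and r :: "nat \<Rightarrow> nat" where r: "strict_mono r"
    and conv: "\<And>e. 0 < e \<Longrightarrow> \<exists>N. \<forall>n x. n \<ge> N \<and> x \<in> closure \<Omega> \<longrightarrow> norm (S m (u (r n)) x - g x) < e"
  proof (rule Arzela_Ascoli[of "closure \<Omega>" "\<lambda>n. S m (u n)" "\<bar>D\<bar> * C1"])
    show "compact (closure \<Omega>)" using bounded_dom by simp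
    show "norm (S m (u n) x) \<le> \<bar>D\<bar> * C1" if "x \<in> closure \<Omega>" for n x
    proof -
      have "\<bar>S m (u n) x\<bar> \<le> D * (LINT z|M. \<bar>u n z\<bar>)" by (rule D(1)[OF ui that])
      also have "\<dots> \<le> \<bar>D\<bar> * C1" using C1[of n] by (intro mult_mono) auto
      finally show ?thesis by simp
    qed
    fix x e assume x: "x \<in> closure \<Omega>" and "(0::real) < e"
    then have "e / (C1 + 1) > 0" using C10 by simp
    then obtain d where d: "d > 0" "\<And>u x x'. integrable M u \<Longrightarrow> x \<in> closure \<Omega> \<Longrightarrow> x' \<in> closure \<Omega> \<Longrightarrow> norm (x - x') < d \<Longrightarrow>
        \<bar>S m u x - S m u x'\<bar> \<le> e / (C1 + 1) * (LINT z|M. \<bar>u z\<bar>)"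
      using D(2) by metis
    show "\<exists>d. 0 < d \<and> (\<forall>n y. y \<in> closure \<Omega> \<and> norm (x - y) < d \<longrightarrow> norm (S m (u n) x - S m (u n) y) < e)"
    proof (intro exI[of _ d] conjI d(1) allI impI)
      fix n y assume y: "y \<in> closure \<Omega> \<and> norm (x - y) < d"
      have "\<bar>S m (u n) x - S m (u n) y\<bar> \<le> e / (C1 + 1) * (LINT z|M. \<bar>u n z\<bar>)" using d(2)[OF ui x] y by blast
      also have "\<dots> \<le> e / (C1 + 1) * C1" using \<open>0 < e\<close> C10 by (intro mult_left_mono C1) auto
      also have "\<dots> < e" using \<open>0 < e\<close> C10 by (simp add: divide_less_eq)
      finally show "norm (S m (u n) x - S m (u n) y) < e" by simp
    qed
  qed blast
  define V where "V = sqn M (\<lambda>x. 1::real)"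
  have V: "V \<ge> 0" by (simp add: V_def)
  \<comment> \<open>Two members of the tail differ by at most 2 \<eta> pointwise, and (2 \<eta>)^2
    times the volume \<open>V\<close> of the domain is at most \<open>e\<close>.\<close>
  define \<eta> where "\<eta> = sqrt (e / (V + 1)) / 2"
  have \<eta>: "\<eta> > 0" "(2 * \<eta>)\<^sup>2 * V \<le> e" using e V by (auto simp: \<eta>_def divide_simps mult_left_mono)
  obtain N where N: "\<And>n x. n \<ge> N \<Longrightarrow> x \<in> closure \<Omega> \<Longrightarrow> norm (S m (u (r n)) x - g x) < \<eta>" using conv[OF \<eta>(1)] by blast
  show thesis
  proof (rule that[of "\<lambda>i. r (N + i)"])
    show "strict_mono (\<lambda>i. r (N + i))" using r by (simp add: strict_mono_def)
    fix i j
    have "sqn M (\<lambda>x. S m (u (r (N + i))) x - S m (u (r (N + j))) x) \<le> (2 * \<eta>)\<^sup>2 * V" unfolding V_def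
    proof (rule sqint_bound(2)[OF sqint_const[OF open_dom bounded_dom]])
      show "(\<lambda>x. S m (u (r (N + i))) x - S m (u (r (N + j))) x) \<in> borel_measurable M"
        by (intro continuous_borel_measurable_lebesgue_on smooth_continuous smooth_diff S_smooth ui)
      show "AE x in M. norm (S m (u (r (N + i))) x - S m (u (r (N + j))) x) \<le> 2 * \<eta> * norm (1::real)"
      proof (rule AE_lebesgue_onI)
        fix x assume "x \<in> \<Omega>"
        then have x: "x \<in> closure \<Omega>" using closure_subset by blast
        show "norm (S m (u (r (N + i))) x - S m (u (r (N + j))) x) \<le> 2 * \<eta> * norm (1::real)"
          using N[OF _ x, of "N + i"] N[OF _ x, of "N + j"] by (simp add: abs_le_iff abs_less_iff)
      qed
    qed
    then show "sqn M (\<lambda>x. S m (u (r (N + i))) x - S m (u (r (N + j))) x) \<le> e" using \<eta>(2) by linarith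
  qed
qed

theorem Rellich:
  assumes w: "\<And>n::nat. is_weak_grad \<Omega> (u n) (g n)" and B: "\<And>n. sqn M (u n) \<le> B" "\<And>n. sqn M (g n) \<le> B"
  obtains r :: "nat \<Rightarrow> nat" and v where "strict_mono r" "sqint M v" "(\<lambda>n. sqn M (\<lambda>x. u (r n) x - v x)) \<longlonglongrightarrow> 0"
proof -
  have us: "sqint M (u n)" for n by (rule weak_gradD(1)[OF w])
  have ui: "integrable M (u n)" for n by (rule sqint_integrable[OF open_dom bounded_dom us])
  have Ss: "sqint M (S m (u n))" for m n
    by (intro sqint_continuous[OF open_dom bounded_dom] smooth_continuous S_smooth ui)
  define e where "e m = inverse (real (Suc m))" for m
  define \<rho> where "\<rho> m = (real (card P))\<^sup>2 * ((e m)\<^sup>2 * B)" for m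
  have e: "e m > 0" "e \<longlonglongrightarrow> 0" for m unfolding e_def using LIMSEQ_inverse_real_of_nat by auto
  have rate: "sqn M (\<lambda>x. S m (u n) x - u n x) \<le> \<rho> m" for m n
  proof -
    have "sqn M (\<lambda>x. S m (u n) x - u n x) \<le> (real (card P))\<^sup>2 * ((e m)\<^sup>2 * sqn M (g n))"
      unfolding e_def by (rule S_rate[OF w])
    also have "\<dots> \<le> \<rho> m" unfolding \<rho>_def by (intro mult_left_mono B) auto
    finally show ?thesis .
  qed
  \<comment> \<open>u_i - u_j is split into the difference of the smoothed functions and two
    smoothing errors. The difference and the first error pass through two squared triangle
    inequalities (factor 4), the second error through one (factor 2).\<close>
  define c where "c m = 4 * (e m + \<rho> m) + 2 * \<rho> m" for m
  have "(\<lambda>m. 4 * (e m + (real (card P))\<^sup>2 * ((e m)\<^sup>2 * B)) + 2 * ((real (card P))\<^sup>2 * ((e m)\<^sup>2 * B)))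
      \<longlonglongrightarrow> 4 * (0 + (real (card P))\<^sup>2 * (0\<^sup>2 * B)) + 2 * ((real (card P))\<^sup>2 * (0\<^sup>2 * B))"
    by (intro tendsto_intros e)
  moreover have "c = (\<lambda>m. 4 * (e m + (real (card P))\<^sup>2 * ((e m)\<^sup>2 * B)) + 2 * ((real (card P))\<^sup>2 * ((e m)\<^sup>2 * B)))"
    by (simp add: fun_eq_iff c_def \<rho>_def)
  ultimately have c: "c \<longlonglongrightarrow> 0" by simp
  obtain r :: "nat \<Rightarrow> nat" where r: "strict_mono r"
    "\<And>e. e > 0 \<Longrightarrow> \<exists>N. \<forall>i\<ge>N. \<forall>j\<ge>N. sqn M (\<lambda>x. u (r i) x - u (r j) x) \<le> e"
  proof (rule Cauchy_subsequence_diagonal[OF c, of "\<lambda>i j. sqn M (\<lambda>x. u i x - u j x)"])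
    fix m and s :: "nat \<Rightarrow> nat" assume "strict_mono s"
    obtain r :: "nat \<Rightarrow> nat" where r: "strict_mono r"
      "\<And>i j. sqn M (\<lambda>x. S m (u (s (r i))) x - S m (u (s (r j))) x) \<le> e m"
      using S_compact[of "\<lambda>n. u (s n)" B "e m" m] us B(1) e(1) by metis
    show "\<exists>r :: nat \<Rightarrow> nat. strict_mono r \<and> (\<forall>i j. sqn M (\<lambda>x. u (s (r i)) x - u (s (r j)) x) \<le> c m)"
    proof (intro exI[of _ r] conjI r(1) allI)
      fix i j
      let ?a = "s (r i)" and ?b = "s (r j)"
      have eq: "(\<lambda>x. ((S m (u ?a) x - S m (u ?b) x) - (S m (u ?a) x - u ?a x)) + (S m (u ?b) x - u ?b x)) = (\<lambda>x. u ?a x - u ?b x)"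
        by auto
      have "sqn M (\<lambda>x. u ?a x - u ?b x)
        \<le> 2 * sqn M (\<lambda>x. (S m (u ?a) x - S m (u ?b) x) - (S m (u ?a) x - u ?a x)) + 2 * sqn M (\<lambda>x. S m (u ?b) x - u ?b x)"
        unfolding eq[symmetric] by (intro sqint_add sqint_diff us Ss)
      moreover have "sqn M (\<lambda>x. (S m (u ?a) x - S m (u ?b) x) - (S m (u ?a) x - u ?a x))
        \<le> 2 * sqn M (\<lambda>x. S m (u ?a) x - S m (u ?b) x) + 2 * sqn M (\<lambda>x. S m (u ?a) x - u ?a x)"
        by (intro sqint_diff us Ss)
      ultimately show "sqn M (\<lambda>x. u ?a x - u ?b x) \<le> c m"
        unfolding c_def using r(2)[of i j] rate[of m ?a] rate[of m ?b] by argo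
    qed
  qed blast
  have "\<exists>v. sqint M v \<and> (\<lambda>n. sqn M (\<lambda>x. u (r n) x - v x)) \<longlonglongrightarrow> 0"
    by (rule sqint_complete[of M "\<lambda>n. u (r n)"]) (use us r(2) in auto)
  then show thesis using r(1) that by blast
qed

text \<open>The bound on the gradients survives in the limit as a bound for the functional \<phi>
  \<mapsto> -\<integral> v \<partial>\<phi> in the L2 norm. Test functions representing it ever more
  accurately form a Cauchy sequence, whose L2 limit is the weak partial derivative.\<close>

lemma weak_grad_of_limit:
  assumes w: "\<And>n::nat. is_weak_grad \<Omega> (z n) (h n)" and v: "sqint M v" and lim: "(\<lambda>n. sqn M (\<lambda>x. z n x - v x)) \<longlonglongrightarrow> 0"
    and B: "\<And>n. sqn M (h n) \<le> B"
  obtains G where "is_weak_grad \<Omega> v G"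
proof -
  have ex: "\<exists>G. sqint M G \<and> (\<forall>\<phi>. test_fun \<Omega> \<phi> \<longrightarrow> (LINT x|M. v x * partial i \<phi> x) = - (LINT x|M. G x * \<phi> x))" for i
  proof -
    let ?V = "{\<phi>. test_fun \<Omega> \<phi>}"
    define L where "L \<phi> = - (LINT x|M. v x * partial i \<phi> x)" for \<phi>
    define b where "b \<phi> \<psi> = (LINT x|M. \<phi> x * \<psi> x)" for \<phi> \<psi> :: "real^'n \<Rightarrow> real"
    have bb: "b \<phi> \<phi> = sqn M \<phi>" for \<phi> by (simp add: b_def sqn_def power2_eq_square)
    have Lb: "\<bar>L \<phi>\<bar> \<le> sqrt B * sqrt (b \<phi> \<phi>)" if \<phi>: "test_fun \<Omega> \<phi>" for \<phi>
    proof (rule LIMSEQ_le_const2)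
      have "(\<lambda>n. LINT x|M. z n x * partial i \<phi> x) \<longlonglongrightarrow> (LINT x|M. v x * partial i \<phi> x)"
        by (intro integral_mult_tendsto weak_gradD(1)[OF w] v lim sqint_test \<phi>)
      from tendsto_rabs[OF this] show "(\<lambda>n. \<bar>LINT x|M. z n x * partial i \<phi> x\<bar>) \<longlonglongrightarrow> \<bar>L \<phi>\<bar>" by (simp add: L_def)
      show "\<exists>N. \<forall>n\<ge>N. \<bar>LINT x|M. z n x * partial i \<phi> x\<bar> \<le> sqrt B * sqrt (b \<phi> \<phi>)"
      proof (intro exI[of _ 0] allI impI)
        fix n
        have "\<bar>LINT x|M. z n x * partial i \<phi> x\<bar> = \<bar>LINT x|M. h n x $ i \<bullet> \<phi> x\<bar>" using weak_gradD(4)[OF w \<phi>] by simp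
        also have "\<dots> \<le> sqrt (sqn M (\<lambda>x. h n x $ i) * sqn M \<phi>)"
          by (rule sqint_Cauchy_Schwarz[OF weak_gradD(3)[OF w] sqint_test(1)[OF \<phi>]])
        also have "\<dots> \<le> sqrt (B * sqn M \<phi>)"
          by (intro real_sqrt_le_mono mult_right_mono order_trans[OF sqn_nth_le[OF weak_gradD(2)[OF w]] B]) simp
        finally show "\<bar>LINT x|M. z n x * partial i \<phi> x\<bar> \<le> sqrt B * sqrt (b \<phi> \<phi>)" by (simp add: bb real_sqrt_mult)
      qed
    qed
    have Llin: "L (\<lambda>x. \<alpha> * \<phi> x + \<beta> * \<psi> x) = \<alpha> * L \<phi> + \<beta> * L \<psi>" if "test_fun \<Omega> \<phi>" "test_fun \<Omega> \<psi>" for \<phi> \<psi> \<alpha> \<beta>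
      using sqint_mult[OF v sqint_test(2)[OF that(1), of i]] sqint_mult[OF v sqint_test(2)[OF that(2), of i]]
      unfolding L_def test_fun_lincomb(2)[OF that] by (simp add: distrib_left mult.left_commute)
    have blin: "b (\<lambda>x. \<alpha> * \<phi> x + \<beta> * \<psi> x) \<chi>' = \<alpha> * b \<phi> \<chi>' + \<beta> * b \<psi> \<chi>'"
      if "sqint M \<phi>" "sqint M \<psi>" "sqint M \<chi>'" for \<phi> \<psi> \<chi>' \<alpha> \<beta>
      unfolding b_def using sqint_mult[OF that(1,3)] sqint_mult[OF that(2,3)] by (simp add: distrib_right mult.assoc)
    have "\<exists>f. test_fun \<Omega> f \<and> (\<forall>\<phi>. test_fun \<Omega> \<phi> \<longrightarrow> \<bar>L \<phi> - b f \<phi>\<bar> \<le> inverse (real (Suc m)) * sqrt (b \<phi> \<phi>))" for m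
    proof (rule approx_riesz[of ?V b L "sqrt B" "inverse (real (Suc m))"])
      have "test_fun \<Omega> (\<lambda>x. 0)" unfolding test_fun_def by (simp add: smooth_const)
      then show "?V \<noteq> {}" by blast
    qed (use Lb Llin blin sqint_test(1) test_fun_lincomb(1) in \<open>auto simp: bb b_def mult.commute\<close>)
    then obtain f where f: "\<And>m. test_fun \<Omega> (f m)" "\<And>m \<phi>. test_fun \<Omega> \<phi> \<Longrightarrow> \<bar>L \<phi> - b (f m) \<phi>\<bar> \<le> inverse (real (Suc m)) * sqrt (b \<phi> \<phi>)"
      by metis
    have fs: "sqint M (f m)" for m by (rule sqint_test(1)[OF f(1)])
    \<comment> \<open>Both functions represent the same functional up to 1/(m+1) and 1/(l+1);
      testing with their difference bounds its norm by the sum of the two tolerances.\<close>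
    have fm: "sqn M (\<lambda>x. f m x - f l x) \<le> (inverse (real (Suc m)) + inverse (real (Suc l)))\<^sup>2" for m l
    proof -
      let ?d = "\<lambda>x. f m x - f l x"
      have d: "test_fun \<Omega> ?d" using test_fun_lincomb(1)[OF f(1)[of m] f(1)[of l], of 1 "-1"] by simp
      have "b ?d ?d = b (f m) ?d - b (f l) ?d" using blin[OF fs[of m] fs[of l] sqint_test(1)[OF d], of 1 "-1"] by simp
      also have "\<dots> \<le> (inverse (real (Suc m)) + inverse (real (Suc l))) * sqrt (b ?d ?d)"
        using f(2)[OF d, of m] f(2)[OF d, of l] by (simp add: distrib_right del: of_nat_Suc)
      finally have *: "sqrt (b ?d ?d) * sqrt (b ?d ?d) \<le> (inverse (real (Suc m)) + inverse (real (Suc l))) * sqrt (b ?d ?d)"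
        by (simp add: bb)
      have "sqrt (b ?d ?d) \<le> inverse (real (Suc m)) + inverse (real (Suc l))"
      proof (cases "sqrt (b ?d ?d) = 0")
        case False
        then have "sqrt (b ?d ?d) > 0" by (simp add: bb less_le)
        then show ?thesis using * mult_right_le_imp_le by blast
      qed (simp del: of_nat_Suc)
      then have "(sqrt (b ?d ?d))\<^sup>2 \<le> (inverse (real (Suc m)) + inverse (real (Suc l)))\<^sup>2"
        by (intro power_mono) (simp_all add: bb)
      then show ?thesis by (simp add: bb)
    qed
    have "\<exists>G. sqint M G \<and> (\<lambda>m. sqn M (\<lambda>x. f m x - G x)) \<longlonglongrightarrow> 0"
    proof (rule sqint_complete[OF fs])
      fix e :: real assume "e > 0"
      then have "sqrt e / 2 > 0" by simp
      then obtain N where N: "inverse (real (Suc N)) < sqrt e / 2" using reals_Archimedean by blast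
      show "\<exists>N. \<forall>m\<ge>N. \<forall>n\<ge>N. sqn M (\<lambda>x. f m x - f n x) \<le> e"
      proof (intro exI[of _ N] allI impI)
        fix m n assume mn: "m \<ge> N" "n \<ge> N"
        have "inverse (real (Suc m)) \<le> inverse (real (Suc N))" "inverse (real (Suc n)) \<le> inverse (real (Suc N))"
          using mn by (simp_all add: le_imp_inverse_le)
        then have "inverse (real (Suc m)) + inverse (real (Suc n)) \<le> sqrt e" using N by linarith
        then have "(inverse (real (Suc m)) + inverse (real (Suc n)))\<^sup>2 \<le> (sqrt e)\<^sup>2" by (intro power_mono) (simp_all del: of_nat_Suc)
        then show "sqn M (\<lambda>x. f m x - f n x) \<le> e" using fm[of m n] \<open>e > 0\<close> by simp
      qed
    qed blast
    then obtain G where G: "sqint M G" "(\<lambda>m. sqn M (\<lambda>x. f m x - G x)) \<longlonglongrightarrow> 0" by blast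
    have "(LINT x|M. v x * partial i \<phi> x) = - (LINT x|M. G x * \<phi> x)" if \<phi>: "test_fun \<Omega> \<phi>" for \<phi>
    proof -
      have "(\<lambda>m. b (f m) \<phi>) \<longlonglongrightarrow> (LINT x|M. G x * \<phi> x)"
        unfolding b_def by (intro integral_mult_tendsto fs G sqint_test \<phi>)
      moreover have "(\<lambda>m. L \<phi> - b (f m) \<phi>) \<longlonglongrightarrow> 0"
      proof (rule Lim_null_comparison)
        show "\<forall>\<^sub>F m in sequentially. norm (L \<phi> - b (f m) \<phi>) \<le> inverse (real (Suc m)) * sqrt (b \<phi> \<phi>)"
          using f(2)[OF \<phi>] by simp
        show "(\<lambda>m. inverse (real (Suc m)) * sqrt (b \<phi> \<phi>)) \<longlonglongrightarrow> 0"
          using tendsto_mult_right[OF LIMSEQ_inverse_real_of_nat, of "sqrt (b \<phi> \<phi>)"] by simp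
      qed
      ultimately have "(\<lambda>m. (L \<phi> - b (f m) \<phi>) + b (f m) \<phi>) \<longlonglongrightarrow> 0 + (LINT x|M. G x * \<phi> x)"
        by (intro tendsto_add)
      then have "L \<phi> = (LINT x|M. G x * \<phi> x)" by (simp add: LIMSEQ_const_iff)
      then show ?thesis by (simp add: L_def)
    qed
    with G(1) show ?thesis by blast
  qed
  have "\<exists>G. \<forall>i. sqint M (G i) \<and> (\<forall>\<phi>. test_fun \<Omega> \<phi> \<longrightarrow> (LINT x|M. v x * partial i \<phi> x) = - (LINT x|M. G i x * \<phi> x))"
    by (rule choice, rule allI, rule ex)
  then obtain G where G: "\<And>i. sqint M (G i)"
    "\<And>i \<phi>. test_fun \<Omega> \<phi> \<Longrightarrow> (LINT x|M. v x * partial i \<phi> x) = - (LINT x|M. G i x * \<phi> x)" by blast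
  have "is_weak_grad \<Omega> v (\<lambda>x. \<chi> i. G i x)"
    unfolding is_weak_grad_iff sqint_vec_iff using v G by simp
  then show thesis by (rule that)
qed

end

section \<open>The dual of the Sobolev space\<close>

lemma borel_measurable_vecI:
  fixes f :: "'a \<Rightarrow> real^'n"
  assumes "\<And>i. (\<lambda>x. f x $ i) \<in> borel_measurable M"
  shows "f \<in> borel_measurable M"
proof -
  have "(\<lambda>x. \<Sum>i\<in>UNIV. (f x $ i) *\<^sub>R (axis i 1 :: real^'n)) \<in> borel_measurable M"
    using assms by (intro borel_measurable_sum borel_measurable_scaleR) auto
  moreover have "(\<lambda>x. \<Sum>i\<in>UNIV. (f x $ i) *\<^sub>R (axis i 1 :: real^'n)) = f"
    by (simp add: fun_eq_iff basis_expansion flip: scalar_mult_eq_scaleR)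
  ultimately show ?thesis by simp
qed

lemma borel_measurable_nth: "f \<in> borel_measurable M \<Longrightarrow> (\<lambda>x. f x $ i) \<in> borel_measurable M" for f :: "'a \<Rightarrow> real^'n"
  using borel_measurable_inner[of f M "\<lambda>x. axis i 1"] by (simp add: inner_axis)

lemma borel_measurable_matrix_vector:
  fixes F :: "'a \<Rightarrow> real^'n^'n"
  assumes "\<And>i j. (\<lambda>x. F x $ i $ j) \<in> borel_measurable M" "q \<in> borel_measurable M"
  shows "(\<lambda>x. F x *v q x) \<in> borel_measurable M"
proof (rule borel_measurable_vecI)
  fix i
  show "(\<lambda>x. (F x *v q x) $ i) \<in> borel_measurable M"
    unfolding matrix_vector_mult_def vec_lambda_beta
    by (intro borel_measurable_sum borel_measurable_times assms(1) borel_measurable_nth[OF assms(2)])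
qed

lemma matrix_vector_bound:
  fixes F :: "real^'n^'n"
  assumes "\<And>i j. \<bar>F $ i $ j\<bar> \<le> C"
  shows "norm (F *v \<xi>) \<le> C * (real CARD('n))\<^sup>2 * norm \<xi>"
proof -
  have "norm (F *v \<xi>) \<le> (\<Sum>i\<in>UNIV. \<bar>(F *v \<xi>) $ i\<bar>)" by (rule norm_le_l1_cart)
  also have "\<dots> \<le> (\<Sum>i::'n\<in>UNIV. \<Sum>j::'n\<in>UNIV. C * norm \<xi>)"
  proof (rule sum_mono)
    fix i
    have "\<bar>(F *v \<xi>) $ i\<bar> \<le> (\<Sum>j\<in>UNIV. \<bar>F $ i $ j * \<xi> $ j\<bar>)"
      unfolding matrix_vector_mult_def vec_lambda_beta by (rule sum_abs)
    also have "\<dots> \<le> (\<Sum>j::'n\<in>UNIV. C * norm \<xi>)"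
      unfolding abs_mult
      by (intro sum_mono mult_mono assms component_le_norm_cart) (use assms[of i i] in auto)
    finally show "\<bar>(F *v \<xi>) $ i\<bar> \<le> (\<Sum>j::'n\<in>UNIV. C * norm \<xi>)" .
  qed
  also have "\<dots> = C * (real CARD('n))\<^sup>2 * norm \<xi>" by (simp add: power2_eq_square)
  finally show ?thesis .
qed

text \<open>Rounding \<open>v\<close> down to multiples of 1/(m+1) leaves countably many values, for
  which measurability in \<open>x\<close> suffices; continuity in the second variable then passes to
  the limit almost everywhere.\<close>

lemma Caratheodory_measurable:
  fixes F :: "'a::euclidean_space \<Rightarrow> real \<Rightarrow> real"
  assumes S: "S \<in> sets lebesgue" and F: "\<And>s. (\<lambda>x. F x s) \<in> borel_measurable (lebesgue_on S)"
    and cont: "AE x in lebesgue_on S. \<forall>s. isCont (F x) s" and v: "v \<in> borel_measurable (lebesgue_on S)"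
  shows "(\<lambda>x. F x (v x)) \<in> borel_measurable (lebesgue_on S)"
proof -
  define q where "q m s = real_of_int \<lfloor>real (Suc m) * s\<rfloor> / real (Suc m)" for m s
  have qb: "norm (q m s - s) \<le> inverse (real (Suc m))" for m s
  proof -
    have "q m s - s = (real_of_int \<lfloor>real (Suc m) * s\<rfloor> - real (Suc m) * s) / real (Suc m)"
      by (simp add: q_def field_simps del: of_nat_Suc)
    moreover have "\<bar>real_of_int \<lfloor>real (Suc m) * s\<rfloor> - real (Suc m) * s\<bar> \<le> 1"
      using of_int_floor_le[of "real (Suc m) * s"] floor_correct[of "real (Suc m) * s"] by linarith
    ultimately show ?thesis
      by (simp add: divide_inverse abs_mult mult_left_le_one_le del: of_nat_Suc)
  qed
  have q: "(\<lambda>m. q m s) \<longlonglongrightarrow> s" for s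
    by (rule LIM_zero_cancel, rule Lim_null_comparison[OF _ LIMSEQ_inverse_real_of_nat])
      (rule always_eventually, rule allI, rule qb)
  have m: "(\<lambda>x. F x (q m (v x))) \<in> borel_measurable (lebesgue_on S)" for m
  proof -
    have "(\<lambda>x. (\<lambda>i x. F x (real_of_int i / real (Suc m))) \<lfloor>real (Suc m) * v x\<rfloor> x) \<in> borel_measurable (lebesgue_on S)"
    proof (rule measurable_compose_countable[where f = "\<lambda>i x. F x (real_of_int i / real (Suc m))"
          and g = "\<lambda>x. \<lfloor>real (Suc m) * v x\<rfloor>"])
      show "(\<lambda>x. F x (real_of_int i / real (Suc m))) \<in> borel_measurable (lebesgue_on S)" for i by (rule F)
      show "(\<lambda>x. \<lfloor>real (Suc m) * v x\<rfloor>) \<in> measurable (lebesgue_on S) (count_space UNIV)"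
        using v by measurable
    qed
    then show ?thesis by (simp add: q_def)
  qed
  have "(\<lambda>x. lim (\<lambda>m. F x (q m (v x)))) \<in> borel_measurable (lebesgue_on S)"
    by (rule borel_measurable_lim_metric[OF m])
  then show ?thesis
  proof (rule borel_measurable_lebesgue_on_AE[OF _ S])
    show "AE x in lebesgue_on S. lim (\<lambda>m. F x (q m (v x))) = F x (v x)"
      using cont by eventually_elim (metis isCont_tendsto_compose q limI)
  qed
qed

text \<open>The derivative is the almost everywhere limit of difference quotients with steps
  1/(m+1), and each of these is covered by the preceding result. So measurability of
  \<open>dA\<close> along a function follows from that of \<open>A\<close>.\<close>

lemma Caratheodory_derivative_measurable:
  fixes F dF :: "'a::euclidean_space \<Rightarrow> real \<Rightarrow> real"
  assumes S: "S \<in> sets lebesgue" and F: "\<And>s. (\<lambda>x. F x s) \<in> borel_measurable (lebesgue_on S)"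
    and der: "AE x in lebesgue_on S. \<forall>s. (F x has_real_derivative dF x s) (at s)" and v: "v \<in> borel_measurable (lebesgue_on S)"
  shows "(\<lambda>x. dF x (v x)) \<in> borel_measurable (lebesgue_on S)"
proof -
  have cont: "AE x in lebesgue_on S. \<forall>s. isCont (F x) s" using der by eventually_elim (auto intro: DERIV_isCont)
  define q where "q m x = (F x (v x + inverse (real (Suc m))) - F x (v x)) / inverse (real (Suc m))" for m x
  have m: "q m \<in> borel_measurable (lebesgue_on S)" for m
  proof -
    have "(\<lambda>x. F x (v x + inverse (real (Suc m)))) \<in> borel_measurable (lebesgue_on S)"
      by (rule Caratheodory_measurable[OF S F cont]) (use v in measurable)
    then show ?thesis unfolding q_def using Caratheodory_measurable[OF S F cont v] by measurable
  qed
  have "(\<lambda>x. lim (\<lambda>m. q m x)) \<in> borel_measurable (lebesgue_on S)"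
    by (rule borel_measurable_lim_metric[OF m])
  then show ?thesis
  proof (rule borel_measurable_lebesgue_on_AE[OF _ S])
    show "AE x in lebesgue_on S. lim (\<lambda>m. q m x) = dF x (v x)"
      using der
    proof eventually_elim
      case (elim x)
      have "((\<lambda>h. (F x (v x + h) - F x (v x)) / h) \<longlongrightarrow> dF x (v x)) (at 0)"
        using elim by (simp add: DERIV_def)
      moreover have "filterlim (\<lambda>m. inverse (real (Suc m))) (at 0) sequentially"
        using LIMSEQ_inverse_real_of_nat by (intro filterlim_atI) auto
      ultimately have "(\<lambda>m. q m x) \<longlonglongrightarrow> dF x (v x)" unfolding q_def by (rule filterlim_compose)
      then show ?case by (rule limI)
    qed
  qed
qed

context smoothing
begin

section \<open>Functionals along weakly convergent sequences\<close>

lemma wgrad_weak: "u \<in> H1 \<Omega> \<Longrightarrow> is_weak_grad \<Omega> u (wgrad \<Omega> u)"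
  unfolding wgrad_def H1_def mem_Collect_eq by (erule someI_ex)

lemma weak_grad_H1: "is_weak_grad \<Omega> u g \<Longrightarrow> u \<in> H1 \<Omega>"
  unfolding H1_def by blast

lemma sqn_cong_AE:
  fixes f g :: "real^'n \<Rightarrow> 'b::euclidean_space"
  assumes "sqint M f" "sqint M g" "AE x in M. f x = g x"
  shows "sqn M f = sqn M g"
  unfolding sqn_def by (rule integral_cong_AE) (use assms in \<open>auto simp: sqint_def elim: eventually_mono\<close>)

text \<open>\<open>wgrad\<close> is an arbitrary choice of weak gradient; by uniqueness almost
  everywhere any other one computes the same norm, so explicit gradients can be used from here
  on.\<close>

lemma H1_norm_eq:
  assumes u: "is_weak_grad \<Omega> u g"
  shows "H1_norm \<Omega> u = sqrt (sqn M u + sqn M g)"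
proof -
  have w: "is_weak_grad \<Omega> u (wgrad \<Omega> u)" by (rule wgrad_weak[OF weak_grad_H1[OF u]])
  have "sqn M (wgrad \<Omega> u) = sqn M g"
    by (rule sqn_cong_AE[OF weak_gradD(2)[OF w] weak_gradD(2)[OF u] weak_grad_unique[OF w u]])
  then show ?thesis by (simp add: H1_norm_def sqn_def)
qed

lemma H1_dual_tendsto_0:
  assumes L: "H1_dual \<Omega> L" and w: "\<And>n::nat. is_weak_grad \<Omega> (z n) (h n)"
    and lim: "(\<lambda>n. sqn M (z n)) \<longlonglongrightarrow> 0" "(\<lambda>n. sqn M (h n)) \<longlonglongrightarrow> 0"
  shows "(\<lambda>n. L (z n)) \<longlonglongrightarrow> 0"
proof -
  obtain K where K: "\<And>v. v \<in> H1 \<Omega> \<Longrightarrow> \<bar>L v\<bar> \<le> K * H1_norm \<Omega> v" using L unfolding H1_dual_def by blast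
  show ?thesis
  proof (rule Lim_null_comparison)
    show "\<forall>\<^sub>F n in sequentially. norm (L (z n)) \<le> K * sqrt (sqn M (z n) + sqn M (h n))"
      using K[OF weak_grad_H1[OF w]] H1_norm_eq[OF w] by simp
    show "(\<lambda>n. K * sqrt (sqn M (z n) + sqn M (h n))) \<longlonglongrightarrow> 0"
      using tendsto_mult_left[OF tendsto_real_sqrt[OF tendsto_add[OF lim]], of K] by simp
  qed
qed

lemma H1_dual_diff:
  assumes "H1_dual \<Omega> L" "u \<in> H1 \<Omega>" "v \<in> H1 \<Omega>"
  shows "L (\<lambda>x. u x - v x) = L u - L v"
proof -
  have "L (\<lambda>x. 1 * u x + (-1) * v x) = 1 * L u + (-1) * L v" using assms unfolding H1_dual_def by blast
  then show ?thesis by simp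
qed

lemma H1_dual_continuous:
  assumes L: "H1_dual \<Omega> L" and w: "\<And>n::nat. is_weak_grad \<Omega> (z n) (h n)" and v: "is_weak_grad \<Omega> v g"
    and lim: "(\<lambda>n. sqn M (\<lambda>x. z n x - v x)) \<longlonglongrightarrow> 0" "(\<lambda>n. sqn M (\<lambda>x. h n x - g x)) \<longlonglongrightarrow> 0"
  shows "(\<lambda>n. L (z n)) \<longlonglongrightarrow> L v"
proof (rule LIM_zero_cancel)
  have "(\<lambda>n. L (\<lambda>x. z n x - v x)) \<longlonglongrightarrow> 0"
    by (rule H1_dual_tendsto_0[OF L weak_grad_diff[OF w v] lim])
  then show "(\<lambda>n. L (z n) - L v) \<longlonglongrightarrow> 0"
    by (simp add: H1_dual_diff[OF L weak_grad_H1[OF w] weak_grad_H1[OF v]])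
qed

text \<open>It is enough to approximate \<open>L\<close> by inner products, so neither completeness nor Riesz representation is needed.\<close>

lemma H1_dual_weak:
  assumes L: "H1_dual \<Omega> L" and w: "\<And>n::nat. is_weak_grad \<Omega> (z n) (h n)"
    and lim: "(\<lambda>n. sqn M (z n)) \<longlonglongrightarrow> 0" and B: "\<And>n. sqn M (h n) \<le> B"
  shows "(\<lambda>n. L (z n)) \<longlonglongrightarrow> 0"
proof (rule LIMSEQ_I)
  fix e :: real assume e: "e > 0"
  \<comment> \<open>The inner product of \<open>H1\<close>. It is built from chosen gradients, so
    its linearity holds only through uniqueness almost everywhere, which is the content of
    \<open>blin\<close>.\<close>
  define b where "b u v = (LINT x|M. u x * v x) + (LINT x|M. wgrad \<Omega> u x \<bullet> wgrad \<Omega> v x)" for u v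
  have bb: "sqrt (b v v) = H1_norm \<Omega> v" for v
    unfolding b_def H1_norm_def power2_norm_eq_inner unfolding power2_eq_square ..
  have bpos: "b v v \<ge> 0" for v unfolding b_def by simp
  obtain K where K: "\<And>v. v \<in> H1 \<Omega> \<Longrightarrow> \<bar>L v\<bar> \<le> K * H1_norm \<Omega> v" using L unfolding H1_dual_def by blast
  obtain Bz where Bz: "\<And>n. sqn M (z n) \<le> Bz" using lim
    by (metis Bseq_def convergentI convergent_imp_Bseq real_norm_def abs_le_iff)
  define Q where "Q = sqrt (Bz + B)"
  have Q0: "Q \<ge> 0" unfolding Q_def using order_trans[OF sqn_nonneg Bz] order_trans[OF sqn_nonneg B] by simp
  have zQ: "H1_norm \<Omega> (z n) \<le> Q" for n
    unfolding H1_norm_eq[OF w] Q_def by (intro real_sqrt_le_mono add_mono Bz B)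
  define \<epsilon> where "\<epsilon> = e / (2 * (Q + 1))"
  have \<epsilon>: "\<epsilon> > 0" "\<epsilon> * Q < e / 2" using e Q0 by (auto simp: \<epsilon>_def divide_simps)
  have blin: "b (\<lambda>x. \<alpha> * u x + \<beta> * v x) f = \<alpha> * b u f + \<beta> * b v f"
    if "u \<in> H1 \<Omega>" "v \<in> H1 \<Omega>" "f \<in> H1 \<Omega>" for u v f \<alpha> \<beta>
  proof -
    note W = wgrad_weak[OF that(1)] wgrad_weak[OF that(2)] wgrad_weak[OF that(3)]
    have wl: "is_weak_grad \<Omega> (\<lambda>x. \<alpha> * u x + \<beta> * v x) (\<lambda>x. \<alpha> *\<^sub>R wgrad \<Omega> u x + \<beta> *\<^sub>R wgrad \<Omega> v x)"
      by (rule weak_grad_lincomb[OF W(1,2)])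
    have wg: "is_weak_grad \<Omega> (\<lambda>x. \<alpha> * u x + \<beta> * v x) (wgrad \<Omega> (\<lambda>x. \<alpha> * u x + \<beta> * v x))"
      by (rule wgrad_weak[OF weak_grad_H1[OF wl]])
    have "(LINT x|M. wgrad \<Omega> (\<lambda>x. \<alpha> * u x + \<beta> * v x) x \<bullet> wgrad \<Omega> f x) =
        (LINT x|M. (\<alpha> *\<^sub>R wgrad \<Omega> u x + \<beta> *\<^sub>R wgrad \<Omega> v x) \<bullet> wgrad \<Omega> f x)"
    proof (rule integral_cong_AE)
      show "AE x in M. wgrad \<Omega> (\<lambda>x. \<alpha> * u x + \<beta> * v x) x \<bullet> wgrad \<Omega> f x = (\<alpha> *\<^sub>R wgrad \<Omega> u x + \<beta> *\<^sub>R wgrad \<Omega> v x) \<bullet> wgrad \<Omega> f x"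
        using weak_grad_unique[OF wg wl] by eventually_elim simp
    qed (rule borel_measurable_integrable[OF sqint_inner[OF weak_gradD(2)[OF wg] weak_gradD(2)[OF W(3)]]],
         rule borel_measurable_integrable[OF sqint_inner[OF weak_gradD(2)[OF wl] weak_gradD(2)[OF W(3)]]])
    also have "\<dots> = \<alpha> * (LINT x|M. wgrad \<Omega> u x \<bullet> wgrad \<Omega> f x) + \<beta> * (LINT x|M. wgrad \<Omega> v x \<bullet> wgrad \<Omega> f x)"
      using sqint_inner[OF weak_gradD(2)[OF W(1)] weak_gradD(2)[OF W(3)]] sqint_inner[OF weak_gradD(2)[OF W(2)] weak_gradD(2)[OF W(3)]]
      by (simp add: inner_add_left)
    finally show ?thesis unfolding b_def
      using sqint_mult[OF weak_gradD(1)[OF W(1)] weak_gradD(1)[OF W(3)]] sqint_mult[OF weak_gradD(1)[OF W(2)] weak_gradD(1)[OF W(3)]]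
      by (simp add: distrib_right mult.assoc algebra_simps)
  qed
  obtain f where f: "f \<in> H1 \<Omega>" "\<And>v. v \<in> H1 \<Omega> \<Longrightarrow> \<bar>L v - b f v\<bar> \<le> \<epsilon> * sqrt (b v v)"
  proof (rule approx_riesz[of "H1 \<Omega>" b L K \<epsilon>])
    show "H1 \<Omega> \<noteq> {}" using weak_grad_H1[OF weak_grad_const] by blast
    show "(\<lambda>x. \<alpha> * u x + \<beta> * v x) \<in> H1 \<Omega>" if "u \<in> H1 \<Omega>" "v \<in> H1 \<Omega>" for u v \<alpha> \<beta>
      by (rule weak_grad_H1[OF weak_grad_lincomb[OF wgrad_weak[OF that(1)] wgrad_weak[OF that(2)]]])
    show "b u v = b v u" for u v by (simp add: b_def mult.commute inner_commute)
    show "L (\<lambda>x. \<alpha> * u x + \<beta> * v x) = \<alpha> * L u + \<beta> * L v" if "u \<in> H1 \<Omega>" "v \<in> H1 \<Omega>" for u v \<alpha> \<beta>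
      using L that unfolding H1_dual_def by blast
    show "\<bar>L v\<bar> \<le> K * sqrt (b v v)" if "v \<in> H1 \<Omega>" for v unfolding bb by (rule K[OF that])
  qed (use blin bpos \<epsilon> in auto)
  note fw = wgrad_weak[OF f(1)]
  have "(\<lambda>n. LINT x|M. z n x \<bullet> f x) \<longlonglongrightarrow> 0"
    by (rule inner_tendsto_0[OF weak_gradD(1)[OF w] weak_gradD(1)[OF fw] lim order_refl])
  from tendsto_add[OF this weak_convergence[OF w lim B weak_gradD(2)[OF fw]]]
  have "(\<lambda>n. (LINT x|M. z n x \<bullet> f x) + (LINT x|M. h n x \<bullet> wgrad \<Omega> f x)) \<longlonglongrightarrow> 0" by simp
  moreover have "(LINT x|M. z n x \<bullet> f x) + (LINT x|M. h n x \<bullet> wgrad \<Omega> f x) = b f (z n)" for n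
  proof -
    have wz: "is_weak_grad \<Omega> (z n) (wgrad \<Omega> (z n))" by (rule wgrad_weak[OF weak_grad_H1[OF w]])
    have "(LINT x|M. wgrad \<Omega> f x \<bullet> wgrad \<Omega> (z n) x) = (LINT x|M. h n x \<bullet> wgrad \<Omega> f x)"
    proof (rule integral_cong_AE)
      show "AE x in M. wgrad \<Omega> f x \<bullet> wgrad \<Omega> (z n) x = h n x \<bullet> wgrad \<Omega> f x"
        using weak_grad_unique[OF wz w] by eventually_elim (simp add: inner_commute)
    qed (rule borel_measurable_integrable[OF sqint_inner[OF weak_gradD(2)[OF fw] weak_gradD(2)[OF wz]]],
         rule borel_measurable_integrable[OF sqint_inner[OF weak_gradD(2)[OF w] weak_gradD(2)[OF fw]]])
    then show ?thesis by (simp add: b_def mult.commute)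
  qed
  ultimately have "(\<lambda>n. b f (z n)) \<longlonglongrightarrow> 0" by simp
  then obtain N where N: "\<And>n. n \<ge> N \<Longrightarrow> \<bar>b f (z n)\<bar> < e / 2" using LIMSEQ_D[of _ 0 "e/2"] e by fastforce
  show "\<exists>N. \<forall>n\<ge>N. norm (L (z n) - 0) < e"
  proof (intro exI[of _ N] allI impI)
    fix n assume n: "n \<ge> N"
    have "\<bar>L (z n) - b f (z n)\<bar> \<le> \<epsilon> * H1_norm \<Omega> (z n)" using f(2)[OF weak_grad_H1[OF w]] by (simp add: bb)
    also have "\<dots> \<le> \<epsilon> * Q" using \<epsilon>(1) by (intro mult_left_mono zQ) simp
    finally show "norm (L (z n) - 0) < e" using N[OF n] \<epsilon>(2) by simp
  qed
qed

text \<open>On a sequence bounded in \<open>H1\<close>, convergence in the dual norm makes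
  \<open>\<omega> n - L\<close> uniformly small, and \<open>L\<close> itself tends to 0 along weakly
  null sequences. Pointwise convergence of the functionals would not allow the argument to vary with
  \<open>n\<close>.\<close>

lemma dual_tendsto_weak:
  assumes L: "H1_dual \<Omega> L" and \<omega>: "dual_tendsto \<Omega> \<omega> L" and w: "\<And>n::nat. is_weak_grad \<Omega> (z n) (h n)"
    and lim: "(\<lambda>n. sqn M (z n)) \<longlonglongrightarrow> 0" and B: "\<And>n. sqn M (h n) \<le> B"
  shows "(\<lambda>n. \<omega> n (z n)) \<longlonglongrightarrow> 0"
proof -
  obtain Bz where Bz: "\<And>n. sqn M (z n) \<le> Bz" using lim
    by (metis Bseq_def convergentI convergent_imp_Bseq real_norm_def abs_le_iff)
  define Q where "Q = sqrt (Bz + B)"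
  have Q0: "Q \<ge> 0" unfolding Q_def using order_trans[OF sqn_nonneg Bz] order_trans[OF sqn_nonneg B] by simp
  have zQ: "H1_norm \<Omega> (z n) \<le> Q" for n
    unfolding H1_norm_eq[OF w] Q_def by (intro real_sqrt_le_mono add_mono Bz B)
  have "(\<lambda>n. \<omega> n (z n) - L (z n)) \<longlonglongrightarrow> 0"
  proof (rule LIMSEQ_I)
    fix e :: real assume e: "e > 0"
    then have "e / (Q + 1) > 0" using Q0 by simp
    then obtain N where N: "\<And>n v. n \<ge> N \<Longrightarrow> v \<in> H1 \<Omega> \<Longrightarrow> \<bar>\<omega> n v - L v\<bar> \<le> e / (Q + 1) * H1_norm \<Omega> v"
      using \<omega> unfolding dual_tendsto_def by metis
    show "\<exists>N. \<forall>n\<ge>N. norm (\<omega> n (z n) - L (z n) - 0) < e"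
    proof (intro exI[of _ N] allI impI)
      fix n assume n: "n \<ge> N"
      have "\<bar>\<omega> n (z n) - L (z n)\<bar> \<le> e / (Q + 1) * H1_norm \<Omega> (z n)" by (rule N[OF n weak_grad_H1[OF w]])
      also have "\<dots> \<le> e / (Q + 1) * Q" using e Q0 by (intro mult_left_mono zQ) auto
      also have "\<dots> < e" using e Q0 by (simp add: divide_less_eq)
      finally show "norm (\<omega> n (z n) - L (z n) - 0) < e" by simp
    qed
  qed
  from tendsto_add[OF this H1_dual_weak[OF L w lim B]] show ?thesis by simp
qed

lemma dual_tendsto_pointwise:
  assumes \<omega>: "dual_tendsto \<Omega> \<omega> L" and v: "v \<in> H1 \<Omega>"
  shows "(\<lambda>n. \<omega> n v) \<longlonglongrightarrow> L v"
proof (rule LIMSEQ_I)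
  fix e :: real assume e: "e > 0"
  define Q where "Q = \<bar>H1_norm \<Omega> v\<bar>"
  have Q0: "Q \<ge> 0" "H1_norm \<Omega> v \<le> Q" by (auto simp: Q_def)
  have "e / (Q + 1) > 0" using e Q0 by simp
  then obtain N where N: "\<And>n v. n \<ge> N \<Longrightarrow> v \<in> H1 \<Omega> \<Longrightarrow> \<bar>\<omega> n v - L v\<bar> \<le> e / (Q + 1) * H1_norm \<Omega> v"
    using \<omega> unfolding dual_tendsto_def by metis
  show "\<exists>N. \<forall>n\<ge>N. norm (\<omega> n v - L v) < e"
  proof (intro exI[of _ N] allI impI)
    fix n assume n: "n \<ge> N"
    have "\<bar>\<omega> n v - L v\<bar> \<le> e / (Q + 1) * H1_norm \<Omega> v" by (rule N[OF n v])
    also have "\<dots> \<le> e / (Q + 1) * Q" using e Q0 by (intro mult_left_mono) auto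
    also have "\<dots> < e" using e Q0 by (simp add: divide_less_eq)
    finally show "norm (\<omega> n v - L v) < e" by simp
  qed
qed

end

section \<open>Quasilinear operators\<close>

text \<open>The situation after all extractions: \<open>u n\<close> already converges to
  \<open>w\<close> in L2 and almost everywhere, with gradients bounded in L2. The formula for
  \<open>\<omega> n\<close> is assumed for smooth arguments only.\<close>

locale quasilinear = smoothing \<Omega> P \<psi> k
  for \<Omega> P :: "(real^'n) set" and \<psi> :: "real^'n \<Rightarrow> real^'n \<Rightarrow> real" and k :: "nat \<Rightarrow> real^'n \<Rightarrow> real^'n \<Rightarrow> real" +
  fixes A dA :: "real^'n \<Rightarrow> real \<Rightarrow> real^'n^'n" and C \<nu> R Bd :: real
    and u :: "nat \<Rightarrow> real^'n \<Rightarrow> real" and g :: "nat \<Rightarrow> real^'n \<Rightarrow> real^'n"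
    and w :: "real^'n \<Rightarrow> real" and G :: "real^'n \<Rightarrow> real^'n"
    and \<omega> :: "nat \<Rightarrow> (real^'n \<Rightarrow> real) \<Rightarrow> real" and L :: "(real^'n \<Rightarrow> real) \<Rightarrow> real"
  assumes cpos: "C > 0" "\<nu> > 0" "R > 0"
    and meas: "\<And>s i j. (\<lambda>x. A x s $ i $ j) \<in> borel_measurable (lebesgue_on \<Omega>)"
    and C1: "AE x in lebesgue_on \<Omega>. \<forall>i j s. ((\<lambda>t. A x t $ i $ j) has_real_derivative dA x s $ i $ j) (at s)"
    and bnd: "AE x in lebesgue_on \<Omega>. \<forall>s i j. \<bar>A x s $ i $ j\<bar> \<le> C \<and> \<bar>dA x s $ i $ j\<bar> \<le> C"
    and ell: "AE x in lebesgue_on \<Omega>. \<forall>s \<xi>. (A x s *v \<xi>) \<bullet> \<xi> \<ge> \<nu> * (norm \<xi>)\<^sup>2"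
    and sgn: "AE x in lebesgue_on \<Omega>. \<forall>s \<xi>. \<bar>s\<bar> \<ge> R \<longrightarrow> s * ((dA x s *v \<xi>) \<bullet> \<xi>) \<ge> 0"
    and u: "\<And>n. is_weak_grad \<Omega> (u n) (g n)" and gB: "\<And>n. sqn (lebesgue_on \<Omega>) (g n) \<le> Bd"
    and w: "is_weak_grad \<Omega> w G"
    and uw: "(\<lambda>n. sqn (lebesgue_on \<Omega>) (\<lambda>x. u n x - w x)) \<longlonglongrightarrow> 0"
    and uw_AE: "AE x in lebesgue_on \<Omega>. (\<lambda>n. u n x) \<longlonglongrightarrow> w x"
    and \<omega>: "\<And>n. H1_dual \<Omega> (\<omega> n)" and L: "H1_dual \<Omega> L" and \<omega>L: "dual_tendsto \<Omega> \<omega> L"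
    and \<omega>_smooth: "\<And>n v. smooth v \<Longrightarrow>
      \<omega> n v = (LINT x|lebesgue_on \<Omega>. (A x (u n x) *v g n x) \<bullet> grad v x)
             + 1/2 * (LINT x|lebesgue_on \<Omega>. ((dA x (u n x) *v g n x) \<bullet> g n x) * v x)"
begin

text \<open>A crude bound for the operator norms of \<open>A\<close> and \<open>dA\<close> in terms
  of the bound \<open>C\<close> of their entries.\<close>

definition "CN = C * (real CARD('n))\<^sup>2"

definition "flux n x = A x (u n x) *v g n x"

definition "quad n x = (dA x (u n x) *v g n x) \<bullet> g n x"

lemma CN_pos: "CN > 0"
  unfolding CN_def using cpos by simp

lemma um: "u n \<in> borel_measurable M" and gm: "g n \<in> borel_measurable M"
  using weak_gradD(1,2)[OF u] by (auto simp: sqint_def)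

lemma A_isCont: "AE x in M. \<forall>i j s. isCont (\<lambda>t. A x t $ i $ j) s"
  using C1 by eventually_elim (auto intro: DERIV_isCont)

lemma A_measurable: "v \<in> borel_measurable M \<Longrightarrow> (\<lambda>x. A x (v x) $ i $ j) \<in> borel_measurable M"
  by (rule Caratheodory_measurable[OF dom_borel(2) meas]) (use A_isCont in \<open>auto elim: eventually_mono\<close>)

lemma dA_measurable: "v \<in> borel_measurable M \<Longrightarrow> (\<lambda>x. dA x (v x) $ i $ j) \<in> borel_measurable M"
proof -
  have "AE x in M. \<forall>s. ((\<lambda>t. A x t $ i $ j) has_real_derivative dA x s $ i $ j) (at s)"
    using C1 by eventually_elim blast
  then show "v \<in> borel_measurable M \<Longrightarrow> (\<lambda>x. dA x (v x) $ i $ j) \<in> borel_measurable M"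
    by (rule Caratheodory_derivative_measurable[OF dom_borel(2) meas])
qed

lemma A_bound: "AE x in M. \<forall>s \<xi>. norm (A x s *v \<xi>) \<le> CN * norm \<xi> \<and> norm (dA x s *v \<xi>) \<le> CN * norm \<xi>"
  using bnd by eventually_elim (auto simp: CN_def intro!: matrix_vector_bound)

lemma A_sqint:
  assumes "v \<in> borel_measurable M" "sqint M q"
  shows "sqint M (\<lambda>x. A x (v x) *v q x)"
  by (rule sqint_bound(1)[OF assms(2), of _ CN])
    (use assms A_bound in \<open>auto simp: sqint_def intro!: borel_measurable_matrix_vector A_measurable elim: eventually_mono\<close>)

lemma flux_sqint: "sqint M (flux n)"
  unfolding flux_def[abs_def] by (rule A_sqint[OF um weak_gradD(2)[OF u]])

lemma quad_measurable: "quad n \<in> borel_measurable M"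
  unfolding quad_def[abs_def]
  by (intro borel_measurable_inner borel_measurable_matrix_vector dA_measurable um gm)

lemma quad_bound: "AE x in M. \<forall>n. \<bar>quad n x\<bar> \<le> CN * (norm (g n x))\<^sup>2"
  using A_bound
proof eventually_elim
  case (elim x)
  show ?case
  proof
    fix n
    have "\<bar>quad n x\<bar> \<le> norm (dA x (u n x) *v g n x) * norm (g n x)" unfolding quad_def by (rule Cauchy_Schwarz_ineq2)
    also have "\<dots> \<le> (CN * norm (g n x)) * norm (g n x)" using elim by (intro mult_right_mono) auto
    finally show "\<bar>quad n x\<bar> \<le> CN * (norm (g n x))\<^sup>2" by (simp add: power2_eq_square mult.assoc)
  qed
qed

lemma quad_mult_integrable:
  assumes v: "v \<in> borel_measurable M" "AE x in M. \<bar>v x\<bar> \<le> K"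
  shows "integrable M (\<lambda>x. quad n x * v x)"
proof (rule Bochner_Integration.integrable_bound)
  show "integrable M (\<lambda>x. (CN * \<bar>K\<bar>) * (norm (g n x))\<^sup>2)" using weak_gradD(2)[OF u[of n]] by (simp add: sqint_def)
  show "(\<lambda>x. quad n x * v x) \<in> borel_measurable M" using quad_measurable v by auto
  show "AE x in M. norm (quad n x * v x) \<le> norm ((CN * \<bar>K\<bar>) * (norm (g n x))\<^sup>2)"
    using quad_bound v(2)
  proof eventually_elim
    case (elim x)
    have "\<bar>quad n x\<bar> * \<bar>v x\<bar> \<le> (CN * (norm (g n x))\<^sup>2) * \<bar>K\<bar>" using elim CN_pos by (intro mult_mono) auto
    then show ?case using CN_pos by (simp add: abs_mult mult_ac)
  qed
qed

text \<open>The left side passes to the limit by continuity on \<open>H1\<close> and the flux term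
  by L2 convergence. The quadratic term is only integrable, and needs approximations that are
  uniformly bounded and converge almost everywhere.\<close>

lemma \<omega>_bounded:
  assumes v: "is_weak_grad \<Omega> v h" and K: "AE x in M. \<bar>v x\<bar> \<le> K" "K \<ge> 0"
  shows "\<omega> n v = (LINT x|M. flux n x \<bullet> h x) + 1/2 * (LINT x|M. quad n x * v x)"
proof -
  obtain z where z: "\<And>m::nat. smooth (z m)" "(\<lambda>m. sqn M (\<lambda>x. z m x - v x)) \<longlonglongrightarrow> 0"
    "(\<lambda>m. sqn M (\<lambda>x. grad (z m) x - h x)) \<longlonglongrightarrow> 0" "AE x in M. (\<lambda>m. z m x) \<longlonglongrightarrow> v x"
    "\<And>K m x. K \<ge> 0 \<Longrightarrow> (AE x in M. \<bar>v x\<bar> \<le> K) \<Longrightarrow> x \<in> \<Omega> \<Longrightarrow> \<bar>z m x\<bar> \<le> K"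
    using ex_smooth_sequence[OF v] by blast
  have zw: "is_weak_grad \<Omega> (z m) (grad (z m))" for m by (rule weak_grad_smooth[OF z(1)])
  have "(\<lambda>m. LINT x|M. (grad (z m) x - h x) \<bullet> flux n x) \<longlonglongrightarrow> 0"
    by (rule inner_tendsto_0[OF _ flux_sqint z(3) order_refl]) (rule sqint_diff(1)[OF weak_gradD(2)[OF zw] weak_gradD(2)[OF v]])
  moreover have "(LINT x|M. (grad (z m) x - h x) \<bullet> flux n x) = (LINT x|M. flux n x \<bullet> grad (z m) x) - (LINT x|M. flux n x \<bullet> h x)" for m
    unfolding inner_commute[of _ "flux n _"] inner_diff_right
    by (intro Bochner_Integration.integral_diff sqint_inner flux_sqint weak_gradD(2)[OF zw] weak_gradD(2)[OF v])
  ultimately have 1: "(\<lambda>m. LINT x|M. flux n x \<bullet> grad (z m) x) \<longlonglongrightarrow> (LINT x|M. flux n x \<bullet> h x)"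
    using LIM_zero_cancel by (simp only:)
  have vm: "v \<in> borel_measurable M" "z m \<in> borel_measurable M" for m
    using weak_gradD(1)[OF v] weak_gradD(1)[OF zw] by (auto simp: sqint_def)
  have 2: "(\<lambda>m. LINT x|M. quad n x * z m x) \<longlonglongrightarrow> (LINT x|M. quad n x * v x)"
  proof (rule integral_dominated_convergence[where w = "\<lambda>x. \<bar>quad n x\<bar> * K"])
    have "integrable M (\<lambda>x. quad n x * K)" by (rule quad_mult_integrable[of _ "\<bar>K\<bar>"]) auto
    from integrable_norm[OF this] show "integrable M (\<lambda>x. \<bar>quad n x\<bar> * K)" using K by (simp add: abs_mult)
    show "AE x in M. (\<lambda>m. quad n x * z m x) \<longlonglongrightarrow> quad n x * v x"
      using z(4) by eventually_elim (intro tendsto_intros)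
    show "AE x in M. norm (quad n x * z m x) \<le> \<bar>quad n x\<bar> * K" for m
      using z(5)[OF K(2,1)] by (intro AE_lebesgue_onI) (simp add: abs_mult mult_left_mono)
  qed (use quad_measurable vm in auto)
  have "(\<lambda>m. \<omega> n (z m)) \<longlonglongrightarrow> \<omega> n v"
    by (rule H1_dual_continuous[OF \<omega> zw v z(2,3)])
  moreover have "(\<lambda>m. \<omega> n (z m)) \<longlonglongrightarrow> (LINT x|M. flux n x \<bullet> h x) + 1/2 * (LINT x|M. quad n x * v x)"
    unfolding \<omega>_smooth[OF z(1)] flux_def[symmetric] quad_def[symmetric] by (intro tendsto_intros 1 2)
  ultimately show ?thesis by (rule LIMSEQ_unique)
qed

section \<open>Gradients where the functions are large\<close>

lemma flux_ell: "AE x in M. \<forall>n. flux n x \<bullet> g n x \<ge> \<nu> * (norm (g n x))\<^sup>2"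
  using ell by eventually_elim (auto simp: flux_def)

lemma quad_sgn: "AE x in M. \<forall>n. (u n x \<ge> R \<longrightarrow> quad n x \<ge> 0) \<and> (u n x \<le> - R \<longrightarrow> quad n x \<le> 0)"
  using sgn
proof eventually_elim
  case (elim x)
  have "0 \<le> u n x * quad n x" if "\<bar>u n x\<bar> \<ge> R" for n using elim that by (simp add: quad_def)
  note * = this
  show ?case
  proof (intro allI conjI impI)
    fix n assume "R \<le> u n x"
    then have "0 \<le> u n x * quad n x" "u n x > 0" using *[of n] cpos(3) by auto
    then show "0 \<le> quad n x" by (simp add: zero_le_mult_iff)
  next
    fix n assume "u n x \<le> - R"
    then have "0 \<le> u n x * quad n x" "u n x < 0" using *[of n] cpos(3) by auto
    then show "quad n x \<le> 0" by (simp add: zero_le_mult_iff)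
  qed
qed

lemma sqint_cut: "sqint M h \<Longrightarrow> v \<in> borel_measurable M \<Longrightarrow> sqint M (\<lambda>x. if \<bar>v x\<bar> < \<kappa> then h x else 0)"
  "sqint M h \<Longrightarrow> v \<in> borel_measurable M \<Longrightarrow> sqint M (\<lambda>x. if \<bar>v x\<bar> < \<kappa> then 0 else h x)"
  for h :: "real^'n \<Rightarrow> 'b::euclidean_space" and v :: "real^'n \<Rightarrow> real"
proof -
  assume h: "sqint M h" and v: "v \<in> borel_measurable M"
  have m: "(\<lambda>x. indicator B (v x) *\<^sub>R h x) \<in> borel_measurable M" if "B \<in> sets borel" for B
    using h by (intro borel_measurable_scaleR measurable_compose[OF v] borel_measurable_indicator that) (simp add: sqint_def)
  have "(\<lambda>x. if \<bar>v x\<bar> < \<kappa> then h x else 0) = (\<lambda>x. indicator {y. \<bar>y\<bar> < \<kappa>} (v x) *\<^sub>R h x)"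
    "(\<lambda>x. if \<bar>v x\<bar> < \<kappa> then 0 else h x) = (\<lambda>x. indicator {y. \<not> \<bar>y\<bar> < \<kappa>} (v x) *\<^sub>R h x)"
    by (auto simp: indicator_def)
  then have "(\<lambda>x. if \<bar>v x\<bar> < \<kappa> then h x else 0) \<in> borel_measurable M"
    "(\<lambda>x. if \<bar>v x\<bar> < \<kappa> then 0 else h x) \<in> borel_measurable M"
    using m[of "{y. \<bar>y\<bar> < \<kappa>}"] m[of "{y. \<not> \<bar>y\<bar> < \<kappa>}"] by simp_all
  then show "sqint M (\<lambda>x. if \<bar>v x\<bar> < \<kappa> then h x else 0)" "sqint M (\<lambda>x. if \<bar>v x\<bar> < \<kappa> then 0 else h x)"
    by (auto intro: sqint_bound(1)[OF h, where K = 1])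
qed

lemma tail_estimate:
  assumes \<kappa>: "\<kappa> \<ge> R"
  shows "\<nu> * sqn M (\<lambda>x. if \<bar>u n x\<bar> < \<kappa> then 0 else g n x) \<le> \<omega> n (\<lambda>x. u n x - trunc \<kappa> (u n x))"
proof (rule LIMSEQ_le)
  have kp: "\<kappa> > 0" using \<kappa> cpos by simp
  let ?c = "\<lambda>j. \<kappa> + real j"
  let ?v = "\<lambda>j x. trunc (?c j) (u n x) - trunc \<kappa> (u n x)"
  let ?t = "\<lambda>c x. if \<bar>u n x\<bar> < c then g n x else 0"
  let ?h = "\<lambda>j x. ?t (?c j) x - ?t \<kappa> x"
  have cp: "?c j > 0" for j using kp by (simp add: add_pos_nonneg)
  have us: "sqint M (u n)" and gs: "sqint M (g n)" by (rule weak_gradD[OF u])+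
  have tw: "is_weak_grad \<Omega> (\<lambda>x. trunc c (u n x)) (?t c)" if "c > 0" for c by (rule weak_grad_trunc[OF u that])
  have vw: "is_weak_grad \<Omega> (?v j) (?h j)" for j by (rule weak_grad_diff[OF tw[OF cp] tw[OF kp]])
  have yw: "is_weak_grad \<Omega> (\<lambda>x. u n x - trunc \<kappa> (u n x)) (\<lambda>x. g n x - ?t \<kappa> x)" by (rule weak_grad_diff[OF u tw[OF kp]])
  have gt: "(\<lambda>x. g n x - ?t \<kappa> x) = (\<lambda>x. if \<bar>u n x\<bar> < \<kappa> then 0 else g n x)" by auto
  have ev: "\<forall>\<^sub>F j in sequentially. \<bar>s\<bar> < ?c j" for s
  proof -
    obtain J where "\<bar>s\<bar> < real J" using reals_Archimedean2 by blast
    then show ?thesis using kp by (intro eventually_sequentiallyI[of J]) simp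
  qed
  have l1: "(\<lambda>j. sqn M (\<lambda>x. ?v j x - (u n x - trunc \<kappa> (u n x)))) \<longlonglongrightarrow> 0"
  proof (rule sqn_dominated[OF us, where K = 2])
    show "(\<lambda>x. ?v j x - (u n x - trunc \<kappa> (u n x))) \<in> borel_measurable M" for j using um by measurable
    show "AE x in M. norm (?v j x - (u n x - trunc \<kappa> (u n x))) \<le> 2 * norm (u n x)" for j
    proof (intro AE_I2)
      fix x
      have "\<bar>trunc (?c j) (u n x)\<bar> \<le> \<bar>u n x\<bar>" by (rule trunc_bounds(2)[OF less_imp_le[OF cp[of j]]])
      moreover have "?v j x - (u n x - trunc \<kappa> (u n x)) = trunc (?c j) (u n x) - u n x" by simp
      ultimately show "norm (?v j x - (u n x - trunc \<kappa> (u n x))) \<le> 2 * norm (u n x)"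
        using abs_triangle_ineq4[of "trunc (?c j) (u n x)" "u n x"] by simp
    qed
    show "AE x in M. (\<lambda>j. ?v j x - (u n x - trunc \<kappa> (u n x))) \<longlonglongrightarrow> 0"
    proof (intro AE_I2 tendsto_eventually)
      fix x show "\<forall>\<^sub>F j in sequentially. ?v j x - (u n x - trunc \<kappa> (u n x)) = 0"
        using ev[of "u n x"] by eventually_elim (simp add: trunc_bounds(4))
    qed
  qed
  have l2: "(\<lambda>j. sqn M (\<lambda>x. ?h j x - (g n x - ?t \<kappa> x))) \<longlonglongrightarrow> 0"
  proof (rule sqn_dominated[OF gs, where K = 1])
    show "(\<lambda>x. ?h j x - (g n x - ?t \<kappa> x)) \<in> borel_measurable M" for j using um gm by measurable
    show "AE x in M. norm (?h j x - (g n x - ?t \<kappa> x)) \<le> 1 * norm (g n x)" for j by (intro AE_I2) auto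
    show "AE x in M. (\<lambda>j. ?h j x - (g n x - ?t \<kappa> x)) \<longlonglongrightarrow> 0"
    proof (intro AE_I2 tendsto_eventually)
      fix x show "\<forall>\<^sub>F j in sequentially. ?h j x - (g n x - ?t \<kappa> x) = 0"
        using ev[of "u n x"] by eventually_elim simp
    qed
  qed
  show "(\<lambda>j. \<omega> n (?v j)) \<longlonglongrightarrow> \<omega> n (\<lambda>x. u n x - trunc \<kappa> (u n x))"
    by (rule H1_dual_continuous[OF \<omega> vw yw l1 l2])
  have "(\<lambda>j. sqn M (?h j)) \<longlonglongrightarrow> sqn M (\<lambda>x. g n x - ?t \<kappa> x)"
    by (rule sqn_tendsto[OF weak_gradD(2)[OF vw] weak_gradD(2)[OF yw] l2])
  then show "(\<lambda>j. \<nu> * sqn M (?h j)) \<longlonglongrightarrow> \<nu> * sqn M (\<lambda>x. if \<bar>u n x\<bar> < \<kappa> then 0 else g n x)"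
    unfolding gt by (rule tendsto_mult_left)
  show "\<exists>N. \<forall>j\<ge>N. \<nu> * sqn M (?h j) \<le> \<omega> n (?v j)"
  proof (intro exI[of _ 0] allI impI)
    fix j
    have vb: "AE x in M. \<bar>?v j x\<bar> \<le> ?c j + \<kappa>"
      using trunc_bounds(1)[OF less_imp_le[OF cp[of j]]] trunc_bounds(1)[OF less_imp_le[OF kp]]
      by (intro AE_I2 order_trans[OF abs_triangle_ineq4] add_mono)
    have vm: "?v j \<in> borel_measurable M" using weak_gradD(1)[OF vw] by (simp add: sqint_def)
    have q: "\<omega> n (?v j) = (LINT x|M. flux n x \<bullet> ?h j x) + 1/2 * (LINT x|M. quad n x * ?v j x)"
      by (rule \<omega>_bounded[OF vw vb]) (use cp[of j] kp in simp)
    have hs: "sqint M (?h j)" by (rule weak_gradD(2)[OF vw])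
    have "\<nu> * sqn M (?h j) = (LINT x|M. \<nu> * (norm (?h j x))\<^sup>2)" by (simp add: sqn_def)
    also have "\<dots> \<le> (LINT x|M. flux n x \<bullet> ?h j x)"
    proof (rule integral_mono_AE)
      show "integrable M (\<lambda>x. \<nu> * (norm (?h j x))\<^sup>2)" using hs by (simp add: sqint_def)
      show "integrable M (\<lambda>x. flux n x \<bullet> ?h j x)" by (rule sqint_inner[OF flux_sqint hs])
      \<comment> \<open>The gradient \<open>?h j\<close> equals \<open>g n\<close> on the band
        \<kappa> \<le> |u n| < \<kappa> + j and is 0 elsewhere, so ellipticity applies
        pointwise.\<close>
      show "AE x in M. \<nu> * (norm (?h j x))\<^sup>2 \<le> flux n x \<bullet> ?h j x"
        using flux_ell by eventually_elim auto
    qed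
    finally have i1: "\<nu> * sqn M (?h j) \<le> (LINT x|M. flux n x \<bullet> ?h j x)" .
    have i2: "(LINT x|M. quad n x * ?v j x) \<ge> 0"
    proof (rule integral_nonneg_AE)
      show "AE x in M. 0 \<le> quad n x * ?v j x"
        using quad_sgn
      proof eventually_elim
        case (elim x)
        consider "\<bar>u n x\<bar> < \<kappa>" | "u n x \<ge> \<kappa>" | "u n x \<le> - \<kappa>" by linarith
        then show ?case
        proof cases
          case 1 then show ?thesis by (simp add: trunc_bounds(4))
        next
          case 2
          then have "quad n x \<ge> 0" using elim \<kappa> by auto
          moreover have "?v j x \<ge> 0" using 2 kp by (auto simp: trunc_def)
          ultimately show ?thesis by simp
        next
          case 3
          then have "quad n x \<le> 0" using elim \<kappa> by auto
          moreover have "?v j x \<le> 0" using 3 kp by (auto simp: trunc_def)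
          ultimately show ?thesis by (simp add: mult_nonpos_nonpos)
        qed
      qed
    qed
    show "\<nu> * sqn M (?h j) \<le> \<omega> n (?v j)" using i1 i2 unfolding q by linarith
  qed
qed

lemma cut_tendsto_0:
  fixes v :: "real^'n \<Rightarrow> real" and h :: "real^'n \<Rightarrow> 'b::euclidean_space"
  assumes h: "sqint M h" and v: "v \<in> borel_measurable M"
  shows "(\<lambda>j. sqn M (\<lambda>x. if \<bar>v x\<bar> < a + real j then 0 else h x)) \<longlonglongrightarrow> 0"
proof (rule sqn_dominated[OF h, where K = 1])
  show "(\<lambda>x. if \<bar>v x\<bar> < a + real j then 0 else h x) \<in> borel_measurable M" for j
    using sqint_cut(2)[OF h v] by (simp add: sqint_def)
  show "AE x in M. (\<lambda>j. if \<bar>v x\<bar> < a + real j then 0 else h x) \<longlonglongrightarrow> 0"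
  proof (intro AE_I2 tendsto_eventually)
    fix x
    obtain J where "\<bar>v x\<bar> - a < real J" using reals_Archimedean2 by blast
    then show "\<forall>\<^sub>F j in sequentially. (if \<bar>v x\<bar> < a + real j then 0 else h x) = 0"
      by (intro eventually_sequentiallyI[of J]) auto
  qed
qed auto

text \<open>Along the sequence, \<omega>_n(u_n - T u_n) tends to L(w - T w), and w - T w is small in
  \<open>H1\<close> for large \<kappa>. So \<kappa> is chosen from the limit \<open>w\<close> alone
  and \<open>N\<close> afterwards, which gives a bound uniform in n.\<close>

lemma tails_small:
  assumes e: "e > 0"
  obtains \<kappa> N where "\<kappa> \<ge> R" "\<And>n. n \<ge> N \<Longrightarrow> sqn M (\<lambda>x. if \<bar>u n x\<bar> < \<kappa> then 0 else g n x) \<le> e"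
    "sqn M (\<lambda>x. if \<bar>w x\<bar> < \<kappa> then 0 else G x) \<le> e"
proof -
  have ws: "sqint M w" and Gs: "sqint M G" by (rule weak_gradD[OF w])+
  have wm: "w \<in> borel_measurable M" using ws by (simp add: sqint_def)
  let ?c = "\<lambda>j. R + real j"
  have cp: "?c j > 0" for j using cpos by (simp add: add_pos_nonneg)
  let ?y = "\<lambda>\<kappa> x. w x - trunc \<kappa> (w x)"
  have yw: "is_weak_grad \<Omega> (?y \<kappa>) (\<lambda>x. if \<bar>w x\<bar> < \<kappa> then 0 else G x)" if "\<kappa> > 0" for \<kappa>
  proof -
    have "(\<lambda>x. if \<bar>w x\<bar> < \<kappa> then 0 else G x) = (\<lambda>x. G x - (if \<bar>w x\<bar> < \<kappa> then G x else 0))" by auto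
    then show ?thesis using weak_grad_diff[OF w weak_grad_trunc[OF w that]] by simp
  qed
  have yb: "\<bar>?y \<kappa> x\<bar> \<le> 1 * \<bar>if \<bar>w x\<bar> < \<kappa> then 0 else w x\<bar>" if "\<kappa> > 0" for \<kappa> x
    using that by (auto simp: trunc_def abs_if max_def min_def)
  have y0: "(\<lambda>j. sqn M (?y (?c j))) \<longlonglongrightarrow> 0"
    by (rule sqn_tendsto_0_bound[OF sqint_cut(2)[OF ws wm] _ _ cut_tendsto_0[OF ws wm, of R], where K = 1])
      (use yb[OF cp] wm in auto)
  have G0: "(\<lambda>j. sqn M (\<lambda>x. if \<bar>w x\<bar> < ?c j then 0 else G x)) \<longlonglongrightarrow> 0" by (rule cut_tendsto_0[OF Gs wm])
  have "(\<lambda>j. L (?y (?c j))) \<longlonglongrightarrow> 0" by (rule H1_dual_tendsto_0[OF L yw[OF cp] y0 G0])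
  then have "\<forall>\<^sub>F j in sequentially. L (?y (?c j)) < \<nu> * e / 2" using e cpos by (intro order_tendstoD(2)) auto
  moreover have "\<forall>\<^sub>F j in sequentially. sqn M (\<lambda>x. if \<bar>w x\<bar> < ?c j then 0 else G x) < e" using G0 e by (intro order_tendstoD(2)) auto
  ultimately obtain j where j: "L (?y (?c j)) < \<nu> * e / 2" "sqn M (\<lambda>x. if \<bar>w x\<bar> < ?c j then 0 else G x) < e"
    using eventually_happens[OF eventually_conj] trivial_limit_sequentially by blast
  define \<kappa> where "\<kappa> = ?c j"
  have \<kappa>: "\<kappa> \<ge> R" "\<kappa> > 0" using cp[of j] by (auto simp: \<kappa>_def)
  let ?yn = "\<lambda>n x. u n x - trunc \<kappa> (u n x)"
  have ynw: "is_weak_grad \<Omega> (?yn n) (\<lambda>x. g n x - (if \<bar>u n x\<bar> < \<kappa> then g n x else 0))" for n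
    by (rule weak_grad_diff[OF u weak_grad_trunc[OF u \<kappa>(2)]])
  let ?z = "\<lambda>n x. ?yn n x - ?y \<kappa> x"
  have zw: "is_weak_grad \<Omega> (?z n) (\<lambda>x. (g n x - (if \<bar>u n x\<bar> < \<kappa> then g n x else 0)) - (if \<bar>w x\<bar> < \<kappa> then 0 else G x))" for n
    by (rule weak_grad_diff[OF ynw yw[OF \<kappa>(2)]])
  have z0: "(\<lambda>n. sqn M (?z n)) \<longlonglongrightarrow> 0"
  proof (rule sqn_tendsto_0_bound[OF _ _ _ uw, where K = 2])
    show "sqint M (\<lambda>x. u n x - w x)" for n by (rule sqint_diff(1)[OF weak_gradD(1)[OF u] ws])
    show "?z n \<in> borel_measurable M" for n using um wm by measurable
    show "AE x in M. norm (?z n x) \<le> 2 * norm (u n x - w x)" for n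
    proof (intro AE_I2)
      fix x
      have "?z n x = (u n x - w x) - (trunc \<kappa> (u n x) - trunc \<kappa> (w x))" by simp
      then have "\<bar>?z n x\<bar> \<le> \<bar>u n x - w x\<bar> + \<bar>trunc \<kappa> (u n x) - trunc \<kappa> (w x)\<bar>"
        by (simp only: abs_triangle_ineq4)
      then show "norm (?z n x) \<le> 2 * norm (u n x - w x)"
        using trunc_bounds(5)[of \<kappa> "u n x" "w x"] by simp
    qed
  qed
  have zB: "sqn M (\<lambda>x. (g n x - (if \<bar>u n x\<bar> < \<kappa> then g n x else 0)) - (if \<bar>w x\<bar> < \<kappa> then 0 else G x)) \<le> 2 * Bd + 2 * sqn M G" for n
  proof -
    have "sqn M (\<lambda>x. g n x - (if \<bar>u n x\<bar> < \<kappa> then g n x else 0)) \<le> 1\<^sup>2 * sqn M (g n)"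
      using weak_gradD(2)[OF ynw[of n]] by (intro sqint_bound(2)[OF weak_gradD(2)[OF u]]) (auto simp: sqint_def)
    moreover have "sqn M (\<lambda>x. if \<bar>w x\<bar> < \<kappa> then 0 else G x) \<le> 1\<^sup>2 * sqn M G"
      using weak_gradD(2)[OF yw[OF \<kappa>(2)]] by (intro sqint_bound(2)[OF Gs]) (auto simp: sqint_def)
    ultimately show ?thesis
      using sqint_diff(2)[OF weak_gradD(2)[OF ynw[of n]] weak_gradD(2)[OF yw[OF \<kappa>(2)]]] gB[of n] by simp
  qed
  \<comment> \<open>The difference (u_n - T u_n) - (w - T w) is weakly null, so only the value at
    the fixed function w - T w remains.\<close>
  have "(\<lambda>n. \<omega> n (?z n)) \<longlonglongrightarrow> 0" by (rule dual_tendsto_weak[OF L \<omega>L zw z0 zB])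
  from tendsto_add[OF this dual_tendsto_pointwise[OF \<omega>L weak_grad_H1[OF yw[OF \<kappa>(2)]]]]
  have "(\<lambda>n. \<omega> n (?yn n)) \<longlonglongrightarrow> L (?y \<kappa>)"
    by (simp add: H1_dual_diff[OF \<omega> weak_grad_H1[OF ynw] weak_grad_H1[OF yw[OF \<kappa>(2)]]])
  moreover have "L (?y \<kappa>) < \<nu> * e" using j(1) mult_pos_pos[OF cpos(2) e] unfolding \<kappa>_def by linarith
  ultimately have "\<forall>\<^sub>F n in sequentially. \<omega> n (?yn n) < \<nu> * e" by (rule order_tendstoD(2))
  then obtain N where N: "\<And>n. n \<ge> N \<Longrightarrow> \<omega> n (?yn n) < \<nu> * e" by (auto simp: eventually_sequentially)
  show thesis
  proof (rule that[OF \<kappa>(1), of N])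
    fix n assume "n \<ge> N"
    then have "\<nu> * sqn M (\<lambda>x. if \<bar>u n x\<bar> < \<kappa> then 0 else g n x) \<le> \<nu> * e"
      using tail_estimate[OF \<kappa>(1), of n] N[of n] by linarith
    then show "sqn M (\<lambda>x. if \<bar>u n x\<bar> < \<kappa> then 0 else g n x) \<le> e" using cpos(2) by simp
  qed (use j(2) in \<open>simp add: \<kappa>_def\<close>)
qed

text \<open>This is where the test function \<open>f(T u - T w)\<close> comes from: with \<open>\<lambda> = 2 CN / \<nu>\<close>, the choice
  \<open>f(s) = sinh(\<lambda> s) / \<lambda>\<close> gives \<open>\<nu> f' - CN \<bar>f\<bar> \<ge> \<nu>/2\<close>, which absorbs the quadratic term where \<open>\<bar>u\<bar> < \<kappa>\<close>;
  elsewhere that term has a good sign.\<close>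

lemma pointwise_coercivity:
  fixes F :: "real^'n^'n" and \<xi> t :: "real^'n"
  assumes ell: "\<And>\<xi>. (F *v \<xi>) \<bullet> \<xi> \<ge> \<nu> * (norm \<xi>)\<^sup>2"
    and b: "\<bar>b\<bar> \<le> CN * (norm \<xi>)\<^sup>2" and p: "p \<ge> 1" and f: "CN * \<bar>f\<bar> \<le> \<nu> / 2 * p"
    and good: "\<not> small \<Longrightarrow> b * f \<ge> 0"
    and h: "h = (if small then \<xi> else 0) - t"
  shows "\<nu> / 2 * (norm h)\<^sup>2 \<le> (F *v \<xi>) \<bullet> (p *\<^sub>R h) + 1/2 * (b * f) - h \<bullet> (p *\<^sub>R (F *v t))
     + CN * ((norm t)\<^sup>2 * \<bar>f\<bar>) + \<nu> / 2 * (norm (if small then 0 else t))\<^sup>2 + p * \<bar>(F *v \<xi>) \<bullet> (if small then 0 else t)\<bar>"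
proof (cases small)
  case True
  then have hx: "h = \<xi> - t" using h by simp
  \<comment> \<open>Only the part \<open>h\<close> of \<xi> = h + t can be absorbed by coercivity.
    The factor 2 of this splitting cancels the 1/2 in front of b f; the part with \<open>t\<close>
    goes into the error.\<close>
  have "(norm \<xi>)\<^sup>2 \<le> 2 * (norm h)\<^sup>2 + 2 * (norm t)\<^sup>2"
  proof -
    have "(norm (h + t))\<^sup>2 \<le> (norm h + norm t)\<^sup>2" by (intro power_mono norm_triangle_ineq) simp
    also have "\<dots> \<le> 2 * (norm h)\<^sup>2 + 2 * (norm t)\<^sup>2"
      using sum_squares_bound[of "norm h" "norm t"] by (simp add: power2_sum)
    finally show ?thesis by (simp add: hx)
  qed
  then have "CN * (norm \<xi>)\<^sup>2 \<le> CN * (2 * (norm h)\<^sup>2 + 2 * (norm t)\<^sup>2)" using CN_pos by (intro mult_left_mono) auto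
  then have "\<bar>b * f\<bar> \<le> CN * (2 * (norm h)\<^sup>2 + 2 * (norm t)\<^sup>2) * \<bar>f\<bar>"
    unfolding abs_mult using b by (intro mult_right_mono) auto
  then have "\<bar>b * f\<bar> \<le> 2 * ((CN * \<bar>f\<bar>) * (norm h)\<^sup>2) + 2 * (CN * ((norm t)\<^sup>2 * \<bar>f\<bar>))" by (simp add: algebra_simps)
  moreover have "(CN * \<bar>f\<bar>) * (norm h)\<^sup>2 \<le> (\<nu> / 2 * p) * (norm h)\<^sup>2" using f by (intro mult_right_mono) auto
  ultimately have bf: "- (1/2 * (b * f)) \<le> \<nu> / 2 * p * (norm h)\<^sup>2 + CN * ((norm t)\<^sup>2 * \<bar>f\<bar>)" by argo
  have "(F *v \<xi>) \<bullet> (p *\<^sub>R h) - h \<bullet> (p *\<^sub>R (F *v t)) = p * ((F *v h) \<bullet> h)"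
    unfolding hx by (simp add: matrix_vector_mult_diff_distrib inner_diff_left inner_diff_right inner_commute algebra_simps)
  also have "\<dots> \<ge> p * (\<nu> * (norm h)\<^sup>2)" using ell[of h] p by (intro mult_left_mono) auto
  finally have ph: "p * (\<nu> * (norm h)\<^sup>2) \<le> (F *v \<xi>) \<bullet> (p *\<^sub>R h) - h \<bullet> (p *\<^sub>R (F *v t))" .
  have "\<nu> / 2 * (norm h)\<^sup>2 * 1 \<le> \<nu> / 2 * (norm h)\<^sup>2 * p" using p cpos by (intro mult_left_mono) auto
  then have "\<nu> / 2 * (norm h)\<^sup>2 \<le> p * (\<nu> * (norm h)\<^sup>2) - \<nu> / 2 * p * (norm h)\<^sup>2" by (simp add: algebra_simps)
  then have "\<nu> / 2 * (norm h)\<^sup>2 \<le> (F *v \<xi>) \<bullet> (p *\<^sub>R h) + 1/2 * (b * f) - h \<bullet> (p *\<^sub>R (F *v t)) + CN * ((norm t)\<^sup>2 * \<bar>f\<bar>)"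
    using bf ph by argo
  then show ?thesis using True by simp
next
  case False
  \<comment> \<open>Here h = -t, so the left side is exactly the error term with \<nu>/2. In the
    rest, the flux term is compensated by its absolute value, and (F t) \<bullet> t and b f are
    nonnegative.\<close>
  then have hx: "h = - t" using h by simp
  have "(F *v t) \<bullet> t \<ge> 0" using ell[of t] cpos by (meson mult_nonneg_nonneg less_imp_le order_trans zero_le_power2)
  then have 1: "p * ((F *v t) \<bullet> t) \<ge> 0" using p by simp
  have 2: "- (p * ((F *v \<xi>) \<bullet> t)) \<ge> - (p * \<bar>(F *v \<xi>) \<bullet> t\<bar>)" using p by (simp add: mult_left_mono)
  have 3: "CN * ((norm t)\<^sup>2 * \<bar>f\<bar>) \<ge> 0" using CN_pos by simp
  show ?thesis using good[OF False] 1 2 3 False by (simp add: hx inner_commute)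
qed

text \<open>Integrating the pointwise coercivity bounds the squared norm of \<open>h n\<close>, the
  gradient of T u_n - T w, by an expression \<open>E n\<close> in which no square of an unknown
  gradient remains. Each of its five terms pairs a bounded or fixed factor with something that tends
  to 0.\<close>

lemma truncations_converge:
  assumes \<kappa>: "\<kappa> \<ge> R"
  shows "(\<lambda>n. sqn M (\<lambda>x. (if \<bar>u n x\<bar> < \<kappa> then g n x else 0) - (if \<bar>w x\<bar> < \<kappa> then G x else 0))) \<longlonglongrightarrow> 0"
proof -
  have kp: "\<kappa> > 0" using \<kappa> cpos by simp
  define \<Lambda> where "\<Lambda> = 2 * CN / \<nu>"
  have \<Lambda>: "\<Lambda> > 0" using CN_pos cpos by (simp add: \<Lambda>_def)
  define f where "f s = sinh (\<Lambda> * s) / \<Lambda>" for s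
  define p where "p s = cosh (\<Lambda> * s)" for s
  have fder: "(f has_real_derivative p s) (at s)" for s
    unfolding f_def p_def using \<Lambda> by (auto intro!: derivative_eq_intros)
  have pcont: "continuous_on UNIV p" unfolding p_def by (intro continuous_intros)
  have p1: "p s \<ge> 1" for s unfolding p_def by (rule cosh_real_ge_1)
  have fp: "CN * \<bar>f s\<bar> \<le> \<nu> / 2 * p s" for s
  proof -
    have "CN / \<Lambda> = \<nu> / 2" using CN_pos cpos by (simp add: \<Lambda>_def)
    moreover have "CN * \<bar>f s\<bar> = CN / \<Lambda> * \<bar>sinh (\<Lambda> * s)\<bar>" using \<Lambda> by (simp add: f_def)
    ultimately have "CN * \<bar>f s\<bar> = \<nu> / 2 * \<bar>sinh (\<Lambda> * s)\<bar>" by (simp only:)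
    also have "\<bar>sinh (\<Lambda> * s)\<bar> \<le> p s"
      unfolding p_def sinh_real_abs[symmetric] cosh_real_abs[of "\<Lambda> * s", symmetric]
      by (simp add: sinh_def cosh_def)
    finally show ?thesis using cpos by simp
  qed
  \<comment> \<open>The range of a difference of two truncations. On it cosh is bounded by
    \<open>P0\<close>, although f' is unbounded on the line.\<close>
  define J where "J = {- (2 * \<kappa>)..2 * \<kappa>}"
  define P0 where "P0 = p (2 * \<kappa>)"
  have pJ: "\<bar>p s\<bar> \<le> P0" if "s \<in> J" for s
  proof -
    have "cosh \<bar>\<Lambda> * s\<bar> \<le> cosh (\<Lambda> * (2 * \<kappa>))"
    proof (subst cosh_real_nonneg_le_iff)
      show "\<bar>\<Lambda> * s\<bar> \<le> \<Lambda> * (2 * \<kappa>)" unfolding abs_mult using that \<Lambda> by (intro mult_mono) (auto simp: J_def)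
    qed (use \<Lambda> kp in auto)
    then show ?thesis using p1[of s] by (simp add: P0_def p_def)
  qed
  have P01: "P0 \<ge> 1" unfolding P0_def by (rule p1)
  have f0: "f 0 = 0" by (simp add: f_def)
  have fb: "\<bar>f s\<bar> \<le> P0 * \<bar>s\<bar>" if "s \<in> J" for s
    using deriv_bounded_Lipschitz[where f = f and f' = p and J = J and K = P0 and a = s and b = 0, OF fder pJ] that kp f0
    by (auto simp: J_def)
  have fcont: "continuous_on UNIV f" unfolding f_def using \<Lambda> by (intro continuous_intros) auto
  have [measurable]: "f \<in> borel_measurable borel" "p \<in> borel_measurable borel"
    using fcont pcont by (auto intro: borel_measurable_continuous_onI)
  have ws: "sqint M w" and Gs: "sqint M G" by (rule weak_gradD[OF w])+
  have wm [measurable]: "w \<in> borel_measurable M" using ws by (simp add: sqint_def)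
  note um[measurable] gm[measurable]
  define t where "t x = (if \<bar>w x\<bar> < \<kappa> then G x else 0)" for x
  define h where "h n x = (if \<bar>u n x\<bar> < \<kappa> then g n x else 0) - t x" for n x
  define z where "z n x = trunc \<kappa> (u n x) - trunc \<kappa> (w x)" for n x
  define v where "v n x = f (z n x)" for n x
  \<comment> \<open>The gradient of T w on the set where that of T u_n has been cut off: the
    mismatch between the two truncation sets.\<close>
  define \<tau> where "\<tau> n x = (if \<bar>u n x\<bar> < \<kappa> then 0 else t x)" for n x
  \<comment> \<open>The flux of T w with the coefficients of \<open>u n\<close>. Subtracting it
    turns the flux into A h \<bullet> h where |u n| < \<kappa>; it converges strongly, so its
    pairing with \<open>h n\<close> tends to 0.\<close>
  define q where "q n x = p (z n x) *\<^sub>R (A x (u n x) *v t x)" for n x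
  have zw: "is_weak_grad \<Omega> (z n) (h n)" for n
    unfolding z_def[abs_def] h_def[abs_def] t_def by (intro weak_grad_diff weak_grad_trunc u w kp)
  have zJ: "z n x \<in> J" for n x
    unfolding z_def J_def using trunc_bounds(1)[of \<kappa> "u n x"] trunc_bounds(1)[of \<kappa> "w x"] kp by (auto simp: abs_le_iff)
  have vw: "is_weak_grad \<Omega> (v n) (\<lambda>x. p (z n x) *\<^sub>R h n x)" for n
    unfolding v_def[abs_def]
    by (rule weak_grad_chain[where J = J and K = P0, OF zw fder pcont pJ]) (use zJ kp in \<open>auto simp: J_def intro!: exI[of _ "2 * \<kappa>"]\<close>)
  have hs: "sqint M (h n)" for n by (rule weak_gradD(2)[OF zw])
  have ts: "sqint M t" unfolding t_def[abs_def] by (rule sqint_cut(1)[OF Gs wm])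
  have \<tau>s: "sqint M (\<tau> n)" for n unfolding \<tau>_def[abs_def] by (rule sqint_cut(2)[OF ts um])
  have [measurable]: "t \<in> borel_measurable M" "h n \<in> borel_measurable M" "z n \<in> borel_measurable M" "\<tau> n \<in> borel_measurable M" for n
    using ts hs \<tau>s weak_gradD(1)[OF zw] by (auto simp: sqint_def)
  have vm [measurable]: "v n \<in> borel_measurable M" for n unfolding v_def by measurable
  have hB: "sqn M (h n) \<le> 2 * Bd + 2 * sqn M t" for n
  proof -
    have s: "sqint M (\<lambda>x. if \<bar>u n x\<bar> < \<kappa> then g n x else 0)" by (rule sqint_cut(1)[OF weak_gradD(2)[OF u] um])
    have "sqn M (\<lambda>x. if \<bar>u n x\<bar> < \<kappa> then g n x else 0) \<le> 1\<^sup>2 * sqn M (g n)"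
      using s by (intro sqint_bound(2)[OF weak_gradD(2)[OF u]]) (auto simp: sqint_def)
    then show ?thesis using sqint_diff(2)[OF s ts] gB[of n] unfolding h_def by simp
  qed
  have z0: "(\<lambda>n. sqn M (z n)) \<longlonglongrightarrow> 0"
    by (rule sqn_tendsto_0_bound[OF sqint_diff(1)[OF weak_gradD(1)[OF u] ws] _ _ uw, where K = 1])
      (auto simp: z_def trunc_bounds(5))
  have v0: "(\<lambda>n. sqn M (v n)) \<longlonglongrightarrow> 0"
    by (rule sqn_tendsto_0_bound[OF weak_gradD(1)[OF zw] vm _ z0, where K = P0]) (use fb zJ in \<open>auto simp: v_def\<close>)
  have zAE: "AE x in M. (\<lambda>n. z n x) \<longlonglongrightarrow> 0"
    using uw_AE
  proof eventually_elim
    case (elim x)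
    have "(\<lambda>n. trunc \<kappa> (u n x)) \<longlonglongrightarrow> trunc \<kappa> (w x)" unfolding trunc_def by (intro tendsto_intros elim)
    from LIM_zero[OF this] show ?case unfolding z_def .
  qed
  have contp: "(\<lambda>n. p (a n)) \<longlonglongrightarrow> 1" if "a \<longlonglongrightarrow> 0" for a
  proof -
    have "isCont p 0" using pcont by (simp add: continuous_on_eq_continuous_at)
    from isCont_tendsto_compose[OF this that] show ?thesis by (simp add: p_def)
  qed
  have contf: "(\<lambda>n. f (a n)) \<longlonglongrightarrow> 0" if "a \<longlonglongrightarrow> 0" for a
  proof -
    have "isCont f 0" using fcont by (simp add: continuous_on_eq_continuous_at)
    from isCont_tendsto_compose[OF this that] show ?thesis by (simp add: f0)
  qed
  have vF: "\<bar>v n x\<bar> \<le> P0 * (2 * \<kappa>)" for n x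
  proof -
    have "\<bar>v n x\<bar> \<le> P0 * \<bar>z n x\<bar>" unfolding v_def by (rule fb[OF zJ])
    also have "\<dots> \<le> P0 * (2 * \<kappa>)" using zJ[of n x] P01 by (intro mult_left_mono) (auto simp: J_def)
    finally show ?thesis .
  qed

  have ph: "sqint M (\<lambda>x. p (z n x) *\<^sub>R h n x)" and phB: "sqn M (\<lambda>x. p (z n x) *\<^sub>R h n x) \<le> P0\<^sup>2 * (2 * Bd + 2 * sqn M t)" for n
  proof -
    have ae: "AE x in M. norm (p (z n x) *\<^sub>R h n x) \<le> P0 * norm (h n x)"
      using pJ[OF zJ] by (intro AE_I2) (simp add: mult_right_mono)
    show "sqint M (\<lambda>x. p (z n x) *\<^sub>R h n x)" by (rule weak_gradD(2)[OF vw])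
    have "sqn M (\<lambda>x. p (z n x) *\<^sub>R h n x) \<le> P0\<^sup>2 * sqn M (h n)"
      by (rule sqint_bound(2)[OF hs _ ae]) measurable
    also have "\<dots> \<le> P0\<^sup>2 * (2 * Bd + 2 * sqn M t)" by (intro mult_left_mono hB) simp
    finally show "sqn M (\<lambda>x. p (z n x) *\<^sub>R h n x) \<le> P0\<^sup>2 * (2 * Bd + 2 * sqn M t)" .
  qed
  \<comment> \<open>The test functions tend to 0 in L2 with bounded gradients, so strong convergence
    of the functionals gives the limit 0.\<close>
  have lim1: "(\<lambda>n. \<omega> n (v n)) \<longlonglongrightarrow> 0" by (rule dual_tendsto_weak[OF L \<omega>L vw v0 phB])
  have At: "sqint M (\<lambda>x. A x (y x) *v t x)" if "y \<in> borel_measurable M" for y by (rule A_sqint[OF that ts])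
  have qs: "sqint M (q n)" for n
    unfolding q_def[abs_def]
    by (rule sqint_bound(1)[OF At[OF um], of _ P0 n])
      (use At[OF um] pJ[OF zJ] in \<open>auto simp: sqint_def intro!: mult_right_mono borel_measurable_scaleR\<close>)
  have ql: "(\<lambda>n. sqn M (\<lambda>x. q n x - A x (w x) *v t x)) \<longlonglongrightarrow> 0"
  proof (rule sqn_dominated[OF ts, where K = "P0 * CN + CN"])
    show "(\<lambda>x. q n x - A x (w x) *v t x) \<in> borel_measurable M" for n
      using qs At[OF wm] by (intro borel_measurable_diff) (auto simp: sqint_def)
    show "AE x in M. norm (q n x - A x (w x) *v t x) \<le> (P0 * CN + CN) * norm (t x)" for n
      using A_bound
    proof eventually_elim
      case (elim x)
      have "norm (q n x) \<le> P0 * (CN * norm (t x))"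
        unfolding q_def norm_scaleR using elim pJ[OF zJ] P01 by (intro mult_mono) auto
      moreover have "norm (A x (w x) *v t x) \<le> CN * norm (t x)" using elim by blast
      ultimately show ?case using norm_triangle_ineq4[of "q n x" "A x (w x) *v t x"] by (simp add: algebra_simps)
    qed
    show "AE x in M. (\<lambda>n. q n x - A x (w x) *v t x) \<longlonglongrightarrow> 0"
      using A_isCont uw_AE zAE
    proof eventually_elim
      case (elim x)
      have "(\<lambda>n. A x (u n x) $ i $ j) \<longlonglongrightarrow> A x (w x) $ i $ j" for i j
        using elim(1,2) isCont_tendsto_compose[of "w x" "\<lambda>s. A x s $ i $ j"] by blast
      then have "(\<lambda>n. A x (u n x) *v t x) \<longlonglongrightarrow> A x (w x) *v t x"
        unfolding matrix_vector_mult_def by (intro tendsto_vec_lambda tendsto_sum tendsto_mult tendsto_const)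
      from tendsto_scaleR[OF contp[OF elim(3)] this] show ?case unfolding q_def by (intro LIM_zero) simp
    qed
  qed
  have lim2: "(\<lambda>n. LINT x|M. h n x \<bullet> q n x) \<longlonglongrightarrow> 0"
    by (rule weak_strong_convergence[OF zw z0 hB At[OF wm] qs ql])
  have i3: "integrable M (\<lambda>x. (norm (t x))\<^sup>2 * \<bar>v n x\<bar>)" for n
  proof (rule Bochner_Integration.integrable_bound)
    show "integrable M (\<lambda>x. (norm (t x))\<^sup>2 * (P0 * (2 * \<kappa>)))" using ts by (simp add: sqint_def)
    show "AE x in M. norm ((norm (t x))\<^sup>2 * \<bar>v n x\<bar>) \<le> norm ((norm (t x))\<^sup>2 * (P0 * (2 * \<kappa>)))"
      using vF P01 kp by (intro AE_I2) (auto simp: abs_mult intro!: mult_left_mono)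
  qed measurable
  \<comment> \<open>The square of \<open>t\<close> is a fixed integrable function, while
    \<open>v n\<close> is bounded and tends to 0 almost everywhere.\<close>
  have "(\<lambda>n. LINT x|M. (norm (t x))\<^sup>2 * \<bar>v n x\<bar>) \<longlonglongrightarrow> (LINT x|M. 0)"
  proof (rule integral_dominated_convergence[where w = "\<lambda>x. (norm (t x))\<^sup>2 * (P0 * (2 * \<kappa>))"])
    show "integrable M (\<lambda>x. (norm (t x))\<^sup>2 * (P0 * (2 * \<kappa>)))" using ts by (simp add: sqint_def)
    show "AE x in M. norm ((norm (t x))\<^sup>2 * \<bar>v n x\<bar>) \<le> (norm (t x))\<^sup>2 * (P0 * (2 * \<kappa>))" for n
      using vF by (intro AE_I2) (auto simp: abs_mult intro!: mult_left_mono)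
    show "AE x in M. (\<lambda>n. (norm (t x))\<^sup>2 * \<bar>v n x\<bar>) \<longlonglongrightarrow> 0"
      using zAE
    proof eventually_elim
      case (elim x)
      from tendsto_mult_left[OF tendsto_rabs_zero[OF contf[OF elim]], of "(norm (t x))\<^sup>2"] show ?case by (simp add: v_def)
    qed
  qed measurable
  then have lim3: "(\<lambda>n. LINT x|M. (norm (t x))\<^sup>2 * \<bar>v n x\<bar>) \<longlonglongrightarrow> 0" by simp
  \<comment> \<open>Where |w| < \<kappa>, eventually |u n| < \<kappa> and \<tau> is 0; where |w|
    \<ge> \<kappa>, already \<open>t\<close> is 0. The strict inequalities matter: on |w| =
    \<kappa>, u_n may lie on either side.\<close>
  have lim4: "(\<lambda>n. sqn M (\<tau> n)) \<longlonglongrightarrow> 0"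
  proof (rule sqn_dominated[OF ts, where K = 1])
    show "AE x in M. norm (\<tau> n x) \<le> 1 * norm (t x)" for n by (intro AE_I2) (simp add: \<tau>_def)
    show "AE x in M. (\<lambda>n. \<tau> n x) \<longlonglongrightarrow> 0"
      using uw_AE
    proof eventually_elim
      case (elim x)
      show ?case
      proof (cases "\<bar>w x\<bar> < \<kappa>")
        case True
        have "\<forall>\<^sub>F n in sequentially. \<bar>u n x\<bar> < \<kappa>" by (rule order_tendstoD(2)[OF tendsto_rabs[OF elim] True])
        then have "\<forall>\<^sub>F n in sequentially. \<tau> n x = 0" by eventually_elim (simp add: \<tau>_def)
        then show ?thesis by (rule tendsto_eventually)
      next
        case False
        then have "\<tau> n x = 0" for n by (simp add: \<tau>_def t_def)
        then show ?thesis by simp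
      qed
    qed
  qed measurable
  have p\<tau>: "sqint M (\<lambda>x. p (z n x) *\<^sub>R \<tau> n x)" and p\<tau>0: "(\<lambda>n. sqn M (\<lambda>x. p (z n x) *\<^sub>R \<tau> n x)) \<longlonglongrightarrow> 0" for n
  proof -
    have m: "(\<lambda>x. p (z n x) *\<^sub>R \<tau> n x) \<in> borel_measurable M" for n by measurable
    have ae: "AE x in M. norm (p (z n x) *\<^sub>R \<tau> n x) \<le> P0 * norm (\<tau> n x)" for n
      using pJ[OF zJ] by (intro AE_I2) (simp add: mult_right_mono)
    show "sqint M (\<lambda>x. p (z n x) *\<^sub>R \<tau> n x)" by (rule sqint_bound(1)[OF \<tau>s m ae])
    show "(\<lambda>n. sqn M (\<lambda>x. p (z n x) *\<^sub>R \<tau> n x)) \<longlonglongrightarrow> 0" by (rule sqn_tendsto_0_bound[OF \<tau>s m ae lim4])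
  qed
  have fluxB: "sqn M (flux n) \<le> CN\<^sup>2 * Bd" for n
  proof -
    have "sqn M (flux n) \<le> CN\<^sup>2 * sqn M (g n)"
      by (rule sqint_bound(2)[OF weak_gradD(2)[OF u]]) (use flux_sqint[of n] A_bound in \<open>auto simp: sqint_def flux_def elim: eventually_mono\<close>)
    also have "\<dots> \<le> CN\<^sup>2 * Bd" by (intro mult_left_mono gB) simp
    finally show ?thesis .
  qed
  \<comment> \<open>The flux is only bounded in L2; the other factor converges strongly to
    0.\<close>
  have lim5: "(\<lambda>n. LINT x|M. norm (p (z n x) *\<^sub>R \<tau> n x) \<bullet> norm (flux n x)) \<longlonglongrightarrow> 0"
  proof (rule inner_tendsto_0)
    show "sqint M (\<lambda>x. norm (p (z n x) *\<^sub>R \<tau> n x))" for n by (rule sqint_norm[OF p\<tau>])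
    show "sqint M (\<lambda>x. norm (flux n x))" for n by (rule sqint_norm[OF flux_sqint])
    show "(\<lambda>n. sqn M (\<lambda>x. norm (p (z n x) *\<^sub>R \<tau> n x))) \<longlonglongrightarrow> 0" using p\<tau>0 by (simp add: sqn_def)
    show "sqn M (\<lambda>x. norm (flux n x)) \<le> CN\<^sup>2 * Bd" for n using fluxB by (simp add: sqn_def)
  qed
  define E where "E n = \<omega> n (v n) - (LINT x|M. h n x \<bullet> q n x) + CN * (LINT x|M. (norm (t x))\<^sup>2 * \<bar>v n x\<bar>)
      + \<nu> / 2 * sqn M (\<tau> n) + (LINT x|M. norm (p (z n x) *\<^sub>R \<tau> n x) \<bullet> norm (flux n x))" for n
  have "(\<lambda>n. \<omega> n (v n) - (LINT x|M. h n x \<bullet> q n x) + CN * (LINT x|M. (norm (t x))\<^sup>2 * \<bar>v n x\<bar>)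
      + \<nu> / 2 * sqn M (\<tau> n) + (LINT x|M. norm (p (z n x) *\<^sub>R \<tau> n x) \<bullet> norm (flux n x))) \<longlonglongrightarrow> 0 - 0 + CN * 0 + \<nu> / 2 * 0 + 0"
    by (intro tendsto_add tendsto_diff tendsto_mult tendsto_const lim1 lim2 lim3 lim4 lim5)
  then have E0: "E \<longlonglongrightarrow> 0" unfolding E_def[abs_def] by simp
  have main: "\<nu> / 2 * sqn M (h n) \<le> E n" for n
  proof -
    have vAE: "AE x in M. \<bar>v n x\<bar> \<le> P0 * (2 * \<kappa>)" using vF by simp
    have i1: "integrable M (\<lambda>x. flux n x \<bullet> (p (z n x) *\<^sub>R h n x))" by (rule sqint_inner[OF flux_sqint ph])
    have i2: "integrable M (\<lambda>x. quad n x * v n x)" by (rule quad_mult_integrable[OF vm vAE])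
    have i4: "integrable M (\<lambda>x. h n x \<bullet> q n x)" by (rule sqint_inner[OF hs qs])
    have i5: "integrable M (\<lambda>x. (norm (\<tau> n x))\<^sup>2)" using \<tau>s by (simp add: sqint_def)
    have i6: "integrable M (\<lambda>x. norm (p (z n x) *\<^sub>R \<tau> n x) \<bullet> norm (flux n x))"
      by (rule sqint_inner[OF sqint_norm[OF p\<tau>] sqint_norm[OF flux_sqint]])
    have "\<nu> / 2 * sqn M (h n) = (LINT x|M. \<nu> / 2 * (norm (h n x))\<^sup>2)" by (simp add: sqn_def)
    also have "\<dots> \<le> (LINT x|M. flux n x \<bullet> (p (z n x) *\<^sub>R h n x) + 1/2 * (quad n x * v n x) - h n x \<bullet> q n x
       + CN * ((norm (t x))\<^sup>2 * \<bar>v n x\<bar>) + \<nu> / 2 * (norm (\<tau> n x))\<^sup>2 + norm (p (z n x) *\<^sub>R \<tau> n x) \<bullet> norm (flux n x))"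
    proof (rule integral_mono_AE)
      show "integrable M (\<lambda>x. \<nu> / 2 * (norm (h n x))\<^sup>2)" using hs[of n] by (simp add: sqint_def)
      show "integrable M (\<lambda>x. flux n x \<bullet> (p (z n x) *\<^sub>R h n x) + 1/2 * (quad n x * v n x) - h n x \<bullet> q n x
       + CN * ((norm (t x))\<^sup>2 * \<bar>v n x\<bar>) + \<nu> / 2 * (norm (\<tau> n x))\<^sup>2 + norm (p (z n x) *\<^sub>R \<tau> n x) \<bullet> norm (flux n x))"
        by (intro Bochner_Integration.integrable_add Bochner_Integration.integrable_diff integrable_mult_right i1 i2 i3 i4 i5 i6)
      show "AE x in M. \<nu> / 2 * (norm (h n x))\<^sup>2 \<le> flux n x \<bullet> (p (z n x) *\<^sub>R h n x) + 1/2 * (quad n x * v n x) - h n x \<bullet> q n x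
       + CN * ((norm (t x))\<^sup>2 * \<bar>v n x\<bar>) + \<nu> / 2 * (norm (\<tau> n x))\<^sup>2 + norm (p (z n x) *\<^sub>R \<tau> n x) \<bullet> norm (flux n x)"
        using ell quad_bound quad_sgn
      proof eventually_elim
        case (elim x)
        \<comment> \<open>Since |T w| \<le> \<kappa>, the difference T u_n - T w has the sign of u_n
          as soon as |u_n| \<ge> \<kappa>. The function f preserves signs, and the quadratic term
          has the sign of u_n by the sign condition.\<close>
        have good: "quad n x * v n x \<ge> 0" if big: "\<not> \<bar>u n x\<bar> < \<kappa>"
        proof -
          have sgnf: "(f s \<ge> 0 \<longleftrightarrow> s \<ge> 0) \<and> (f s \<le> 0 \<longleftrightarrow> s \<le> 0)" for s
            using \<Lambda> by (simp add: f_def zero_le_divide_iff divide_le_0_iff zero_le_mult_iff mult_le_0_iff)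
          consider "u n x \<ge> \<kappa>" | "u n x \<le> - \<kappa>" using big by linarith
          then show ?thesis
          proof cases
            case 1
            then have "quad n x \<ge> 0" using elim(3) \<kappa> by auto
            moreover have "z n x \<ge> 0" using 1 kp by (auto simp: z_def trunc_def)
            ultimately show ?thesis using sgnf by (simp add: v_def)
          next
            case 2
            then have "quad n x \<le> 0" using elim(3) \<kappa> by auto
            moreover have "z n x \<le> 0" using 2 kp by (auto simp: z_def trunc_def)
            ultimately show ?thesis using sgnf by (simp add: v_def mult_nonpos_nonpos)
          qed
        qed
        have "\<nu> / 2 * (norm (h n x))\<^sup>2 \<le> (A x (u n x) *v g n x) \<bullet> (p (z n x) *\<^sub>R h n x) + 1/2 * (quad n x * v n x) - h n x \<bullet> (p (z n x) *\<^sub>R (A x (u n x) *v t x))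
     + CN * ((norm (t x))\<^sup>2 * \<bar>v n x\<bar>) + \<nu> / 2 * (norm (if \<bar>u n x\<bar> < \<kappa> then 0 else t x))\<^sup>2
     + p (z n x) * \<bar>(A x (u n x) *v g n x) \<bullet> (if \<bar>u n x\<bar> < \<kappa> then 0 else t x)\<bar>"
          by (rule pointwise_coercivity) (use elim p1 fp good in \<open>auto simp: h_def v_def\<close>)
        moreover have "p (z n x) * \<bar>flux n x \<bullet> \<tau> n x\<bar> \<le> norm (p (z n x) *\<^sub>R \<tau> n x) \<bullet> norm (flux n x)"
        proof -
          have "\<bar>flux n x \<bullet> \<tau> n x\<bar> \<le> norm (flux n x) * norm (\<tau> n x)" by (rule Cauchy_Schwarz_ineq2)
          then have "p (z n x) * \<bar>flux n x \<bullet> \<tau> n x\<bar> \<le> p (z n x) * (norm (flux n x) * norm (\<tau> n x))"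
            using p1[of "z n x"] by (intro mult_left_mono) auto
          then show ?thesis using p1[of "z n x"] by (simp add: mult_ac)
        qed
        ultimately show ?case unfolding flux_def q_def \<tau>_def by argo
      qed
    qed
    \<comment> \<open>The first two terms of the integrand add up to the value of
      \<open>\<omega> n\<close> at the bounded test function \<open>v n\<close>.\<close>
    also have "\<dots> = E n"
      using i1 i2 i3[of n] i4 i5 i6 unfolding E_def \<omega>_bounded[OF vw vAE mult_nonneg_nonneg[OF order_trans[OF zero_le_one P01] less_imp_le[OF mult_pos_pos[OF zero_less_numeral kp]]]]
      by (simp add: sqn_def)
    finally show ?thesis .
  qed
  have "(\<lambda>n. sqn M (h n)) \<longlonglongrightarrow> 0"
  proof (rule Lim_null_comparison)
    show "\<forall>\<^sub>F n in sequentially. norm (sqn M (h n)) \<le> 2 / \<nu> * E n"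
    proof (intro always_eventually allI)
      fix n show "norm (sqn M (h n)) \<le> 2 / \<nu> * E n"
        using main[of n] cpos by (simp add: field_simps)
    qed
    show "(\<lambda>n. 2 / \<nu> * E n) \<longlonglongrightarrow> 0" using tendsto_mult_left[OF E0, of "2 / \<nu>"] by simp
  qed
  then show ?thesis unfolding h_def[abs_def] t_def .
qed

theorem gradients_converge: "(\<lambda>n. sqn M (\<lambda>x. g n x - G x)) \<longlonglongrightarrow> 0"
proof (rule LIMSEQ_I)
  fix e :: real assume e: "e > 0"
  \<comment> \<open>The truncated part and the two tails enter with weights 2, 4 and 4, ten times
    e/20 in total, which is e/2.\<close>
  then have "e / 20 > 0" by simp
  obtain \<kappa> N where \<kappa>: "\<kappa> \<ge> R" "\<And>n. n \<ge> N \<Longrightarrow> sqn M (\<lambda>x. if \<bar>u n x\<bar> < \<kappa> then 0 else g n x) \<le> e / 20"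
    "sqn M (\<lambda>x. if \<bar>w x\<bar> < \<kappa> then 0 else G x) \<le> e / 20"
    using tails_small[OF \<open>e / 20 > 0\<close>] by blast
  have ws: "sqint M w" and Gs: "sqint M G" by (rule weak_gradD[OF w])+
  have wm: "w \<in> borel_measurable M" using ws by (simp add: sqint_def)
  let ?h = "\<lambda>n x. (if \<bar>u n x\<bar> < \<kappa> then g n x else 0) - (if \<bar>w x\<bar> < \<kappa> then G x else 0)"
  let ?a = "\<lambda>n x. if \<bar>u n x\<bar> < \<kappa> then 0 else g n x" and ?b = "\<lambda>x. if \<bar>w x\<bar> < \<kappa> then 0 else G x"
  obtain N' where N': "\<And>n. n \<ge> N' \<Longrightarrow> sqn M (?h n) < e / 20"
    using order_tendstoD(2)[OF truncations_converge[OF \<kappa>(1)] \<open>e / 20 > 0\<close>] by (auto simp: eventually_sequentially)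
  show "\<exists>N. \<forall>n\<ge>N. norm (sqn M (\<lambda>x. g n x - G x) - 0) < e"
  proof (intro exI[of _ "max N N'"] allI impI)
    fix n assume n: "n \<ge> max N N'"
    have s: "sqint M (?h n)" "sqint M (?a n)" "sqint M ?b"
      by (intro sqint_diff sqint_cut weak_gradD(2)[OF u] Gs um wm)+
    have eq: "(\<lambda>x. ?h n x + (?a n x - ?b x)) = (\<lambda>x. g n x - G x)" by auto
    have "sqn M (\<lambda>x. ?h n x + (?a n x - ?b x)) \<le> 2 * sqn M (?h n) + 2 * sqn M (\<lambda>x. ?a n x - ?b x)"
      by (intro sqint_add sqint_diff s)
    moreover have "sqn M (\<lambda>x. ?a n x - ?b x) \<le> 2 * sqn M (?a n) + 2 * sqn M ?b" by (intro sqint_diff s)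
    moreover have "sqn M (?h n) < e / 20" "sqn M (?a n) \<le> e / 20" using N'[of n] \<kappa>(2)[of n] n by auto
    ultimately have "sqn M (\<lambda>x. g n x - G x) < e" unfolding eq using \<kappa>(3) e by argo
    then show "norm (sqn M (\<lambda>x. g n x - G x) - 0) < e" by simp
  qed
qed

end

section \<open>Extraction of the subsequence and conclusion\<close>

theorem theorem4p1:
  fixes \<Omega> :: "(real^'n) set"
    and A dA :: "real^'n \<Rightarrow> real \<Rightarrow> real^'n^'n"
    and C \<nu> R :: real
    and u :: "nat \<Rightarrow> real^'n \<Rightarrow> real"
  assumes N2: "CARD('n) \<ge> 2"
    and dom: "lipschitz_domain \<Omega>" "bounded \<Omega>"
    and cpos: "C > 0" "\<nu> > 0" "R > 0"
    and meas: "\<forall>s i j. (\<lambda>x. A x s $ i $ j) \<in> borel_measurable (lebesgue_on \<Omega>)"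
    and C1: "AE x in lebesgue_on \<Omega>. \<forall>i j. (\<forall>s. ((\<lambda>t. A x t $ i $ j) has_real_derivative dA x s $ i $ j) (at s))
                 \<and> continuous_on UNIV (\<lambda>s. dA x s $ i $ j)"
    and sym: "AE x in lebesgue_on \<Omega>. \<forall>s i j. A x s $ i $ j = A x s $ j $ i"
    and bnd: "AE x in lebesgue_on \<Omega>. \<forall>s i j. \<bar>A x s $ i $ j\<bar> \<le> C \<and> \<bar>dA x s $ i $ j\<bar> \<le> C"
    and ell: "AE x in lebesgue_on \<Omega>. \<forall>s \<xi>. (A x s *v \<xi>) \<bullet> \<xi> \<ge> \<nu> * (norm \<xi>)\<^sup>2"
    and sgn: "AE x in lebesgue_on \<Omega>. \<forall>s \<xi>. \<bar>s\<bar> \<ge> R \<longrightarrow> s * ((dA x s *v \<xi>) \<bullet> \<xi>) \<ge> 0"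
    and bdd: "\<exists>M. \<forall>n. u n \<in> H1 \<Omega> \<and> H1_norm \<Omega> (u n) \<le> M"
    and omega: "\<exists>\<omega> :: nat \<Rightarrow> (real^'n \<Rightarrow> real) \<Rightarrow> real.
        (\<forall>n. H1_dual \<Omega> (\<omega> n) \<and>
           (\<forall>v. smooth v \<longrightarrow>
              \<omega> n v = (LINT x|lebesgue_on \<Omega>. (A x (u n x) *v wgrad \<Omega> (u n) x) \<bullet> grad v x)
                     + 1/2 * (LINT x|lebesgue_on \<Omega>.
                          ((dA x (u n x) *v wgrad \<Omega> (u n) x) \<bullet> wgrad \<Omega> (u n) x) * v x))) \<and>
        (\<exists>L. H1_dual \<Omega> L \<and> dual_tendsto \<Omega> \<omega> L)"
  shows "\<exists>r w. strict_mono r \<and> w \<in> H1 \<Omega> \<and>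
           (\<lambda>k. H1_norm \<Omega> (\<lambda>x. u (r k) x - w x)) \<longlonglongrightarrow> 0"
proof -
  obtain P \<psi> k where "smoothing \<Omega> P \<psi> k" using ex_smoothing[OF dom] .
  then interpret smoothing \<Omega> P \<psi> k .
  obtain M0 where M0: "\<And>n. u n \<in> H1 \<Omega>" "\<And>n. H1_norm \<Omega> (u n) \<le> M0" using bdd by blast
  obtain \<omega> L where \<omega>: "\<And>n. H1_dual \<Omega> (\<omega> n)" and L: "H1_dual \<Omega> L" "dual_tendsto \<Omega> \<omega> L"
    and form: "\<And>n v. smooth v \<Longrightarrow> \<omega> n v = (LINT x|lebesgue_on \<Omega>. (A x (u n x) *v wgrad \<Omega> (u n) x) \<bullet> grad v x)
                     + 1/2 * (LINT x|lebesgue_on \<Omega>.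
                          ((dA x (u n x) *v wgrad \<Omega> (u n) x) \<bullet> wgrad \<Omega> (u n) x) * v x)"
    using omega by blast
  let ?g = "\<lambda>n. wgrad \<Omega> (u n)"
  have ug: "is_weak_grad \<Omega> (u n) (?g n)" for n by (rule wgrad_weak[OF M0(1)])
  have "sqrt (sqn M (u n) + sqn M (?g n)) \<le> M0" for n using M0(2)[of n] unfolding H1_norm_eq[OF ug] .
  then have sum: "sqn M (u n) + sqn M (?g n) \<le> M0\<^sup>2" for n by (intro sqrt_le_D)
  have B: "sqn M (u n) \<le> M0\<^sup>2" "sqn M (?g n) \<le> M0\<^sup>2" for n
    using sum[of n] sqn_nonneg[of M "u n"] sqn_nonneg[of M "?g n"] by linarith+
  obtain r w where r: "strict_mono r" and ws: "sqint M w" and lim: "(\<lambda>n. sqn M (\<lambda>x. u (r n) x - w x)) \<longlonglongrightarrow> 0"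
    using Rellich[OF ug B] .
  have ds: "sqint M (\<lambda>x. u (r n) x - w x)" for n by (rule sqint_diff(1)[OF weak_gradD(1)[OF ug] ws])
  \<comment> \<open>A second extraction for convergence almost everywhere, which the continuity of
    the coefficients in \<open>s\<close> requires.\<close>
  obtain r' where r': "strict_mono r'" and ae0: "AE x in M. (\<lambda>n. u (r (r' n)) x - w x) \<longlonglongrightarrow> 0"
    using sqn_tendsto_0_AE_subseq[OF ds lim] by blast
  define s where "s n = r (r' n)" for n
  have s: "strict_mono s" using r r' by (simp add: s_def strict_mono_def)
  have lim': "(\<lambda>n. sqn M (\<lambda>x. u (s n) x - w x)) \<longlonglongrightarrow> 0"
    using LIMSEQ_subseq_LIMSEQ[OF lim r'] by (simp add: comp_def s_def)
  have ae: "AE x in M. (\<lambda>n. u (s n) x) \<longlonglongrightarrow> w x"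
    using ae0 by eventually_elim (auto simp: s_def intro: LIM_zero_cancel)
  obtain G where G: "is_weak_grad \<Omega> w G"
    using weak_grad_of_limit[OF ug ws lim' B(2)] .
  \<comment> \<open>The indices satisfy s n \<ge> n, so the same threshold works along the
    subsequence.\<close>
  have "dual_tendsto \<Omega> (\<lambda>n. \<omega> (s n)) L"
    unfolding dual_tendsto_def
  proof (intro allI impI)
    fix \<epsilon> :: real assume "\<epsilon> > 0"
    then obtain N where "\<And>n v. n \<ge> N \<Longrightarrow> v \<in> H1 \<Omega> \<Longrightarrow> \<bar>\<omega> n v - L v\<bar> \<le> \<epsilon> * H1_norm \<Omega> v"
      using L(2) unfolding dual_tendsto_def by blast
    then show "\<exists>N. \<forall>n\<ge>N. \<forall>v\<in>H1 \<Omega>. \<bar>\<omega> (s n) v - L v\<bar> \<le> \<epsilon> * H1_norm \<Omega> v"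
      using seq_suble[OF s] by (intro exI[of _ N]) (meson order_trans)
  qed
  then interpret quasilinear \<Omega> P \<psi> k A dA C \<nu> R "M0\<^sup>2" "\<lambda>n. u (s n)" "\<lambda>n. ?g (s n)" w G "\<lambda>n. \<omega> (s n)" L
    using cpos meas C1 bnd ell sgn ug B(2) G lim' ae \<omega> L(1) form
    by unfold_locales (auto elim: eventually_mono)
  have "H1_norm \<Omega> (\<lambda>x. u (s n) x - w x) = sqrt (sqn M (\<lambda>x. u (s n) x - w x) + sqn M (\<lambda>x. ?g (s n) x - G x))" for n
    by (rule H1_norm_eq[OF weak_grad_diff[OF ug G]])
  moreover have "(\<lambda>n. sqrt (sqn M (\<lambda>x. u (s n) x - w x) + sqn M (\<lambda>x. ?g (s n) x - G x))) \<longlonglongrightarrow> 0"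
    using tendsto_real_sqrt[OF tendsto_add[OF lim' gradients_converge]] by simp
  ultimately show ?thesis using s weak_grad_H1[OF G] by (intro exI[of _ s] exI[of _ w]) simp
qed

end
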